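(* Let $k$ be an algebraically closed field of characteristic $2$, let $n\ge 4$, and let $\mathcal{O}$ be a non-trivial unipotent conjugacy class of $SO(2n)=SO_{2n}(k)$. Then $\mathcal{O}$ is spherical if and only if it consists of involutions.
   Context: Here $SO(2n)$ denotes the identity component of the orthogonal group $O(2n)$ of a non-degenerate quadratic form on a $2n$-dimensional $k$-vector space. A conjugacy class $\mathcal{O}$ of an algebraic group $G$ is called spherical if a Borel subgroup of $G$, acting by conjugation, has a dense orbit on $\mathcal{O}$. An involution is an element of order exactly $2$. A unipotent conjugacy class is non-trivial if it is not $\{1\}$. *)

theory Defs
  imports
    "HOL-Computational_Algebra.Polynomial"
    "HOL-Algebra.Multiplicative_Group"
    "HOL-Algebra.Group_Action"
    "HOL-Algebra.Solvable_Groups"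
    "HOL-Analysis.Abstract_Topology_2"
    "Jordan_Normal_Form.Matrix"
begin

no_notation eq_closure_of ("closure'_of\<index>")

section \<open>The Zariski topology on square matrices\<close>

inductive polynomial_fun :: "nat \<Rightarrow> ('a::field mat \<Rightarrow> 'a) \<Rightarrow> bool" for m :: nat where
  const: "polynomial_fun m (\<lambda>A. c)"
| entry: "i < m \<Longrightarrow> j < m \<Longrightarrow> polynomial_fun m (\<lambda>A. A $$ (i, j))"
| add: "polynomial_fun m f \<Longrightarrow> polynomial_fun m g \<Longrightarrow> polynomial_fun m (\<lambda>A. f A + g A)"
| mult: "polynomial_fun m f \<Longrightarrow> polynomial_fun m g \<Longrightarrow> polynomial_fun m (\<lambda>A. f A * g A)"

definition zero_locus :: "nat \<Rightarrow> ('a::field mat \<Rightarrow> 'a) set \<Rightarrow> 'a mat set" where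
  "zero_locus m F = {A \<in> carrier_mat m m. \<forall>f\<in>F. f A = 0}"

definition algebraic_set :: "nat \<Rightarrow> 'a::field mat set \<Rightarrow> bool" where
  "algebraic_set m Z \<longleftrightarrow> (\<exists>F. (\<forall>f\<in>F. polynomial_fun m f) \<and> Z = zero_locus m F)"

definition zariski :: "nat \<Rightarrow> 'a::field mat topology" where
  "zariski m = topology (\<lambda>U. U \<subseteq> carrier_mat m m \<and> algebraic_set m (carrier_mat m m - U))"

lemma algebraic_set_Un:
  assumes "algebraic_set m Y" "algebraic_set m Z"
  shows "algebraic_set m (Y \<union> Z)"
proof -
  obtain F where F: "\<And>f. f \<in> F \<Longrightarrow> polynomial_fun m f" "Y = zero_locus m F"
    using assms(1) unfolding algebraic_set_def by blast
  obtain G where G: "\<And>f. f \<in> G \<Longrightarrow> polynomial_fun m f" "Z = zero_locus m G"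
    using assms(2) unfolding algebraic_set_def by blast
  define H where "H = (\<lambda>(f, g) A. f A * g A) ` (F \<times> G)"
  have H: "polynomial_fun m h" if "h \<in> H" for h
  proof -
    obtain f g where "f \<in> F" "g \<in> G" "h = (\<lambda>A. f A * g A)"
      using \<open>h \<in> H\<close> unfolding H_def by auto
    then show ?thesis by (simp only:) (intro polynomial_fun.mult F(1) G(1))
  qed
  have "A \<in> zero_locus m H \<longleftrightarrow> A \<in> Y \<union> Z" for A
  proof -
    have "(\<forall>h\<in>H. h A = 0) \<longleftrightarrow> (\<forall>f\<in>F. \<forall>g\<in>G. f A * g A = 0)"
      unfolding H_def by simp
    also have "\<dots> \<longleftrightarrow> (\<forall>f\<in>F. f A = 0) \<or> (\<forall>g\<in>G. g A = 0)"
      unfolding mult_eq_0_iff by blast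
    finally show ?thesis unfolding F(2) G(2) zero_locus_def by blast
  qed
  then have "Y \<union> Z = zero_locus m H" by blast
  then show ?thesis unfolding algebraic_set_def using H by blast
qed

lemma algebraic_set_Inter:
  assumes "\<And>Z. Z \<in> K \<Longrightarrow> algebraic_set m Z"
  shows "algebraic_set m (carrier_mat m m \<inter> \<Inter>K)"
proof -
  have "\<exists>F. (\<forall>f\<in>F. polynomial_fun m f) \<and> Z = zero_locus m F" if "Z \<in> K" for Z
    using assms[OF that] unfolding algebraic_set_def .
  then obtain F where F: "\<And>Z f. Z \<in> K \<Longrightarrow> f \<in> F Z \<Longrightarrow> polynomial_fun m f"
    "\<And>Z. Z \<in> K \<Longrightarrow> Z = zero_locus m (F Z)"
    by metis
  have "A \<in> \<Inter>K \<longleftrightarrow> (\<forall>Z\<in>K. A \<in> zero_locus m (F Z))" for A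
    using F(2) by auto
  then have "carrier_mat m m \<inter> \<Inter>K = zero_locus m (\<Union>(F ` K))"
    unfolding zero_locus_def by auto
  moreover have "\<forall>f\<in>\<Union>(F ` K). polynomial_fun m f" using F(1) by blast
  ultimately show ?thesis unfolding algebraic_set_def by blast
qed

lemma algebraic_set_empty: "algebraic_set m {}"
proof -
  have "{} = zero_locus m {\<lambda>A. 1}" unfolding zero_locus_def by simp
  moreover have "\<forall>f\<in>{\<lambda>A. 1}. polynomial_fun m f"
    using polynomial_fun.const by simp
  ultimately show ?thesis unfolding algebraic_set_def by (intro exI conjI)
qed

lemma openin_zariski:
  "openin (zariski m) U \<longleftrightarrow> U \<subseteq> carrier_mat m m \<and> algebraic_set m (carrier_mat m m - U)"
proof -
  let ?P = "\<lambda>U :: 'a mat set. U \<subseteq> carrier_mat m m \<and> algebraic_set m (carrier_mat m m - U)"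
  have "?P (S \<inter> T)" if "?P S" "?P T" for S T
    using that algebraic_set_Un[of m "carrier_mat m m - S" "carrier_mat m m - T"]
    by (simp add: Diff_Int le_infI1)
  moreover have "?P (\<Union>K)" if K: "\<forall>U\<in>K. ?P U" for K
  proof -
    have "algebraic_set m (carrier_mat m m \<inter> \<Inter>((\<lambda>U. carrier_mat m m - U) ` K))"
    proof (rule algebraic_set_Inter)
      fix Z assume "Z \<in> (\<lambda>U. carrier_mat m m - U) ` K"
      then show "algebraic_set m Z" using K by fast
    qed
    moreover have "carrier_mat m m \<inter> \<Inter>((\<lambda>U. carrier_mat m m - U) ` K) = carrier_mat m m - \<Union>K"
      by blast
    ultimately show ?thesis using K by (simp add: Union_least)
  qed
  ultimately have "istopology ?P" unfolding istopology_def by blast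
  then show ?thesis unfolding zariski_def by (simp add: topology_inverse')
qed

lemma topspace_zariski: "topspace (zariski m) = carrier_mat m m"
proof
  show "topspace (zariski m) \<subseteq> carrier_mat m m"
    unfolding topspace_def openin_zariski by blast
  have "openin (zariski m) (carrier_mat m m)"
    unfolding openin_zariski using algebraic_set_empty by (simp only: Diff_cancel) blast
  then show "carrier_mat m m \<subseteq> topspace (zariski m)"
    by (rule openin_subset)
qed

lemma closedin_zariski: "closedin (zariski m) Z \<longleftrightarrow> algebraic_set m Z"
proof -
  have "Z \<subseteq> carrier_mat m m" if "algebraic_set m Z"
    using that unfolding algebraic_set_def zero_locus_def by blast
  then show ?thesis
    unfolding closedin_def topspace_zariski openin_zariski
    using double_diff[of Z "carrier_mat m m" "carrier_mat m m"] by auto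
qed


section \<open>Linear algebraic groups\<close>

definition GL :: "nat \<Rightarrow> 'a::field mat monoid" where
  "GL m = units_of (ring_mat TYPE('a) m ())"

text \<open>For a subgroup \<open>G\<close> of \<open>GL m\<close> the topology of \<open>G\<close> is the one induced from the affine
  space of all matrices. Inverting the determinant does not change it: a polynomial divided by a
  power of the determinant has the same zeros in \<open>GL m\<close> as the polynomial.\<close>

abbreviation zariski_on :: "nat \<Rightarrow> 'a::field mat monoid \<Rightarrow> 'a mat topology" where
  "zariski_on m G \<equiv> subtopology (zariski m) (carrier G)"

definition identity_component :: "nat \<Rightarrow> 'a::field mat monoid \<Rightarrow> 'a mat monoid" where
  "identity_component m G =
     G\<lparr>carrier := connected_component_of_set (zariski_on m G) \<one>\<^bsub>G\<^esub>\<rparr>"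

definition closed_connected_solvable :: "nat \<Rightarrow> 'a::field mat monoid \<Rightarrow> 'a mat set \<Rightarrow> bool" where
  "closed_connected_solvable m G H \<longleftrightarrow>
     subgroup H G \<and> closedin (zariski_on m G) H \<and> connectedin (zariski_on m G) H \<and>
     solvable (G\<lparr>carrier := H\<rparr>)"

definition borel_subgroup :: "nat \<Rightarrow> 'a::field mat monoid \<Rightarrow> 'a mat set \<Rightarrow> bool" where
  "borel_subgroup m G B \<longleftrightarrow>
     closed_connected_solvable m G B \<and>
     (\<forall>H. closed_connected_solvable m G H \<and> B \<subseteq> H \<longrightarrow> H = B)"

definition conjugation :: "('a, 'b) monoid_scheme \<Rightarrow> 'a \<Rightarrow> 'a \<Rightarrow> 'a" where
  "conjugation G = (\<lambda>g. \<lambda>h \<in> carrier G. g \<otimes>\<^bsub>G\<^esub> h \<otimes>\<^bsub>G\<^esub> inv\<^bsub>G\<^esub> g)"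

definition conjugacy_classes :: "('a, 'b) monoid_scheme \<Rightarrow> 'a set set" where
  "conjugacy_classes G = orbits G (carrier G) (conjugation G)"

definition spherical :: "nat \<Rightarrow> 'a::field mat monoid \<Rightarrow> 'a mat set \<Rightarrow> bool" where
  "spherical m G C \<longleftrightarrow>
     (\<exists>B. borel_subgroup m G B \<and>
       (\<exists>x\<in>C. (subtopology (zariski_on m G) C) closure_of
                 (orbit (G\<lparr>carrier := B\<rparr>) (conjugation G) x) = C))"

definition unipotent :: "nat \<Rightarrow> 'a::field mat \<Rightarrow> bool" where
  "unipotent m A \<longleftrightarrow> A \<in> carrier_mat m m \<and> (\<exists>r. (A - 1\<^sub>m m) ^\<^sub>m r = 0\<^sub>m m m)"


section \<open>Quadratic forms and orthogonal groups\<close>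

definition polar :: "('a::field vec \<Rightarrow> 'a) \<Rightarrow> 'a vec \<Rightarrow> 'a vec \<Rightarrow> 'a" where
  "polar q u v = q (u + v) - q u - q v"

text \<open>The polar form is symmetric, so linearity in the first argument is bilinearity.\<close>

definition quadratic_form :: "nat \<Rightarrow> ('a::field vec \<Rightarrow> 'a) \<Rightarrow> bool" where
  "quadratic_form m q \<longleftrightarrow>
     (\<forall>c. \<forall>v\<in>carrier_vec m. q (c \<cdot>\<^sub>v v) = c\<^sup>2 * q v) \<and>
     (\<forall>u\<in>carrier_vec m. \<forall>v\<in>carrier_vec m. \<forall>w\<in>carrier_vec m.
        polar q (u + v) w = polar q u w + polar q v w) \<and>
     (\<forall>c. \<forall>u\<in>carrier_vec m. \<forall>w\<in>carrier_vec m. polar q (c \<cdot>\<^sub>v u) w = c * polar q u w)"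

text \<open>Non-degeneracy is that of the polar form. In characteristic 2 the polar form is alternating,
  so this forces \<open>m\<close> to be even; for even \<open>m\<close> and a perfect field it is equivalent to \<open>q\<close> having
  no non-trivial zero in the radical of its polar form.\<close>

definition nondegenerate_quadratic_form :: "nat \<Rightarrow> ('a::field vec \<Rightarrow> 'a) \<Rightarrow> bool" where
  "nondegenerate_quadratic_form m q \<longleftrightarrow>
     quadratic_form m q \<and>
     (\<forall>u\<in>carrier_vec m. (\<forall>v\<in>carrier_vec m. polar q u v = 0) \<longrightarrow> u = 0\<^sub>v m)"

definition orthogonal_group :: "nat \<Rightarrow> ('a::field vec \<Rightarrow> 'a) \<Rightarrow> 'a mat monoid" where
  "orthogonal_group m q =
     (GL m)\<lparr>carrier := {A \<in> carrier (GL m). \<forall>v\<in>carrier_vec m. q (A *\<^sub>v v) = q v}\<rparr>"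

text \<open>In characteristic 2 this is not the subgroup of matrices of determinant 1, which is all of
  the orthogonal group.\<close>

definition special_orthogonal_group :: "nat \<Rightarrow> ('a::field vec \<Rightarrow> 'a) \<Rightarrow> 'a mat monoid" where
  "special_orthogonal_group m q = identity_component m (orthogonal_group m q)"


section \<open>The special orthogonal group is a group\<close>

lemma GL_simps [simp]:
  "mult (GL m :: 'a::field mat monoid) = (*)" "\<one>\<^bsub>(GL m :: 'a mat monoid)\<^esub> = 1\<^sub>m m"
  unfolding GL_def units_of_def by (simp_all add: ring_mat_simps)

lemma GL_carrier_mat: "A \<in> carrier (GL m) \<Longrightarrow> A \<in> carrier_mat m m"
  unfolding GL_def units_of_def Units_def by (simp add: ring_mat_simps)

lemma group_GL: "group (GL m :: 'a::field mat monoid)"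
proof -
  interpret R: ring "ring_mat TYPE('a) m ()" by (rule ring_mat)
  show ?thesis unfolding GL_def by (rule R.units_group)
qed

lemma subgroup_orthogonal_group:
  fixes q :: "'a::field vec \<Rightarrow> 'a"
  shows "subgroup (carrier (orthogonal_group m q)) (GL m)"
proof -
  interpret group "GL m :: 'a mat monoid" by (rule group_GL)
  show ?thesis
  proof (rule subgroupI)
    show "carrier (orthogonal_group m q) \<subseteq> carrier (GL m)"
      unfolding orthogonal_group_def by auto
    have "1\<^sub>m m \<in> carrier (orthogonal_group m q)"
      using one_closed unfolding orthogonal_group_def by simp
    then show "carrier (orthogonal_group m q) \<noteq> {}" by blast
  next
    fix A assume "A \<in> carrier (orthogonal_group m q)"
    then have A: "A \<in> carrier (GL m)" "\<And>v. v \<in> carrier_vec m \<Longrightarrow> q (A *\<^sub>v v) = q v"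
      unfolding orthogonal_group_def by auto
    let ?B = "inv\<^bsub>GL m\<^esub> A"
    have B: "?B \<in> carrier (GL m)" "A * ?B = 1\<^sub>m m"
      using A(1) r_inv[OF A(1)] by simp_all
    have "q (?B *\<^sub>v v) = q v" if v: "v \<in> carrier_vec m" for v
    proof -
      have "q (?B *\<^sub>v v) = q (A *\<^sub>v (?B *\<^sub>v v))"
        using A(2) GL_carrier_mat[OF B(1)] v by (metis mult_mat_vec_carrier)
      also have "A *\<^sub>v (?B *\<^sub>v v) = (A * ?B) *\<^sub>v v"
        using GL_carrier_mat[OF A(1)] GL_carrier_mat[OF B(1)] v
        by (metis assoc_mult_mat_vec)
      finally show ?thesis using B(2) v by simp
    qed
    then show "?B \<in> carrier (orthogonal_group m q)"
      using B(1) unfolding orthogonal_group_def by simp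
  next
    fix A B assume "A \<in> carrier (orthogonal_group m q)" "B \<in> carrier (orthogonal_group m q)"
    then have A: "A \<in> carrier (GL m)" "\<And>v. v \<in> carrier_vec m \<Longrightarrow> q (A *\<^sub>v v) = q v"
      and B: "B \<in> carrier (GL m)" "\<And>v. v \<in> carrier_vec m \<Longrightarrow> q (B *\<^sub>v v) = q v"
      unfolding orthogonal_group_def by auto
    have "q ((A * B) *\<^sub>v v) = q v" if v: "v \<in> carrier_vec m" for v
    proof -
      have "(A * B) *\<^sub>v v = A *\<^sub>v (B *\<^sub>v v)"
        using GL_carrier_mat[OF A(1)] GL_carrier_mat[OF B(1)] v
        by (metis assoc_mult_mat_vec)
      then show ?thesis
        using A(2) B(2) GL_carrier_mat[OF B(1)] v by (metis mult_mat_vec_carrier)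
    qed
    then show "A \<otimes>\<^bsub>GL m\<^esub> B \<in> carrier (orthogonal_group m q)"
      using m_closed[OF A(1) B(1)] unfolding orthogonal_group_def by simp
  qed
qed

lemma polynomial_fun_sum:
  assumes "finite K" "\<And>k. k \<in> K \<Longrightarrow> polynomial_fun m (f k)"
  shows "polynomial_fun m (\<lambda>A. \<Sum>k\<in>K. f k A)"
  using assms
proof (induction K rule: finite_induct)
  case empty
  show ?case by (simp add: polynomial_fun.const)
next
  case (insert k K)
  have "polynomial_fun m (\<lambda>A. f k A + (\<Sum>k\<in>K. f k A))"
    by (intro polynomial_fun.add insert) (auto intro: insert)
  then show ?case using insert(1,2) by simp
qed

lemma polynomial_fun_translate:
  assumes "polynomial_fun m f" "g \<in> carrier_mat m m"
  shows "\<exists>f'. polynomial_fun m f' \<and> (\<forall>A\<in>carrier_mat m m. f' A = f (g * A))"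
  using assms(1)
proof induction
  case (const c)
  show ?case by (rule exI[of _ "\<lambda>A. c"]) (simp add: polynomial_fun.const)
next
  case (entry i j)
  have "polynomial_fun m (\<lambda>A. \<Sum>k<m. g $$ (i, k) * A $$ (k, j))"
    using entry by (intro polynomial_fun_sum polynomial_fun.mult polynomial_fun.const
      polynomial_fun.entry) auto
  moreover have "\<forall>A\<in>carrier_mat m m. (\<Sum>k<m. g $$ (i, k) * A $$ (k, j)) = (g * A) $$ (i, j)"
    using entry assms(2) by (simp add: scalar_prod_def atLeast0LessThan)
  ultimately show ?case by blast
next
  case (add f1 f2)
  then obtain h1 h2 where h: "polynomial_fun m h1" "\<forall>A\<in>carrier_mat m m. h1 A = f1 (g * A)"
    "polynomial_fun m h2" "\<forall>A\<in>carrier_mat m m. h2 A = f2 (g * A)" by blast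
  show ?case
    by (rule exI[of _ "\<lambda>A. h1 A + h2 A"]) (use h polynomial_fun.add[OF h(1,3)] in simp)
next
  case (mult f1 f2)
  then obtain h1 h2 where h: "polynomial_fun m h1" "\<forall>A\<in>carrier_mat m m. h1 A = f1 (g * A)"
    "polynomial_fun m h2" "\<forall>A\<in>carrier_mat m m. h2 A = f2 (g * A)" by blast
  show ?case
    by (rule exI[of _ "\<lambda>A. h1 A * h2 A"]) (use h polynomial_fun.mult[OF h(1,3)] in simp)
qed

lemma continuous_map_translate:
  assumes g: "g \<in> carrier_mat m m"
  shows "continuous_map (zariski m) (zariski m) (\<lambda>A. g * A)"
  unfolding continuous_map_closedin topspace_zariski closedin_zariski
proof (intro conjI allI impI)
  show "(\<lambda>A. g * A) \<in> carrier_mat m m \<rightarrow> carrier_mat m m" using g by auto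
  fix Z :: "'a mat set" assume "algebraic_set m Z"
  then obtain F where F: "\<forall>f\<in>F. polynomial_fun m f" "Z = zero_locus m F"
    unfolding algebraic_set_def by blast
  have "\<forall>f\<in>F. \<exists>f'. polynomial_fun m f' \<and> (\<forall>A\<in>carrier_mat m m. f' A = f (g * A))"
    using F(1) polynomial_fun_translate[OF _ g] by blast
  then obtain t where t: "\<And>f. f \<in> F \<Longrightarrow> polynomial_fun m (t f)"
    "\<And>f A. f \<in> F \<Longrightarrow> A \<in> carrier_mat m m \<Longrightarrow> t f A = f (g * A)" by metis
  have "{A \<in> carrier_mat m m. g * A \<in> Z} = zero_locus m (t ` F)"
    unfolding F(2) zero_locus_def using t(2) g by auto
  moreover have "\<forall>f\<in>t ` F. polynomial_fun m f" using t(1) by blast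
  ultimately show "algebraic_set m {A \<in> carrier_mat m m. g * A \<in> Z}"
    unfolding algebraic_set_def by blast
qed

lemma subgroup_identity_component:
  assumes H: "subgroup H (GL m :: 'a::field mat monoid)"
  shows "subgroup (carrier (identity_component m ((GL m)\<lparr>carrier := H\<rparr>))) ((GL m)\<lparr>carrier := H\<rparr>)"
proof -
  define G where "G = (GL m :: 'a mat monoid)\<lparr>carrier := H\<rparr>"
  interpret G: group G
    unfolding G_def using H group_GL by (rule subgroup.subgroup_is_group)
  have mult: "mult G = (*)" and one: "\<one>\<^bsub>G\<^esub> = 1\<^sub>m m" and carrier: "carrier G = H"
    unfolding G_def by simp_all
  have Hm: "H \<subseteq> carrier_mat m m"
    using subgroup.subset[OF H] GL_carrier_mat by blast
  define X where "X = zariski_on m G"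
  have top: "topspace X = H"
    unfolding X_def using Hm carrier by (auto simp: topspace_zariski)
  define C where "C = connected_component_of_set X \<one>\<^bsub>G\<^esub>"
  have C_H: "C \<subseteq> carrier G"
    unfolding C_def using connected_component_of_subset_topspace[of X] top carrier by metis
  have one_C: "\<one>\<^bsub>G\<^esub> \<in> C"
    using G.one_closed unfolding C_def by (simp add: connected_component_of_refl top carrier)
  have conn: "connectedin X C"
    unfolding C_def by (rule connectedin_connected_component_of)
  have transl: "inv\<^bsub>G\<^esub> a \<otimes>\<^bsub>G\<^esub> b \<in> C" if a: "a \<in> C" and b: "b \<in> C" for a b
  proof -
    let ?f = "\<lambda>x. inv\<^bsub>G\<^esub> a \<otimes>\<^bsub>G\<^esub> x"
    have inv: "inv\<^bsub>G\<^esub> a \<in> carrier G" using a C_H by auto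
    have "continuous_map (zariski m) (zariski m) ?f"
      unfolding mult using continuous_map_translate inv carrier Hm by blast
    then have "continuous_map X (zariski m) ?f"
      unfolding X_def by (rule continuous_map_from_subtopology)
    moreover have "?f \<in> topspace X \<rightarrow> carrier G"
      using G.m_closed[OF inv] top carrier by blast
    ultimately have "continuous_map X X ?f"
      unfolding X_def by (simp add: continuous_map_in_subtopology image_subset_iff_funcset)
    then have "connectedin X (?f ` C)"
      using conn by (rule connectedin_continuous_map_image)
    moreover have "\<one>\<^bsub>G\<^esub> \<in> ?f ` C"
      using a C_H by (metis G.l_inv image_eqI subsetD)
    ultimately have "?f ` C \<subseteq> C"
      unfolding C_def by (rule connected_component_of_maximal)
    then show ?thesis using b by blast
  qed
  have inv_C: "inv\<^bsub>G\<^esub> a \<in> C" if "a \<in> C" for a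
    using transl[OF that one_C] that C_H by (metis G.inv_closed G.r_one subsetD)
  have "subgroup C G"
  proof (rule G.subgroupI)
    show "a \<otimes>\<^bsub>G\<^esub> b \<in> C" if "a \<in> C" "b \<in> C" for a b
      using transl[OF inv_C[OF that(1)] that(2)] that(1) C_H by (metis G.inv_inv subsetD)
  qed (use C_H one_C inv_C in blast)+
  then show ?thesis
    unfolding C_def X_def G_def identity_component_def by simp
qed

lemma group_special_orthogonal_group: "group (special_orthogonal_group m q)"
proof -
  let ?H = "carrier (orthogonal_group m q)"
  have eq: "orthogonal_group m q = (GL m)\<lparr>carrier := ?H\<rparr>"
    unfolding orthogonal_group_def by simp
  have grp: "group (orthogonal_group m q)"
    using subgroup.subgroup_is_group[OF subgroup_orthogonal_group group_GL] eq by metis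
  have "subgroup (carrier (special_orthogonal_group m q)) (orthogonal_group m q)"
    using subgroup_identity_component[OF subgroup_orthogonal_group, of m q] eq
    unfolding special_orthogonal_group_def by metis
  from subgroup.subgroup_is_group[OF this grp] show ?thesis
    unfolding special_orthogonal_group_def identity_component_def by simp
qed

end

theory Submission
  imports Defs "Jordan_Normal_Form.Determinant"
begin

text \<open>
  Write \<open>N = x - 1\<close> and let \<open>\<beta>\<close> be the polar form of the quadratic form \<open>q\<close>.

  Suppose that a Borel subgroup \<open>B\<close> has a dense orbit on the class of \<open>x\<close>. By Lie and Kolchin, \<open>B\<close>
  stabilises a singular line \<open>\<langle>v\<^sub>1\<rangle>\<close> inside a totally singular plane \<open>\<langle>v\<^sub>1, v\<^sub>2\<rangle>\<close>. The functions
  \<open>\<beta> v\<^sub>1 (y v\<^sub>1)\<close> and \<open>\<beta> v\<^sub>1 (y\<^sup>2 v\<^sub>1)\<close> of \<open>y\<close> are semi-invariants of \<open>B\<close> of the same weight, and so are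
  \<open>a\<^sub>1\<^sub>1 a\<^sub>2\<^sub>2 + a\<^sub>1\<^sub>2 a\<^sub>2\<^sub>1\<close> and \<open>(a\<^sub>1\<^sub>2 + a\<^sub>2\<^sub>1)\<^sup>2\<close> with \<open>a\<^sub>i\<^sub>j = \<beta> v\<^sub>i (y v\<^sub>j)\<close>; as the orbit is dense, each
  pair is linearly dependent on the class. Since \<open>SO\<close> is transitive on singular vectors and on pairs
  spanning a totally singular plane, these are identities in singular vectors for \<open>x\<close>, and they
  force \<open>N\<^sup>2 = 0\<close>.

  Conversely let \<open>N\<^sup>2 = 0\<close>. Then \<open>\<beta> u (N w)\<close> is a symmetric bilinear form. If the leading minors of
  its Gram matrix with respect to a singular flag do not vanish (only those of even size, if the form
  is alternating), Gram-Schmidt along the flag produces a frame adapted to the flag in which \<open>x\<close> has a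
  normal form. Hence the conjugates of \<open>x\<close> with non-vanishing minors are all conjugate under the
  stabiliser of the flag, which is a Borel subgroup, and they are dense because \<open>SO\<close> is irreducible.
\<close>

section \<open>Linear combinations and subspaces\<close>

text \<open>Necessity uses an arbitrary Borel subgroup only through the singular flag that it fixes;
  sufficiency exhibits one flag stabiliser, whose maximality is again drawn from Lie-Kolchin.
  Semi-invariants of equal weight have a constant ratio on an orbit, which is why the dependence
  spreads to the class. The identity component is a topological component, whereas density arguments
  require irreducibility. Explicit rational curves through 1 are the bridge: Siegel transformations
  and torus elements are joined to 1, and together they match any two frames up to an exchange in
  the last hyperbolic pair. So the elements joined to 1 fill the orthogonal group up to index two.
  The same exchange obstructs the maximality of the flag stabiliser, because a totally singular
  subspace of dimension \<open>n - 1\<close> lies in two of dimension \<open>n\<close>. In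
  characteristic two every vector is orthogonal to itself but need not be singular. Stable flags
  must therefore be made singular by extracting square roots, and alternating forms need a normal
  form of their own.\<close>

definition comb :: "nat \<Rightarrow> 'i set \<Rightarrow> ('i \<Rightarrow> 'a::field) \<Rightarrow> ('i \<Rightarrow> 'a vec) \<Rightarrow> 'a vec" where
  "comb m K c g = vec m (\<lambda>k. \<Sum>i\<in>K. c i * g i $ k)"

lemma comb_carrier [simp]: "comb m K c g \<in> carrier_vec m"
  unfolding comb_def by simp

lemma comb_empty [simp]: "comb m {} c g = 0\<^sub>v m"
  unfolding comb_def by (intro eq_vecI) auto

lemma comb_insert:
  assumes "finite K" "i \<notin> K" "\<And>j. j \<in> insert i K \<Longrightarrow> g j \<in> carrier_vec m"
  shows "comb m (insert i K) c g = c i \<cdot>\<^sub>v g i + comb m K c g"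
proof -
  have dim: "dim_vec (g i) = m" using assms(3) carrier_vecD by blast
  show ?thesis unfolding comb_def using assms by (intro eq_vecI) (auto simp: dim)
qed

lemma comb_cong:
  assumes "\<And>i. i \<in> K \<Longrightarrow> c i = c' i" "\<And>i. i \<in> K \<Longrightarrow> g i = g' i"
  shows "comb m K c g = comb m K c' g'"
  unfolding comb_def using assms by (intro eq_vecI) auto

definition additive_on :: "nat \<Rightarrow> ('a::field vec \<Rightarrow> 'a) \<Rightarrow> bool" where
  "additive_on m \<phi> \<longleftrightarrow> (\<forall>u\<in>carrier_vec m. \<forall>v\<in>carrier_vec m. \<phi> (u + v) = \<phi> u + \<phi> v) \<and>
     (\<forall>c. \<forall>u\<in>carrier_vec m. \<phi> (c \<cdot>\<^sub>v u) = c * \<phi> u)"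

lemma additive_on_zero:
  assumes "additive_on m \<phi>"
  shows "\<phi> (0\<^sub>v m) = 0"
proof -
  have "\<phi> (0 \<cdot>\<^sub>v 0\<^sub>v m) = 0 * \<phi> (0\<^sub>v m)"
    using assms zero_carrier_vec unfolding additive_on_def by blast
  moreover have "(0::'a) \<cdot>\<^sub>v 0\<^sub>v m = 0\<^sub>v m" by auto
  ultimately show ?thesis by simp
qed

lemma additive_on_comb:
  assumes "additive_on m \<phi>" "finite K" "\<And>i. i \<in> K \<Longrightarrow> g i \<in> carrier_vec m"
  shows "\<phi> (comb m K c g) = (\<Sum>i\<in>K. c i * \<phi> (g i))"
  using assms(2,3)
proof (induction K)
  case empty
  then show ?case using additive_on_zero[OF assms(1)] by simp
next
  case (insert i K)
  then have "comb m (insert i K) c g = c i \<cdot>\<^sub>v g i + comb m K c g" by (intro comb_insert) auto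
  then show ?case using insert assms(1) unfolding additive_on_def by simp
qed

lemma mult_mat_comb:
  assumes "A \<in> carrier_mat r m" "finite K" "\<And>i. i \<in> K \<Longrightarrow> g i \<in> carrier_vec m"
  shows "A *\<^sub>v comb m K c g = comb r K c (\<lambda>i. A *\<^sub>v g i)"
  using assms(2,3)
proof (induction K)
  case empty
  then show ?case using assms(1) by (intro eq_vecI) auto
next
  case (insert i K)
  have "comb m (insert i K) c g = c i \<cdot>\<^sub>v g i + comb m K c g"
    by (intro comb_insert) (use insert in auto)
  moreover have "comb r (insert i K) c (\<lambda>i. A *\<^sub>v g i) = c i \<cdot>\<^sub>v (A *\<^sub>v g i) + comb r K c (\<lambda>i. A *\<^sub>v g i)"
    by (intro comb_insert) (use insert assms(1) in auto)
  moreover have "A *\<^sub>v (c i \<cdot>\<^sub>v g i + comb m K c g) = A *\<^sub>v (c i \<cdot>\<^sub>v g i) + A *\<^sub>v comb m K c g"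
    by (intro mult_add_distrib_mat_vec[OF assms(1)]) (use insert in auto)
  ultimately show ?case using insert mult_mat_vec[OF assms(1)] by simp
qed

lemma vec_eq_comb_unit:
  assumes "v \<in> carrier_vec m"
  shows "v = comb m {..<m} (\<lambda>i. v $ i) (unit_vec m)"
  unfolding comb_def using assms
  by (intro eq_vecI) (auto simp: unit_vec_def if_distrib cong: if_cong)

text \<open>A unit vector lies in the kernel of the transpose, so the determinant vanishes. Padding
  a system with zero rows to a square one turns both the kernel count and the dependency count below
  into this determinant fact.\<close>

lemma kernel_of_zero_row:
  fixes A :: "'a::field mat"
  assumes A: "A \<in> carrier_mat d d" and k: "k < d" and z: "\<And>j. j < d \<Longrightarrow> A $$ (k, j) = 0"
  obtains v where "v \<in> carrier_vec d" "v \<noteq> 0\<^sub>v d" "A *\<^sub>v v = 0\<^sub>v d"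
proof -
  have "A\<^sup>T *\<^sub>v unit_vec d k = 0\<^sub>v d"
    using A k z by (intro eq_vecI) auto
  moreover have "unit_vec d k \<noteq> 0\<^sub>v d" using k
    by (metis index_unit_vec(1) index_zero_vec(1) zero_neq_one)
  ultimately have "det (A\<^sup>T) = 0"
    using A det_0_iff_vec_prod_zero_field[of "A\<^sup>T" d] by (metis transpose_carrier_mat unit_vec_carrier)
  then have "det A = 0" using A by (simp add: det_transpose)
  then show ?thesis using that A det_0_iff_vec_prod_zero_field[of A d] by blast
qed

lemma exists_common_kernel:
  fixes \<phi> :: "nat \<Rightarrow> 'a::field vec \<Rightarrow> 'a"
  assumes "k < m" "\<And>i. i < k \<Longrightarrow> additive_on m (\<phi> i)"
  obtains v where "v \<in> carrier_vec m" "v \<noteq> 0\<^sub>v m" "\<And>i. i < k \<Longrightarrow> \<phi> i v = 0"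
proof -
  define A where "A = mat m m (\<lambda>(i, j). if i < k then \<phi> i (unit_vec m j) else 0)"
  have A: "A \<in> carrier_mat m m" unfolding A_def by simp
  obtain v where v: "v \<in> carrier_vec m" "v \<noteq> 0\<^sub>v m" "A *\<^sub>v v = 0\<^sub>v m"
    using kernel_of_zero_row[OF A assms(1)] assms(1) unfolding A_def by auto
  have "\<phi> i v = 0" if "i < k" for i
  proof -
    have "\<phi> i v = (\<Sum>j<m. v $ j * \<phi> i (unit_vec m j))"
      by (subst vec_eq_comb_unit[OF v(1)], subst additive_on_comb[OF assms(2)[OF that]]) auto
    also have "\<dots> = (A *\<^sub>v v) $ i"
      using that assms(1) v(1) unfolding A_def
      by (simp add: scalar_prod_def atLeast0LessThan mult.commute)
    also have "\<dots> = 0" using v(3) that assms(1) by simp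
    finally show ?thesis .
  qed
  then show ?thesis using that v by blast
qed

lemma exists_dependency:
  fixes u :: "nat \<Rightarrow> 'a::field vec"
  assumes "\<And>i. i \<le> m \<Longrightarrow> u i \<in> carrier_vec m"
  obtains c where "comb m {..m} c u = 0\<^sub>v m" "\<exists>i\<le>m. c i \<noteq> 0"
proof -
  define A where "A = mat (Suc m) (Suc m) (\<lambda>(i, j). if i < m then u j $ i else 0)"
  have A: "A \<in> carrier_mat (Suc m) (Suc m)" unfolding A_def by simp
  obtain v where v: "v \<in> carrier_vec (Suc m)" "v \<noteq> 0\<^sub>v (Suc m)" "A *\<^sub>v v = 0\<^sub>v (Suc m)"
    using kernel_of_zero_row[OF A, of m] unfolding A_def by auto
  have "(\<Sum>j\<le>m. v $ j * u j $ i) = 0" if "i < m" for i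
  proof -
    have "(\<Sum>j\<le>m. v $ j * u j $ i) = (A *\<^sub>v v) $ i"
      using that v(1) unfolding A_def
      by (simp add: scalar_prod_def atLeast0LessThan mult.commute lessThan_Suc_atMost del: sum.lessThan_Suc)
    then show ?thesis using v(3) that by simp
  qed
  then have "comb m {..m} (($) v) u = 0\<^sub>v m" unfolding comb_def by (intro eq_vecI) auto
  moreover have "\<exists>i\<le>m. v $ i \<noteq> 0"
  proof (rule ccontr)
    assume "\<not> ?thesis"
    then have "v = 0\<^sub>v (Suc m)" using v(1) by (intro eq_vecI) (auto simp: less_Suc_eq_le)
    then show False using v(2) by simp
  qed
  ultimately show ?thesis using that by blast
qed

section \<open>Subspaces and descending chains\<close>

definition vsubspace :: "nat \<Rightarrow> 'a::field vec set \<Rightarrow> bool" where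
  "vsubspace m W \<longleftrightarrow> W \<subseteq> carrier_vec m \<and> 0\<^sub>v m \<in> W \<and> (\<forall>u\<in>W. \<forall>v\<in>W. u + v \<in> W) \<and>
     (\<forall>c. \<forall>u\<in>W. c \<cdot>\<^sub>v u \<in> W)"

lemma vsubspace_comb:
  assumes "vsubspace m W" "finite K" "\<And>i. i \<in> K \<Longrightarrow> g i \<in> W"
  shows "comb m K c g \<in> W"
  using assms(2,3)
proof (induction K)
  case empty
  then show ?case using assms(1) unfolding vsubspace_def by simp
next
  case (insert i K)
  then show ?case using assms(1) unfolding vsubspace_def
    by (subst comb_insert) auto
qed

lemma vsubspace_minus:
  assumes "vsubspace m W" "u \<in> W" "v \<in> W"
  shows "u - v \<in> W"
proof -
  have "u \<in> carrier_vec m" "v \<in> carrier_vec m" using assms unfolding vsubspace_def by auto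
  then have "u - v = u + (-1) \<cdot>\<^sub>v v" by (intro eq_vecI) auto
  then show ?thesis using assms unfolding vsubspace_def by simp
qed

lemma vsubspace_smult_iff:
  assumes "vsubspace m W" "c \<noteq> 0" "u \<in> carrier_vec m"
  shows "c \<cdot>\<^sub>v u \<in> W \<longleftrightarrow> u \<in> W"
proof
  assume "c \<cdot>\<^sub>v u \<in> W"
  then have "inverse c \<cdot>\<^sub>v (c \<cdot>\<^sub>v u) \<in> W" using assms(1) unfolding vsubspace_def by blast
  moreover have "inverse c \<cdot>\<^sub>v (c \<cdot>\<^sub>v u) = u" using assms by (intro eq_vecI) auto
  ultimately show "u \<in> W" by simp
qed (use assms in \<open>auto simp: vsubspace_def\<close>)

lemma vsubspace_add_iff:
  assumes "vsubspace m W" "w \<in> W" "u \<in> carrier_vec m"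
  shows "u + w \<in> W \<longleftrightarrow> u \<in> W"
proof
  assume "u + w \<in> W"
  then have "(u + w) - w \<in> W" using vsubspace_minus assms by blast
  moreover have "w \<in> carrier_vec m" using assms unfolding vsubspace_def by blast
  then have "(u + w) - w = u" using assms by (intro eq_vecI) auto
  ultimately show "u \<in> W" by simp
qed (use assms in \<open>auto simp: vsubspace_def\<close>)

text \<open>In a strictly descending chain, vectors \<open>u i \<in> W i - W (i + 1)\<close> are linearly independent.\<close>

lemma wf_vsubspace: "wf {(U, W). vsubspace m U \<and> vsubspace m W \<and> U \<subset> (W :: 'a::field vec set)}"
proof (rule ccontr)
  assume "\<not> ?thesis"
  then obtain W :: "nat \<Rightarrow> 'a vec set" where
    W: "\<And>i. vsubspace m (W i)" "\<And>i. W (Suc i) \<subset> W i"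
    unfolding wf_iff_no_infinite_down_chain by blast
  have mono: "W j \<subseteq> W i" if "i \<le> j" for i j
    using that W(2) by (induction rule: dec_induct) (auto simp: psubset_eq)
  have "\<exists>u. u \<in> W i \<and> u \<notin> W (Suc i)" for i using W(2)[of i] by blast
  then obtain u where u: "\<And>i. u i \<in> W i" "\<And>i. u i \<notin> W (Suc i)" by metis
  have uc: "u i \<in> carrier_vec m" for i using u(1) W(1) unfolding vsubspace_def by blast
  obtain c where c: "comb m {..m} c u = 0\<^sub>v m" "\<exists>i\<le>m. c i \<noteq> 0"
    using exists_dependency[of m u] uc by blast
  \<comment> \<open>With the least index carrying a nonzero coefficient, every later term already
    lies in \<open>W (Suc j)\<close>, which forces \<open>u j\<close> into it as well.\<close>
  define j where "j = (LEAST i. i \<le> m \<and> c i \<noteq> 0)"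
  have j: "j \<le> m" "c j \<noteq> 0" using c(2) LeastI_ex[of "\<lambda>i. i \<le> m \<and> c i \<noteq> 0"] unfolding j_def by auto
  have jl: "c i = 0" if "i < j" for i
    using not_less_Least[of i "\<lambda>i. i \<le> m \<and> c i \<noteq> 0"] that j(1) unfolding j_def by auto
  have "comb m {..m} c u = comb m {j..m} c u"
    unfolding comb_def by (intro eq_vecI) (use jl in \<open>auto intro!: sum.mono_neutral_right\<close>)
  also have "{j..m} = insert j {Suc j..m}" using j(1) by auto
  also have "comb m \<dots> c u = c j \<cdot>\<^sub>v u j + comb m {Suc j..m} c u"
    by (rule comb_insert) (use uc in auto)
  finally have eq: "c j \<cdot>\<^sub>v u j + comb m {Suc j..m} c u \<in> W (Suc j)"
    using c(1) W(1) unfolding vsubspace_def by metis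
  have "comb m {Suc j..m} c u \<in> W (Suc j)"
    by (rule vsubspace_comb[OF W(1)]) (use u(1) mono in auto)
  then have "c j \<cdot>\<^sub>v u j \<in> W (Suc j)"
    using eq vsubspace_add_iff[OF W(1)] uc by (metis smult_carrier_vec)
  then show False using vsubspace_smult_iff[OF W(1) j(2) uc] u(2) by blast
qed

text \<open>Used to choose a minimal stable subspace above a fixed one, that is, an irreducible
  subquotient without forming quotients.\<close>

lemma minimal_vsubspace:
  assumes "vsubspace m U" "P U"
  obtains U' where "vsubspace m U'" "P U'" "U' \<subseteq> U"
    "\<And>U''. vsubspace m U'' \<Longrightarrow> P U'' \<Longrightarrow> U'' \<subseteq> U' \<Longrightarrow> U'' = U'"
proof -
  have "U \<in> {W. vsubspace m W \<and> P W \<and> W \<subseteq> U}" using assms by simp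
  from wfE_min[OF wf_vsubspace this] obtain Z where
    Z: "Z \<in> {W. vsubspace m W \<and> P W \<and> W \<subseteq> U}"
    "\<And>y. (y, Z) \<in> {(U, W). vsubspace m U \<and> vsubspace m W \<and> U \<subset> W} \<Longrightarrow> y \<notin> {W. vsubspace m W \<and> P W \<and> W \<subseteq> U}"
    by blast
  show ?thesis
  proof (rule that[of Z])
    fix U'' assume "vsubspace m U''" "P U''" "U'' \<subseteq> Z"
    then show "U'' = Z" using Z by blast
  qed (use Z in auto)
qed

lemma mat_of_linear:
  fixes L :: "'a::field vec \<Rightarrow> 'a vec"
  assumes "\<And>v. v \<in> carrier_vec m \<Longrightarrow> L v \<in> carrier_vec m"
    "\<And>u v. u \<in> carrier_vec m \<Longrightarrow> v \<in> carrier_vec m \<Longrightarrow> L (u + v) = L u + L v"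
    "\<And>c v. v \<in> carrier_vec m \<Longrightarrow> L (c \<cdot>\<^sub>v v) = c \<cdot>\<^sub>v L v"
  defines "A \<equiv> mat m m (\<lambda>(i, j). L (unit_vec m j) $ i)"
  shows "A \<in> carrier_mat m m" "v \<in> carrier_vec m \<Longrightarrow> A *\<^sub>v v = L v"
proof -
  show "A \<in> carrier_mat m m" unfolding A_def by simp
  assume v: "v \<in> carrier_vec m"
  show "A *\<^sub>v v = L v"
  proof (rule eq_vecI)
    show "dim_vec (A *\<^sub>v v) = dim_vec (L v)" using assms(1)[OF v] unfolding A_def by simp
    fix i assume "i < dim_vec (L v)"
    then have i: "i < m" using assms(1)[OF v] by simp
    have "additive_on m (\<lambda>v. L v $ i)"
      unfolding additive_on_def using assms(2,3) i carrier_vecD[OF assms(1)] by simp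
    then have "L v $ i = (\<Sum>j<m. v $ j * L (unit_vec m j) $ i)"
      by (subst vec_eq_comb_unit[OF v], subst additive_on_comb[of m "\<lambda>v. L v $ i"]) auto
    then show "(A *\<^sub>v v) $ i = L v $ i"
      using i v unfolding A_def by (simp add: scalar_prod_def atLeast0LessThan mult.commute)
  qed
qed

lemma mat_eq_iff_mult_vec:
  fixes A B :: "'a::field mat"
  assumes "A \<in> carrier_mat m m" "B \<in> carrier_mat m m" "\<And>v. v \<in> carrier_vec m \<Longrightarrow> A *\<^sub>v v = B *\<^sub>v v"
  shows "A = B"
proof (rule eq_matI)
  fix i j assume "i < dim_row B" "j < dim_col B"
  then have ij: "i < m" "j < m" using assms by auto
  have "(A *\<^sub>v unit_vec m j) $ i = (B *\<^sub>v unit_vec m j) $ i" using assms(3) by simp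
  then show "A $$ (i, j) = B $$ (i, j)" using ij assms(1,2) by simp
qed (use assms in auto)

section \<open>Quadratic forms in characteristic two and their frames\<close>

locale char2_quadratic_space =
  fixes n m :: nat and q :: "'k::alg_closed_field vec \<Rightarrow> 'k"
  assumes char2: "CHAR('k) = 2" and m_def: "m = 2 * n" and n3: "n \<ge> 3"
    and nondegenerate: "nondegenerate_quadratic_form m q"
begin

abbreviation V :: "'k vec set" where "V \<equiv> carrier_vec m"
abbreviation bil :: "'k vec \<Rightarrow> 'k vec \<Rightarrow> 'k" ("\<beta>") where "\<beta> \<equiv> polar q"

lemma two_eq_0 [simp]: "(2::'k) = 0"
  using of_nat_CHAR[where 'a='k] char2 by simp

lemma add_self [simp]: "(x::'k) + x = 0"
  using two_eq_0 by (metis mult_2 mult_zero_left)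

lemma add_self_left [simp]: "(x::'k) + (x + y) = y"
  by (simp add: add.assoc[symmetric])

lemma uminus_eq [simp]: "- (x::'k) = x"
  using add_self[of x] by (simp add: minus_unique)

text \<open>Signs are normalised away: once subtraction is addition, equal terms cancel by
  simplification, which is how the later coordinate computations close.\<close>

lemma minus_eq_add [simp]: "(x::'k) - y = x + y"
  using uminus_eq[of y] by (metis add_uminus_conv_diff)

lemma add_eq_0_iff2: "(x::'k) + y = 0 \<longleftrightarrow> x = y"
  by (metis add_self add_self_left add.right_neutral)

lemma exists_quadratic_root:
  assumes "(d::'k) \<noteq> 0"
  obtains c where "a + b * c + d * c\<^sup>2 = 0"
proof -
  have "degree [:a, b, d:] > 0" using assms by simp
  then obtain c where "poly [:a, b, d:] c = 0" using alg_closed_imp_poly_has_root by blast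
  then have "a + b * c + d * c\<^sup>2 = 0" by (simp add: algebra_simps power2_eq_square)
  then show ?thesis using that by blast
qed

lemma exists_sqrt:
  obtains c where "(c::'k)\<^sup>2 = a"
  using exists_quadratic_root[of 1 a 0] by (metis add_eq_0_iff2 mult_1 mult_zero_left add_0_right)

lemma m_pos: "m > 0" "n > 0" "n < m" using m_def n3 by auto

lemma quadratic: "quadratic_form m q"
  using nondegenerate unfolding nondegenerate_quadratic_form_def by simp

lemma q_smult [simp]: "v \<in> V \<Longrightarrow> q (c \<cdot>\<^sub>v v) = c\<^sup>2 * q v"
  using quadratic unfolding quadratic_form_def by simp

lemma q_zero [simp]: "q (0\<^sub>v m) = 0"
proof -
  have "(0::'k) \<cdot>\<^sub>v 0\<^sub>v m = 0\<^sub>v m" by auto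
  then show ?thesis using q_smult[of "0\<^sub>v m" 0] by simp
qed

lemma bil_add_left [simp]: "u \<in> V \<Longrightarrow> v \<in> V \<Longrightarrow> w \<in> V \<Longrightarrow> \<beta> (u + v) w = \<beta> u w + \<beta> v w"
  using quadratic unfolding quadratic_form_def by simp

lemma bil_smult_left [simp]: "u \<in> V \<Longrightarrow> w \<in> V \<Longrightarrow> \<beta> (c \<cdot>\<^sub>v u) w = c * \<beta> u w"
  using quadratic unfolding quadratic_form_def by simp

lemma bil_sym: "u \<in> V \<Longrightarrow> v \<in> V \<Longrightarrow> \<beta> u v = \<beta> v u"
  unfolding polar_def by (simp add: comm_add_vec[of u m v] add_ac)

lemma bil_add_right [simp]: "u \<in> V \<Longrightarrow> v \<in> V \<Longrightarrow> w \<in> V \<Longrightarrow> \<beta> w (u + v) = \<beta> w u + \<beta> w v"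
  using bil_add_left[of u v w] bil_sym[of w "u + v"] bil_sym[of w u] bil_sym[of w v] by simp

lemma bil_smult_right [simp]: "u \<in> V \<Longrightarrow> w \<in> V \<Longrightarrow> \<beta> w (c \<cdot>\<^sub>v u) = c * \<beta> w u"
  using bil_smult_left[of u w c] bil_sym[of w "c \<cdot>\<^sub>v u"] bil_sym[of w u] by simp

lemma q_add: "u \<in> V \<Longrightarrow> v \<in> V \<Longrightarrow> q (u + v) = q u + q v + \<beta> u v"
  unfolding polar_def by (simp add: add_ac)

lemma vec_add_self [simp]: "v \<in> V \<Longrightarrow> v + v = 0\<^sub>v m"
  by (intro eq_vecI) auto

lemma vec_smult_one [simp]: "(1::'k) \<cdot>\<^sub>v v = v"
  by (intro eq_vecI) auto

lemma vec_smult_zero [simp]: "v \<in> V \<Longrightarrow> (0::'k) \<cdot>\<^sub>v v = 0\<^sub>v m"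
  by (intro eq_vecI) auto

lemma vec_smult_zero_right [simp]: "(c::'k) \<cdot>\<^sub>v 0\<^sub>v m = 0\<^sub>v m"
  by (intro eq_vecI) auto

lemma vec_add_eq_0_iff: "u \<in> V \<Longrightarrow> v \<in> V \<Longrightarrow> u + v = 0\<^sub>v m \<longleftrightarrow> u = v"
proof
  assume uv: "u \<in> V" "v \<in> V" "u + v = 0\<^sub>v m"
  show "u = v"
  proof (rule eq_vecI)
    fix i assume i: "i < dim_vec v"
    then have "(u + v) $ i = 0" using uv by simp
    then show "u $ i = v $ i" using uv(1,2) i by (simp add: add_eq_0_iff2)
  qed (use uv in auto)
qed auto

lemma smult_eq_0_iff: "v \<in> V \<Longrightarrow> (c::'k) \<cdot>\<^sub>v v = 0\<^sub>v m \<longleftrightarrow> c = 0 \<or> v = 0\<^sub>v m"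
proof
  assume v: "v \<in> V" "c \<cdot>\<^sub>v v = 0\<^sub>v m"
  show "c = 0 \<or> v = 0\<^sub>v m"
  proof (rule ccontr)
    assume *: "\<not> ?thesis"
    have "v = inverse c \<cdot>\<^sub>v (c \<cdot>\<^sub>v v)" using * v(1) by (intro eq_vecI) auto
    then show False using * v by simp
  qed
qed auto

lemma bil_self [simp]: "v \<in> V \<Longrightarrow> \<beta> v v = 0"
  unfolding polar_def by simp

lemma bil_zero [simp]: "v \<in> V \<Longrightarrow> \<beta> (0\<^sub>v m) v = 0" "v \<in> V \<Longrightarrow> \<beta> v (0\<^sub>v m) = 0"
  using bil_smult_left[of "0\<^sub>v m" v 0] bil_smult_right[of "0\<^sub>v m" v 0] by auto

lemma bil_nondegenerate: "u \<in> V \<Longrightarrow> (\<And>v. v \<in> V \<Longrightarrow> \<beta> u v = 0) \<Longrightarrow> u = 0\<^sub>v m"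
  using nondegenerate unfolding nondegenerate_quadratic_form_def by blast

lemma additive_bil: "w \<in> V \<Longrightarrow> additive_on m (\<lambda>v. \<beta> v w)" "w \<in> V \<Longrightarrow> additive_on m (\<beta> w)"
  unfolding additive_on_def by auto

lemma bil_comb_left:
  "finite K \<Longrightarrow> (\<And>i. i \<in> K \<Longrightarrow> g i \<in> V) \<Longrightarrow> w \<in> V \<Longrightarrow> \<beta> (comb m K c g) w = (\<Sum>i\<in>K. c i * \<beta> (g i) w)"
  using additive_on_comb[OF additive_bil(1)] by blast

lemma bil_comb_right:
  "finite K \<Longrightarrow> (\<And>i. i \<in> K \<Longrightarrow> g i \<in> V) \<Longrightarrow> w \<in> V \<Longrightarrow> \<beta> w (comb m K c g) = (\<Sum>i\<in>K. c i * \<beta> w (g i))"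
  using additive_on_comb[OF additive_bil(2)] by blast

text \<open>A hyperbolic basis numbered symmetrically about the middle: \<open>g i\<close> is paired
  with \<open>g (m - 1 - i)\<close>. The antidiagonal Gram matrix makes the complement of the first
  \<open>i\<close> vectors the span of the first \<open>m - i\<close>, so one numbering serves the
  full self-dual flag.\<close>

definition frame :: "(nat \<Rightarrow> 'k vec) \<Rightarrow> bool" where
  "frame g \<longleftrightarrow> (\<forall>i<m. g i \<in> V \<and> q (g i) = 0) \<and>
     (\<forall>i<m. \<forall>j<m. \<beta> (g i) (g j) = (if i + j = m - 1 then 1 else 0))"

lemma frame_carrier [simp]: "frame g \<Longrightarrow> i < m \<Longrightarrow> g i \<in> V"
  and frame_q [simp]: "frame g \<Longrightarrow> i < m \<Longrightarrow> q (g i) = 0"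
  and frame_bil: "frame g \<Longrightarrow> i < m \<Longrightarrow> j < m \<Longrightarrow> \<beta> (g i) (g j) = (if i + j = m - 1 then 1 else 0)"
  unfolding frame_def by auto

lemma frame_nonzero: "frame g \<Longrightarrow> i < m \<Longrightarrow> g i \<noteq> 0\<^sub>v m"
  using frame_bil[of g i "m - 1 - i"] frame_carrier[of g "m - 1 - i"] by auto

lemma frame_coeff:
  assumes "frame g" "j < m"
  shows "\<beta> (comb m {..<m} c g) (g j) = c (m - 1 - j)"
proof -
  have "\<beta> (comb m {..<m} c g) (g j) = (\<Sum>i<m. c i * \<beta> (g i) (g j))"
    using assms by (intro bil_comb_left) auto
  also have "\<dots> = (\<Sum>i<m. if i = m - 1 - j then c i else 0)"
    using assms by (intro sum.cong) (auto simp: frame_bil)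
  also have "\<dots> = c (m - 1 - j)" using assms by simp
  finally show ?thesis .
qed

text \<open>The frame together with \<open>w\<close> gives \<open>m + 1\<close> dependent vectors.
  Pairing the dependency with \<open>g (m - 1 - i)\<close> isolates the coefficient of
  \<open>g i\<close>, so only the coefficient of \<open>w\<close> can survive.\<close>

lemma frame_eqI_0:
  assumes g: "frame g" and w: "w \<in> V" and 0: "\<And>j. j < m \<Longrightarrow> \<beta> w (g j) = 0"
  shows "w = 0\<^sub>v m"
proof -
  define u where "u = (\<lambda>i. if i < m then g i else w)"
  have u: "u i \<in> V" if "i \<le> m" for i using that g w unfolding u_def by auto
  obtain c where c: "comb m {..m} c u = 0\<^sub>v m" "\<exists>i\<le>m. c i \<noteq> 0"
    using exists_dependency[of m u] u by blast
  have ins: "{..m} = insert m {..<m}" by auto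
  have "comb m {..m} c u = c m \<cdot>\<^sub>v u m + comb m {..<m} c u"
    unfolding ins by (intro comb_insert) (use u in auto)
  also have "comb m {..<m} c u = comb m {..<m} c g"
    by (intro comb_cong) (auto simp: u_def)
  finally have eq: "c m \<cdot>\<^sub>v w + comb m {..<m} c g = 0\<^sub>v m" using c(1) unfolding u_def by simp
  have c0: "c i = 0" if "i < m" for i
  proof -
    have "0 = \<beta> (c m \<cdot>\<^sub>v w + comb m {..<m} c g) (g (m - 1 - i))"
      unfolding eq using g that by simp
    also have "\<dots> = c i" using g that w 0 by (simp add: frame_coeff)
    finally show ?thesis by simp
  qed
  then have "c m \<noteq> 0" using c(2) by (metis le_neq_implies_less)
  moreover have "comb m {..<m} c g = 0\<^sub>v m" unfolding comb_def using c0 by (intro eq_vecI) auto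
  then have "c m \<cdot>\<^sub>v w = 0\<^sub>v m" using eq w by simp
  ultimately show ?thesis using w smult_eq_0_iff by blast
qed

lemma frame_expand:
  assumes "frame g" "v \<in> V"
  shows "v = comb m {..<m} (\<lambda>i. \<beta> v (g (m - 1 - i))) g"
proof -
  let ?w = "comb m {..<m} (\<lambda>i. \<beta> v (g (m - 1 - i))) g"
  have "v + ?w = 0\<^sub>v m"
    by (rule frame_eqI_0[OF assms(1)]) (use assms in \<open>auto simp: frame_coeff\<close>)
  then show ?thesis using assms(2) vec_add_eq_0_iff by simp
qed

lemma frame_eqI:
  assumes "frame g" "v \<in> V" "w \<in> V" "\<And>j. j < m \<Longrightarrow> \<beta> v (g j) = \<beta> w (g j)"
  shows "v = w"
  using frame_eqI_0[OF assms(1), of "v + w"] assms vec_add_eq_0_iff by simp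

text \<open>Stated for an arbitrary form \<open>Q\<close>, since besides \<open>q\<close> it serves
  pullbacks of \<open>q\<close> by linear maps and combinations of these.\<close>

lemma quadratic_form_comb:
  fixes g :: "nat \<Rightarrow> 'k vec"
  assumes Q: "quadratic_form m Q" and g: "\<And>i. i < k \<Longrightarrow> g i \<in> V" "\<And>i. i < k \<Longrightarrow> Q (g i) = (0::'k)"
  shows "Q (comb m {..<k} c g) = (\<Sum>j<k. \<Sum>i<j. c i * c j * polar Q (g i) (g j))"
  using g
proof (induction k)
  case 0
  have "Q (0 \<cdot>\<^sub>v 0\<^sub>v m) = 0\<^sup>2 * Q (0\<^sub>v m)" using Q zero_carrier_vec unfolding quadratic_form_def by blast
  then show ?case by simp
next
  case (Suc k)
  let ?w = "comb m {..<k} c g"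
  have add: "additive_on m (\<lambda>v. polar Q v w)" if "w \<in> V" for w
    using Q that unfolding additive_on_def quadratic_form_def by blast
  have "comb m {..<Suc k} c g = c k \<cdot>\<^sub>v g k + ?w"
    unfolding lessThan_Suc by (intro comb_insert) (use Suc.prems in auto)
  then have "Q (comb m {..<Suc k} c g) = Q (c k \<cdot>\<^sub>v g k) + Q ?w + polar Q (c k \<cdot>\<^sub>v g k) ?w"
    unfolding polar_def by (simp add: add_ac)
  also have "Q (c k \<cdot>\<^sub>v g k) = 0" using Q Suc.prems unfolding quadratic_form_def by simp
  also have "polar Q (c k \<cdot>\<^sub>v g k) ?w = c k * polar Q (g k) ?w"
    using Q Suc.prems(1)[of k] unfolding quadratic_form_def by simp
  also have "polar Q (g k) ?w = polar Q ?w (g k)"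
    unfolding polar_def using comm_add_vec[of "g k" m ?w] Suc.prems(1)[of k] by (simp add: add_ac)
  also have "\<dots> = (\<Sum>i<k. c i * polar Q (g i) (g k))"
    using additive_on_comb[OF add, of "g k" "{..<k}" g c] Suc.prems(1) by simp
  finally show ?case using Suc by (simp add: sum_distrib_left mult_ac)
qed

text \<open>In characteristic two the polar form does not determine the quadratic form; the values
  on a basis enter as well, and here they are all zero.\<close>

lemma quadratic_form_eq_on_frame:
  assumes Q: "quadratic_form m Q" and g: "frame g" and z: "\<And>i. i < m \<Longrightarrow> Q (g i) = 0"
    and p: "\<And>i j. i < j \<Longrightarrow> j < m \<Longrightarrow> polar Q (g i) (g j) = d * \<beta> (g i) (g j)" and v: "v \<in> V"
  shows "Q v = d * q v"
proof -
  let ?c = "\<lambda>i. \<beta> v (g (m - 1 - i))"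
  have "Q v = (\<Sum>j<m. \<Sum>i<j. ?c i * ?c j * polar Q (g i) (g j))"
    by (subst frame_expand[OF g v], rule quadratic_form_comb[OF Q]) (use g z in auto)
  also have "\<dots> = d * (\<Sum>j<m. \<Sum>i<j. ?c i * ?c j * \<beta> (g i) (g j))"
    unfolding sum_distrib_left by (intro sum.cong) (auto simp: p)
  also have "(\<Sum>j<m. \<Sum>i<j. ?c i * ?c j * \<beta> (g i) (g j)) = q v"
    by (subst (3) frame_expand[OF g v], rule quadratic_form_comb[OF quadratic, symmetric]) (use g in auto)
  finally show ?thesis .
qed

section \<open>Isometries\<close>

definition Or :: "'k mat set" where
  "Or = {A \<in> carrier_mat m m. \<forall>v\<in>V. q (A *\<^sub>v v) = q v}"

lemma Or_carrier: "A \<in> Or \<Longrightarrow> A \<in> carrier_mat m m"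
  and Or_q [simp]: "A \<in> Or \<Longrightarrow> v \<in> V \<Longrightarrow> q (A *\<^sub>v v) = q v"
  unfolding Or_def by auto

lemma mat_V [simp]: "A \<in> carrier_mat m m \<Longrightarrow> v \<in> V \<Longrightarrow> A *\<^sub>v v \<in> V"
  by simp

lemma Or_V [simp]: "A \<in> Or \<Longrightarrow> v \<in> V \<Longrightarrow> A *\<^sub>v v \<in> V"
  using Or_carrier mat_V by blast

lemma mat_add [simp]: "A \<in> carrier_mat m m \<Longrightarrow> u \<in> V \<Longrightarrow> v \<in> V \<Longrightarrow> A *\<^sub>v (u + v) = A *\<^sub>v u + A *\<^sub>v (v::'k vec)"
  by (rule mult_add_distrib_mat_vec)

lemma mat_smult [simp]: "A \<in> carrier_mat m m \<Longrightarrow> v \<in> V \<Longrightarrow> A *\<^sub>v (c \<cdot>\<^sub>v v) = c \<cdot>\<^sub>v (A *\<^sub>v (v::'k vec))"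
  by (rule mult_mat_vec)

lemma mat_zero [simp]: "A \<in> carrier_mat m m \<Longrightarrow> A *\<^sub>v 0\<^sub>v m = (0\<^sub>v m :: 'k vec)"
  by (intro eq_vecI) auto

lemma Or_mult_vec [simp]: "A \<in> Or \<Longrightarrow> B \<in> Or \<Longrightarrow> v \<in> V \<Longrightarrow> (A * B) *\<^sub>v v = A *\<^sub>v (B *\<^sub>v v)"
  using Or_carrier assoc_mult_mat_vec by blast

lemma Or_mult: "A \<in> Or \<Longrightarrow> B \<in> Or \<Longrightarrow> A * B \<in> Or"
  unfolding Or_def using assoc_mult_mat_vec[of A m m B m] by auto

lemma Or_one: "1\<^sub>m m \<in> Or" unfolding Or_def by auto

lemma Or_bil [simp]: "A \<in> Or \<Longrightarrow> u \<in> V \<Longrightarrow> v \<in> V \<Longrightarrow> \<beta> (A *\<^sub>v u) (A *\<^sub>v v) = \<beta> u v"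
  unfolding polar_def using mat_add[of A u v] Or_carrier[of A] Or_q[of A "u + v"]
  by (metis Or_q add_carrier_vec)

text \<open>Invertibility is automatic, as a kernel vector of an isometry would lie in the radical
  of \<beta>.\<close>

lemma Or_GL: "A \<in> Or \<Longrightarrow> A \<in> carrier (GL m)"
proof -
  assume A: "A \<in> Or"
  have "det A \<noteq> 0"
  proof
    assume "det A = 0"
    then obtain v where v: "v \<in> V" "v \<noteq> 0\<^sub>v m" "A *\<^sub>v v = 0\<^sub>v m"
      using det_0_iff_vec_prod_zero_field[OF Or_carrier[OF A]] by blast
    have "\<beta> v w = 0" if "w \<in> V" for w
      using Or_bil[OF A v(1) that] v(3) A that by simp
    then show False using bil_nondegenerate v by blast
  qed
  then have "A \<in> Units (ring_mat TYPE('k) m ())"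
    by (rule det_non_zero_imp_unit[OF Or_carrier[OF A]])
  then show ?thesis unfolding GL_def units_of_def by simp
qed

lemma carrier_orthogonal_group: "carrier (orthogonal_group m q) = Or"
proof (rule subset_antisym; rule subsetI)
  fix A assume "A \<in> carrier (orthogonal_group m q)"
  then show "A \<in> Or" unfolding orthogonal_group_def Or_def by (simp add: GL_carrier_mat)
next
  fix A assume "A \<in> Or"
  then show "A \<in> carrier (orthogonal_group m q)"
    using Or_GL[of A] unfolding Or_def orthogonal_group_def by simp
qed

definition minv :: "'k mat \<Rightarrow> 'k mat" where "minv A = inv\<^bsub>GL m\<^esub> A"

lemma minv:
  assumes "A \<in> Or"
  shows "minv A \<in> Or" "A * minv A = 1\<^sub>m m" "minv A * A = 1\<^sub>m m"
proof -
  interpret group "GL m :: 'k mat monoid" by (rule group_GL)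
  show "minv A \<in> Or" unfolding minv_def
    using subgroup.m_inv_closed[OF subgroup_orthogonal_group[of m q]] assms carrier_orthogonal_group by auto
  show "A * minv A = 1\<^sub>m m" "minv A * A = 1\<^sub>m m"
    using r_inv[OF Or_GL[OF assms]] l_inv[OF Or_GL[OF assms]] unfolding minv_def by simp_all
qed

lemma minv_unique:
  assumes "A \<in> Or" "B \<in> Or" "A * B = 1\<^sub>m m"
  shows "minv A = B"
proof -
  interpret group "GL m :: 'k mat monoid" by (rule group_GL)
  show ?thesis unfolding minv_def
    using inv_unique'[OF Or_GL[OF assms(1)] Or_GL[OF assms(2)]] assms(3)
      mat_mult_left_right_inverse[OF Or_carrier[OF assms(1)] Or_carrier[OF assms(2)] assms(3)] by simp
qed

lemma minv_vec [simp]: "A \<in> Or \<Longrightarrow> v \<in> V \<Longrightarrow> A *\<^sub>v (minv A *\<^sub>v v) = v"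
  "A \<in> Or \<Longrightarrow> v \<in> V \<Longrightarrow> minv A *\<^sub>v (A *\<^sub>v v) = v"
  using Or_mult_vec[of A "minv A" v] Or_mult_vec[of "minv A" A v] minv[of A] by auto

lemma bil_minv: "A \<in> Or \<Longrightarrow> u \<in> V \<Longrightarrow> v \<in> V \<Longrightarrow> \<beta> (minv A *\<^sub>v u) v = \<beta> u (A *\<^sub>v v)"
  using Or_bil[of A "minv A *\<^sub>v u" v] minv(1) by simp

lemma mat_expand:
  assumes "frame g" "A \<in> carrier_mat m m" "v \<in> V"
  shows "A *\<^sub>v v = comb m {..<m} (\<lambda>i. \<beta> v (g (m - 1 - i))) (\<lambda>i. A *\<^sub>v g i)"
proof -
  have "A *\<^sub>v v = A *\<^sub>v comb m {..<m} (\<lambda>i. \<beta> v (g (m - 1 - i))) g"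
    using frame_expand[OF assms(1,3)] by (rule arg_cong)
  also have "\<dots> = comb m {..<m} (\<lambda>i. \<beta> v (g (m - 1 - i))) (\<lambda>i. A *\<^sub>v g i)"
    by (rule mult_mat_comb[OF assms(2)]) (use assms in auto)
  finally show ?thesis .
qed

lemma Or_eqI:
  assumes "frame g" "A \<in> Or" "B \<in> Or" "\<And>i. i < m \<Longrightarrow> A *\<^sub>v g i = B *\<^sub>v g i"
  shows "A = B"
proof (rule mat_eq_iff_mult_vec[OF Or_carrier[OF assms(2)] Or_carrier[OF assms(3)]])
  fix v assume v: "v \<in> V"
  show "A *\<^sub>v v = B *\<^sub>v v"
    unfolding mat_expand[OF assms(1) Or_carrier[OF assms(2)] v] mat_expand[OF assms(1) Or_carrier[OF assms(3)] v]
    using assms(4) by (intro comb_cong) auto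
qed

lemma frame_image: "frame g \<Longrightarrow> A \<in> Or \<Longrightarrow> frame (\<lambda>i. A *\<^sub>v g i)"
  unfolding frame_def by auto

text \<open>The pullback of \<open>q\<close> by \<open>A\<close> is a quadratic form that vanishes
  on the frame and has the same polar values there, hence equals \<open>q\<close>.\<close>

lemma frame_image_rev:
  assumes "frame g" "A \<in> carrier_mat m m" "frame (\<lambda>i. A *\<^sub>v g i)"
  shows "A \<in> Or"
proof -
  let ?Q = "\<lambda>v. q (A *\<^sub>v v)"
  have pol: "polar ?Q u v = \<beta> (A *\<^sub>v u) (A *\<^sub>v v)" if "u \<in> V" "v \<in> V" for u v
    unfolding polar_def using that assms(2) by simp
  have Q: "quadratic_form m ?Q"
    unfolding quadratic_form_def using assms(2) by (simp add: pol)
  have "?Q v = 1 * q v" if "v \<in> V" for v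
    by (rule quadratic_form_eq_on_frame[OF Q assms(1) _ _ that])
      (use assms in \<open>auto simp: pol frame_bil frame_bil[OF assms(3)] frame_q[OF assms(3)]\<close>)
  then show ?thesis unfolding Or_def using assms(2) by simp
qed

text \<open>An explicit formula instead of a choice: the entries are linear in the coordinates of
  \<open>h\<close>, so a frame depending rationally on a parameter gives a matrix depending
  rationally on it.\<close>

definition frame_mat :: "(nat \<Rightarrow> 'k vec) \<Rightarrow> (nat \<Rightarrow> 'k vec) \<Rightarrow> 'k mat" where
  "frame_mat g h = mat m m (\<lambda>(a, b). \<Sum>i<m. \<beta> (unit_vec m b) (g (m - 1 - i)) * h i $ a)"

lemma frame_mat_carrier [simp]: "frame_mat g h \<in> carrier_mat m m"
  unfolding frame_mat_def by simp

lemma frame_mat_frame: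
  assumes g: "frame g" and h: "\<And>i. i < m \<Longrightarrow> h i \<in> V" and i: "i < m"
  shows "frame_mat g h *\<^sub>v g i = h i"
proof -
  define L where "L = (\<lambda>v. comb m {..<m} (\<lambda>i. \<beta> v (g (m - 1 - i))) h)"
  have L1: "L v \<in> V" for v unfolding L_def by simp
  have L2: "L (u + v) = L u + L v" if "u \<in> V" "v \<in> V" for u v
    unfolding L_def comb_def using that g by (intro eq_vecI) (auto simp: sum.distrib algebra_simps)
  have L3: "L (c \<cdot>\<^sub>v v) = c \<cdot>\<^sub>v L v" if "v \<in> V" for c v
    unfolding L_def comb_def using that g by (intro eq_vecI) (auto simp: sum_distrib_left mult_ac)
  have "frame_mat g h = mat m m (\<lambda>(i, j). L (unit_vec m j) $ i)"
    unfolding frame_mat_def L_def comb_def by (intro eq_matI) auto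
  then have "frame_mat g h *\<^sub>v g i = L (g i)"
    using mat_of_linear(2)[of m L "g i"] L1 L2 L3 g i by simp
  also have "\<dots> = h i"
  proof (rule eq_vecI)
    fix a assume "a < dim_vec (h i)"
    then have a: "a < m" using h[OF i] by simp
    have "L (g i) $ a = (\<Sum>j<m. \<beta> (g i) (g (m - 1 - j)) * h j $ a)"
      unfolding L_def comb_def using a by simp
    also have "\<dots> = (\<Sum>j<m. if j = i then h j $ a else 0)"
      using i by (intro sum.cong) (auto simp: frame_bil[OF g])
    also have "\<dots> = h i $ a" using i by simp
    finally show "L (g i) $ a = h i $ a" .
  qed (use h[OF i] in \<open>simp add: L_def comb_def\<close>)
  finally show ?thesis .
qed

lemma frame_mat_Or:
  assumes "frame g" "frame h"
  shows "frame_mat g h \<in> Or"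
proof (rule frame_image_rev[OF assms(1)])
  have "frame_mat g h *\<^sub>v g i = h i" if "i < m" for i
    using frame_mat_frame[OF assms(1)] assms(2) that by simp
  then show "frame (\<lambda>i. frame_mat g h *\<^sub>v g i)" using assms(2) unfolding frame_def by simp
qed simp

lemma frame_map:
  assumes g: "frame g" and h: "frame h"
  obtains A where "A \<in> Or" "\<And>i. i < m \<Longrightarrow> A *\<^sub>v g i = h i"
  using that frame_mat_Or[OF assms] frame_mat_frame[OF g] h by (metis frame_carrier)

section \<open>Hyperbolic pairs\<close>

text \<open>\<open>hyp k e f\<close>: \<open>k\<close> mutually orthogonal hyperbolic pairs \<open>(e i, f i)\<close>; \<open>orth k e f\<close> is the orthogonal
  complement of their span.\<close>

definition hyp :: "nat \<Rightarrow> (nat \<Rightarrow> 'k vec) \<Rightarrow> (nat \<Rightarrow> 'k vec) \<Rightarrow> bool" where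
  "hyp k e f \<longleftrightarrow> (\<forall>i<k. e i \<in> V \<and> f i \<in> V \<and> q (e i) = 0 \<and> q (f i) = 0) \<and>
     (\<forall>i<k. \<forall>j<k. \<beta> (e i) (e j) = 0 \<and> \<beta> (f i) (f j) = 0 \<and> \<beta> (e i) (f j) = (if i = j then 1 else 0))"

definition orth :: "nat \<Rightarrow> (nat \<Rightarrow> 'k vec) \<Rightarrow> (nat \<Rightarrow> 'k vec) \<Rightarrow> 'k vec \<Rightarrow> bool" where
  "orth k e f v \<longleftrightarrow> v \<in> V \<and> (\<forall>i<k. \<beta> v (e i) = 0 \<and> \<beta> v (f i) = 0)"

lemma hypD:
  assumes "hyp k e f" "i < k"
  shows "e i \<in> V" "f i \<in> V" "q (e i) = 0" "q (f i) = 0"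
    "j < k \<Longrightarrow> \<beta> (e i) (e j) = 0" "j < k \<Longrightarrow> \<beta> (f i) (f j) = 0"
    "j < k \<Longrightarrow> \<beta> (e i) (f j) = (if i = j then 1 else 0)"
    "j < k \<Longrightarrow> \<beta> (f i) (e j) = (if i = j then 1 else 0)"
proof -
  show 1: "e i \<in> V" "f i \<in> V" "q (e i) = 0" "q (f i) = 0" "j < k \<Longrightarrow> \<beta> (e i) (e j) = 0"
    "j < k \<Longrightarrow> \<beta> (f i) (f j) = 0" "j < k \<Longrightarrow> \<beta> (e i) (f j) = (if i = j then 1 else 0)"
    using assms unfolding hyp_def by auto
  assume j: "j < k"
  then have "\<beta> (f i) (e j) = \<beta> (e j) (f i)" using assms bil_sym unfolding hyp_def by auto
  then show "\<beta> (f i) (e j) = (if i = j then 1 else 0)" using assms j unfolding hyp_def by auto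
qed

lemma orth_add: "orth k e f u \<Longrightarrow> orth k e f v \<Longrightarrow> hyp k e f \<Longrightarrow> orth k e f (u + v)"
  unfolding orth_def hyp_def by auto

lemma orth_smult: "orth k e f u \<Longrightarrow> hyp k e f \<Longrightarrow> orth k e f (c \<cdot>\<^sub>v u)"
  unfolding orth_def hyp_def by auto

lemma hyp_extend:
  assumes h: "hyp k e f" and "orth k e f u" "orth k e f w" "q u = 0" "q w = 0" "\<beta> u w = 1"
  shows "hyp (Suc k) (e(k := u)) (f(k := w))"
proof -
  have *: "u \<in> V" "w \<in> V" "\<And>i. i < k \<Longrightarrow> \<beta> u (e i) = 0" "\<And>i. i < k \<Longrightarrow> \<beta> u (f i) = 0"
     "\<And>i. i < k \<Longrightarrow> \<beta> w (e i) = 0" "\<And>i. i < k \<Longrightarrow> \<beta> w (f i) = 0"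
    using assms unfolding orth_def by auto
  have **: "\<And>i. i < k \<Longrightarrow> \<beta> (e i) u = 0" "\<And>i. i < k \<Longrightarrow> \<beta> (f i) u = 0"
     "\<And>i. i < k \<Longrightarrow> \<beta> (e i) w = 0" "\<And>i. i < k \<Longrightarrow> \<beta> (f i) w = 0"
    using * hypD[OF h] bil_sym by metis+
  show ?thesis unfolding hyp_def
    using * ** hypD[OF h] assms(4-6) by (auto simp: less_Suc_eq)
qed

text \<open>Removing the components along the pairs changes no product with a vector orthogonal to
  all of them.\<close>

lemma exists_orth_projection:
  assumes h: "hyp k e f" and v: "v \<in> V"
  obtains w where "orth k e f w" "\<And>z. orth k e f z \<Longrightarrow> \<beta> w z = \<beta> v z"
proof -
  define w where "w = v + (comb m {..<k} (\<lambda>i. \<beta> v (f i)) e + comb m {..<k} (\<lambda>i. \<beta> v (e i)) f)"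
  have b: "\<beta> w z = \<beta> v z + ((\<Sum>i<k. \<beta> v (f i) * \<beta> (e i) z) + (\<Sum>i<k. \<beta> v (e i) * \<beta> (f i) z))" if "z \<in> V" for z
  proof -
    have "\<beta> (comb m {..<k} (\<lambda>i. \<beta> v (f i)) e) z = (\<Sum>i<k. \<beta> v (f i) * \<beta> (e i) z)"
      "\<beta> (comb m {..<k} (\<lambda>i. \<beta> v (e i)) f) z = (\<Sum>i<k. \<beta> v (e i) * \<beta> (f i) z)"
      by (rule bil_comb_left; use that hypD[OF h] in auto)+
    then show ?thesis unfolding w_def using v that by simp
  qed
  have "orth k e f w"
    unfolding orth_def
  proof (intro conjI allI impI)
    show "w \<in> V" unfolding w_def using v by simp
    fix j assume j: "j < k"
    have "(\<Sum>i<k. \<beta> v (f i) * \<beta> (e i) (e j)) = 0" "(\<Sum>i<k. \<beta> v (e i) * \<beta> (f i) (f j)) = 0"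
      using j hypD[OF h] by (auto intro!: sum.neutral)
    moreover have "(\<Sum>i<k. \<beta> v (e i) * \<beta> (f i) (e j)) = (\<Sum>i<k. if i = j then \<beta> v (e i) else 0)"
      using j hypD[OF h] by (intro sum.cong) auto
    moreover have "(\<Sum>i<k. \<beta> v (f i) * \<beta> (e i) (f j)) = (\<Sum>i<k. if i = j then \<beta> v (f i) else 0)"
      using j hypD[OF h] by (intro sum.cong) auto
    ultimately show "\<beta> w (e j) = 0" "\<beta> w (f j) = 0"
      using b[of "e j"] b[of "f j"] j hypD[OF h] by auto
  qed
  moreover have "\<beta> w z = \<beta> v z" if z: "orth k e f z" for z
  proof -
    have zV: "z \<in> V" using z unfolding orth_def by simp
    have "\<beta> (e i) z = 0" "\<beta> (f i) z = 0" if "i < k" for i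
      using z that hypD[OF h] bil_sym[OF zV] unfolding orth_def by auto
    then show ?thesis using b[OF zV] by simp
  qed
  ultimately show ?thesis using that by blast
qed

lemma exists_orth_dual:
  assumes "hyp k e f" "orth k e f u" "u \<noteq> 0\<^sub>v m"
  obtains w where "orth k e f w" "\<beta> u w = 1"
proof -
  have u: "u \<in> V" using assms unfolding orth_def by simp
  obtain y where y: "y \<in> V" "\<beta> u y \<noteq> 0" using bil_nondegenerate[OF u] assms(3) by blast
  obtain w where w: "orth k e f w" "\<And>z. orth k e f z \<Longrightarrow> \<beta> w z = \<beta> y z"
    using exists_orth_projection[OF assms(1) y(1)] by blast
  have wV: "w \<in> V" using w unfolding orth_def by simp
  have "\<beta> u w = \<beta> u y" using w(2)[OF assms(2)] bil_sym u y(1) wV by metis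
  then have "\<beta> u (inverse (\<beta> u y) \<cdot>\<^sub>v w) = 1" using u wV y by simp
  then show ?thesis using that orth_smult w(1) assms(1) by blast
qed

text \<open>A vector \<open>y\<close> with \<open>\<beta> u y = 1\<close> becomes singular after
  adding \<open>q y\<close> times \<open>u\<close>: the change of \<open>q\<close> is
  \<open>q y * \<beta> y u\<close>, which cancels \<open>q y\<close>.\<close>

lemma exists_partner:
  assumes "hyp k e f" "orth k e f u" "u \<noteq> 0\<^sub>v m" "q u = 0"
  obtains w where "orth k e f w" "q w = 0" "\<beta> u w = 1"
proof -
  obtain y where y: "orth k e f y" "\<beta> u y = 1" using exists_orth_dual assms by blast
  have V: "u \<in> V" "y \<in> V" using y assms unfolding orth_def by auto
  have "q (y + q y \<cdot>\<^sub>v u) = 0" using V y assms(4) bil_sym[of y u] by (simp add: q_add)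
  moreover have "\<beta> u (y + q y \<cdot>\<^sub>v u) = 1" using V y by simp
  ultimately show ?thesis using that orth_add orth_smult y(1) assms(1,2) by blast
qed

text \<open>The \<open>2 * k\<close> orthogonality conditions leave two independent solutions
  \<open>y\<close> and \<open>z\<close>. If \<open>z\<close> is not singular itself,
  \<open>q\<close> on the line of all \<open>y + c z\<close> is a quadratic polynomial in
  \<open>c\<close> and has a root.\<close>

lemma exists_orth_singular:
  assumes h: "hyp k e f" and k: "k < n"
  obtains u where "orth k e f u" "u \<noteq> 0\<^sub>v m" "q u = 0"
proof -
  define \<phi> where "\<phi> = (\<lambda>i v. if i < k then \<beta> v (e i) else if i < 2 * k then \<beta> v (f (i - k)) else v $ (i - 2 * k) :: 'k)"
  have orth: "orth k e f v" if "v \<in> V" "\<And>i. i < 2 * k \<Longrightarrow> \<phi> i v = 0" for v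
    unfolding orth_def
  proof (intro conjI allI impI)
    fix i assume "i < k"
    then show "\<beta> v (e i) = 0" "\<beta> v (f i) = 0" using that(2)[of i] that(2)[of "i + k"] unfolding \<phi>_def by auto
  qed (rule that(1))
  have add: "additive_on m (\<phi> i)" if "i < 2 * k" for i
    unfolding \<phi>_def using that hypD(1)[OF h, of i] hypD(2)[OF h, of "i - k"]
    by (cases "i < k") (simp_all add: additive_bil)
  obtain y where y: "y \<in> V" "y \<noteq> 0\<^sub>v m" "\<And>i. i < 2 * k \<Longrightarrow> \<phi> i y = 0"
    using exists_common_kernel[of "2 * k" m \<phi>] add k m_def by auto
  obtain l where l: "l < m" "y $ l \<noteq> 0"
    using y(1,2) by (metis carrier_vecD eq_vecI index_zero_vec)
  \<comment> \<open>One extra condition, the vanishing of a coordinate \<open>l\<close> at which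
    \<open>y\<close> does not vanish, makes \<open>z\<close> independent of \<open>y\<close>; the
    same coordinate later shows \<open>y + c z\<close> to be nonzero.\<close>
  define \<psi> where "\<psi> = (\<lambda>i v. if i < 2 * k then \<phi> i v else v $ l)"
  have "additive_on m (\<psi> i)" for i
    using add l unfolding \<psi>_def additive_on_def by auto
  then obtain z where z: "z \<in> V" "z \<noteq> 0\<^sub>v m" "\<And>i. i < Suc (2 * k) \<Longrightarrow> \<psi> i z = 0"
    using exists_common_kernel[of "Suc (2 * k)" m \<psi>] k m_def by auto
  have zl: "z $ l = 0" using z(3)[of "2 * k"] unfolding \<psi>_def by simp
  have oz: "orth k e f z" using orth[OF z(1)] z(3) unfolding \<psi>_def by (metis less_Suc_eq)
  have oy: "orth k e f y" using orth y by blast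
  show ?thesis
  proof (cases "q z = 0")
    case True
    then show ?thesis using that oz z(2) by blast
  next
    case False
    obtain c where c: "q y + \<beta> y z * c + q z * c\<^sup>2 = 0" using exists_quadratic_root[OF False] by blast
    have "q (y + c \<cdot>\<^sub>v z) = 0" using c y z by (simp add: q_add algebra_simps)
    moreover have "(y + c \<cdot>\<^sub>v z) $ l \<noteq> 0" using l zl y z by simp
    then have "y + c \<cdot>\<^sub>v z \<noteq> 0\<^sub>v m" using l by auto
    ultimately show ?thesis using that orth_add[OF oy orth_smult[OF oz h] h] by blast
  qed
qed

lemma exists_hyp_extension:
  assumes "hyp k e f" "k \<le> n"
  obtains e' f' where "hyp n e' f'" "\<And>i. i < k \<Longrightarrow> e' i = e i" "\<And>i. i < k \<Longrightarrow> f' i = f i"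
proof -
  have "\<exists>e' f'. hyp n e' f' \<and> (\<forall>i<k. e' i = e i \<and> f' i = f i)"
    using assms(2,1)
  proof (induction k arbitrary: e f rule: inc_induct)
    case base
    then show ?case by blast
  next
    case (step k)
    obtain u where u: "orth k e f u" "u \<noteq> 0\<^sub>v m" "q u = 0"
      using exists_orth_singular[OF step.prems step.hyps(2)] by blast
    obtain w where w: "orth k e f w" "q w = 0" "\<beta> u w = 1"
      using exists_partner[OF step.prems u] by blast
    obtain e' f' where *: "hyp n e' f'" "\<forall>i<Suc k. e' i = (e(k := u)) i \<and> f' i = (f(k := w)) i"
      using step.IH[OF hyp_extend[OF step.prems u(1) w(1) u(3) w(2,3)]] by blast
    then show ?case by (intro exI[of _ e'] exI[of _ f']) auto
  qed
  then show ?thesis using that by blast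
qed

lemma hyp_frame:
  assumes "hyp n e f"
  shows "frame (\<lambda>i. if i < n then e i else f (m - 1 - i))"
  unfolding frame_def using hypD[OF assms] m_def by (auto simp: not_less)

lemma frame_hyp:
  assumes "frame g" "k \<le> n"
  shows "hyp k g (\<lambda>i. g (m - 1 - i))"
  unfolding hyp_def
proof (intro conjI allI impI)
  fix i assume "i < k"
  then have lt: "i < m" "m - 1 - i < m" using assms(2) m_def by auto
  show "g i \<in> V" "g (m - 1 - i) \<in> V" "q (g i) = 0" "q (g (m - 1 - i)) = 0"
    using lt assms(1) by simp_all
  fix j assume "j < k"
  then have lt': "j < m" "m - 1 - j < m" and ne: "i + j \<noteq> m - 1" "m - 1 - i + (m - 1 - j) \<noteq> m - 1"
    "i + (m - 1 - j) = m - 1 \<longleftrightarrow> i = j"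
    using \<open>i < k\<close> assms(2) m_def by auto
  show "\<beta> (g i) (g j) = 0" "\<beta> (g (m - 1 - i)) (g (m - 1 - j)) = 0"
    "\<beta> (g i) (g (m - 1 - j)) = (if i = j then 1 else 0)"
    unfolding frame_bil[OF assms(1) lt(1) lt'(1)] frame_bil[OF assms(1) lt(2) lt'(2)]
      frame_bil[OF assms(1) lt(1) lt'(2)] using ne by simp_all
qed

lemma exists_frame:
  assumes "hyp k e f" "k \<le> n"
  obtains g where "frame g" "\<And>i. i < k \<Longrightarrow> g i = e i" "\<And>i. i < k \<Longrightarrow> g (m - 1 - i) = f i"
proof -
  obtain e' f' where ef: "hyp n e' f'" "\<And>i. i < k \<Longrightarrow> e' i = e i" "\<And>i. i < k \<Longrightarrow> f' i = f i"
    using exists_hyp_extension[OF assms] by blast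
  show ?thesis
    by (rule that[OF hyp_frame[OF ef(1)]]) (use ef assms(2) m_def in auto)
qed

lemma exists_frame_vector:
  assumes "u \<in> V" "u \<noteq> 0\<^sub>v m" "q u = 0"
  obtains g where "frame g" "g 0 = u"
proof -
  have h0: "hyp 0 e f" for e f unfolding hyp_def by simp
  have o0: "v \<in> V \<Longrightarrow> orth 0 e f v" for e f v unfolding orth_def by simp
  obtain w where w: "orth 0 (\<lambda>_. u) (\<lambda>_. u) w" "q w = 0" "\<beta> u w = 1"
    by (rule exists_partner[OF h0 o0[OF assms(1)] assms(2,3)])
  have "hyp 1 ((\<lambda>_. u)(0 := u)) ((\<lambda>_. u)(0 := w))"
    using hyp_extend[OF h0 o0[OF assms(1)] w(1) assms(3) w(2,3)] by simp
  then obtain g where "frame g" "\<And>i. i < 1 \<Longrightarrow> g i = ((\<lambda>_. u)(0 := u)) i"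
    using exists_frame[of 1] n3 by (metis One_nat_def Suc_leD numeral_3_eq_3)
  then show ?thesis using that[of g] by simp
qed

text \<open>The dual vector of \<open>u\<close> supplied by a frame need not be orthogonal to
  \<open>w\<close>. So \<open>w\<close> is corrected by \<open>u\<close> only to find its partner
  \<open>f1\<close> in the complement, and then the dual of \<open>u\<close> is corrected by
  \<open>f1\<close> while \<open>w\<close> itself is retained.\<close>

lemma exists_frame_pair:
  assumes u: "u \<in> V" "u \<noteq> 0\<^sub>v m" "q u = 0" and w: "w \<in> V" "q w = 0" "\<beta> u w = 0"
    and indep: "\<And>c. w \<noteq> c \<cdot>\<^sub>v u"
  obtains g where "frame g" "g 0 = u" "g 1 = w"
proof -
  obtain g where g: "frame g" "g 0 = u" using exists_frame_vector[OF u] by blast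
  define f0 where "f0 = g (m - 1)"
  have f0: "f0 \<in> V" "q f0 = 0" "\<beta> u f0 = 1"
    using g m_pos frame_bil[OF g(1), of 0 "m - 1"] unfolding f0_def by auto
  define a where "a = \<beta> w f0"
  define w0 where "w0 = w + a \<cdot>\<^sub>v u"
  have h1: "hyp 1 (\<lambda>_. u) (\<lambda>_. f0)" unfolding hyp_def using u f0 by simp
  have sym: "\<beta> w u = 0" "\<beta> f0 u = 1" using w(3) bil_sym u(1) w(1) f0 by metis+
  have o1: "orth 1 (\<lambda>_. u) (\<lambda>_. f0) w0"
    unfolding orth_def w0_def using w u f0 sym by (auto simp: a_def)
  have "w0 \<noteq> 0\<^sub>v m" unfolding w0_def using vec_add_eq_0_iff[of w "a \<cdot>\<^sub>v u"] w u indep by auto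
  moreover have "q w0 = 0" unfolding w0_def using w u sym by (simp add: q_add)
  ultimately obtain f1 where f1: "orth 1 (\<lambda>_. u) (\<lambda>_. f0) f1" "q f1 = 0" "\<beta> w0 f1 = 1"
    using exists_partner[OF h1 o1] by blast
  have f1': "f1 \<in> V" "\<beta> f1 u = 0" "\<beta> f1 f0 = 0" using f1(1) unfolding orth_def by auto
  have f1'': "\<beta> u f1 = 0" "\<beta> f0 f1 = 0" using f1' bil_sym u f0 by metis+
  have wf1: "\<beta> w f1 = 1" using f1(3) f1'' f1' w u unfolding w0_def by simp
  define f0' where "f0' = f0 + a \<cdot>\<^sub>v f1"
  have f0': "f0' \<in> V" "q f0' = 0" "\<beta> u f0' = 1" "\<beta> w f0' = 0" "\<beta> f1 f0' = 0"
    unfolding f0'_def using f0 f1' f1'' f1(2) u w wf1 by (auto simp: q_add a_def)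
  have "hyp 1 (\<lambda>_. u) (\<lambda>_. f0')" unfolding hyp_def using u f0' by simp
  moreover have "orth 1 (\<lambda>_. u) (\<lambda>_. f0') w" "orth 1 (\<lambda>_. u) (\<lambda>_. f0') f1"
    unfolding orth_def using w f1' f0' sym by auto
  ultimately have "hyp (Suc 1) ((\<lambda>_. u)(1 := w)) ((\<lambda>_. f0')(1 := f1))"
    using hyp_extend w(2) f1(2) wf1 by blast
  then obtain g' where g': "frame g'" "\<And>i. i < Suc 1 \<Longrightarrow> g' i = ((\<lambda>_. u)(1 := w)) i"
    using exists_frame[of "Suc 1"] n3 by (metis One_nat_def Suc_leD numeral_2_eq_2 numeral_3_eq_3)
  show ?thesis using that[OF g'(1)] g'(2)[of 0] g'(2)[of 1] by simp
qed

end

section \<open>Rational curves and irreducibility\<close>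

text \<open>A root of \<open>p + 1\<close> is a point where \<open>p\<close> takes the value -1;
  algebraic closedness thus provides enough points.\<close>

lemma exists_poly_nonzero:
  fixes p :: "'a::alg_closed_field poly"
  assumes "p \<noteq> 0"
  obtains t where "poly p t \<noteq> 0"
proof (rule ccontr)
  assume "\<not> thesis"
  then have 0: "poly p t = 0" for t using that by blast
  show False
  proof (cases "degree p > 0")
    case True
    then have "degree (p + 1) > 0" by (metis degree_1 degree_add_eq_left)
    then obtain t where "poly (p + 1) t = 0" using alg_closed_imp_poly_has_root by blast
    then show False using 0[of t] by simp
  next
    case False
    then obtain c where "p = [:c:]" using degree_eq_zeroE by blast
    then show False using 0[of 0] assms by simp
  qed
qed

text \<open>\<open>\<phi>\<close> is the quotient of a polynomial by a power of \<open>d\<close> wherever \<open>d\<close> does not vanish.\<close>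

definition regular :: "'a::field poly \<Rightarrow> ('a \<Rightarrow> 'a) \<Rightarrow> bool" where
  "regular d \<phi> \<longleftrightarrow> (\<exists>F N. \<forall>t. poly d t \<noteq> 0 \<longrightarrow> poly d t ^ N * \<phi> t = poly F t)"

lemma regularI: "(\<And>t. poly d t \<noteq> 0 \<Longrightarrow> poly d t ^ N * \<phi> t = poly F t) \<Longrightarrow> regular d \<phi>"
  unfolding regular_def by blast

lemma regular_poly: "regular d (poly p)"
  by (rule regularI[of _ 0]) simp

lemma regular_const: "regular d (\<lambda>t. c)"
proof -
  have "poly [:c:] = (\<lambda>t. c)" by (rule ext) simp
  then show ?thesis using regular_poly[of d "[:c:]"] by simp
qed

lemma regular_inverse: "regular d (\<lambda>t. inverse (poly d t))"
  by (rule regularI[of _ 1 _ 1]) simp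

lemma regular_cong:
  assumes "regular d \<phi>" "\<And>t. poly d t \<noteq> 0 \<Longrightarrow> \<phi> t = \<psi> t"
  shows "regular d \<psi>"
  using assms unfolding regular_def by metis

lemma regular_add:
  assumes "regular d \<phi>" "regular d \<psi>"
  shows "regular d (\<lambda>t. \<phi> t + \<psi> t)"
proof -
  obtain F N G M where *: "\<forall>t. poly d t \<noteq> 0 \<longrightarrow> poly d t ^ N * \<phi> t = poly F t"
    "\<forall>t. poly d t \<noteq> 0 \<longrightarrow> poly d t ^ M * \<psi> t = poly G t"
    using assms unfolding regular_def by blast
  show ?thesis
  proof (rule regularI[of _ "N + M" _ "d ^ M * F + d ^ N * G"])
    fix t assume t: "poly d t \<noteq> 0"
    have "poly d t ^ (N + M) * (\<phi> t + \<psi> t) =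
      poly d t ^ M * (poly d t ^ N * \<phi> t) + poly d t ^ N * (poly d t ^ M * \<psi> t)"
      by (simp add: power_add algebra_simps)
    then show "poly d t ^ (N + M) * (\<phi> t + \<psi> t) = poly (d ^ M * F + d ^ N * G) t"
      using * t by simp
  qed
qed

lemma regular_mult:
  assumes "regular d \<phi>" "regular d \<psi>"
  shows "regular d (\<lambda>t. \<phi> t * \<psi> t)"
proof -
  obtain F N G M where *: "\<forall>t. poly d t \<noteq> 0 \<longrightarrow> poly d t ^ N * \<phi> t = poly F t"
    "\<forall>t. poly d t \<noteq> 0 \<longrightarrow> poly d t ^ M * \<psi> t = poly G t"
    using assms unfolding regular_def by blast
  show ?thesis
  proof (rule regularI[of _ "N + M" _ "F * G"])
    fix t assume t: "poly d t \<noteq> 0"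
    have "poly d t ^ (N + M) * (\<phi> t * \<psi> t) = (poly d t ^ N * \<phi> t) * (poly d t ^ M * \<psi> t)"
      by (simp add: power_add algebra_simps)
    then show "poly d t ^ (N + M) * (\<phi> t * \<psi> t) = poly (F * G) t" using * t by simp
  qed
qed

lemma regular_sum:
  assumes "finite K" "\<And>i. i \<in> K \<Longrightarrow> regular d (\<phi> i)"
  shows "regular d (\<lambda>t. \<Sum>i\<in>K. \<phi> i t)"
  using assms
proof (induction K)
  case empty
  then show ?case by (simp add: regular_const)
next
  case (insert i K)
  then show ?case using regular_add[of d "\<phi> i" "\<lambda>t. \<Sum>i\<in>K. \<phi> i t"] by simp
qed

lemma regular_dvd:
  assumes "regular d \<phi>"
  shows "regular (d * d') \<phi>"
proof -
  obtain F N where *: "\<forall>t. poly d t \<noteq> 0 \<longrightarrow> poly d t ^ N * \<phi> t = poly F t"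
    using assms unfolding regular_def by blast
  show ?thesis
    by (rule regularI[of _ N _ "d' ^ N * F"])
      (use * in \<open>auto simp: power_mult_distrib mult_ac\<close>)
qed

lemma regular_pcompose:
  assumes "regular d \<phi>"
  shows "regular (pcompose d p) (\<lambda>t. \<phi> (poly p t))"
proof -
  obtain F N where *: "\<forall>t. poly d t \<noteq> 0 \<longrightarrow> poly d t ^ N * \<phi> t = poly F t"
    using assms unfolding regular_def by blast
  show ?thesis
    by (rule regularI[of _ N _ "pcompose F p"]) (use * in \<open>auto simp: poly_pcompose\<close>)
qed

text \<open>Two nonempty open subsets meet, tested on principal open sets. The set \<open>S\<close>
  may be any set of matrices, closed or not.\<close>

definition irreducible_set :: "nat \<Rightarrow> 'a::field mat set \<Rightarrow> bool" where
  "irreducible_set m S \<longleftrightarrow> (\<forall>f g. polynomial_fun m f \<longrightarrow> polynomial_fun m g \<longrightarrow>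
     (\<exists>A\<in>S. f A \<noteq> 0) \<longrightarrow> (\<exists>A\<in>S. g A \<noteq> 0) \<longrightarrow> (\<exists>A\<in>S. f A \<noteq> 0 \<and> g A \<noteq> 0))"

lemma irreducible_imp_connected:
  assumes "irreducible_set m S" "S \<subseteq> carrier_mat m m"
  shows "connectedin (zariski m) S"
  unfolding connectedin_closedin
proof (intro conjI notI)
  show "S \<subseteq> topspace (zariski m)" using assms(2) by (simp add: topspace_zariski)
  assume "\<exists>E1 E2. closedin (zariski m) E1 \<and> closedin (zariski m) E2 \<and> S \<subseteq> E1 \<union> E2 \<and>
    E1 \<inter> E2 \<inter> S = {} \<and> E1 \<inter> S \<noteq> {} \<and> E2 \<inter> S \<noteq> {}"
  then obtain E1 E2 A1 A2 where E: "algebraic_set m E1" "algebraic_set m E2" "S \<subseteq> E1 \<union> E2"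
    "E1 \<inter> E2 \<inter> S = {}" "A1 \<in> E1" "A1 \<in> S" "A2 \<in> E2" "A2 \<in> S"
    unfolding closedin_zariski by blast
  obtain F1 where F1: "\<forall>f\<in>F1. polynomial_fun m f" "E1 = zero_locus m F1"
    using E(1) unfolding algebraic_set_def by blast
  obtain F2 where F2: "\<forall>f\<in>F2. polynomial_fun m f" "E2 = zero_locus m F2"
    using E(2) unfolding algebraic_set_def by blast
  have "A2 \<notin> E1" "A1 \<notin> E2" using E by auto
  then obtain f1 f2 where f: "f1 \<in> F1" "f1 A2 \<noteq> 0" "f2 \<in> F2" "f2 A1 \<noteq> 0"
    using F1 F2 E assms(2) unfolding zero_locus_def by blast
  then obtain A where A: "A \<in> S" "f1 A \<noteq> 0" "f2 A \<noteq> 0"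
    using assms(1) F1(1) F2(1) E unfolding irreducible_set_def by blast
  then have "A \<notin> E1" "A \<notin> E2" using f F1(2) F2(2) unfolding zero_locus_def by auto
  then show False using A(1) E(3) by blast
qed

context char2_quadratic_space
begin

subsection \<open>Polynomial functions on the orthogonal group\<close>

text \<open>Agreement with a polynomial is demanded only on \<open>Or\<close>. There the inverse is
  polynomial in the entries, so conjugates and commutators remain polynomial and no denominators
  occur.\<close>

definition pf :: "('k mat \<Rightarrow> 'k) \<Rightarrow> bool" where
  "pf F \<longleftrightarrow> (\<exists>f. polynomial_fun m f \<and> (\<forall>A\<in>Or. F A = f A))"

definition pfv :: "('k mat \<Rightarrow> 'k vec) \<Rightarrow> bool" where
  "pfv u \<longleftrightarrow> (\<forall>A\<in>Or. u A \<in> V) \<and> (\<forall>i<m. pf (\<lambda>A. u A $ i))"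

definition pfm :: "('k mat \<Rightarrow> 'k mat) \<Rightarrow> bool" where
  "pfm M \<longleftrightarrow> (\<forall>A\<in>Or. M A \<in> carrier_mat m m) \<and> (\<forall>i<m. \<forall>j<m. pf (\<lambda>A. M A $$ (i, j)))"

lemma pf_polynomial: "polynomial_fun m f \<Longrightarrow> pf f"
  unfolding pf_def by blast

lemma pf_const: "pf (\<lambda>A. c)"
  by (rule pf_polynomial[OF polynomial_fun.const])

lemma pf_cong: "pf F \<Longrightarrow> (\<And>A. A \<in> Or \<Longrightarrow> F A = G A) \<Longrightarrow> pf G"
  unfolding pf_def by auto

lemma pf_add:
  assumes "pf F" "pf G" shows "pf (\<lambda>A. F A + G A)"
proof -
  obtain f g where "polynomial_fun m f" "polynomial_fun m g" "\<forall>A\<in>Or. F A = f A" "\<forall>A\<in>Or. G A = g A"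
    using assms unfolding pf_def by blast
  then show ?thesis unfolding pf_def using polynomial_fun.add[of m f g]
    by (intro exI[of _ "\<lambda>A. f A + g A"]) simp
qed

lemma pf_mult:
  assumes "pf F" "pf G" shows "pf (\<lambda>A. F A * G A)"
proof -
  obtain f g where "polynomial_fun m f" "polynomial_fun m g" "\<forall>A\<in>Or. F A = f A" "\<forall>A\<in>Or. G A = g A"
    using assms unfolding pf_def by blast
  then show ?thesis unfolding pf_def using polynomial_fun.mult[of m f g]
    by (intro exI[of _ "\<lambda>A. f A * g A"]) simp
qed

lemma pf_sum:
  assumes "finite K" "\<And>i. i \<in> K \<Longrightarrow> pf (F i)" shows "pf (\<lambda>A. \<Sum>i\<in>K. F i A)"
  using assms
proof (induction K)
  case empty
  then show ?case by (simp add: pf_const)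
next
  case (insert i K)
  then show ?case using pf_add[of "F i" "\<lambda>A. \<Sum>i\<in>K. F i A"] by simp
qed

lemma pf_prod:
  assumes "finite K" "\<And>i. i \<in> K \<Longrightarrow> pf (F i)" shows "pf (\<lambda>A. \<Prod>i\<in>K. F i A)"
  using assms
proof (induction K)
  case empty
  then show ?case by (simp add: pf_const)
next
  case (insert i K)
  then show ?case using pf_mult[of "F i" "\<lambda>A. \<Prod>i\<in>K. F i A"] by simp
qed

lemma pf_power: "pf F \<Longrightarrow> pf (\<lambda>A. F A ^ r)"
  using pf_prod[of "{..<r}" "\<lambda>i. F"] by simp

lemma pf_det:
  assumes "\<And>i j. i < r \<Longrightarrow> j < r \<Longrightarrow> pf (\<lambda>A. F A i j)"
  shows "pf (\<lambda>A. det (mat r r (\<lambda>(i, j). F A i j)))"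
proof -
  have eq: "det (mat r r (\<lambda>(i, j). F A i j)) =
    (\<Sum>p | p permutes {0..<r}. signof p * (\<Prod>i = 0..<r. F A i (p i)))" for A
    by (subst det_def'[of _ r]) (auto intro!: sum.cong prod.cong)
  have "pf (\<lambda>A. \<Sum>p | p permutes {0..<r}. signof p * (\<Prod>i = 0..<r. F A i (p i)))"
  proof (intro pf_sum pf_mult pf_const pf_prod assms)
    fix p i assume "p \<in> {p. p permutes {0..<r}}" "i \<in> {0..<r}"
    then show "i < r" "p i < r" using permutes_in_image[of p "{0..<r}" i] by auto
  qed (auto intro: finite_permutations)
  then show ?thesis unfolding eq .
qed

lemma pfv_const: "v \<in> V \<Longrightarrow> pfv (\<lambda>A. v)"
  unfolding pfv_def by (simp add: pf_const)

lemma pfm_const: "M \<in> carrier_mat m m \<Longrightarrow> pfm (\<lambda>A. M)"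
  unfolding pfm_def by (simp add: pf_const)

lemma pfm_id: "pfm (\<lambda>A. A)"
  unfolding pfm_def by (auto simp: Or_carrier intro: pf_polynomial polynomial_fun.entry)

lemma pfm_mult:
  assumes "pfm M" "pfm N" shows "pfm (\<lambda>A. M A * N A)"
  unfolding pfm_def
proof (intro conjI ballI allI impI)
  fix i j assume ij: "i < m" "j < m"
  have "pf (\<lambda>A. \<Sum>k<m. M A $$ (i, k) * N A $$ (k, j))"
    using assms ij unfolding pfm_def by (intro pf_sum pf_mult) auto
  then show "pf (\<lambda>A. (M A * N A) $$ (i, j))"
  proof (rule pf_cong)
    fix A assume "A \<in> Or"
    then have "M A \<in> carrier_mat m m" "N A \<in> carrier_mat m m" using assms unfolding pfm_def by auto
    then show "(\<Sum>k<m. M A $$ (i, k) * N A $$ (k, j)) = (M A * N A) $$ (i, j)"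
      using ij by (simp add: scalar_prod_def atLeast0LessThan)
  qed
qed (use assms in \<open>auto simp: pfm_def intro: mult_carrier_mat\<close>)

lemma pfv_mult:
  assumes "pfm M" "pfv u" shows "pfv (\<lambda>A. M A *\<^sub>v u A)"
  unfolding pfv_def
proof (intro conjI ballI allI impI)
  fix i assume i: "i < m"
  have "pf (\<lambda>A. \<Sum>k<m. M A $$ (i, k) * u A $ k)"
    using assms i unfolding pfm_def pfv_def by (intro pf_sum pf_mult) auto
  then show "pf (\<lambda>A. (M A *\<^sub>v u A) $ i)"
  proof (rule pf_cong)
    fix A assume "A \<in> Or"
    then have "M A \<in> carrier_mat m m" "u A \<in> V" using assms unfolding pfm_def pfv_def by auto
    then show "(\<Sum>k<m. M A $$ (i, k) * u A $ k) = (M A *\<^sub>v u A) $ i"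
      using i by (simp add: scalar_prod_def atLeast0LessThan)
  qed
qed (use assms in \<open>auto simp: pfm_def pfv_def\<close>)

lemma pf_bil:
  assumes "pfv u" "pfv w" shows "pf (\<lambda>A. \<beta> (u A) (w A))"
proof -
  have "pf (\<lambda>A. \<Sum>i<m. u A $ i * (\<Sum>j<m. w A $ j * \<beta> (unit_vec m i) (unit_vec m j)))"
    using assms unfolding pfv_def by (intro pf_sum pf_mult pf_const) auto
  then show ?thesis
  proof (rule pf_cong)
    fix A assume "A \<in> Or"
    then have uw: "u A \<in> V" "w A \<in> V" using assms unfolding pfv_def by auto
    have "\<beta> (u A) (w A) = \<beta> (comb m {..<m} (($) (u A)) (unit_vec m)) (w A)"
      using vec_eq_comb_unit[OF uw(1)] by simp
    also have "\<dots> = (\<Sum>i<m. u A $ i * \<beta> (unit_vec m i) (w A))"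
      by (rule bil_comb_left) (use uw in auto)
    also have "\<dots> = (\<Sum>i<m. u A $ i * (\<Sum>j<m. w A $ j * \<beta> (unit_vec m i) (unit_vec m j)))"
    proof (intro sum.cong refl arg_cong2[of _ _ _ _ "(*)"])
      fix i
      have "\<beta> (unit_vec m i) (w A) = \<beta> (unit_vec m i) (comb m {..<m} (($) (w A)) (unit_vec m))"
        using vec_eq_comb_unit[OF uw(2)] by simp
      also have "\<dots> = (\<Sum>j<m. w A $ j * \<beta> (unit_vec m i) (unit_vec m j))"
        by (rule bil_comb_right) auto
      finally show "\<beta> (unit_vec m i) (w A) = (\<Sum>j<m. w A $ j * \<beta> (unit_vec m i) (unit_vec m j))" .
    qed
    finally show "(\<Sum>i<m. u A $ i * (\<Sum>j<m. w A $ j * \<beta> (unit_vec m i) (unit_vec m j))) = \<beta> (u A) (w A)"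
      by simp
  qed
qed

lemma exists_frame0: obtains g where "frame g"
proof -
  have "hyp 0 (\<lambda>_. 0\<^sub>v m) (\<lambda>_. 0\<^sub>v m)" unfolding hyp_def by simp
  then show ?thesis using exists_frame that by blast
qed

text \<open>On the orthogonal group the inverse is the adjoint, hence linear in the matrix entries.\<close>

lemma pfm_minv: "pfm minv"
  unfolding pfm_def
proof (intro conjI ballI allI impI)
  obtain g where g: "frame g" using exists_frame0 by blast
  fix i j assume ij: "i < m" "j < m"
  have "pf (\<lambda>A. \<Sum>k<m. \<beta> (unit_vec m j) (A *\<^sub>v g (m - 1 - k)) * g k $ i)"
    using g by (intro pf_sum pf_mult pf_const pf_bil pfv_mult pfm_id pfv_const) auto
  then show "pf (\<lambda>A. minv A $$ (i, j))"
  proof (rule pf_cong)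
    fix A assume A: "A \<in> Or"
    have "minv A $$ (i, j) = (minv A *\<^sub>v unit_vec m j) $ i"
      using Or_carrier[OF minv(1)[OF A]] ij by simp
    also have "\<dots> = (\<Sum>k<m. \<beta> (minv A *\<^sub>v unit_vec m j) (g (m - 1 - k)) * g k $ i)"
      using frame_expand[OF g, of "minv A *\<^sub>v unit_vec m j"] minv(1)[OF A] ij
      unfolding comb_def by (metis (no_types, lifting) Or_V index_vec unit_vec_carrier)
    also have "\<dots> = (\<Sum>k<m. \<beta> (unit_vec m j) (A *\<^sub>v g (m - 1 - k)) * g k $ i)"
      using g A by (intro sum.cong) (auto simp: bil_minv)
    finally show "(\<Sum>k<m. \<beta> (unit_vec m j) (A *\<^sub>v g (m - 1 - k)) * g k $ i) = minv A $$ (i, j)" by simp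
  qed
qed (use minv(1) Or_carrier in blast)

lemma pf_compose:
  assumes "polynomial_fun m f" "pfm M" shows "pf (\<lambda>A. f (M A))"
  using assms
  by (induction rule: polynomial_fun.induct) (auto simp: pfm_def intro: pf_const pf_add pf_mult)

subsection \<open>Rational curves\<close>

text \<open>A rational curve on the open set where \<open>d\<close> does not vanish, which must
  contain the end points 0 and 1; the values of \<open>\<gamma>\<close> elsewhere are left
  unconstrained.\<close>

definition curve :: "'k mat set \<Rightarrow> 'k poly \<Rightarrow> ('k \<Rightarrow> 'k mat) \<Rightarrow> bool" where
  "curve S d \<gamma> \<longleftrightarrow> poly d 0 \<noteq> 0 \<and> poly d 1 \<noteq> 0 \<and> (\<forall>i<m. \<forall>j<m. regular d (\<lambda>t. \<gamma> t $$ (i, j))) \<and>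
     (\<forall>t. poly d t \<noteq> 0 \<longrightarrow> \<gamma> t \<in> S)"

definition linked :: "'k mat set \<Rightarrow> 'k mat \<Rightarrow> bool" where
  "linked S A \<longleftrightarrow> (\<exists>d \<gamma>. curve S d \<gamma> \<and> \<gamma> 0 = 1\<^sub>m m \<and> \<gamma> 1 = A)"

lemma curve_pf:
  assumes "pf F" "curve S d \<gamma>" "S \<subseteq> Or" shows "regular d (\<lambda>t. F (\<gamma> t))"
proof -
  obtain f where f: "polynomial_fun m f" "\<forall>A\<in>Or. F A = f A" using assms(1) unfolding pf_def by blast
  have "regular d (\<lambda>t. f (\<gamma> t))" using f(1)
    by (induction rule: polynomial_fun.induct)
      (use assms(2) in \<open>auto simp: curve_def intro: regular_const regular_add regular_mult\<close>)
  then show ?thesis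
    by (rule regular_cong) (use assms(2,3) f(2) in \<open>auto simp: curve_def\<close>)
qed

lemma curve_mult:
  assumes S: "S \<subseteq> Or" "\<And>A B. A \<in> S \<Longrightarrow> B \<in> S \<Longrightarrow> A * B \<in> S" and c: "curve S d \<gamma>" "curve S d' \<gamma>'"
  shows "curve S (d * d') (\<lambda>t. \<gamma> t * \<gamma>' t)"
  unfolding curve_def
proof (intro conjI allI impI)
  fix i j assume ij: "i < m" "j < m"
  have r: "regular (d * d') (\<lambda>t. \<gamma> t $$ (i, k))" "regular (d * d') (\<lambda>t. \<gamma>' t $$ (k, j))" if "k < m" for k
    using c ij that regular_dvd[of d _ d'] regular_dvd[of d' _ d] unfolding curve_def
    by (auto simp: mult.commute)
  have "regular (d * d') (\<lambda>t. \<Sum>k<m. \<gamma> t $$ (i, k) * \<gamma>' t $$ (k, j))"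
    by (intro regular_sum regular_mult r) auto
  then show "regular (d * d') (\<lambda>t. (\<gamma> t * \<gamma>' t) $$ (i, j))"
  proof (rule regular_cong)
    fix t assume "poly (d * d') t \<noteq> 0"
    then have "\<gamma> t \<in> carrier_mat m m" "\<gamma>' t \<in> carrier_mat m m"
      using c S(1) Or_carrier unfolding curve_def by auto
    then show "(\<Sum>k<m. \<gamma> t $$ (i, k) * \<gamma>' t $$ (k, j)) = (\<gamma> t * \<gamma>' t) $$ (i, j)"
      using ij by (simp add: scalar_prod_def atLeast0LessThan)
  qed
next
  fix t assume "poly (d * d') t \<noteq> 0"
  then show "\<gamma> t * \<gamma>' t \<in> S" using c S(2) unfolding curve_def by simp
qed (use c in \<open>auto simp: curve_def\<close>)

lemma curve_pcompose:
  assumes "curve S d \<gamma>" "poly d (poly p 0) \<noteq> 0" "poly d (poly p 1) \<noteq> 0"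
  shows "curve S (pcompose d p) (\<lambda>t. \<gamma> (poly p t))"
  unfolding curve_def using assms regular_pcompose[of d _ p]
  by (auto simp: curve_def poly_pcompose)

lemma linked_mult:
  assumes "S \<subseteq> Or" "\<And>A B. A \<in> S \<Longrightarrow> B \<in> S \<Longrightarrow> A * B \<in> S" "linked S A" "linked S B"
  shows "linked S (A * B)"
proof -
  obtain d \<gamma> d' \<gamma>' where *: "curve S d \<gamma>" "\<gamma> 0 = 1\<^sub>m m" "\<gamma> 1 = A" "curve S d' \<gamma>'" "\<gamma>' 0 = 1\<^sub>m m" "\<gamma>' 1 = B"
    using assms(3,4) unfolding linked_def by blast
  have "curve S (d * d') (\<lambda>t. \<gamma> t * \<gamma>' t)" by (rule curve_mult[OF assms(1,2) *(1,4)])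
  moreover have "\<gamma> 0 * \<gamma>' 0 = 1\<^sub>m m" "\<gamma> 1 * \<gamma>' 1 = A * B" using * by simp_all
  ultimately show ?thesis unfolding linked_def by blast
qed

text \<open>Two curves from 1 combine to one from \<open>A\<close> to \<open>B\<close> inside
  \<open>S\<close>. Along it \<open>f\<close> and \<open>g\<close> become nonzero rational functions
  of one parameter, hence are simultaneously nonzero somewhere.\<close>

lemma linked_imp_irreducible:
  assumes S: "S \<subseteq> Or" "\<And>A B. A \<in> S \<Longrightarrow> B \<in> S \<Longrightarrow> A * B \<in> S" and l: "\<And>A. A \<in> S \<Longrightarrow> linked S A"
  shows "irreducible_set m S"
  unfolding irreducible_set_def
proof (intro allI impI)
  fix f g :: "'k mat \<Rightarrow> 'k"
  assume f: "polynomial_fun m f" and g: "polynomial_fun m g"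
  assume "\<exists>A\<in>S. f A \<noteq> 0" "\<exists>A\<in>S. g A \<noteq> 0"
  then obtain A B where A: "A \<in> S" "f A \<noteq> 0" and B: "B \<in> S" "g B \<noteq> 0" by blast
  obtain d \<gamma> where d: "curve S d \<gamma>" "\<gamma> 0 = 1\<^sub>m m" "\<gamma> 1 = A" using l[OF A(1)] unfolding linked_def by blast
  obtain d' \<gamma>' where d': "curve S d' \<gamma>'" "\<gamma>' 0 = 1\<^sub>m m" "\<gamma>' 1 = B" using l[OF B(1)] unfolding linked_def by blast
  \<comment> \<open>Reversal of the parameter: \<open>\<gamma>\<close> runs back from
    \<open>A\<close> to 1 while \<open>\<gamma>'\<close> runs from 1 to \<open>B\<close>.\<close>
  let ?r = "[:1, -1:] :: 'k poly"
  define e where "e = pcompose d ?r * d'"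
  define \<delta> where "\<delta> = (\<lambda>t. \<gamma> (poly ?r t) * \<gamma>' t)"
  have c: "curve S e \<delta>"
    unfolding e_def \<delta>_def using d d'
    by (intro curve_mult[OF S] curve_pcompose) (auto simp: curve_def)
  have AB: "A \<in> carrier_mat m m" "B \<in> carrier_mat m m" using A(1) B(1) S(1) Or_carrier by auto
  have ends: "\<delta> 0 = A" "\<delta> 1 = B" unfolding \<delta>_def using d d' AB by auto
  obtain F N where F: "\<And>t. poly e t \<noteq> 0 \<Longrightarrow> poly e t ^ N * f (\<delta> t) = poly F t"
    using curve_pf[OF pf_polynomial[OF f] c S(1)] unfolding regular_def by blast
  obtain G M where G: "\<And>t. poly e t \<noteq> 0 \<Longrightarrow> poly e t ^ M * g (\<delta> t) = poly G t"
    using curve_pf[OF pf_polynomial[OF g] c S(1)] unfolding regular_def by blast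
  have e01: "poly e 0 \<noteq> 0" "poly e 1 \<noteq> 0" using c unfolding curve_def by auto
  have "poly F 0 \<noteq> 0" using F[of 0] e01 ends A(2) by (metis mult_eq_0_iff power_not_zero)
  moreover have "poly G 1 \<noteq> 0" using G[of 1] e01 ends B(2) by (metis mult_eq_0_iff power_not_zero)
  ultimately have "F * G * e \<noteq> 0" using e01 by (metis mult_eq_0_iff poly_0)
  then obtain t where t: "poly (F * G * e) t \<noteq> 0" using exists_poly_nonzero by blast
  then have et: "poly e t \<noteq> 0" by auto
  have "f (\<delta> t) \<noteq> 0" "g (\<delta> t) \<noteq> 0" using F[OF et] G[OF et] t by auto
  moreover have "\<delta> t \<in> S" using c et unfolding curve_def by blast
  ultimately show "\<exists>A\<in>S. f A \<noteq> 0 \<and> g A \<noteq> 0" by blast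
qed

text \<open>An isometry amounts to the frame to which it sends \<open>g\<close>, so it suffices to
  move frames; membership in \<open>S\<close> is tested on the isometry belonging to each
  intermediate frame.\<close>

lemma linked_frames:
  assumes g: "frame g" and A: "A \<in> Or"
    and d: "poly d 0 \<noteq> 0" "poly d 1 \<noteq> 0"
    and reg: "\<And>i a. i < m \<Longrightarrow> a < m \<Longrightarrow> regular d (\<lambda>t. h t i $ a)"
    and fr: "\<And>t. poly d t \<noteq> 0 \<Longrightarrow> frame (h t)"
    and S: "\<And>t B. poly d t \<noteq> 0 \<Longrightarrow> B \<in> Or \<Longrightarrow> (\<And>i. i < m \<Longrightarrow> B *\<^sub>v g i = h t i) \<Longrightarrow> B \<in> S"
    and ends: "\<And>i. i < m \<Longrightarrow> h 0 i = g i" "\<And>i. i < m \<Longrightarrow> h 1 i = A *\<^sub>v g i"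
  shows "linked S A"
proof -
  define \<gamma> where "\<gamma> = (\<lambda>t. frame_mat g (h t))"
  have \<gamma>: "\<gamma> t \<in> Or" "\<And>i. i < m \<Longrightarrow> \<gamma> t *\<^sub>v g i = h t i" if "poly d t \<noteq> 0" for t
    using frame_mat_Or[OF g fr[OF that]] frame_mat_frame[OF g frame_carrier[OF fr[OF that]]]
    unfolding \<gamma>_def by auto
  have "regular d (\<lambda>t. \<gamma> t $$ (i, j))" if "i < m" "j < m" for i j
  proof -
    have "regular d (\<lambda>t. \<Sum>k<m. \<beta> (unit_vec m j) (g (m - 1 - k)) * h t k $ i)"
      using that reg by (intro regular_sum regular_mult regular_const) auto
    then show ?thesis using that unfolding \<gamma>_def frame_mat_def by simp
  qed
  moreover have "\<gamma> t \<in> S" if "poly d t \<noteq> 0" for t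
    using S[OF that \<gamma>(1)[OF that]] \<gamma>(2)[OF that] by simp
  ultimately have "curve S d \<gamma>" unfolding curve_def using d by simp
  moreover have "\<gamma> 0 = 1\<^sub>m m"
    by (rule Or_eqI[OF g \<gamma>(1)[OF d(1)] Or_one]) (use \<gamma>(2)[OF d(1)] ends(1) g in simp)
  moreover have "\<gamma> 1 = A"
    by (rule Or_eqI[OF g \<gamma>(1)[OF d(2)] A]) (use \<gamma>(2)[OF d(2)] ends(2) in simp)
  ultimately show ?thesis unfolding linked_def by blast
qed

subsection \<open>The stabiliser of a flag\<close>

text \<open>Since \<open>\<beta> (A *\<^sub>v g i) (g j)\<close> is the coefficient of
  \<open>g (m - 1 - j)\<close> in \<open>A *\<^sub>v g i\<close>, the condition says that the matrix
  of \<open>A\<close> in the frame is upper triangular.\<close>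

definition Bor :: "(nat \<Rightarrow> 'k vec) \<Rightarrow> 'k mat set" where
  "Bor g = {A \<in> Or. \<forall>i<m. \<forall>j<m. i + j < m - 1 \<longrightarrow> \<beta> (A *\<^sub>v g i) (g j) = 0}"

lemma Bor_Or: "A \<in> Bor g \<Longrightarrow> A \<in> Or"
  and Bor_bil: "A \<in> Bor g \<Longrightarrow> i < m \<Longrightarrow> j < m \<Longrightarrow> i + j < m - 1 \<Longrightarrow> \<beta> (A *\<^sub>v g i) (g j) = 0"
  unfolding Bor_def by auto

lemma bil_expand:
  assumes "frame g" "u \<in> V" "w \<in> V"
  shows "\<beta> u w = (\<Sum>k<m. \<beta> u (g (m - 1 - k)) * \<beta> w (g k))"
proof -
  have "\<beta> u w = \<beta> (comb m {..<m} (\<lambda>i. \<beta> u (g (m - 1 - i))) g) w"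
    using frame_expand[OF assms(1,2)] by simp
  also have "\<dots> = (\<Sum>k<m. \<beta> u (g (m - 1 - k)) * \<beta> (g k) w)"
    by (rule bil_comb_left) (use assms in auto)
  also have "\<dots> = (\<Sum>k<m. \<beta> u (g (m - 1 - k)) * \<beta> w (g k))"
    using assms bil_sym by (intro sum.cong) auto
  finally show ?thesis .
qed

lemma Bor_minv:
  assumes g: "frame g" and A: "A \<in> Bor g"
  shows "minv A \<in> Bor g"
  unfolding Bor_def
proof (intro CollectI conjI allI impI)
  show "minv A \<in> Or" using minv(1) Bor_Or A by blast
  fix i j assume ij: "i < m" "j < m" "i + j < m - 1"
  have "\<beta> (minv A *\<^sub>v g i) (g j) = \<beta> (g i) (A *\<^sub>v g j)"
    using bil_minv[OF Bor_Or[OF A]] g ij by simp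
  also have "\<dots> = \<beta> (A *\<^sub>v g j) (g i)" using bil_sym g ij Bor_Or[OF A] by simp
  also have "\<dots> = 0" using Bor_bil[OF A ij(2,1)] ij(3) by simp
  finally show "\<beta> (minv A *\<^sub>v g i) (g j) = 0" .
qed

lemma Bor_mult:
  assumes g: "frame g" and A: "A \<in> Bor g" and B: "B \<in> Bor g"
  shows "A * B \<in> Bor g"
  unfolding Bor_def
proof (intro CollectI conjI allI impI)
  have O: "A \<in> Or" "B \<in> Or" using A B Bor_Or by auto
  show "A * B \<in> Or" using Or_mult O by blast
  fix i j assume ij: "i < m" "j < m" "i + j < m - 1"
  have "\<beta> ((A * B) *\<^sub>v g i) (g j) = \<beta> (B *\<^sub>v g i) (minv A *\<^sub>v g j)"
    using Or_bil[OF O(1), of "B *\<^sub>v g i" "minv A *\<^sub>v g j"] O g ij minv(1)[OF O(1)] by simp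
  also have "\<dots> = (\<Sum>k<m. \<beta> (B *\<^sub>v g i) (g (m - 1 - k)) * \<beta> (minv A *\<^sub>v g j) (g k))"
    using O g ij minv(1)[OF O(1)] by (intro bil_expand) auto
  also have "\<dots> = 0"
  proof (intro sum.neutral ballI)
    fix k assume "k \<in> {..<m}"
    then have k: "k < m" by simp
    show "\<beta> (B *\<^sub>v g i) (g (m - 1 - k)) * \<beta> (minv A *\<^sub>v g j) (g k) = 0"
      using Bor_bil[OF B ij(1), of "m - 1 - k"] Bor_bil[OF Bor_minv[OF g A] ij(2) k] k ij
      by (cases "i < k") auto
  qed
  finally show "\<beta> ((A * B) *\<^sub>v g i) (g j) = 0" .
qed

text \<open>Each of the first \<open>n\<close> eigenvalues is joined to 1 by a linear polynomial and
  its partner follows as the inverse; the product of these polynomials is the denominator. The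
  condition on \<open>S\<close> admits both \<open>Or\<close> and the flag stabiliser.\<close>

lemma linked_diagonal:
  assumes g: "frame g" and c: "\<And>i. i < m \<Longrightarrow> c i * c (m - 1 - i) = 1"
    and A: "A \<in> Or" "\<And>i. i < m \<Longrightarrow> A *\<^sub>v g i = c i \<cdot>\<^sub>v g i"
    and S: "\<And>B c. B \<in> Or \<Longrightarrow> (\<And>i. i < m \<Longrightarrow> B *\<^sub>v g i = c i \<cdot>\<^sub>v g i) \<Longrightarrow> B \<in> S"
  shows "linked S A"
proof -
  define p where "p = (\<lambda>i. [:1, c i - 1:])"
  define d where "d = (\<Prod>i<n. p i)"
  define h where "h = (\<lambda>t i. (if i < n then poly (p i) t else inverse (poly (p (m - 1 - i)) t)) \<cdot>\<^sub>v g i)"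
  have c0: "c i \<noteq> 0" if "i < m" for i using c[OF that] by auto
  have pd: "poly (p i) t \<noteq> 0" if "poly d t \<noteq> 0" "i < n" for t i
    using that unfolding d_def by (simp add: poly_prod)
  show ?thesis
  proof (rule linked_frames[OF g A(1), of d h])
    show "poly d 0 \<noteq> 0" "poly d 1 \<noteq> 0"
      using c0 m_def unfolding d_def p_def by (auto simp: poly_prod)
    fix i assume i: "i < m"
    show "h 0 i = g i" unfolding h_def p_def using i g by simp
    have "inverse (c (m - 1 - i)) = c i" using c[OF i] c0[OF i] by (metis inverse_unique mult.commute)
    then show "h 1 i = A *\<^sub>v g i" unfolding h_def p_def A(2)[OF i] by simp
    fix a assume a: "a < m"
    have "regular d (\<lambda>t. inverse (poly (p j) t))" if "j < n" for j
    proof -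
      have "d = p j * (\<Prod>i\<in>{..<n} - {j}. p i)" unfolding d_def using that by (simp add: prod.remove)
      then show ?thesis using regular_dvd[OF regular_inverse] by metis
    qed
    then have "regular d (\<lambda>t. (if i < n then poly (p i) t else inverse (poly (p (m - 1 - i)) t)) * g i $ a)"
      using i m_def by (intro regular_mult regular_const) (cases "i < n"; simp add: regular_poly)
    then show "regular d (\<lambda>t. h t i $ a)" unfolding h_def using carrier_vecD[OF frame_carrier[OF g i]] a by simp
  next
    fix t assume t: "poly d t \<noteq> 0"
    show "frame (h t)" unfolding frame_def
    proof (intro conjI allI impI)
      fix i assume i: "i < m"
      show "h t i \<in> V" "q (h t i) = 0" unfolding h_def using g i by auto
      fix j assume j: "j < m"
      show "\<beta> (h t i) (h t j) = (if i + j = m - 1 then 1 else 0)"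
      proof (cases "i + j = m - 1")
        case True
        then have "j = m - 1 - i" "i = m - 1 - j" "i < n \<longleftrightarrow> \<not> j < n" using i j m_def by auto
        then show ?thesis unfolding h_def using True g i j pd[OF t] by (auto simp: frame_bil)
      next
        case False
        then show ?thesis unfolding h_def using g i j by (simp add: frame_bil)
      qed
    qed
    fix B assume "B \<in> Or" "\<And>i. i < m \<Longrightarrow> B *\<^sub>v g i = h t i"
    then show "B \<in> S" unfolding h_def by (rule S)
  qed
qed

text \<open>Conjugating by a one-parameter torus contracts a unipotent element of the flag stabiliser to
  the identity; in coordinates the entry \<open>(j, i)\<close> is multiplied by \<open>t ^ (i - j)\<close>.\<close>

lemma linked_unipotent:
  assumes g: "frame g" and A: "A \<in> Bor g" and diag: "\<And>i. i < m \<Longrightarrow> \<beta> (A *\<^sub>v g i) (g (m - 1 - i)) = 1"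
  shows "linked (Bor g) A"
proof -
  note AO = Bor_Or[OF A]
  define a where "a = (\<lambda>j i. \<beta> (A *\<^sub>v g i) (g (m - 1 - j)))"
  define c where "c = (\<lambda>t i j. if j \<le> i then t ^ (i - j) * a j i else 0 :: 'k)"
  define h where "h = (\<lambda>t i. comb m {..<m} (c t i) g)"
  have a0: "a j i = 0" if "i < j" "j < m" for i j
    unfolding a_def using Bor_bil[OF A, of i "m - 1 - j"] that by simp
  have hV: "h t i \<in> V" for t i unfolding h_def by simp
  have coeff: "\<beta> (h t i) (g j) = c t i (m - 1 - j)" if "j < m" for t i j
    unfolding h_def using frame_coeff[OF g that] .
  \<comment> \<open>The exponents \<open>i - j\<close> and \<open>k - (m - 1 - j)\<close> add up to
    a number independent of the summation index \<open>j\<close>, so a whole Gram entry is scaled by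
    one power of \<open>t\<close>. The entry vanishes unless \<open>i + k = m - 1\<close>, where the
    power is 1; hence the Gram matrix does not change.\<close>
  have cc: "c t i j * c t k (m - 1 - j) = t ^ (i + k - (m - 1)) * (a j i * a (m - 1 - j) k)"
    if "i < m" "k < m" "j < m" for t i j k
  proof (cases "j \<le> i \<and> m - 1 - j \<le> k")
    case True
    then have "i - j + (k - (m - 1 - j)) = i + k - (m - 1)" using that by auto
    then have "t ^ (i - j) * t ^ (k - (m - 1 - j)) = t ^ (i + k - (m - 1))" by (metis power_add)
    moreover have "c t i j * c t k (m - 1 - j) = (t ^ (i - j) * t ^ (k - (m - 1 - j))) * (a j i * a (m - 1 - j) k)"
      unfolding c_def using True by (simp only: if_True mult_ac)
    ultimately show ?thesis by (simp only:)
  next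
    case False
    then have "a j i = 0 \<or> a (m - 1 - j) k = 0" using a0[of i j] a0[of k "m - 1 - j"] that by auto
    moreover have "c t i j = 0 \<or> c t k (m - 1 - j) = 0" using False unfolding c_def by auto
    ultimately show ?thesis by auto
  qed
  have h1: "h 1 i = A *\<^sub>v g i" if i: "i < m" for i
  proof (rule frame_eqI[OF g])
    fix j assume "j < m"
    then show "\<beta> (h 1 i) (g j) = \<beta> (A *\<^sub>v g i) (g j)"
      using coeff[of j 1 i] a0[of i "m - 1 - j"] unfolding c_def by (auto simp: a_def)
  qed (use i g AO hV in auto)
  have bilh: "\<beta> (h t i) (h t k) = t ^ (i + k - (m - 1)) * \<beta> (A *\<^sub>v g i) (A *\<^sub>v g k)"
    if "i < m" "k < m" for t i k
  proof -
    have "\<beta> (h t i) (h t k) = (\<Sum>j<m. c t i j * c t k (m - 1 - j))"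
      unfolding bil_expand[OF g hV hV] by (intro sum.cong) (auto simp: coeff)
    also have "\<dots> = t ^ (i + k - (m - 1)) * (\<Sum>j<m. a j i * a (m - 1 - j) k)"
      unfolding sum_distrib_left using cc that by (intro sum.cong) auto
    also have "(\<Sum>j<m. a j i * a (m - 1 - j) k) = \<beta> (A *\<^sub>v g i) (A *\<^sub>v g k)"
      using g AO that by (subst bil_expand[OF g]) (auto simp: a_def intro!: sum.cong)
    finally show ?thesis .
  qed
  have qh: "q (h t i) = t ^ (i + i - (m - 1)) * q (h 1 i)" if i: "i < m" for t i
  proof -
    have Q: "q (h t i) = (\<Sum>j<m. \<Sum>l<j. c t i l * c t i j * \<beta> (g l) (g j))" for t
      unfolding h_def by (rule quadratic_form_comb[OF quadratic]) (use g in auto)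
    show ?thesis unfolding Q sum_distrib_left
    proof (intro sum.cong refl)
      fix j l assume "j \<in> {..<m}" "l \<in> {..<j}"
      then have jl: "j < m" "l < m" by auto
      show "c t i l * c t i j * \<beta> (g l) (g j) = t ^ (i + i - (m - 1)) * (c 1 i l * c 1 i j * \<beta> (g l) (g j))"
      proof (cases "l + j = m - 1")
        case True
        then have "j = m - 1 - l" by simp
        then show ?thesis using cc[OF i i jl(2), of t] cc[OF i i jl(2), of 1] by simp
      next
        case False
        then show ?thesis using frame_bil[OF g jl(2,1)] by simp
      qed
    qed
  qed
  show ?thesis
  proof (rule linked_frames[OF g AO, of 1 h])
    fix i assume i: "i < m"
    show "h 1 i = A *\<^sub>v g i" by (rule h1[OF i])
    \<comment> \<open>Because \<open>0 ^ 0 = 1\<close>, exactly the diagonal coefficient, assumed to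
      be 1, survives at \<open>t = 0\<close>.\<close>
    show "h 0 i = g i"
    proof (rule frame_eqI[OF g])
      fix j assume j: "j < m"
      have "m - 1 - j = i \<longleftrightarrow> i + j = m - 1" using i j by auto
      then show "\<beta> (h 0 i) (g j) = \<beta> (g i) (g j)"
        using coeff[OF j, of 0 i] diag[OF i] frame_bil[OF g i j] unfolding c_def a_def by auto
    qed (use i g hV in auto)
    fix b assume b: "b < m"
    have "regular 1 (\<lambda>t. \<Sum>j<m. c t i j * g j $ b)"
    proof (intro regular_sum regular_mult regular_const)
      fix j
      have "regular 1 (\<lambda>t. poly ([:0, 1:] ^ (i - j)) t * a j i)" by (intro regular_mult regular_const regular_poly)
      then show "regular 1 (\<lambda>t. c t i j)" unfolding c_def by (cases "j \<le> i") (simp_all add: regular_const)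
    qed simp
    then show "regular 1 (\<lambda>t. h t i $ b)" unfolding h_def comb_def using b by simp
  next
    fix t
    show "frame (h t)" unfolding frame_def
    proof (intro conjI allI impI)
      fix i assume i: "i < m"
      show "h t i \<in> V" by (rule hV)
      show "q (h t i) = 0" using qh[OF i, of t] h1[OF i] g i AO by simp
      fix j assume j: "j < m"
      show "\<beta> (h t i) (h t j) = (if i + j = m - 1 then 1 else 0)"
        using bilh[OF i j, of t] g i j AO by (simp add: frame_bil)
    qed
    fix B assume B: "B \<in> Or" "\<And>i. i < m \<Longrightarrow> B *\<^sub>v g i = h t i"
    show "B \<in> Bor g" unfolding Bor_def
      using B coeff a0 unfolding c_def by auto
  qed simp_all
qed

lemma Bor_diag:
  assumes g: "frame g" and A: "A \<in> Bor g" and i: "i < m"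
  shows "\<beta> (A *\<^sub>v g i) (g (m - 1 - i)) * \<beta> (A *\<^sub>v g (m - 1 - i)) (g i) = 1"
proof -
  note AO = Bor_Or[OF A]
  let ?i = "m - 1 - i"
  have "1 = \<beta> (A *\<^sub>v g i) (A *\<^sub>v g ?i)" using AO g i by (simp add: frame_bil)
  also have "\<dots> = (\<Sum>k<m. \<beta> (A *\<^sub>v g i) (g (m - 1 - k)) * \<beta> (A *\<^sub>v g ?i) (g k))"
    using AO g i by (intro bil_expand) auto
  also have "\<dots> = (\<Sum>k<m. if k = i then \<beta> (A *\<^sub>v g i) (g ?i) * \<beta> (A *\<^sub>v g ?i) (g i) else 0)"
  proof (intro sum.cong refl)
    fix k assume "k \<in> {..<m}"
    then have k: "k < m" by simp
    show "\<beta> (A *\<^sub>v g i) (g (m - 1 - k)) * \<beta> (A *\<^sub>v g ?i) (g k) =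
      (if k = i then \<beta> (A *\<^sub>v g i) (g ?i) * \<beta> (A *\<^sub>v g ?i) (g i) else 0)"
      using Bor_bil[OF A i, of "m - 1 - k"] Bor_bil[OF A _ k, of ?i] k i
      by (cases k i rule: linorder_cases) auto
  qed
  also have "\<dots> = \<beta> (A *\<^sub>v g i) (g ?i) * \<beta> (A *\<^sub>v g ?i) (g i)" using i by simp
  finally show ?thesis by simp
qed

lemma frame_smult:
  assumes g: "frame g" and c: "\<And>i. i < m \<Longrightarrow> c i * c (m - 1 - i) = 1"
  shows "frame (\<lambda>i. c i \<cdot>\<^sub>v g i)"
  unfolding frame_def
proof (intro conjI allI impI)
  fix i assume i: "i < m"
  show "c i \<cdot>\<^sub>v g i \<in> V" "q (c i \<cdot>\<^sub>v g i) = 0" using i g by auto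
  fix j assume j: "j < m"
  show "\<beta> (c i \<cdot>\<^sub>v g i) (c j \<cdot>\<^sub>v g j) = (if i + j = m - 1 then 1 else 0)"
  proof (cases "i + j = m - 1")
    case True
    then have "j = m - 1 - i" by simp
    then show ?thesis using c[OF i] frame_bil[OF g i j] True g i j by (simp add: mult.commute)
  qed (use i j g in \<open>simp add: frame_bil\<close>)
qed

lemma diagonal_Bor:
  assumes "frame g" "B \<in> Or" "\<And>i. i < m \<Longrightarrow> B *\<^sub>v g i = c i \<cdot>\<^sub>v g i"
  shows "B \<in> Bor g"
  unfolding Bor_def using assms by (auto simp: frame_bil)

text \<open>Triangular matrices factor as \<open>A = U * D\<close> with \<open>D\<close> the
  diagonal part and \<open>U\<close> unipotent, and each factor is joined to 1 separately.\<close>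

lemma linked_Bor:
  assumes g: "frame g" and A: "A \<in> Bor g"
  shows "linked (Bor g) A"
proof -
  note AO = Bor_Or[OF A]
  define c where "c = (\<lambda>i. \<beta> (A *\<^sub>v g i) (g (m - 1 - i)))"
  have c: "c i * c (m - 1 - i) = 1" if "i < m" for i
    using Bor_diag[OF g A that] that unfolding c_def by simp
  obtain D where D: "D \<in> Or" "\<And>i. i < m \<Longrightarrow> D *\<^sub>v g i = c i \<cdot>\<^sub>v g i"
    using frame_map[OF g frame_smult[of g c, OF g c]] by blast
  have DB: "D \<in> Bor g" by (rule diagonal_Bor[OF g D])
  have lD: "linked (Bor g) D"
    by (rule linked_diagonal[OF g c D]) (use diagonal_Bor[OF g] in blast)+
  define U where "U = A * minv D"
  have UB: "U \<in> Bor g" unfolding U_def using Bor_mult[OF g A Bor_minv[OF g DB]] .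
  have "\<beta> (U *\<^sub>v g i) (g (m - 1 - i)) = 1" if i: "i < m" for i
  proof -
    have c0: "c i \<noteq> 0" using c[OF i] by auto
    have "D *\<^sub>v (inverse (c i) \<cdot>\<^sub>v g i) = g i"
      using D(1)[THEN Or_carrier] D(2)[OF i] c0 i g by (simp add: smult_smult_assoc)
    then have "minv D *\<^sub>v g i = inverse (c i) \<cdot>\<^sub>v g i"
      using minv_vec(2)[OF D(1), of "inverse (c i) \<cdot>\<^sub>v g i"] g i by simp
    then have "U *\<^sub>v g i = inverse (c i) \<cdot>\<^sub>v (A *\<^sub>v g i)"
      unfolding U_def using AO minv(1)[OF D(1)] g i Or_carrier[OF AO] by simp
    then show ?thesis using c0 g i AO unfolding c_def by simp
  qed
  then have lU: "linked (Bor g) U" by (rule linked_unipotent[OF g UB])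
  have "U * D = A" unfolding U_def
    using minv[OF D(1)] Or_carrier AO D(1) by (metis assoc_mult_mat right_mult_one_mat)
  then show ?thesis
    using linked_mult[OF _ Bor_mult[OF g] lU lD] Bor_Or by auto
qed

lemma connected_Bor:
  assumes "frame g" shows "connectedin (zariski m) (Bor g)"
  using irreducible_imp_connected[OF linked_imp_irreducible] linked_Bor[OF assms] Bor_mult[OF assms]
    Bor_Or Or_carrier by (metis subsetI)

section \<open>Siegel transformations and the identity component\<close>

text \<open>\<open>R\<close> turns out to be dense in \<open>SO\<close>, which transfers irreducibility from \<open>R\<close> to \<open>SO\<close>.\<close>

definition R :: "'k mat set" where "R = {A \<in> Or. linked Or A}"

lemma R_Or: "A \<in> R \<Longrightarrow> A \<in> Or"
  unfolding R_def by simp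

lemma R_mult: "A \<in> R \<Longrightarrow> B \<in> R \<Longrightarrow> A * B \<in> R"
  unfolding R_def using linked_mult[of Or] Or_mult by blast

lemma minv_one: "minv (1\<^sub>m m) = 1\<^sub>m m"
  by (rule minv_unique) (auto simp: Or_one)

lemma R_one: "1\<^sub>m m \<in> R"
  unfolding R_def linked_def
proof (intro CollectI conjI exI)
  show "curve Or 1 (\<lambda>t. 1\<^sub>m m)"
    unfolding curve_def by (simp add: Or_one regular_const)
qed (auto simp: Or_one)

lemma R_minv:
  assumes "A \<in> R" shows "minv A \<in> R"
proof -
  obtain d \<gamma> where c: "curve Or d \<gamma>" "\<gamma> 0 = 1\<^sub>m m" "\<gamma> 1 = A"
    using assms unfolding R_def linked_def by blast
  have "curve Or d (\<lambda>t. minv (\<gamma> t))"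
    unfolding curve_def
  proof (intro conjI allI impI)
    fix i j assume "i < m" "j < m"
    then have "pf (\<lambda>A. minv A $$ (i, j))" using pfm_minv unfolding pfm_def by blast
    from curve_pf[OF this c(1)] show "regular d (\<lambda>t. minv (\<gamma> t) $$ (i, j))" by simp
  qed (use c(1) minv(1) in \<open>auto simp: curve_def\<close>)
  then show ?thesis unfolding R_def linked_def using c minv_one minv(1) assms R_Or
    by (intro CollectI conjI exI[of _ d] exI[of _ "\<lambda>t. minv (\<gamma> t)"]) auto
qed

text \<open>Every point of a curve starting at 1 is itself joined to 1 by the initial piece of that
  curve, reparametrised from \<open>s\<close> to \<open>t * s\<close>.\<close>

lemma linked_R:
  assumes "A \<in> R" shows "linked R A"
proof -
  obtain d \<gamma> where c: "curve Or d \<gamma>" "\<gamma> 0 = 1\<^sub>m m" "\<gamma> 1 = A"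
    using assms unfolding R_def linked_def by blast
  have "\<gamma> t \<in> R" if "poly d t \<noteq> 0" for t
  proof -
    have "curve Or (pcompose d [:0, t:]) (\<lambda>s. \<gamma> (poly [:0, t:] s))"
      using c(1) that by (intro curve_pcompose) (auto simp: curve_def)
    then show ?thesis unfolding R_def linked_def using c that
      by (intro CollectI conjI exI[of _ "pcompose d [:0, t:]"] exI[of _ "\<lambda>s. \<gamma> (poly [:0, t:] s)"])
        (auto simp: curve_def)
  qed
  then have "curve R d \<gamma>" using c(1) unfolding curve_def by blast
  then show ?thesis unfolding linked_def using c by blast
qed

lemma irreducible_R: "irreducible_set m R"
  by (rule linked_imp_irreducible) (use R_Or R_mult linked_R in auto)

text \<open>These are the Siegel (Eichler) transformations. Replacing \<open>a\<close> by
  \<open>t\<close> times \<open>a\<close> gives a family polynomial in \<open>t\<close> that starts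
  at the identity, which is what puts them into \<open>R\<close>.\<close>

lemma R_siegel:
  assumes z: "z \<in> V" "q z = 0" and a: "a \<in> V" "\<beta> a z = 0"
  obtains A where "A \<in> R"
    "\<And>v. v \<in> V \<Longrightarrow> A *\<^sub>v v = v + (\<beta> v z \<cdot>\<^sub>v a + (\<beta> v a + q a * \<beta> v z) \<cdot>\<^sub>v z)"
proof -
  define L where "L = (\<lambda>t v. v + ((t * \<beta> v z) \<cdot>\<^sub>v a + (t * \<beta> v a + t\<^sup>2 * (q a * \<beta> v z)) \<cdot>\<^sub>v z))"
  define \<gamma> where "\<gamma> = (\<lambda>t. mat m m (\<lambda>(i, j). L t (unit_vec m j) $ i))"
  have L1: "L t v \<in> V" if "v \<in> V" for t v unfolding L_def using that z a by simp
  have L2: "L t (u + v) = L t u + L t v" if "u \<in> V" "v \<in> V" for t u v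
    unfolding L_def using that z a by (intro eq_vecI) (auto simp: algebra_simps)
  have L3: "L t (c \<cdot>\<^sub>v v) = c \<cdot>\<^sub>v L t v" if "v \<in> V" for t c v
    unfolding L_def using that z a by (intro eq_vecI) (auto simp: algebra_simps)
  have \<gamma>: "\<gamma> t \<in> carrier_mat m m" "\<And>v. v \<in> V \<Longrightarrow> \<gamma> t *\<^sub>v v = L t v" for t
    using mat_of_linear[of m "L t"] L1 L2 L3 unfolding \<gamma>_def by blast+
  have az: "\<beta> z a = 0" using a z bil_sym by metis
  have qL: "q (L t v) = q v" if v: "v \<in> V" for t v
  proof -
    have "q (L t v) = q v + (t * \<beta> v z)\<^sup>2 * q a + (t * \<beta> v z * \<beta> v a + (t * \<beta> v a + t\<^sup>2 * (q a * \<beta> v z)) * \<beta> v z)"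
      unfolding L_def using v z a az by (simp add: q_add add_ac)
    also have "\<dots> = q v" by (simp add: power2_eq_square algebra_simps)
    finally show ?thesis .
  qed
  have \<gamma>O: "\<gamma> t \<in> Or" for t unfolding Or_def using \<gamma> qL by simp
  have "curve Or 1 \<gamma>"
    unfolding curve_def
  proof (intro conjI allI impI)
    fix i j assume ij: "i < m" "j < m"
    let ?e = "unit_vec m j :: 'k vec"
    have "regular 1 (poly [:?e $ i, \<beta> ?e z * a $ i + \<beta> ?e a * z $ i, q a * \<beta> ?e z * z $ i:])" by (rule regular_poly)
    moreover have "poly [:?e $ i, \<beta> ?e z * a $ i + \<beta> ?e a * z $ i, q a * \<beta> ?e z * z $ i:] t = \<gamma> t $$ (i, j)" for t
      unfolding \<gamma>_def L_def using ij z a by (simp add: algebra_simps power2_eq_square)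
    ultimately show "regular 1 (\<lambda>t. \<gamma> t $$ (i, j))" by (rule regular_cong)
  qed (use \<gamma>O in auto)
  moreover have "\<gamma> 0 = 1\<^sub>m m"
    by (rule mat_eq_iff_mult_vec[of _ m]) (use \<gamma> z a in \<open>auto simp: L_def\<close>)
  ultimately have "\<gamma> 1 \<in> R" unfolding R_def linked_def using \<gamma>O by blast
  then show ?thesis using that \<gamma>(2)[of _ 1] unfolding L_def by auto
qed

text \<open>Take the Siegel transformation along \<open>v + w\<close>. As
  \<open>q (v + w) = \<beta> v w\<close>, the coefficient of \<open>z\<close> in the image of
  \<open>v\<close> cancels and \<open>v\<close> goes to \<open>v + (v + w) = w\<close>.\<close>

lemma R_move:
  assumes z: "z \<in> V" "q z = 0" and v: "v \<in> V" "q v = 0" "\<beta> v z = 1" and w: "w \<in> V" "q w = 0" "\<beta> w z = 1"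
  obtains A where "A \<in> R" "A *\<^sub>v v = w" "A *\<^sub>v z = z"
    "\<And>y. y \<in> V \<Longrightarrow> \<beta> y z = 0 \<Longrightarrow> \<beta> y v = \<beta> y w \<Longrightarrow> A *\<^sub>v y = y"
proof -
  have a: "v + w \<in> V" "\<beta> (v + w) z = 0" using v w z by auto
  obtain A where A: "A \<in> R" "\<And>y. y \<in> V \<Longrightarrow> A *\<^sub>v y = y + (\<beta> y z \<cdot>\<^sub>v (v + w) + (\<beta> y (v + w) + q (v + w) * \<beta> y z) \<cdot>\<^sub>v z)"
    using R_siegel[OF z a] by blast
  have sym: "\<beta> z v = 1" "\<beta> z w = 1" using v w z bil_sym by metis+
  have "A *\<^sub>v v = v + (1 \<cdot>\<^sub>v (v + w) + (0::'k) \<cdot>\<^sub>v z)"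
    unfolding A(2)[OF v(1)] using v w z by (simp add: q_add)
  also have "\<dots> = w" using v w z by (intro eq_vecI) auto
  finally have 1: "A *\<^sub>v v = w" .
  have 2: "A *\<^sub>v z = z"
    unfolding A(2)[OF z(1)] using v w z sym by simp
  have 3: "A *\<^sub>v y = y" if "y \<in> V" "\<beta> y z = 0" "\<beta> y v = \<beta> y w" for y
    unfolding A(2)[OF that(1)] using that v w z by simp
  show ?thesis using that A(1) 1 2 3 by blast
qed

lemma R_scale:
  assumes g: "frame g" and i: "i < n" and c: "c \<noteq> 0"
  obtains A where "A \<in> R" "A *\<^sub>v g i = c \<cdot>\<^sub>v g i" "A *\<^sub>v g (m - 1 - i) = inverse c \<cdot>\<^sub>v g (m - 1 - i)"
    "\<And>j. j < m \<Longrightarrow> j \<noteq> i \<Longrightarrow> j \<noteq> m - 1 - i \<Longrightarrow> A *\<^sub>v g j = g j"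
proof -
  define s where "s = (\<lambda>j. if j = i then c else if j = m - 1 - i then inverse c else 1)"
  have ne: "i < m" "m - 1 - i \<noteq> i" "m - 1 - i < m" using i m_def by auto
  have s: "s j * s (m - 1 - j) = 1" if "j < m" for j
    using that ne c unfolding s_def by auto
  obtain A where A: "A \<in> Or" "\<And>j. j < m \<Longrightarrow> A *\<^sub>v g j = s j \<cdot>\<^sub>v g j"
    using frame_map[OF g frame_smult[of g s, OF g s]] by blast
  have "linked Or A" by (rule linked_diagonal[OF g s A])
  then have "A \<in> R" unfolding R_def using A by simp
  then show ?thesis using that A(2)[of i] A(2)[of "m - 1 - i"] A(2) ne unfolding s_def by auto
qed

definition fixes_pairs :: "nat \<Rightarrow> (nat \<Rightarrow> 'k vec) \<Rightarrow> 'k mat \<Rightarrow> bool" where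
  "fixes_pairs k g A \<longleftrightarrow> (\<forall>i<k. A *\<^sub>v g i = g i \<and> A *\<^sub>v g (m - 1 - i) = g (m - 1 - i))"

lemma fixes_pairs_mult:
  assumes "frame g" "k \<le> n" "A \<in> R" "B \<in> R" "fixes_pairs k g A" "fixes_pairs k g B"
  shows "fixes_pairs k g (A * B)"
  unfolding fixes_pairs_def
proof (intro allI impI)
  fix i assume i: "i < k"
  then have "i < m" "m - 1 - i < m" using assms m_def by auto
  then show "(A * B) *\<^sub>v g i = g i \<and> (A * B) *\<^sub>v g (m - 1 - i) = g (m - 1 - i)"
    using assms i R_Or unfolding fixes_pairs_def by simp
qed

lemma frame_orth_bil:
  assumes g: "frame g" and k: "k \<le> n" and u: "orth k g (\<lambda>i. g (m - 1 - i)) u" and j: "j < k \<or> j \<ge> m - k" "j < m"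
  shows "\<beta> u (g j) = 0"
proof (cases "j < k")
  case False
  then have "m - 1 - j < k" "m - 1 - (m - 1 - j) = j" using j by auto
  then show ?thesis using u unfolding orth_def by metis
qed (use u in \<open>auto simp: orth_def\<close>)

text \<open>Once \<open>u\<close> has a nonzero component along \<open>g k\<close>, it can be
  rescaled and carried there by a Siegel transformation at \<open>g (m - 1 - k)\<close>. Everything
  happens inside the complement of the first \<open>k\<close> pairs, which therefore stay
  fixed.\<close>

lemma R_move_to_frame:
  assumes g: "frame g" and k: "k + 1 < n" and u: "orth k g (\<lambda>i. g (m - 1 - i)) u" "u \<noteq> 0\<^sub>v m" "q u = 0"
  obtains A where "A \<in> R" "fixes_pairs k g A" "A *\<^sub>v u = g k"
proof -
  let ?k = "m - 1 - k"
  have lt: "k < m" "?k < m" "k < n" "k + 1 < m" "k \<le> n" "m - 2 - k < m" "k < ?k" using k m_def by auto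
  have uV: "u \<in> V" using u unfolding orth_def by simp
  note gV = frame_carrier[OF g] and gb = frame_bil[OF g]
  have fix_siegel: "fixes_pairs k g A"
    if "\<And>y. y \<in> V \<Longrightarrow> \<beta> y z = 0 \<Longrightarrow> \<beta> y a = 0 \<Longrightarrow> A *\<^sub>v y = y"
      "orth k g (\<lambda>i. g (m - 1 - i)) z" "orth k g (\<lambda>i. g (m - 1 - i)) a" for A z a
    unfolding fixes_pairs_def
  proof (intro allI impI)
    fix i assume i: "i < k"
    then have V: "g i \<in> V" "g (m - 1 - i) \<in> V" using gV lt by auto
    have za: "z \<in> V" "a \<in> V" using that unfolding orth_def by auto
    have "\<beta> (g i) z = 0" "\<beta> (g (m - 1 - i)) z = 0" "\<beta> (g i) a = 0" "\<beta> (g (m - 1 - i)) a = 0"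
      using that(2,3) i bil_sym[OF za(1)] bil_sym[OF za(2)] V unfolding orth_def by auto
    then show "A *\<^sub>v g i = g i \<and> A *\<^sub>v g (m - 1 - i) = g (m - 1 - i)" using that(1) V by blast
  qed
  have og: "orth k g (\<lambda>i. g (m - 1 - i)) (g j)" if "k \<le> j" "j < m - k" for j
    unfolding orth_def using gV gb that lt by auto
  have hg: "hyp k g (\<lambda>i. g (m - 1 - i))" by (rule frame_hyp[OF g lt(5)])
  have "\<exists>B\<in>R. fixes_pairs k g B \<and> \<beta> (B *\<^sub>v u) (g ?k) \<noteq> 0"
  proof (cases "\<beta> u (g ?k) = 0")
    case False
    then show ?thesis using R_one uV gV lt by (intro bexI[of _ "1\<^sub>m m"]) (auto simp: fixes_pairs_def)
  next
    case True
    have "\<exists>a. orth k g (\<lambda>i. g (m - 1 - i)) a \<and> \<beta> a (g k) = 0 \<and> \<beta> a (g ?k) = 0 \<and> \<beta> u a + q a * \<beta> u (g k) \<noteq> 0"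
    proof (cases "\<exists>j. k < j \<and> j < ?k \<and> \<beta> u (g j) \<noteq> 0")
      case True
      then obtain j where j: "k < j" "j < ?k" "\<beta> u (g j) \<noteq> 0" by blast
      show ?thesis by (rule exI[of _ "g j"]) (use j og[of j] g lt in \<open>auto simp: gb\<close>)
    next
      case False
      \<comment> \<open>Here \<open>u\<close> is a multiple of \<open>g (m - 1 - k)\<close>, so
        \<open>\<beta> u a\<close> vanishes for every admissible frame vector. A vector with
        \<open>q a = 1\<close>, built from the next hyperbolic pair, works instead; this is where
        \<open>k + 1 < n\<close> enters.\<close>
      let ?a = "g (k + 1) + g (m - 2 - k)"
      have idx: "k + 1 + (m - 2 - k) = m - 1" using k m_def by auto
      have "\<beta> u (g k) \<noteq> 0"
      proof
        assume 0: "\<beta> u (g k) = 0"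
        have "\<beta> u (g j) = 0" if "j < m" for j
        proof (cases "j < k \<or> j \<ge> m - k")
          case True
          then show ?thesis using frame_orth_bil[OF g lt(5) u(1)] that by blast
        next
          case outer: False
          consider "j = k" | "j = ?k" | "k < j \<and> j < ?k" using outer that by linarith
          then show ?thesis using 0 True False by cases auto
        qed
        then show False using frame_eqI_0[OF g uV] u(2) by blast
      qed
      moreover have "\<beta> u (g (k + 1)) = 0" "\<beta> u (g (m - 2 - k)) = 0" using False k m_def by auto
      moreover have "q ?a = 1" using gV gb idx lt g by (simp add: q_add)
      moreover have "orth k g (\<lambda>i. g (m - 1 - i)) ?a"
        using orth_add[OF og[of "k + 1"] og[of "m - 2 - k"] hg] k m_def by simp
      moreover have "\<beta> ?a (g k) = 0" "\<beta> ?a (g ?k) = 0" using gV gb k m_def lt by auto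
      ultimately show ?thesis using uV gV lt by (intro exI[of _ ?a]) simp
    qed
    then obtain a where a: "orth k g (\<lambda>i. g (m - 1 - i)) a" "\<beta> a (g k) = 0" "\<beta> a (g ?k) = 0"
      "\<beta> u a + q a * \<beta> u (g k) \<noteq> 0" by blast
    have aV: "a \<in> V" using a unfolding orth_def by simp
    obtain A where A: "A \<in> R" "\<And>v. v \<in> V \<Longrightarrow> A *\<^sub>v v = v + (\<beta> v (g k) \<cdot>\<^sub>v a + (\<beta> v a + q a * \<beta> v (g k)) \<cdot>\<^sub>v g k)"
      using R_siegel[OF gV[OF lt(1)] frame_q[OF g lt(1)] aV a(2)] by blast
    have "fixes_pairs k g A"
      by (rule fix_siegel[of "g k" a, OF _ og a(1)]) (use A(2) lt aV gV in auto)
    moreover have "\<beta> (A *\<^sub>v u) (g ?k) = \<beta> u a + q a * \<beta> u (g k)"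
      unfolding A(2)[OF uV] using True a aV uV gV lt gb by simp
    ultimately show ?thesis using A(1) a(4) by auto
  qed
  then obtain B where B: "B \<in> R" "fixes_pairs k g B" "\<beta> (B *\<^sub>v u) (g ?k) \<noteq> 0" by blast
  define b where "b = \<beta> (B *\<^sub>v u) (g ?k)"
  define v where "v = inverse b \<cdot>\<^sub>v (B *\<^sub>v u)"
  have BuV: "B *\<^sub>v u \<in> V" using B(1) R_Or uV by simp
  have b0: "b \<noteq> 0" using B(3) unfolding b_def .
  have v: "v \<in> V" "q v = 0" "\<beta> v (g ?k) = 1"
    unfolding v_def using BuV B R_Or uV u(3) gV lt by (auto simp: b_def)
  have ov: "orth k g (\<lambda>i. g (m - 1 - i)) v"
    unfolding orth_def
  proof (intro conjI allI impI)
    fix i assume i: "i < k"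
    then have V: "g i \<in> V" "g (m - 1 - i) \<in> V" using gV lt by auto
    have "\<beta> (B *\<^sub>v u) (g i) = \<beta> (B *\<^sub>v u) (B *\<^sub>v g i)"
      "\<beta> (B *\<^sub>v u) (g (m - 1 - i)) = \<beta> (B *\<^sub>v u) (B *\<^sub>v g (m - 1 - i))"
      using B(2) i unfolding fixes_pairs_def by simp_all
    then have "\<beta> (B *\<^sub>v u) (g i) = 0" "\<beta> (B *\<^sub>v u) (g (m - 1 - i)) = 0"
      using R_Or[OF B(1)] uV V u(1) i unfolding orth_def by auto
    then show "\<beta> v (g i) = 0" "\<beta> v (g (m - 1 - i)) = 0" unfolding v_def using BuV V by auto
  qed (rule v(1))
  have gk: "\<beta> (g k) (g ?k) = 1" using gb lt by simp
  obtain C where C: "C \<in> R" "C *\<^sub>v v = g k"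
    "\<And>y. y \<in> V \<Longrightarrow> \<beta> y (g ?k) = 0 \<Longrightarrow> \<beta> y v = \<beta> y (g k) \<Longrightarrow> C *\<^sub>v y = y"
    using R_move[OF gV[OF lt(2)] frame_q[OF g lt(2)] v gV[OF lt(1)] frame_q[OF g lt(1)] gk] by blast
  have fC: "fixes_pairs k g C"
  proof (rule fix_siegel[of "g ?k" "v + g k"])
    show "orth k g (\<lambda>i. g (m - 1 - i)) (g ?k)" by (rule og) (use lt in auto)
    show "orth k g (\<lambda>i. g (m - 1 - i)) (v + g k)" by (rule orth_add[OF ov og hg]) (use lt in auto)
    fix y assume y: "y \<in> V" "\<beta> y (g ?k) = 0" "\<beta> y (v + g k) = 0"
    then have "\<beta> y v = \<beta> y (g k)" using v(1) gV lt by (simp add: add_eq_0_iff2)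
    then show "C *\<^sub>v y = y" using C(3) y by blast
  qed
  obtain D where D: "D \<in> R" "D *\<^sub>v g k = inverse b \<cdot>\<^sub>v g k"
    "\<And>j. j < m \<Longrightarrow> j \<noteq> k \<Longrightarrow> j \<noteq> ?k \<Longrightarrow> D *\<^sub>v g j = g j"
    using R_scale[OF g lt(3), of "inverse b"] b0 by (metis nonzero_imp_inverse_nonzero)
  have fD: "fixes_pairs k g D" unfolding fixes_pairs_def
  proof (intro allI impI)
    fix i assume i: "i < k"
    then have "i < m" "i \<noteq> k" "i \<noteq> ?k" "m - 1 - i < m" "m - 1 - i \<noteq> k" "m - 1 - i \<noteq> ?k"
      using lt by auto
    then show "D *\<^sub>v g i = g i \<and> D *\<^sub>v g (m - 1 - i) = g (m - 1 - i)" using D(3) by blast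
  qed
  have f: "fixes_pairs k g (D * (C * B))"
    by (rule fixes_pairs_mult[OF g lt(5) D(1) R_mult[OF C(1) B(1)] fD
      fixes_pairs_mult[OF g lt(5) C(1) B(1) fC B(2)]])
  have "B *\<^sub>v u = b \<cdot>\<^sub>v v" unfolding v_def using b0 BuV by (simp add: smult_smult_assoc)
  then have "(D * (C * B)) *\<^sub>v u = D *\<^sub>v (C *\<^sub>v (b \<cdot>\<^sub>v v))"
    using R_Or[OF B(1)] R_Or[OF C(1)] R_Or[OF D(1)] uV by (simp add: Or_mult)
  also have "\<dots> = b \<cdot>\<^sub>v (D *\<^sub>v (C *\<^sub>v v))"
    using Or_carrier[OF R_Or[OF C(1)]] Or_carrier[OF R_Or[OF D(1)]] v by simp
  also have "\<dots> = g k" using C(2) D(2) b0 gV lt by (simp add: smult_smult_assoc)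
  finally show ?thesis using that[OF R_mult[OF D(1) R_mult[OF C(1) B(1)]] f] by blast
qed

text \<open>Witt extension by induction on the number of pairs: each step places \<open>g k\<close>
  and then its partner. The last pair is out of reach of this argument, since moving a vector into
  place relies on a further hyperbolic plane.\<close>

lemma R_match_frames:
  assumes g: "frame g" and h: "frame h" and k: "k \<le> n - 1"
  obtains A where "A \<in> R" "\<And>i. i < k \<Longrightarrow> A *\<^sub>v h i = g i" "\<And>i. i < k \<Longrightarrow> A *\<^sub>v h (m - 1 - i) = g (m - 1 - i)"
proof -
  have "\<exists>A\<in>R. \<forall>i<k. A *\<^sub>v h i = g i \<and> A *\<^sub>v h (m - 1 - i) = g (m - 1 - i)"
    using k
  proof (induction k)
    case 0
    then show ?case using R_one by blast
  next
    case (Suc k)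
    let ?k = "m - 1 - k"
    have lt: "k < m" "?k < m" "k + 1 < n" "k \<le> n" "k < ?k" using Suc.prems m_def by auto
    obtain A where A: "A \<in> R" "\<And>i. i < k \<Longrightarrow> A *\<^sub>v h i = g i" "\<And>i. i < k \<Longrightarrow> A *\<^sub>v h (m - 1 - i) = g (m - 1 - i)"
      using Suc by auto
    define h1 where "h1 = (\<lambda>i. A *\<^sub>v h i)"
    have h1: "frame h1" unfolding h1_def by (rule frame_image[OF h R_Or[OF A(1)]])
    have h1g: "h1 i = g i" "h1 (m - 1 - i) = g (m - 1 - i)" if "i < k" for i
      using A that unfolding h1_def by auto
    have "orth k g (\<lambda>i. g (m - 1 - i)) (h1 k)"
      unfolding orth_def
    proof (intro conjI allI impI)
      fix i assume i: "i < k"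
      show "\<beta> (h1 k) (g i) = 0" "\<beta> (h1 k) (g (m - 1 - i)) = 0"
        using frame_bil[OF h1, of k i] frame_bil[OF h1, of k "m - 1 - i"] h1g[OF i] i lt m_def by auto
    qed (use h1 lt in simp)
    then obtain B where B: "B \<in> R" "fixes_pairs k g B" "B *\<^sub>v h1 k = g k"
      using R_move_to_frame[OF g lt(3) _ frame_nonzero[OF h1 lt(1)] frame_q[OF h1 lt(1)]] by blast
    define h2 where "h2 = (\<lambda>i. B *\<^sub>v h1 i)"
    have h2: "frame h2" unfolding h2_def by (rule frame_image[OF h1 R_Or[OF B(1)]])
    have h2g: "h2 i = g i" "h2 (m - 1 - i) = g (m - 1 - i)" if "i < k" for i
      using B(2) h1g that unfolding h2_def fixes_pairs_def by auto
    have h2k: "h2 k = g k" unfolding h2_def by (rule B(3))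
    have b: "\<beta> (h2 ?k) (g k) = 1" "\<beta> (g ?k) (g k) = 1"
      using frame_bil[OF h2 lt(2,1)] frame_bil[OF g lt(2,1)] h2k lt by auto
    \<comment> \<open>This Siegel transformation moves the partner of \<open>g k\<close> and fixes
      every vector that is orthogonal to \<open>g k\<close> and has equal products with the old and
      the new partner, in particular the pairs already placed.\<close>
    obtain C where C: "C \<in> R" "C *\<^sub>v h2 ?k = g ?k" "C *\<^sub>v g k = g k"
      "\<And>y. y \<in> V \<Longrightarrow> \<beta> y (g k) = 0 \<Longrightarrow> \<beta> y (h2 ?k) = \<beta> y (g ?k) \<Longrightarrow> C *\<^sub>v y = y"
      using R_move[OF frame_carrier[OF g lt(1)] frame_q[OF g lt(1)] frame_carrier[OF h2 lt(2)]
        frame_q[OF h2 lt(2)] b(1) frame_carrier[OF g lt(2)] frame_q[OF g lt(2)] b(2)] by blast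
    have Ch2: "C *\<^sub>v h2 i = g i \<and> C *\<^sub>v h2 (m - 1 - i) = g (m - 1 - i)" if i: "i < Suc k" for i
    proof (cases "i = k")
      case True
      then show ?thesis using C h2k by simp
    next
      case False
      then have ik: "i < k" using i by simp
      then have im: "i < m" "m - 1 - i < m" "i + k \<noteq> m - 1" "m - 1 - i + k \<noteq> m - 1" "i + ?k \<noteq> m - 1"
         "m - 1 - i + ?k \<noteq> m - 1" using lt by auto
      have "\<beta> (g i) (g k) = 0" "\<beta> (g (m - 1 - i)) (g k) = 0"
        "\<beta> (g i) (g ?k) = 0" "\<beta> (g (m - 1 - i)) (g ?k) = 0"
        unfolding frame_bil[OF g im(1) lt(1)] frame_bil[OF g im(2) lt(1)] frame_bil[OF g im(1) lt(2)]
          frame_bil[OF g im(2) lt(2)] using im by simp_all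
      moreover have "\<beta> (h2 i) (h2 ?k) = 0" "\<beta> (h2 (m - 1 - i)) (h2 ?k) = 0"
        unfolding frame_bil[OF h2 im(1) lt(2)] frame_bil[OF h2 im(2) lt(2)] using im by simp_all
      ultimately have "C *\<^sub>v g i = g i" "C *\<^sub>v g (m - 1 - i) = g (m - 1 - i)"
        using C(4)[OF frame_carrier[OF g im(1)]] C(4)[OF frame_carrier[OF g im(2)]]
        unfolding h2g[OF ik] by simp_all
      then show ?thesis using h2g[OF ik] by simp
    qed
    have CBA: "(C * (B * A)) *\<^sub>v h i = C *\<^sub>v h2 i" if "i < m" for i
      unfolding h2_def h1_def using that h R_Or[OF A(1)] R_Or[OF B(1)] R_Or[OF C(1)] by (simp add: Or_mult)
    have "\<forall>i<Suc k. (C * (B * A)) *\<^sub>v h i = g i \<and> (C * (B * A)) *\<^sub>v h (m - 1 - i) = g (m - 1 - i)"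
    proof (intro allI impI)
      fix i assume i: "i < Suc k"
      then have "i < m" "m - 1 - i < m" using lt by auto
      then show "(C * (B * A)) *\<^sub>v h i = g i \<and> (C * (B * A)) *\<^sub>v h (m - 1 - i) = g (m - 1 - i)"
        using Ch2[OF i] by (simp only: CBA)
    qed
    then show ?case using R_mult[OF C(1) R_mult[OF B(1) A(1)]] by blast
  qed
  then show ?thesis using that by blast
qed

text \<open>The exchange inside the middle pair, the one ambiguity left, up to scaling, after all
  other pairs have been matched by \<open>R\<close>.\<close>

definition swap_frame :: "(nat \<Rightarrow> 'k vec) \<Rightarrow> nat \<Rightarrow> 'k vec" where
  "swap_frame g = (\<lambda>i. if i = n - 1 then g n else if i = n then g (n - 1) else g i)"

lemma frame_swap_frame:
  assumes g: "frame g" shows "frame (swap_frame g)"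
proof -
  define s where "s = (\<lambda>i. if i = n - 1 then n else if i = n then n - 1 else i)"
  have eq: "swap_frame g = (\<lambda>i. g (s i))" unfolding swap_frame_def s_def by auto
  have "n < m" "n - 1 < m" using m_def n3 by auto
  then have lt: "s i < m" if "i < m" for i using that unfolding s_def by simp
  have sum: "s i + s j = m - 1 \<longleftrightarrow> i + j = m - 1" for i j
  proof -
    obtain N where N: "n = Suc N" using n3 by (cases n) auto
    show ?thesis unfolding s_def m_def N by auto
  qed
  show ?thesis unfolding eq frame_def
  proof (intro conjI allI impI)
    fix i assume i: "i < m"
    show "g (s i) \<in> V" "q (g (s i)) = 0" using g lt[OF i] by simp_all
    fix j assume j: "j < m"
    show "\<beta> (g (s i)) (g (s j)) = (if i + j = m - 1 then 1 else 0)"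
      unfolding frame_bil[OF g lt[OF i] lt[OF j]] sum ..
  qed
qed

text \<open>What remains is a hyperbolic plane, whose singular vectors lie on just two lines: the
  equations \<open>a * b = 0\<close>, \<open>c * d = 0\<close> and \<open>a * d + b * c = 1\<close>
  leave a diagonal or an antidiagonal matrix, and \<open>R_scale\<close> removes the
  scalars.\<close>

lemma R_or_swap:
  assumes g: "frame g" and h: "frame h"
  obtains A where "A \<in> R" "(\<forall>i<m. A *\<^sub>v h i = g i) \<or> (\<forall>i<m. A *\<^sub>v h i = swap_frame g i)"
proof -
  obtain A where A: "A \<in> R" "\<And>i. i < n - 1 \<Longrightarrow> A *\<^sub>v h i = g i"
    "\<And>i. i < n - 1 \<Longrightarrow> A *\<^sub>v h (m - 1 - i) = g (m - 1 - i)"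
    using R_match_frames[OF g h, of "n - 1"] by auto
  define h1 where "h1 = (\<lambda>i. A *\<^sub>v h i)"
  have h1: "frame h1" unfolding h1_def by (rule frame_image[OF h R_Or[OF A(1)]])
  have h1g: "h1 i = g i" if "i < m" "i \<noteq> n - 1" "i \<noteq> n" for i
  proof (cases "i < n - 1")
    case False
    then have "m - 1 - i < n - 1" "m - 1 - (m - 1 - i) = i" using that m_def by auto
    then show ?thesis using A(3)[of "m - 1 - i"] unfolding h1_def by simp
  qed (use A(2) in \<open>simp add: h1_def\<close>)
  have lt: "n - 1 < m" "n < m" "n - 1 + n = m - 1" "n \<noteq> n - 1" "n - 1 < n" "m - 1 - (n - 1) = n"
    "n + (n - 1) = m - 1" using m_def n3 by auto
  note gV = frame_carrier[OF g] and gb = frame_bil[OF g]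
  have expand: "v = \<beta> v (g n) \<cdot>\<^sub>v g (n - 1) + \<beta> v (g (n - 1)) \<cdot>\<^sub>v g n"
    if "v \<in> V" "\<And>j. j < m \<Longrightarrow> j \<noteq> n - 1 \<Longrightarrow> j \<noteq> n \<Longrightarrow> \<beta> v (g j) = 0" for v
  proof (rule frame_eqI[OF g that(1)])
    fix j assume j: "j < m"
    have e: "n - 1 + j = m - 1 \<longleftrightarrow> j = n" "n + j = m - 1 \<longleftrightarrow> j = n - 1" using m_def n3 by auto
    show "\<beta> v (g j) = \<beta> (\<beta> v (g n) \<cdot>\<^sub>v g (n - 1) + \<beta> v (g (n - 1)) \<cdot>\<^sub>v g n) (g j)"
      using that(2)[OF j] j lt(1,2,4) gV gb[OF lt(1) j] gb[OF lt(2) j] e by auto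
  qed (use gV lt in auto)
  define a b c d where "a = \<beta> (h1 (n - 1)) (g n)" and "b = \<beta> (h1 (n - 1)) (g (n - 1))"
    and "c = \<beta> (h1 n) (g n)" and "d = \<beta> (h1 n) (g (n - 1))"
  have u: "h1 (n - 1) = a \<cdot>\<^sub>v g (n - 1) + b \<cdot>\<^sub>v g n" unfolding a_def b_def
  proof (rule expand)
    fix j assume j: "j < m" "j \<noteq> n - 1" "j \<noteq> n"
    then show "\<beta> (h1 (n - 1)) (g j) = 0" using frame_bil[OF h1 lt(1) j(1)] h1g[OF j] m_def n3 by auto
  qed (use h1 lt in simp)
  have w: "h1 n = c \<cdot>\<^sub>v g (n - 1) + d \<cdot>\<^sub>v g n" unfolding c_def d_def
  proof (rule expand)
    fix j assume j: "j < m" "j \<noteq> n - 1" "j \<noteq> n"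
    then show "\<beta> (h1 n) (g j) = 0" using frame_bil[OF h1 lt(2) j(1)] h1g[OF j] m_def n3 by auto
  qed (use h1 lt in simp)
  have bb: "\<beta> (g (n - 1)) (g n) = 1" "\<beta> (g n) (g (n - 1)) = 1" using gb lt by auto
  have "q (h1 (n - 1)) = a * b" "q (h1 n) = c * d" "\<beta> (h1 (n - 1)) (h1 n) = a * d + b * c"
    unfolding u w using gV lt bb g by (auto simp: q_add mult_ac)
  then have e: "a * b = 0" "c * d = 0" "a * d + b * c = 1"
    using h1 lt frame_bil[OF h1 lt(1,2)] by auto
  consider "b = 0" "a \<noteq> 0" "c = 0" "d = inverse a" | "a = 0" "b \<noteq> 0" "d = 0" "c = inverse b"
    using e by (metis add.right_neutral add_0 mult_eq_0_iff mult_zero_left mult_zero_right inverse_unique zero_neq_one)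
  then show ?thesis
  proof cases
    case 1
    obtain D where D: "D \<in> R" "D *\<^sub>v g (n - 1) = inverse a \<cdot>\<^sub>v g (n - 1)"
      "D *\<^sub>v g n = inverse (inverse a) \<cdot>\<^sub>v g n"
      "\<And>j. j < m \<Longrightarrow> j \<noteq> n - 1 \<Longrightarrow> j \<noteq> n \<Longrightarrow> D *\<^sub>v g j = g j"
      using R_scale[OF g lt(5), of "inverse a"] 1 lt(6) by (metis nonzero_imp_inverse_nonzero)
    note DO = Or_carrier[OF R_Or[OF D(1)]]
    have u': "h1 (n - 1) = a \<cdot>\<^sub>v g (n - 1)" and w': "h1 n = inverse a \<cdot>\<^sub>v g n"
      unfolding u w using 1 gV lt(1,2) by simp_all
    have "D *\<^sub>v h1 (n - 1) = g (n - 1)" "D *\<^sub>v h1 n = g n"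
      unfolding u' w' using D(2,3) DO gV lt(1,2) 1(2) by (simp_all add: smult_smult_assoc)
    then have "D *\<^sub>v h1 i = g i" if i: "i < m" for i
      using D(4)[OF i] h1g[OF i] by (cases "i = n - 1"; cases "i = n") simp_all
    then have "\<forall>i<m. (D * A) *\<^sub>v h i = g i"
      unfolding h1_def using R_Or[OF A(1)] R_Or[OF D(1)] h by simp
    then show ?thesis using that R_mult A(1) D(1) by blast
  next
    case 2
    obtain D where D: "D \<in> R" "D *\<^sub>v g (n - 1) = b \<cdot>\<^sub>v g (n - 1)"
      "D *\<^sub>v g n = inverse b \<cdot>\<^sub>v g n"
      "\<And>j. j < m \<Longrightarrow> j \<noteq> n - 1 \<Longrightarrow> j \<noteq> n \<Longrightarrow> D *\<^sub>v g j = g j"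
      using R_scale[OF g lt(5), of b] 2 lt(6) by metis
    note DO = Or_carrier[OF R_Or[OF D(1)]]
    have u': "h1 (n - 1) = b \<cdot>\<^sub>v g n" and w': "h1 n = inverse b \<cdot>\<^sub>v g (n - 1)"
      unfolding u w using 2 gV lt(1,2) by simp_all
    have "D *\<^sub>v h1 (n - 1) = g n" "D *\<^sub>v h1 n = g (n - 1)"
      unfolding u' w' using D(2,3) DO gV lt(1,2) 2(2) by (simp_all add: smult_smult_assoc)
    then have "D *\<^sub>v h1 i = swap_frame g i" if i: "i < m" for i
      using D(4)[OF i] h1g[OF i] unfolding swap_frame_def
      by (cases "i = n - 1"; cases "i = n") simp_all
    then have "\<forall>i<m. (D * A) *\<^sub>v h i = swap_frame g i"
      unfolding h1_def using R_Or[OF A(1)] R_Or[OF D(1)] h by simp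
    then show ?thesis using that R_mult A(1) D(1) by blast
  qed
qed

subsection \<open>The special orthogonal group\<close>

definition SO :: "'k mat set" where "SO = carrier (special_orthogonal_group m q)"

lemma SO_eq: "SO = connected_component_of_set (subtopology (zariski m) Or) (1\<^sub>m m)"
  unfolding SO_def special_orthogonal_group_def identity_component_def carrier_orthogonal_group
  by (simp add: orthogonal_group_def)

lemma Or_subset: "Or \<subseteq> carrier_mat m m"
  using Or_carrier by blast

lemma topspace_Or: "topspace (subtopology (zariski m) Or) = Or"
  using Or_subset by (auto simp: topspace_zariski)

lemma SO_subset: "SO \<subseteq> Or"
  unfolding SO_eq using connected_component_of_subset_topspace[of "subtopology (zariski m) Or"] topspace_Or by metis

lemma connected_subset_SO:
  assumes "connectedin (zariski m) S" "S \<subseteq> Or" "1\<^sub>m m \<in> S"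
  shows "S \<subseteq> SO"
  unfolding SO_eq by (rule connected_component_of_maximal) (use assms in \<open>auto simp: connectedin_subtopology\<close>)

lemma connected_SO: "connectedin (zariski m) SO"
  using connectedin_connected_component_of[of "subtopology (zariski m) Or" "1\<^sub>m m"]
  unfolding SO_eq[symmetric] by (simp add: connectedin_subtopology)

lemma R_subset_SO: "R \<subseteq> SO"
  by (rule connected_subset_SO)
    (use irreducible_imp_connected[OF irreducible_R] R_Or Or_carrier R_one in blast)+

lemma one_SO: "1\<^sub>m m \<in> SO"
  using R_subset_SO R_one by blast

text \<open>\<open>R\<close> has index at most two in the orthogonal group, so its closure is open and contains the
  identity component.\<close>

lemma vanishing_on_SO:
  assumes f: "polynomial_fun m f" "\<And>A. A \<in> R \<Longrightarrow> f A = 0" and A: "A \<in> SO"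
  shows "f A = 0"
proof (rule ccontr)
  assume fA: "f A \<noteq> 0"
  obtain g where g: "frame g" using exists_frame0 by blast
  obtain \<tau> where \<tau>: "\<tau> \<in> Or" "\<And>i. i < m \<Longrightarrow> \<tau> *\<^sub>v g i = swap_frame g i"
    using frame_map[OF g frame_swap_frame[OF g]] by blast
  have \<tau>\<tau>: "\<tau> * \<tau> = 1\<^sub>m m"
  proof (rule Or_eqI[OF g Or_mult[OF \<tau>(1) \<tau>(1)] Or_one])
    fix i assume i: "i < m"
    have "\<tau> *\<^sub>v swap_frame g i = g i"
      using \<tau>(2)[of n] \<tau>(2)[of "n - 1"] \<tau>(2)[OF i] m_pos n3 m_def unfolding swap_frame_def by auto
    then show "(\<tau> * \<tau>) *\<^sub>v g i = 1\<^sub>m m *\<^sub>v g i" using \<tau> g i by simp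
  qed
  have cover: "B \<in> R \<or> B * \<tau> \<in> R" if B: "B \<in> Or" for B
  proof -
    obtain C where C: "C \<in> R" "(\<forall>i<m. C *\<^sub>v (B *\<^sub>v g i) = g i) \<or> (\<forall>i<m. C *\<^sub>v (B *\<^sub>v g i) = swap_frame g i)"
      using R_or_swap[OF g frame_image[OF g B]] by blast
    note CO = R_Or[OF C(1)]
    have eq: "X = minv C * Y" if "C * X = Y" "X \<in> Or" for X Y
    proof -
      note M = Or_carrier[OF minv(1)[OF CO]] Or_carrier[OF CO] Or_carrier[OF that(2)]
      have "minv C * Y = (minv C * C) * X" unfolding that(1)[symmetric] using assoc_mult_mat[OF M] by simp
      then show ?thesis using minv(3)[OF CO] M(3) by simp
    qed
    from C(2) show ?thesis
    proof
      assume "\<forall>i<m. C *\<^sub>v (B *\<^sub>v g i) = g i"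
      then have "C * B = 1\<^sub>m m" by (intro Or_eqI[OF g Or_mult[OF CO B] Or_one]) (use CO B g in auto)
      then show ?thesis using eq[OF _ B] R_minv[OF C(1)] Or_carrier[OF minv(1)[OF CO]] by auto
    next
      assume "\<forall>i<m. C *\<^sub>v (B *\<^sub>v g i) = swap_frame g i"
      then have "C * B = \<tau>" by (intro Or_eqI[OF g Or_mult[OF CO B] \<tau>(1)]) (use CO B g \<tau>(2) in auto)
      then have "B * \<tau> = minv C * (\<tau> * \<tau>)"
        using eq[OF _ B] Or_carrier[OF minv(1)[OF CO]] Or_carrier[OF \<tau>(1)] by (metis assoc_mult_mat)
      then show ?thesis using R_minv[OF C(1)] Or_carrier[OF minv(1)[OF CO]] \<tau>\<tau> by auto
    qed
  qed
  have AO: "A \<in> Or" using A SO_subset by blast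
  have A\<tau>: "A * \<tau> \<in> R" using cover[OF AO] f(2) fA by blast
  have B\<tau>\<tau>: "(B * \<tau>) * \<tau> = B" if "B \<in> Or" for B
    using \<tau>\<tau> Or_carrier[OF \<tau>(1)] Or_carrier[OF that] by (metis assoc_mult_mat right_mult_one_mat)
  \<comment> \<open>Left translation by the element \<open>D\<close> of \<open>R\<close> that
    carries \<open>B\<close> to \<open>A\<close> turns \<open>f\<close> into a function that still
    vanishes on \<open>R\<close> but not at \<open>B\<close>. So failure of density at one point
    separates the whole coset from the closure of \<open>R\<close>.\<close>
  have sep: "\<exists>f'. polynomial_fun m f' \<and> (\<forall>C\<in>R. f' C = 0) \<and> f' B \<noteq> 0" if B: "B \<in> Or" "B * \<tau> \<in> R" for B
  proof -
    define D where "D = (A * \<tau>) * minv (B * \<tau>)"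
    have DR: "D \<in> R" unfolding D_def using R_mult A\<tau> R_minv B(2) by blast
    have "D * (B * \<tau>) = A * \<tau>" unfolding D_def
      using minv(3)[OF R_Or[OF B(2)]] Or_carrier[OF R_Or[OF A\<tau>]]
        right_mult_one_mat[OF Or_carrier[OF R_Or[OF A\<tau>]]]
        assoc_mult_mat[OF Or_carrier[OF R_Or[OF A\<tau>]] Or_carrier[OF minv(1)[OF R_Or[OF B(2)]]] Or_carrier[OF R_Or[OF B(2)]]]
      by simp
    then have D\<tau>: "(D * B) * \<tau> = A * \<tau>"
      using assoc_mult_mat[OF Or_carrier[OF R_Or[OF DR]] Or_carrier[OF B(1)] Or_carrier[OF \<tau>(1)]] by simp
    have "D * B = ((D * B) * \<tau>) * \<tau>" by (rule B\<tau>\<tau>[OF Or_mult[OF R_Or[OF DR] B(1)], symmetric])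
    also have "\<dots> = A" unfolding D\<tau> by (rule B\<tau>\<tau>[OF AO])
    finally have DB: "D * B = A" .
    have "pf (\<lambda>X. f (D * X))"
      by (rule pf_compose[OF f(1) pfm_mult[OF pfm_const[OF Or_carrier[OF R_Or[OF DR]]] pfm_id]])
    then obtain f' where f': "polynomial_fun m f'" "\<forall>X\<in>Or. f (D * X) = f' X" unfolding pf_def by blast
    moreover have "f' C = 0" if "C \<in> R" for C using f' f(2) R_mult[OF DR that] R_Or[OF that] by metis
    moreover have "f' B \<noteq> 0" using f' B(1) DB fA by metis
    ultimately show ?thesis by blast
  qed
  \<comment> \<open>\<open>E1\<close> and \<open>E2\<close> are the closures of \<open>R\<close> and
    of the coset of \<open>\<tau>\<close>; they cover \<open>SO\<close>, are disjoint on it and both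
    meet it, against connectedness.\<close>
  define F1 where "F1 = {f'. polynomial_fun m f' \<and> (\<forall>C\<in>R. f' C = 0)}"
  define F2 where "F2 = {f'. polynomial_fun m f' \<and> (\<forall>C\<in>R. f' (C * \<tau>) = 0)}"
  define E1 where "E1 = zero_locus m F1"
  define E2 where "E2 = zero_locus m F2"
  have cl: "closedin (zariski m) E1" "closedin (zariski m) E2"
    unfolding closedin_zariski algebraic_set_def
    by (rule exI[of _ F1], simp add: E1_def F1_def, rule exI[of _ F2], simp add: E2_def F2_def)
  have R1: "B \<in> E1" if "B \<in> R" for B
    using that Or_carrier R_Or unfolding E1_def F1_def zero_locus_def by blast
  have R2: "B \<in> E2" if "B \<in> Or" "B * \<tau> \<in> R" for B
    unfolding E2_def F2_def zero_locus_def
  proof (intro CollectI conjI ballI)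
    fix f' assume "f' \<in> {f'. polynomial_fun m f' \<and> (\<forall>C\<in>R. f' (C * \<tau>) = 0)}"
    then show "f' B = 0" using that B\<tau>\<tau> by (metis (mono_tags, lifting) mem_Collect_eq)
  qed (use that Or_carrier in blast)
  have disj: "B \<notin> E1" if B: "B \<in> Or" "B * \<tau> \<in> R" for B
    using sep[OF B] unfolding E1_def F1_def zero_locus_def by blast
  have disj': "B \<notin> E2" if B: "B \<in> R" for B
  proof -
    have "(B * \<tau>) * \<tau> \<in> R" using B\<tau>\<tau> R_Or B by metis
    then obtain f' where f': "polynomial_fun m f'" "\<forall>C\<in>R. f' C = 0" "f' (B * \<tau>) \<noteq> 0"
      using sep[OF Or_mult[OF R_Or[OF B] \<tau>(1)]] by blast
    have "pf (\<lambda>X. f' (X * \<tau>))"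
      by (rule pf_compose[OF f'(1) pfm_mult[OF pfm_id pfm_const[OF Or_carrier[OF \<tau>(1)]]]])
    then obtain f2 where f2: "polynomial_fun m f2" "\<forall>X\<in>Or. f' (X * \<tau>) = f2 X" unfolding pf_def by blast
    have "f2 (C * \<tau>) = 0" if "C \<in> R" for C
      using f2(2) f'(2) Or_mult[OF R_Or[OF that] \<tau>(1)] B\<tau>\<tau>[OF R_Or[OF that]] that by metis
    moreover have "f2 B \<noteq> 0" using f2(2) f'(3) R_Or[OF B] by metis
    ultimately show ?thesis using f2(1) unfolding E2_def F2_def zero_locus_def by blast
  qed
  have "SO \<subseteq> E1 \<union> E2" using cover R1 R2 SO_subset by blast
  moreover have "E1 \<inter> E2 \<inter> SO = {}" using cover disj disj' SO_subset by blast
  moreover have "E1 \<inter> SO \<noteq> {}" using R1 R_one one_SO by blast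
  moreover have "E2 \<inter> SO \<noteq> {}" using R2[OF AO A\<tau>] A by blast
  ultimately show False using connected_SO cl unfolding connectedin_closedin by blast
qed

lemma irreducible_SO: "irreducible_set m SO"
  unfolding irreducible_set_def
proof (intro allI impI)
  fix f g :: "'k mat \<Rightarrow> 'k"
  assume fg: "polynomial_fun m f" "polynomial_fun m g" and "\<exists>A\<in>SO. f A \<noteq> 0" "\<exists>A\<in>SO. g A \<noteq> 0"
  then have "\<exists>A\<in>R. f A \<noteq> 0" "\<exists>A\<in>R. g A \<noteq> 0" using vanishing_on_SO by blast+
  then show "\<exists>A\<in>SO. f A \<noteq> 0 \<and> g A \<noteq> 0"
    using irreducible_R fg R_subset_SO unfolding irreducible_set_def by blast
qed

lemma SO_transitive:
  assumes "frame g" "frame h"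
  obtains A where "A \<in> SO" "\<And>i. i < n - 1 \<Longrightarrow> A *\<^sub>v g i = h i"
  using R_match_frames[OF assms(2,1) order_refl] R_subset_SO that by (metis subsetD)

section \<open>The Lie-Kolchin theorem\<close>

lemma pf_zero_set_closed:
  assumes "\<And>F. F \<in> \<Phi> \<Longrightarrow> pf F" "H \<subseteq> Or"
  obtains E where "closedin (zariski m) E" "{A \<in> H. \<forall>F\<in>\<Phi>. F A = 0} = E \<inter> H"
proof -
  have "\<forall>F\<in>\<Phi>. \<exists>f. polynomial_fun m f \<and> (\<forall>A\<in>Or. F A = f A)" using assms(1) unfolding pf_def by blast
  then obtain f where f: "\<And>F. F \<in> \<Phi> \<Longrightarrow> polynomial_fun m (f F)"
    "\<And>F A. F \<in> \<Phi> \<Longrightarrow> A \<in> Or \<Longrightarrow> F A = f F A" by metis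
  have "algebraic_set m (zero_locus m (f ` \<Phi>))" unfolding algebraic_set_def using f(1) by blast
  moreover have "{A \<in> H. \<forall>F\<in>\<Phi>. F A = 0} = zero_locus m (f ` \<Phi>) \<inter> H"
    using f(2) assms(2) Or_carrier unfolding zero_locus_def by auto
  ultimately show ?thesis using that closedin_zariski by blast
qed

lemma connectedin_closed_cover:
  assumes "connectedin T S" "closedin T E1" "closedin T E2" "S \<subseteq> E1 \<union> E2" "E1 \<inter> E2 \<inter> S = {}" "E1 \<inter> S \<noteq> {}"
  shows "E2 \<inter> S = {}"
  using assms unfolding connectedin_closedin by blast

text \<open>A connected set is not a disjoint union of finitely many, but at least two, nonempty
  relatively closed level sets. Level sets are given by families of equations because membership in
  \<open>perp X\<close> is such a family.\<close>

lemma finite_valued_constant: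
  fixes \<phi> :: "'k mat \<Rightarrow> 'k"
  assumes conn: "connectedin (zariski m) H" and H: "H \<subseteq> Or" and fin: "finite (\<phi> ` H)"
    and cl: "\<And>c. \<exists>\<Phi>. (\<forall>F\<in>\<Phi>. pf F) \<and> {A \<in> H. \<phi> A = c} = {A \<in> H. \<forall>F\<in>\<Phi>. F A = 0}"
    and AB: "A \<in> H" "B \<in> H"
  shows "\<phi> A = \<phi> B"
proof (rule ccontr)
  assume ne: "\<phi> A \<noteq> \<phi> B"
  have "\<exists>E. closedin (zariski m) E \<and> {A \<in> H. \<phi> A = c} = E \<inter> H" for c
  proof -
    obtain \<Phi> where \<Phi>: "\<forall>F\<in>\<Phi>. pf F" "{A \<in> H. \<phi> A = c} = {A \<in> H. \<forall>F\<in>\<Phi>. F A = 0}"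
      using cl by blast
    obtain E where "closedin (zariski m) E" "{A \<in> H. \<forall>F\<in>\<Phi>. F A = 0} = E \<inter> H"
      by (rule pf_zero_set_closed[of \<Phi> H]) (use \<Phi>(1) H in blast)+
    then show ?thesis unfolding \<Phi>(2) by blast
  qed
  then obtain E where E: "\<And>c. closedin (zariski m) (E c)" "\<And>c. {A \<in> H. \<phi> A = c} = E c \<inter> H" by metis
  define E2 where "E2 = \<Union>(E ` (\<phi> ` H - {\<phi> A}))"
  have cl2: "closedin (zariski m) E2" unfolding E2_def using fin E(1) by (intro closedin_Union) auto
  have in_E: "X \<in> E c \<longleftrightarrow> \<phi> X = c" if X: "X \<in> H" for X c
  proof -
    have "X \<in> {A \<in> H. \<phi> A = c} \<longleftrightarrow> X \<in> E c \<inter> H" by (simp only: E(2))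
    then show ?thesis using X by simp
  qed
  have cover: "H \<subseteq> E (\<phi> A) \<union> E2"
  proof
    fix X assume X: "X \<in> H"
    have "X \<in> E (\<phi> X)" using in_E[OF X] by simp
    then show "X \<in> E (\<phi> A) \<union> E2" unfolding E2_def using X by (cases "\<phi> X = \<phi> A") auto
  qed
  have disj: "E (\<phi> A) \<inter> E2 \<inter> H = {}" unfolding E2_def using in_E by fastforce
  have A: "A \<in> E (\<phi> A) \<inter> H" using in_E[OF AB(1)] AB(1) by simp
  have "\<phi> B \<in> \<phi> ` H - {\<phi> A}" using AB(2) ne by simp
  then have B: "B \<in> E2 \<inter> H" unfolding E2_def using in_E[OF AB(2), of "\<phi> B"] AB(2) by blast
  show False
    using connectedin_closed_cover[OF conn E(1) cl2 cover disj] A B by blast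
qed

text \<open>Lower subspaces in the Lie-Kolchin argument are given as orthogonal complements, so that
  a matrix moving a vector into one of them satisfies a system of polynomial equations.\<close>

definition perp :: "'k vec set \<Rightarrow> 'k vec set" where
  "perp X = {v \<in> V. \<forall>x\<in>X. \<beta> v x = 0}"

lemma vsubspace_perp: "X \<subseteq> V \<Longrightarrow> vsubspace m (perp X)"
  unfolding vsubspace_def perp_def by (auto simp: subset_iff)

lemma pf_perp_condition:
  assumes "X \<subseteq> V" "pfv u"
  obtains \<Phi> where "\<forall>F\<in>\<Phi>. pf F" "\<And>A. A \<in> Or \<Longrightarrow> u A \<in> perp X \<longleftrightarrow> (\<forall>F\<in>\<Phi>. F A = 0)"
proof (rule that[of "(\<lambda>x A. \<beta> (u A) x) ` X"])
  show "\<forall>F\<in>(\<lambda>x A. \<beta> (u A) x) ` X. pf F" using assms pf_bil pfv_const by blast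
  show "u A \<in> perp X \<longleftrightarrow> (\<forall>F\<in>(\<lambda>x A. \<beta> (u A) x) ` X. F A = 0)" if "A \<in> Or" for A
    using assms(2) that unfolding perp_def pfv_def by auto
qed

lemma pfv_add:
  assumes u: "pfv u" and w: "pfv w" shows "pfv (\<lambda>A. u A + w A)"
proof -
  have V: "u A \<in> V" "w A \<in> V" if "A \<in> Or" for A using u w that unfolding pfv_def by simp_all
  have "pf (\<lambda>A. (u A + w A) $ i)" if i: "i < m" for i
  proof (rule pf_cong)
    show "pf (\<lambda>A. u A $ i + w A $ i)" using u w i unfolding pfv_def by (simp add: pf_add)
    show "u A $ i + w A $ i = (u A + w A) $ i" if "A \<in> Or" for A
      using V[OF that] i by (simp add: carrier_vecD)
  qed
  then show ?thesis unfolding pfv_def using V by simp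
qed

text \<open>Applying \<open>A + l k\<close> to a combination lying in \<open>W\<close> removes,
  modulo \<open>W\<close>, the last term and multiplies the others by the nonzero factors
  \<open>l i + l k\<close>.\<close>

lemma eigenvectors_independent:
  fixes W :: "'k vec set" and u :: "nat \<Rightarrow> 'k vec" and l c :: "nat \<Rightarrow> 'k"
  assumes W: "vsubspace m W" and A: "A \<in> carrier_mat m m" "\<And>w. w \<in> W \<Longrightarrow> A *\<^sub>v w \<in> W"
    and u: "\<And>i. i < k \<Longrightarrow> u i \<in> V" "\<And>i. i < k \<Longrightarrow> u i \<notin> W"
    and eig: "\<And>i. i < k \<Longrightarrow> A *\<^sub>v u i + l i \<cdot>\<^sub>v u i \<in> W"
    and inj: "inj_on l {..<k}" and c: "comb m {..<k} c u \<in> W" and j: "j < k"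
  shows "c j = (0::'k)"
  using u eig inj c j
proof (induction k arbitrary: c j)
  case (Suc k)
  have WV: "W \<subseteq> V" using W unfolding vsubspace_def by simp
  let ?s = "comb m {..<Suc k} c u"
  have s: "?s \<in> W" by (rule Suc.prems(5))
  have expand: "comb m {..<Suc k} d u = d k \<cdot>\<^sub>v u k + comb m {..<k} d u" for d
    unfolding lessThan_Suc by (rule comb_insert) (use Suc.prems in auto)
  define w where "w = (\<lambda>i. A *\<^sub>v u i + l i \<cdot>\<^sub>v u i)"
  have wW: "w i \<in> W" if "i < Suc k" for i using Suc.prems(3) that unfolding w_def by simp
  have eq: "A *\<^sub>v ?s + l k \<cdot>\<^sub>v ?s = comb m {..<Suc k} (\<lambda>i. c i * (l i + l k)) u + comb m {..<Suc k} c w"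
  proof -
    have "A *\<^sub>v ?s = comb m {..<Suc k} c (\<lambda>i. A *\<^sub>v u i)"
      by (rule mult_mat_comb[OF A(1)]) (use Suc.prems in auto)
    also have "\<dots> + l k \<cdot>\<^sub>v ?s = comb m {..<Suc k} (\<lambda>i. c i * (l i + l k)) u + comb m {..<Suc k} c w"
    proof (rule eq_vecI)
      fix a assume "a < dim_vec (comb m {..<Suc k} (\<lambda>i. c i * (l i + l k)) u + comb m {..<Suc k} c w)"
      then have a: "a < m" by (simp add: comb_def)
      have w: "w i $ a = (A *\<^sub>v u i) $ a + l i * u i $ a" if "i < Suc k" for i
      proof -
        have "u i \<in> V" using Suc.prems(1) that by simp
        then have "dim_vec (u i) = m" by simp
        then show ?thesis using a A(1) unfolding w_def by simp
      qed
      have "(\<Sum>i<Suc k. c i * (A *\<^sub>v u i) $ a) + l k * (\<Sum>i<Suc k. c i * u i $ a) =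
        (\<Sum>i<Suc k. c i * (A *\<^sub>v u i) $ a + l k * (c i * u i $ a))"
        by (simp only: sum.distrib sum_distrib_left)
      also have "\<dots> = (\<Sum>i<Suc k. c i * (l i + l k) * u i $ a + c i * w i $ a)"
        by (intro sum.cong refl) (simp add: w algebra_simps)
      also have "\<dots> = (\<Sum>i<Suc k. c i * (l i + l k) * u i $ a) + (\<Sum>i<Suc k. c i * w i $ a)"
        by (rule sum.distrib)
      finally show "(comb m {..<Suc k} c (\<lambda>i. A *\<^sub>v u i) + l k \<cdot>\<^sub>v ?s) $ a =
        (comb m {..<Suc k} (\<lambda>i. c i * (l i + l k)) u + comb m {..<Suc k} c w) $ a"
        using a by (simp add: comb_def del: sum.lessThan_Suc)
    qed (simp add: comb_def)
    finally show ?thesis .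
  qed
  have "A *\<^sub>v ?s + l k \<cdot>\<^sub>v ?s \<in> W" using s A(2) W unfolding vsubspace_def by blast
  moreover have cw: "comb m {..<Suc k} c w \<in> W" using wW by (intro vsubspace_comb[OF W]) auto
  ultimately have "comb m {..<Suc k} (\<lambda>i. c i * (l i + l k)) u \<in> W"
    unfolding eq using vsubspace_add_iff[OF W cw comb_carrier] by blast
  then have "comb m {..<k} (\<lambda>i. c i * (l i + l k)) u \<in> W"
    unfolding expand using Suc.prems(1)[of k] by simp
  then have *: "c i * (l i + l k) = 0" if "i < k" for i
    using Suc.IH[of "\<lambda>i. c i * (l i + l k)" i] Suc.prems(1-4) that by (auto simp: inj_on_def)
  have **: "c i = 0" if "i < k" for i
  proof -
    have "l i \<noteq> l k" using Suc.prems(4) that by (auto simp: inj_on_def)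
    then show ?thesis using *[OF that] by (simp add: add_eq_0_iff2)
  qed
  have "comb m {..<k} c u = 0\<^sub>v m" unfolding comb_def using ** by (intro eq_vecI) auto
  then have "c k \<cdot>\<^sub>v u k \<in> W" using s Suc.prems(1)[of k] unfolding expand by simp
  then have "c k = 0" using vsubspace_smult_iff[OF W] Suc.prems(1,2)[of k] by blast
  then show ?case using ** Suc.prems(6) by (auto simp: less_Suc_eq)
qed simp

lemma finite_eigenvalues:
  fixes W :: "'k vec set" and A :: "'k mat"
  assumes W: "vsubspace m W" and A: "A \<in> carrier_mat m m" "\<And>w. w \<in> W \<Longrightarrow> A *\<^sub>v w \<in> W"
  shows "finite {l. \<exists>u\<in>V. u \<notin> W \<and> A *\<^sub>v u + l \<cdot>\<^sub>v u \<in> W}" (is "finite ?L")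
proof (rule ccontr)
  assume "infinite ?L"
  then obtain T where T: "T \<subseteq> ?L" "finite T" "card T = Suc m" using infinite_arbitrarily_large by blast
  obtain l where l: "bij_betw l {..<Suc m} T"
    using ex_bij_betw_nat_finite[OF T(2)] T(3) by (auto simp: atLeast0LessThan)
  have "\<forall>i<Suc m. \<exists>u\<in>V. u \<notin> W \<and> A *\<^sub>v u + l i \<cdot>\<^sub>v u \<in> W"
    using T(1) l bij_betwE by blast
  then obtain u where u: "\<And>i. i < Suc m \<Longrightarrow> u i \<in> V" "\<And>i. i < Suc m \<Longrightarrow> u i \<notin> W"
    "\<And>i. i < Suc m \<Longrightarrow> A *\<^sub>v u i + l i \<cdot>\<^sub>v u i \<in> W" by metis
  obtain c where c: "comb m {..m} c u = 0\<^sub>v m" "\<exists>i\<le>m. c i \<noteq> 0"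
    using exists_dependency[of m u] u(1) by auto
  have cW: "comb m {..<Suc m} c u \<in> W" using c(1) W unfolding vsubspace_def by (simp add: lessThan_Suc_atMost)
  have "c j = 0" if "j < Suc m" for j
    by (rule eigenvectors_independent[where u = u and l = l, OF W A u(1) u(2) u(3) bij_betw_imp_inj_on[OF l] cW that])
  then show False using c(2) by auto
qed

text \<open>The iterates of \<open>u0\<close> under \<open>A\<close> are dependent, so a nonzero
  polynomial in \<open>A\<close> takes \<open>u0\<close> into \<open>W\<close>. Linear factors are
  split off one at a time until an intermediate vector lies outside \<open>W\<close> while its
  factor sends it into \<open>W\<close>. The induction is on a bound for the degree.\<close>

lemma exists_eigenvector:
  fixes W U :: "'k vec set" and A :: "'k mat"
  assumes W: "vsubspace m W" and U: "vsubspace m U" "W \<subset> U" and A: "A \<in> carrier_mat m m"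
    and st: "\<And>w. w \<in> U \<Longrightarrow> A *\<^sub>v w \<in> U"
  obtains u l where "u \<in> U" "u \<notin> W" "A *\<^sub>v u + l \<cdot>\<^sub>v u \<in> W"
proof -
  obtain u0 where u0: "u0 \<in> U" "u0 \<notin> W" using U(2) by blast
  have UV: "U \<subseteq> V" using U unfolding vsubspace_def by simp
  define pw where "pw = (\<lambda>i. ((*\<^sub>v) A ^^ i) u0)"
  have pw_Suc: "pw (Suc i) = A *\<^sub>v pw i" for i unfolding pw_def by simp
  have pwU: "pw i \<in> U" for i by (induction i) (use u0 st pw_def in \<open>auto simp: pw_Suc\<close>)
  have pwV: "pw i \<in> V" for i using pwU UV by blast
  have "\<exists>u l. u \<in> U \<and> u \<notin> W \<and> A *\<^sub>v u + l \<cdot>\<^sub>v u \<in> W"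
    if "p \<noteq> 0" "degree p \<le> d" "comb m {..d} (Polynomial.coeff p) pw \<in> W" for d and p :: "'k poly"
    using that
  proof (induction d arbitrary: p)
    case 0
    have "comb m {..0} (Polynomial.coeff p) pw = Polynomial.coeff p 0 \<cdot>\<^sub>v u0"
      unfolding comb_def using carrier_vecD[OF subsetD[OF UV u0(1)]] by (intro eq_vecI) (auto simp: pw_def)
    moreover have "Polynomial.coeff p 0 \<noteq> 0" using 0 by (metis bot_nat_0.extremum_uniqueI leading_coeff_0_iff)
    ultimately have "u0 \<in> W" using 0(3) vsubspace_smult_iff[OF W] u0 UV by (metis subsetD)
    then show ?case using u0 by simp
  next
    case (Suc d)
    show ?case
    proof (cases "degree p = 0")
      case True
      have "comb m {..Suc d} (Polynomial.coeff p) pw = Polynomial.coeff p 0 \<cdot>\<^sub>v u0"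
      proof (rule eq_vecI)
        fix a assume "a < dim_vec (Polynomial.coeff p 0 \<cdot>\<^sub>v u0)"
        then have a: "a < m" "a < dim_vec u0" using carrier_vecD[OF subsetD[OF UV u0(1)]] by auto
        have "(\<Sum>i\<le>Suc d. Polynomial.coeff p i * pw i $ a) = (\<Sum>i\<in>{0}. Polynomial.coeff p i * pw i $ a)"
          by (rule sum.mono_neutral_right) (use True coeff_eq_0[of p] in auto)
        then show "comb m {..Suc d} (Polynomial.coeff p) pw $ a = (Polynomial.coeff p 0 \<cdot>\<^sub>v u0) $ a"
          using a by (simp add: comb_def pw_def del: sum.atMost_Suc)
      qed (use carrier_vecD[OF subsetD[OF UV u0(1)]] in \<open>simp add: comb_def\<close>)
      moreover have "Polynomial.coeff p 0 \<noteq> 0" using True Suc.prems(1) by (metis leading_coeff_0_iff)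
      ultimately have "u0 \<in> W" using Suc.prems(3) vsubspace_smult_iff[OF W] u0 UV by (metis subsetD)
      then show ?thesis using u0 by simp
    next
      case False
      then obtain l where l: "poly p l = 0" using alg_closed_imp_poly_has_root by blast
      then obtain p' where p': "p = [:- l, 1:] * p'" using poly_eq_0_iff_dvd by (metis dvdE)
      have p'0: "p' \<noteq> 0" using p' Suc.prems(1) by auto
      have deg: "degree p' \<le> d"
      proof -
        have "degree p = degree [:- l, 1:] + degree p'" unfolding p' by (rule degree_mult_eq) (use p'0 in auto)
        then show ?thesis using Suc.prems(2) by simp
      qed
      let ?v = "comb m {..d} (Polynomial.coeff p') pw"
      have vU: "?v \<in> U" by (rule vsubspace_comb[OF U(1)]) (use pwU in auto)
      have "comb m {..Suc d} (Polynomial.coeff p) pw = A *\<^sub>v ?v + l \<cdot>\<^sub>v ?v"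
      proof -
        have "A *\<^sub>v ?v = comb m {..d} (Polynomial.coeff p') (\<lambda>i. pw (Suc i))"
          unfolding pw_Suc by (rule mult_mat_comb[OF A]) (use pwV in auto)
        moreover have "comb m {..Suc d} (Polynomial.coeff p) pw = comb m {..d} (Polynomial.coeff p') (\<lambda>i. pw (Suc i)) + l \<cdot>\<^sub>v ?v"
        proof (rule eq_vecI)
          fix a assume "a < dim_vec (comb m {..d} (Polynomial.coeff p') (\<lambda>i. pw (Suc i)) + l \<cdot>\<^sub>v ?v)"
          then have a: "a < m" by (simp add: comb_def)
          have pc: "Polynomial.coeff p i = Polynomial.coeff (pCons 0 p') i + l * Polynomial.coeff p' i" for i
            unfolding p' by simp
          have "(\<Sum>i\<le>Suc d. Polynomial.coeff p i * pw i $ a) =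
            (\<Sum>i\<le>Suc d. Polynomial.coeff (pCons 0 p') i * pw i $ a) + l * (\<Sum>i\<le>Suc d. Polynomial.coeff p' i * pw i $ a)"
            unfolding pc sum_distrib_left sum.distrib[symmetric] by (intro sum.cong) (auto simp: algebra_simps)
          also have "(\<Sum>i\<le>Suc d. Polynomial.coeff (pCons 0 p') i * pw i $ a) = (\<Sum>i\<le>d. Polynomial.coeff p' i * pw (Suc i) $ a)"
            by (simp add: sum.atMost_Suc_shift del: sum.atMost_Suc)
          also have "(\<Sum>i\<le>Suc d. Polynomial.coeff p' i * pw i $ a) = (\<Sum>i\<le>d. Polynomial.coeff p' i * pw i $ a)"
            using deg coeff_eq_0[of p' "Suc d"] by simp
          finally show "comb m {..Suc d} (Polynomial.coeff p) pw $ a = (comb m {..d} (Polynomial.coeff p') (\<lambda>i. pw (Suc i)) + l \<cdot>\<^sub>v ?v) $ a"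
            using a by (simp add: comb_def del: sum.atMost_Suc)
        qed (simp add: comb_def)
        ultimately show ?thesis by simp
      qed
      then show ?thesis using Suc.IH[OF p'0 deg] Suc.prems(3) vU by (metis)
    qed
  qed
  moreover obtain c where c: "comb m {..m} c pw = 0\<^sub>v m" "\<exists>i\<le>m. c i \<noteq> 0"
    using exists_dependency[of m pw] pwV by blast
  define p where "p = (\<Sum>i\<le>m. Polynomial.monom (c i) i)"
  have pc: "Polynomial.coeff p i = (if i \<le> m then c i else 0)" for i
    unfolding p_def by (simp add: coeff_sum)
  have "p \<noteq> 0" using c(2) pc by (metis coeff_0)
  moreover have "degree p \<le> m" by (rule degree_le) (simp add: pc)
  moreover have "comb m {..m} (Polynomial.coeff p) pw = comb m {..m} c pw" by (intro comb_cong) (auto simp: pc)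
  then have "comb m {..m} (Polynomial.coeff p) pw \<in> W" using c(1) W unfolding vsubspace_def by simp
  ultimately show ?thesis using that by blast
qed

definition stable :: "'k mat set \<Rightarrow> 'k vec set \<Rightarrow> bool" where
  "stable H U \<longleftrightarrow> (\<forall>A\<in>H. \<forall>u\<in>U. A *\<^sub>v u \<in> U)"

text \<open>Lie-Kolchin in relative form: a common eigenvector in every nonzero subquotient of
  \<open>U\<close> by \<open>perp X\<close>, with no quotient space formed. Repeated application
  builds stable flags.\<close>

definition triangulable :: "'k mat set \<Rightarrow> bool" where
  "triangulable H \<longleftrightarrow> (\<forall>X U. X \<subseteq> V \<longrightarrow> vsubspace m U \<longrightarrow> stable H U \<longrightarrow> stable H (perp X) \<longrightarrow> perp X \<subset> U \<longrightarrow>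
     (\<exists>v\<in>U. v \<notin> perp X \<and> (\<forall>A\<in>H. \<exists>c. A *\<^sub>v v + c \<cdot>\<^sub>v v \<in> perp X)))"

text \<open>\<open>D\<close> stands for the derived subgroup. On a minimal stable \<open>U\<close>
  above \<open>W\<close> the weight space of \<open>D\<close> is \<open>H\<close>-stable, because a
  weight takes finitely many values on conjugates and \<open>H\<close> is connected; by minimality
  \<open>D\<close> acts on \<open>U\<close> modulo \<open>W\<close> by scalars. The scalar of a
  commutator is constant in one argument for the same reason, hence 1, so an eigenspace of an
  element of \<open>H\<close> is \<open>H\<close>-stable and equals \<open>U\<close>.\<close>

lemma triangulable_step:
  assumes HO: "H \<subseteq> Or" and H1: "1\<^sub>m m \<in> H" and Hm: "\<And>A B. A \<in> H \<Longrightarrow> B \<in> H \<Longrightarrow> A * B \<in> H"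
    and Hi: "\<And>A. A \<in> H \<Longrightarrow> minv A \<in> H" and conn: "connectedin (zariski m) H"
    and DH: "D \<subseteq> H" and D: "triangulable D" and D1: "1\<^sub>m m \<in> D"
    and normal: "\<And>A d. A \<in> H \<Longrightarrow> d \<in> D \<Longrightarrow> minv A * d * A \<in> D"
    and comm: "\<And>A B. A \<in> H \<Longrightarrow> B \<in> H \<Longrightarrow> A * B * minv A * minv B \<in> D"
  shows "triangulable H"
  unfolding triangulable_def
proof (intro allI impI)
  fix X U'
  assume X: "X \<subseteq> V" and U': "vsubspace m U'" "stable H U'" "perp X \<subset> U'" and stW: "stable H (perp X)"
  define W where "W = perp X"
  have "stable H U' \<and> W \<subset> U'" unfolding W_def using U' by simp
  from minimal_vsubspace[of m U' "\<lambda>U. stable H U \<and> W \<subset> U", OF U'(1) this]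
  obtain U where U: "vsubspace m U" "stable H U" "W \<subset> U" "U \<subseteq> U'"
    "\<And>U''. vsubspace m U'' \<Longrightarrow> stable H U'' \<Longrightarrow> W \<subset> U'' \<Longrightarrow> U'' \<subseteq> U \<Longrightarrow> U'' = U" by metis
  have W: "vsubspace m W" unfolding W_def by (rule vsubspace_perp[OF X])
  have UV: "U \<subseteq> V" and WV: "W \<subseteq> V" using U(1) W unfolding vsubspace_def by auto
  have HV: "A \<in> carrier_mat m m" "A \<in> Or" if "A \<in> H" for A using that HO Or_carrier by auto
  have HW: "A *\<^sub>v w \<in> W" if "A \<in> H" "w \<in> W" for A w using stW that unfolding stable_def W_def by blast
  have HU: "A *\<^sub>v w \<in> U" if "A \<in> H" "w \<in> U" for A w using U(2) that unfolding stable_def by blast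
  have Wadd: "u + w \<in> W" if "u \<in> W" "w \<in> W" for u w using W that unfolding vsubspace_def by blast
  have Wsm: "c \<cdot>\<^sub>v w \<in> W" if "w \<in> W" for c w using W that unfolding vsubspace_def by blast
  have unique: "c = c'" if "A *\<^sub>v v + c \<cdot>\<^sub>v v \<in> W" "A *\<^sub>v v + c' \<cdot>\<^sub>v v \<in> W" "v \<in> V" "v \<notin> W" "A \<in> H" for A c c' v
  proof -
    have "(A *\<^sub>v v + c \<cdot>\<^sub>v v) + (A *\<^sub>v v + c' \<cdot>\<^sub>v v) = (c + c') \<cdot>\<^sub>v v"
      using that(3) HV[OF that(5)] by (intro eq_vecI) (auto simp: algebra_simps)
    then have "(c + c') \<cdot>\<^sub>v v \<in> W" using Wadd that(1,2) by metis
    then show ?thesis using vsubspace_smult_iff[OF W _ that(3)] that(4) add_eq_0_iff2 by blast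
  qed
  have stD: "stable D U" "stable D (perp X)" using U(2) stW DH unfolding stable_def by auto
  obtain v where v: "v \<in> U" "v \<notin> W" "\<And>d. d \<in> D \<Longrightarrow> \<exists>c. d *\<^sub>v v + c \<cdot>\<^sub>v v \<in> W"
    using D[unfolded triangulable_def, rule_format, OF X U(1) stD U(3)[unfolded W_def]]
    unfolding W_def by blast
  then obtain \<chi> where \<chi>: "\<And>d. d \<in> D \<Longrightarrow> d *\<^sub>v v + \<chi> d \<cdot>\<^sub>v v \<in> W" by metis
  have vV: "v \<in> V" using v UV by blast
  \<comment> \<open>Serves both uses of connectedness: \<open>M\<close> sends \<open>A\<close> to a
    conjugate of a fixed \<open>d\<close>, and later \<open>b\<close> to its commutator with a fixed
    \<open>a\<close>.\<close>
  have \<chi>_const: "\<chi> (M A) = \<chi> (M (1\<^sub>m m))"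
    if A: "A \<in> H" and M: "pfm M" "\<And>A. A \<in> H \<Longrightarrow> M A \<in> D" and fin: "finite ((\<lambda>A. \<chi> (M A)) ` H)" for M A
  proof (rule finite_valued_constant[OF conn HO fin _ A H1])
    fix c
    have p: "pfv (\<lambda>A. M A *\<^sub>v v + c \<cdot>\<^sub>v v)"
      by (intro pfv_add pfv_mult M(1) pfv_const) (use vV in auto)
    obtain \<Phi> where \<Phi>: "\<forall>F\<in>\<Phi>. pf F" "\<And>A. A \<in> Or \<Longrightarrow> M A *\<^sub>v v + c \<cdot>\<^sub>v v \<in> perp X \<longleftrightarrow> (\<forall>F\<in>\<Phi>. F A = 0)"
      using pf_perp_condition[OF X p] by blast
    have "\<chi> (M A) = c \<longleftrightarrow> (\<forall>F\<in>\<Phi>. F A = 0)" if A: "A \<in> H" for A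
    proof -
      have "\<chi> (M A) = c \<longleftrightarrow> M A *\<^sub>v v + c \<cdot>\<^sub>v v \<in> W"
        using \<chi>[OF M(2)[OF A]] unique[OF \<chi>[OF M(2)[OF A]] _ vV v(2)] DH M(2)[OF A] by blast
      then show ?thesis using \<Phi>(2) A HO unfolding W_def by blast
    qed
    then show "\<exists>\<Phi>. (\<forall>F\<in>\<Phi>. pf F) \<and> {A \<in> H. \<chi> (M A) = c} = {A \<in> H. \<forall>F\<in>\<Phi>. F A = 0}"
      using \<Phi>(1) by (intro exI[of _ \<Phi>]) blast
  qed
  define U1 where "U1 = {u \<in> U. \<forall>d\<in>D. d *\<^sub>v u + \<chi> d \<cdot>\<^sub>v u \<in> W}"
  have notW: "A *\<^sub>v u \<notin> W" if "A \<in> H" "u \<in> V" "u \<notin> W" for A u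
    using HW[OF Hi[OF that(1)], of "A *\<^sub>v u"] minv_vec(2)[OF HV(2)[OF that(1)] that(2)] that(3) by auto
  have shift: "a *\<^sub>v (x + y) + c \<cdot>\<^sub>v (x + y) = (a *\<^sub>v x + c \<cdot>\<^sub>v x) + (a *\<^sub>v y + c \<cdot>\<^sub>v y)"
    if "a \<in> H" "x \<in> V" "y \<in> V" for a x y c
    using HV[OF that(1)] that(2,3) by (intro eq_vecI) (auto simp: algebra_simps)
  have shift': "a *\<^sub>v (b \<cdot>\<^sub>v x) + c \<cdot>\<^sub>v (b \<cdot>\<^sub>v x) = b \<cdot>\<^sub>v (a *\<^sub>v x + c \<cdot>\<^sub>v x)"
    if "a \<in> H" "x \<in> V" for a x b c
    using HV[OF that(1)] that(2) by (intro eq_vecI) (auto simp: algebra_simps)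
  have eig_subspace: "vsubspace m {u \<in> U. \<forall>d\<in>S. d *\<^sub>v u + f d \<cdot>\<^sub>v u \<in> W}" if "S \<subseteq> H" for S and f :: "'k mat \<Rightarrow> 'k"
    unfolding vsubspace_def
  proof (intro conjI ballI allI)
    show "{u \<in> U. \<forall>d\<in>S. d *\<^sub>v u + f d \<cdot>\<^sub>v u \<in> W} \<subseteq> V" using UV by blast
    have "d *\<^sub>v 0\<^sub>v m + f d \<cdot>\<^sub>v 0\<^sub>v m = 0\<^sub>v m" if "d \<in> H" for d
      using mat_zero[OF HV(1)[OF that]] by simp
    then show "0\<^sub>v m \<in> {u \<in> U. \<forall>d\<in>S. d *\<^sub>v u + f d \<cdot>\<^sub>v u \<in> W}"
      using U(1) W \<open>S \<subseteq> H\<close> unfolding vsubspace_def by auto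
  next
    fix x y assume xy: "x \<in> {u \<in> U. \<forall>d\<in>S. d *\<^sub>v u + f d \<cdot>\<^sub>v u \<in> W}" "y \<in> {u \<in> U. \<forall>d\<in>S. d *\<^sub>v u + f d \<cdot>\<^sub>v u \<in> W}"
    then have "d *\<^sub>v (x + y) + f d \<cdot>\<^sub>v (x + y) \<in> W" if "d \<in> S" for d
    proof -
      have "d \<in> H" "x \<in> V" "y \<in> V" using that xy \<open>S \<subseteq> H\<close> UV by auto
      then show ?thesis unfolding shift[OF \<open>d \<in> H\<close> \<open>x \<in> V\<close> \<open>y \<in> V\<close>] using xy Wadd that by simp
    qed
    then show "x + y \<in> {u \<in> U. \<forall>d\<in>S. d *\<^sub>v u + f d \<cdot>\<^sub>v u \<in> W}" using xy U(1) unfolding vsubspace_def by auto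
  next
    fix b x assume x: "x \<in> {u \<in> U. \<forall>d\<in>S. d *\<^sub>v u + f d \<cdot>\<^sub>v u \<in> W}"
    then have "d *\<^sub>v (b \<cdot>\<^sub>v x) + f d \<cdot>\<^sub>v (b \<cdot>\<^sub>v x) \<in> W" if "d \<in> S" for d
    proof -
      have "d \<in> H" "x \<in> V" using that x \<open>S \<subseteq> H\<close> UV by auto
      then show ?thesis unfolding shift'[OF \<open>d \<in> H\<close> \<open>x \<in> V\<close>] using x Wsm that by simp
    qed
    then show "b \<cdot>\<^sub>v x \<in> {u \<in> U. \<forall>d\<in>S. d *\<^sub>v u + f d \<cdot>\<^sub>v u \<in> W}" using x U(1) unfolding vsubspace_def by auto
  qed
  have W_eig: "W \<subseteq> {u \<in> U. \<forall>d\<in>S. d *\<^sub>v u + f d \<cdot>\<^sub>v u \<in> W}" if "S \<subseteq> H" for S and f :: "'k mat \<Rightarrow> 'k"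
    using U(3) HW Wadd Wsm that by auto
  have U1_sub: "vsubspace m U1" unfolding U1_def by (rule eig_subspace[OF DH])
  have W_U1: "W \<subset> U1" using W_eig[OF DH] v \<chi> unfolding U1_def by blast
  have assoc: "(minv A * d * A) *\<^sub>v u = minv A *\<^sub>v (d *\<^sub>v (A *\<^sub>v u))" if "A \<in> H" "d \<in> H" "u \<in> V" for A d u
    using that HV(2) Hi Or_mult by simp
  have "stable H U1" unfolding stable_def
  proof (intro ballI)
    fix A u assume A: "A \<in> H" and u: "u \<in> U1"
    then have uU: "u \<in> U" "u \<in> V" using UV unfolding U1_def by auto
    have "d *\<^sub>v (A *\<^sub>v u) + \<chi> d \<cdot>\<^sub>v (A *\<^sub>v u) \<in> W" if d: "d \<in> D" for d
    proof -
      have dH: "d \<in> H" using d DH by blast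
      let ?M = "\<lambda>A. minv A * d * A"
      have conj: "d *\<^sub>v (A *\<^sub>v x) + c \<cdot>\<^sub>v (A *\<^sub>v x) = A *\<^sub>v (?M A *\<^sub>v x + c \<cdot>\<^sub>v x)"
        if "A \<in> H" "x \<in> V" for A x c
        using that HV[OF that(1)] HV[OF dH] minv(1)[OF HV(2)[OF that(1)]] assoc[OF that(1) dH that(2)]
        by simp
      \<comment> \<open>The weight at the conjugate of \<open>d\<close> by \<open>A\<close> is an
        eigenvalue of \<open>d\<close> itself, with eigenvector \<open>A *\<^sub>v v\<close>, so
        only finitely many values occur.\<close>
      have "(\<lambda>A. \<chi> (?M A)) ` H \<subseteq> {l. \<exists>u\<in>V. u \<notin> W \<and> d *\<^sub>v u + l \<cdot>\<^sub>v u \<in> W}"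
      proof (intro image_subsetI CollectI)
        fix A assume A: "A \<in> H"
        have "d *\<^sub>v (A *\<^sub>v v) + \<chi> (?M A) \<cdot>\<^sub>v (A *\<^sub>v v) \<in> W"
          unfolding conj[OF A vV] using HW[OF A] \<chi>[OF normal[OF A d]] by blast
        then show "\<exists>u\<in>V. u \<notin> W \<and> d *\<^sub>v u + \<chi> (?M A) \<cdot>\<^sub>v u \<in> W"
          using notW[OF A vV v(2)] HV[OF A] vV by (intro bexI[of _ "A *\<^sub>v v"]) auto
      qed
      then have fin: "finite ((\<lambda>A. \<chi> (?M A)) ` H)"
        using finite_eigenvalues[OF W HV(1)[OF dH] HW[OF dH]] by (rule finite_subset)
      have "\<chi> (?M A) = \<chi> (?M (1\<^sub>m m))"
        by (rule \<chi>_const[OF A _ _ fin])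
          (use normal[OF _ d] pfm_mult[OF pfm_mult[OF pfm_minv pfm_const[OF HV(1)[OF dH]]] pfm_id] in auto)
      also have "?M (1\<^sub>m m) = d" using HV(1)[OF dH] by (simp add: minv_one)
      finally show ?thesis
        unfolding conj[OF A uU(2)] using HW[OF A] u normal[OF A d] unfolding U1_def by auto
    qed
    then show "A *\<^sub>v u \<in> U1" unfolding U1_def using HU[OF A uU(1)] by blast
  qed
  then have "U1 = U" using U(5) U1_sub W_U1 unfolding U1_def by blast
  then have U1: "d *\<^sub>v u + \<chi> d \<cdot>\<^sub>v u \<in> W" if "u \<in> U" "d \<in> D" for u d using that unfolding U1_def by blast
  have "\<exists>c. a *\<^sub>v v + c \<cdot>\<^sub>v v \<in> W" if a: "a \<in> H" for a
  proof -
    obtain u0 \<mu> where u0: "u0 \<in> U" "u0 \<notin> W" "a *\<^sub>v u0 + \<mu> \<cdot>\<^sub>v u0 \<in> W"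
      using exists_eigenvector[OF W U(1,3) HV(1)[OF a] HU[OF a]] by blast
    have u0V: "u0 \<in> V" using u0 UV by blast
    \<comment> \<open>Elements of \<open>H\<close> act invertibly modulo \<open>W\<close>. Being
      nonzero, \<open>\<mu>\<close> can later be divided out of the finite set of eigenvalues, which
      leaves a finite set of weights.\<close>
    have \<mu>0: "\<mu> \<noteq> 0"
    proof
      assume "\<mu> = 0"
      then have "a *\<^sub>v u0 \<in> W" using u0(3) u0V HV[OF a] by simp
      then show False using notW[OF a u0V u0(2)] by simp
    qed
    let ?M = "\<lambda>b. a * b * minv a * minv b"
    \<comment> \<open>With \<open>[a, b]\<close> the commutator, \<open>a b = [a, b] b a\<close>: if
      \<open>u\<close> has eigenvalue \<open>\<mu>\<close> for \<open>a\<close>, then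
      \<open>b *\<^sub>v u\<close> has eigenvalue \<open>\<mu>\<close> times the scalar by which the
      commutator acts.\<close>
    have move: "a *\<^sub>v (b *\<^sub>v u) + (\<mu> * \<chi> (?M b)) \<cdot>\<^sub>v (b *\<^sub>v u) \<in> W"
      if b: "b \<in> H" and u: "u \<in> U" "a *\<^sub>v u + \<mu> \<cdot>\<^sub>v u \<in> W" for b u
    proof -
      have uV: "u \<in> V" using u UV by blast
      have dD: "?M b \<in> D" by (rule comm[OF a b])
      then have dH: "?M b \<in> H" using DH by blast
      have "?M b *\<^sub>v (b *\<^sub>v (a *\<^sub>v u)) = a *\<^sub>v (b *\<^sub>v u)"
        using uV HV(2) a b Hi Or_mult by simp
      moreover have "?M b *\<^sub>v (b *\<^sub>v (a *\<^sub>v u + \<mu> \<cdot>\<^sub>v u)) =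
        ?M b *\<^sub>v (b *\<^sub>v (a *\<^sub>v u)) + \<mu> \<cdot>\<^sub>v (?M b *\<^sub>v (b *\<^sub>v u))"
        using uV HV[OF a] HV[OF b] HV[OF dH] by simp
      ultimately have 1: "a *\<^sub>v (b *\<^sub>v u) + \<mu> \<cdot>\<^sub>v (?M b *\<^sub>v (b *\<^sub>v u)) \<in> W"
        using HW[OF dH HW[OF b u(2)]] by simp
      have 2: "\<mu> \<cdot>\<^sub>v (?M b *\<^sub>v (b *\<^sub>v u) + \<chi> (?M b) \<cdot>\<^sub>v (b *\<^sub>v u)) \<in> W"
        using Wsm U1[OF HU[OF b u(1)] dD] by blast
      have "(a *\<^sub>v (b *\<^sub>v u) + \<mu> \<cdot>\<^sub>v (?M b *\<^sub>v (b *\<^sub>v u))) +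
        \<mu> \<cdot>\<^sub>v (?M b *\<^sub>v (b *\<^sub>v u) + \<chi> (?M b) \<cdot>\<^sub>v (b *\<^sub>v u)) =
        a *\<^sub>v (b *\<^sub>v u) + (\<mu> * \<chi> (?M b)) \<cdot>\<^sub>v (b *\<^sub>v u)"
      proof -
        have *: "x + \<mu> \<cdot>\<^sub>v y + \<mu> \<cdot>\<^sub>v (y + c \<cdot>\<^sub>v z) = x + (\<mu> * c) \<cdot>\<^sub>v z"
          if "x \<in> V" "y \<in> V" "z \<in> V" for x y z c
          using that by (intro eq_vecI) (auto simp: algebra_simps)
        show ?thesis by (rule *) (use uV HV(2) a b dH in auto)
      qed
      then show ?thesis using Wadd[OF 1 2] by simp
    qed
    have "(\<lambda>b. \<mu> * \<chi> (?M b)) ` H \<subseteq> {l. \<exists>u\<in>V. u \<notin> W \<and> a *\<^sub>v u + l \<cdot>\<^sub>v u \<in> W}"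
    proof (intro image_subsetI CollectI)
      fix b assume b: "b \<in> H"
      show "\<exists>u\<in>V. u \<notin> W \<and> a *\<^sub>v u + (\<mu> * \<chi> (?M b)) \<cdot>\<^sub>v u \<in> W"
        using move[OF b u0(1,3)] notW[OF b u0V u0(2)] HV[OF b] u0V by (intro bexI[of _ "b *\<^sub>v u0"]) auto
    qed
    then have "finite ((\<lambda>b. \<mu> * \<chi> (?M b)) ` H)"
      using finite_eigenvalues[OF W HV(1)[OF a] HW[OF a]] by (rule finite_subset)
    then have "finite ((\<lambda>x. inverse \<mu> * x) ` (\<lambda>b. \<mu> * \<chi> (?M b)) ` H)" by (rule finite_imageI)
    then have fin: "finite ((\<lambda>b. \<chi> (?M b)) ` H)"
      using \<mu>0 by (simp add: image_image mult.assoc[symmetric])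
    have "a * minv a = 1\<^sub>m m" using minv(2) HV(2)[OF a] by blast
    then have M1: "?M (1\<^sub>m m) = 1\<^sub>m m"
      using HV(1)[OF a] by (simp add: minv_one)
    have "1\<^sub>m m *\<^sub>v v + \<chi> (1\<^sub>m m) \<cdot>\<^sub>v v \<in> W" "1\<^sub>m m *\<^sub>v v + 1 \<cdot>\<^sub>v v \<in> W"
      using \<chi>[OF D1] vV W unfolding vsubspace_def by auto
    then have \<chi>1: "\<chi> (1\<^sub>m m) = 1" using unique vV v(2) H1 by blast
    have \<chi>M: "\<chi> (?M b) = 1" if b: "b \<in> H" for b
    proof -
      have "\<chi> (?M b) = \<chi> (?M (1\<^sub>m m))"
        by (rule \<chi>_const[OF b _ _ fin])
          (use comm[OF a] pfm_mult[OF pfm_mult[OF pfm_mult[OF pfm_const[OF HV(1)[OF a]] pfm_id]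
             pfm_const[OF HV(1)[OF Hi[OF a]]]] pfm_minv] in auto)
      then show ?thesis unfolding M1 \<chi>1 .
    qed
    \<comment> \<open>The eigenspace of \<open>a\<close>, written with a constant function so that
      \<open>eig_subspace\<close> applies; it is stable because the commutator scalars are
      1.\<close>
    define U2 where "U2 = {u \<in> U. \<forall>d\<in>{a}. d *\<^sub>v u + (\<lambda>_. \<mu>) d \<cdot>\<^sub>v u \<in> W}"
    have aH: "{a} \<subseteq> H" using a by simp
    have "vsubspace m U2" unfolding U2_def by (rule eig_subspace[OF aH])
    moreover have "W \<subset> U2" using W_eig[OF aH, of "\<lambda>_. \<mu>"] u0 unfolding U2_def by blast
    moreover have "stable H U2" unfolding stable_def U2_def using move \<chi>M HU by auto
    ultimately have "U2 = U" using U(5) unfolding U2_def by blast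
    then show ?thesis using v(1) unfolding U2_def by auto
  qed
  then show "\<exists>v\<in>U'. v \<notin> perp X \<and> (\<forall>A\<in>H. \<exists>c. A *\<^sub>v v + c \<cdot>\<^sub>v v \<in> perp X)"
    using v(1,2) U(4) unfolding W_def by blast
qed

lemma triangulable_trivial: "triangulable {1\<^sub>m m}"
  unfolding triangulable_def
proof (intro allI impI)
  fix X U assume *: "X \<subseteq> V" "vsubspace m U" "perp X \<subset> U"
  then obtain v where v: "v \<in> U" "v \<notin> perp X" by blast
  then have "v \<in> V" using *(2) unfolding vsubspace_def by blast
  then have "1\<^sub>m m *\<^sub>v v + 1 \<cdot>\<^sub>v v \<in> perp X"
    using vsubspace_perp[OF *(1)] unfolding vsubspace_def by simp
  then show "\<exists>v\<in>U. v \<notin> perp X \<and> (\<forall>A\<in>{1\<^sub>m m}. \<exists>c. A *\<^sub>v v + c \<cdot>\<^sub>v v \<in> perp X)" using v by blast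
qed

lemma continuous_map_pfm:
  assumes M: "pfm M" and D: "D \<subseteq> Or"
  shows "continuous_map (subtopology (zariski m) D) (zariski m) M"
  unfolding continuous_map_closedin topspace_zariski topspace_subtopology
proof (intro conjI allI impI)
  have eq: "carrier_mat m m \<inter> D = D" using D Or_carrier by blast
  show "M \<in> carrier_mat m m \<inter> D \<rightarrow> carrier_mat m m" using M D unfolding pfm_def by auto
  fix Z :: "'k mat set" assume "closedin (zariski m) Z"
  then obtain F where F: "\<forall>f\<in>F. polynomial_fun m f" "Z = zero_locus m F"
    unfolding closedin_zariski algebraic_set_def by blast
  have pf: "pf h" if "h \<in> (\<lambda>f A. f (M A)) ` F" for h using that F(1) pf_compose[OF _ M] by blast
  obtain E where E: "closedin (zariski m) E" "{A \<in> D. \<forall>h\<in>(\<lambda>f A. f (M A)) ` F. h A = 0} = E \<inter> D"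
    using pf_zero_set_closed[OF pf D] by blast
  have "{A \<in> carrier_mat m m \<inter> D. M A \<in> Z} = E \<inter> D"
    unfolding E(2)[symmetric] F(2) zero_locus_def eq using M D unfolding pfm_def by auto
  then show "closedin (subtopology (zariski m) D) {A \<in> carrier_mat m m \<inter> D. M A \<in> Z}"
    unfolding closedin_subtopology using E(1) by blast
qed

text \<open>For fixed \<open>a\<close> the commutators of \<open>a\<close> with all \<open>b\<close>
  in \<open>D\<close> form a connected set containing 1. They lie in the component of 1, which is a
  subgroup and so contains all that they generate.\<close>

lemma connected_derived:
  assumes D: "subgroup D (GL m)" "D \<subseteq> Or" and conn: "connectedin (zariski m) D"
  shows "connectedin (zariski m) (derived (GL m) D)"
proof -
  interpret GL: group "GL m :: 'k mat monoid" by (rule group_GL)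
  let ?D = "derived (GL m) D"
  have D': "subgroup ?D (GL m)" using GL.derived_is_subgroup subgroup.subset[OF D(1)] by blast
  have DD: "?D \<subseteq> D" using GL.derived_incl[OF subset_refl D(1)] .
  define C where "C = connected_component_of_set (subtopology (zariski m) ?D) (1\<^sub>m m)"
  have "subgroup C ((GL m)\<lparr>carrier := ?D\<rparr>)"
    using subgroup_identity_component[OF D'] unfolding identity_component_def C_def by simp
  then have C: "subgroup C (GL m)" using GL.incl_subgroup[OF D'] by blast
  have Cconn: "connectedin (zariski m) C"
    using connectedin_connected_component_of[of "subtopology (zariski m) ?D" "1\<^sub>m m"]
    unfolding C_def by (simp add: connectedin_subtopology)
  have CD: "C \<subseteq> ?D"
    using connected_component_of_subset_topspace[of "subtopology (zariski m) ?D"] unfolding C_def by auto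
  have one: "1\<^sub>m m \<in> D" using subgroup.one_closed[OF D(1)] by simp
  have "a * b * minv a * minv b \<in> C" if a: "a \<in> D" and b: "b \<in> D" for a b
  proof -
    have aO: "a \<in> Or" using a D by blast
    let ?M = "\<lambda>b. a * b * minv a * minv b"
    have M: "pfm ?M"
      using pfm_mult[OF pfm_mult[OF pfm_mult[OF pfm_const[OF Or_carrier[OF aO]] pfm_id]
             pfm_const[OF Or_carrier[OF minv(1)[OF aO]]]] pfm_minv] .
    have "connectedin (subtopology (zariski m) D) D" using conn by (simp add: connectedin_subtopology)
    then have "connectedin (zariski m) (?M ` D)"
      by (rule connectedin_continuous_map_image[OF continuous_map_pfm[OF M D(2)]])
    moreover have sub: "?M ` D \<subseteq> ?D"
    proof (intro image_subsetI)
      fix b assume "b \<in> D"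
      then have "?M b \<in> derived_set (GL m) D" using a unfolding minv_def by auto
      then show "?M b \<in> ?D" unfolding derived_def by (rule generate.incl)
    qed
    ultimately have "connectedin (subtopology (zariski m) ?D) (?M ` D)"
      by (simp add: connectedin_subtopology)
    moreover have "?M (1\<^sub>m m) = 1\<^sub>m m"
      using minv(2)[OF aO] Or_carrier[OF aO] by (simp add: minv_one)
    then have "1\<^sub>m m \<in> ?M ` D" using one by (intro image_eqI[of _ _ "1\<^sub>m m"]) simp_all
    ultimately have "?M ` D \<subseteq> C" unfolding C_def by (rule connected_component_of_maximal)
    then show ?thesis using b by blast
  qed
  then have "derived_set (GL m) D \<subseteq> C" unfolding minv_def by auto
  then have "?D \<subseteq> C" unfolding derived_def using GL.generate_subgroup_incl C by blast
  then show ?thesis using Cconn CD by (metis subset_antisym)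
qed

theorem lie_kolchin:
  assumes H: "subgroup H (GL m)" "H \<subseteq> Or" and conn: "connectedin (zariski m) H"
    and sol: "(derived (GL m) ^^ N) H = {1\<^sub>m m}"
  shows "triangulable H"
  using assms
proof (induction N arbitrary: H)
  case 0
  then show ?case using triangulable_trivial by simp
next
  case (Suc N)
  interpret GL: group "GL m :: 'k mat monoid" by (rule group_GL)
  let ?D = "derived (GL m) H"
  have D': "subgroup ?D (GL m)" using GL.derived_is_subgroup subgroup.subset[OF Suc.prems(1)] by blast
  have DH: "?D \<subseteq> H" using GL.derived_incl[OF subset_refl Suc.prems(1)] .
  have comm: "A * B * minv A * minv B \<in> ?D" if "A \<in> H" "B \<in> H" for A B
  proof -
    have "A * B * minv A * minv B \<in> derived_set (GL m) H" using that unfolding minv_def by auto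
    then show ?thesis unfolding derived_def by (rule generate.incl)
  qed
  have Hi: "minv A \<in> H" if "A \<in> H" for A
    using subgroup.m_inv_closed[OF Suc.prems(1) that] unfolding minv_def .
  have Hm: "A * B \<in> H" if "A \<in> H" "B \<in> H" for A B
    using subgroup.m_closed[OF Suc.prems(1) that] by simp
  have tri: "triangulable ?D"
    by (rule Suc.IH[OF D' _ connected_derived[OF Suc.prems(1-3)]])
      (use DH Suc.prems in \<open>auto simp: funpow_swap1\<close>)
  have normal: "minv A * d * A \<in> ?D" if A: "A \<in> H" and d: "d \<in> ?D" for A d
  proof -
    have dH: "d \<in> H" using d DH by blast
    have O: "A \<in> Or" "d \<in> Or" "minv A \<in> Or" "minv d \<in> Or" using A dH Suc.prems(2) minv(1) by auto
    have mm: "minv (minv A) = A" by (rule minv_unique[OF O(3,1) minv(3)[OF O(1)]])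
    have md: "minv (minv d) = d" by (rule minv_unique[OF O(4,2) minv(3)[OF O(2)]])
    \<comment> \<open>Normality comes from commutators alone: \<open>d\<close> times the commutator
      of \<open>minv d\<close> and \<open>minv A\<close> is \<open>minv A * d * A\<close>.\<close>
    have "minv d * minv A * minv (minv d) * minv (minv A) \<in> ?D"
      by (rule comm[OF Hi[OF dH] Hi[OF A]])
    then have "d * (minv d * minv A * d * A) \<in> ?D"
      unfolding mm md using subgroup.m_closed[OF D' d] by simp
    moreover have "d * (minv d * minv A * d * A) = minv A * d * A"
    proof (rule mat_eq_iff_mult_vec)
      show "d * (minv d * minv A * d * A) \<in> carrier_mat m m" "minv A * d * A \<in> carrier_mat m m"
        by (intro Or_carrier Or_mult O)+
      fix v assume "v \<in> V"
      then show "(d * (minv d * minv A * d * A)) *\<^sub>v v = (minv A * d * A) *\<^sub>v v"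
        using O by (simp add: Or_mult)
    qed
    ultimately show ?thesis by simp
  qed
  have "1\<^sub>m m \<in> H" "1\<^sub>m m \<in> ?D"
    using subgroup.one_closed[OF Suc.prems(1)] subgroup.one_closed[OF D'] by simp_all
  then show ?case
    using triangulable_step[OF Suc.prems(2) _ Hm Hi Suc.prems(3) DH tri _ normal comm] by blast
qed

section \<open>Involutions among unipotent elements\<close>

lemma vec_add_self_left [simp]: "u \<in> V \<Longrightarrow> v \<in> V \<Longrightarrow> u + (u + v) = v"
  "u \<in> V \<Longrightarrow> v \<in> V \<Longrightarrow> u + (v + u) = v" "u \<in> V \<Longrightarrow> v \<in> V \<Longrightarrow> (u + v) + u = v"
  "u \<in> V \<Longrightarrow> v \<in> V \<Longrightarrow> (v + u) + u = v"
  by (intro eq_vecI; auto simp: algebra_simps)+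

lemma mem_span_of_perp:
  assumes v: "v \<in> V" "v \<noteq> 0\<^sub>v m" and w: "w \<in> V" and sub: "\<And>y. y \<in> V \<Longrightarrow> \<beta> v y = 0 \<Longrightarrow> \<beta> w y = 0"
  obtains c where "w = c \<cdot>\<^sub>v v"
proof -
  obtain y where y: "y \<in> V" "\<beta> v y \<noteq> 0" using bil_nondegenerate[OF v(1)] v(2) by blast
  define y0 where "y0 = inverse (\<beta> v y) \<cdot>\<^sub>v y"
  have y0: "y0 \<in> V" "\<beta> v y0 = 1" unfolding y0_def using y v by auto
  have "w + \<beta> w y0 \<cdot>\<^sub>v v = 0\<^sub>v m"
  proof (rule bil_nondegenerate)
    fix z assume z: "z \<in> V"
    have "\<beta> w (z + \<beta> v z \<cdot>\<^sub>v y0) = 0" by (rule sub) (use z y0 v in auto)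
    then show "\<beta> (w + \<beta> w y0 \<cdot>\<^sub>v v) z = 0" using z y0 v w by (simp add: mult.commute)
  qed (use v w in auto)
  then have "w = \<beta> w y0 \<cdot>\<^sub>v v" using vec_add_eq_0_iff v w by simp
  then show ?thesis using that by blast
qed

lemma exists_dual_vector:
  assumes v: "v \<in> V" "v \<noteq> 0\<^sub>v m" and w: "w \<in> V" "\<And>c. w \<noteq> c \<cdot>\<^sub>v v"
  obtains y where "y \<in> V" "\<beta> v y = 0" "\<beta> w y = 1"
proof -
  obtain y where y: "y \<in> V" "\<beta> v y = 0" "\<beta> w y \<noteq> 0" using mem_span_of_perp[OF v w(1)] w(2) by metis
  then show ?thesis using that[of "inverse (\<beta> w y) \<cdot>\<^sub>v y"] v w by auto
qed

lemma mem_span_of_perp2: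
  assumes v: "v \<in> V" "v \<noteq> 0\<^sub>v m" and w: "w \<in> V" "\<And>c. w \<noteq> c \<cdot>\<^sub>v v" and z: "z \<in> V"
    and sub: "\<And>y. y \<in> V \<Longrightarrow> \<beta> v y = 0 \<Longrightarrow> \<beta> w y = 0 \<Longrightarrow> \<beta> z y = 0"
  obtains c d where "z = c \<cdot>\<^sub>v v + d \<cdot>\<^sub>v w"
proof -
  obtain y1 where y1: "y1 \<in> V" "\<beta> v y1 = 0" "\<beta> w y1 = 1" using exists_dual_vector[OF v w] by blast
  define z' where "z' = z + \<beta> z y1 \<cdot>\<^sub>v w"
  have z'V: "z' \<in> V" unfolding z'_def using z w by simp
  obtain c where c: "z' = c \<cdot>\<^sub>v v"
  proof (rule mem_span_of_perp[OF v z'V])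
    fix y assume y: "y \<in> V" "\<beta> v y = 0"
    have "\<beta> z (y + \<beta> w y \<cdot>\<^sub>v y1) = 0" by (rule sub) (use y y1 v w in auto)
    then show "\<beta> z' y = 0" unfolding z'_def using y y1 z w by (simp add: mult.commute)
  qed
  have "z = c \<cdot>\<^sub>v v + \<beta> z y1 \<cdot>\<^sub>v w"
    unfolding c[symmetric] z'_def using z w by (intro eq_vecI) auto
  then show ?thesis using that by blast
qed

text \<open>In a frame starting with \<open>u\<close> all vectors but the last are singular and
  orthogonal to \<open>u\<close>, so only the coefficient of \<open>u\<close> in \<open>y\<close>
  survives. Singular test vectors are the ones about which the semi-invariants give
  information.\<close>

lemma mem_span_of_singular_perp:
  assumes u: "u \<in> V" "u \<noteq> 0\<^sub>v m" "q u = 0" and y: "y \<in> V"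
    and sub: "\<And>w. w \<in> V \<Longrightarrow> q w = 0 \<Longrightarrow> \<beta> u w = 0 \<Longrightarrow> \<beta> y w = 0"
  obtains c where "y = c \<cdot>\<^sub>v u"
proof -
  obtain g where g: "frame g" "g 0 = u" using exists_frame_vector[OF u] by blast
  have "y = \<beta> y (g (m - 1)) \<cdot>\<^sub>v g 0"
  proof (rule frame_eqI[OF g(1) y])
    fix j assume j: "j < m"
    show "\<beta> y (g j) = \<beta> (\<beta> y (g (m - 1)) \<cdot>\<^sub>v g 0) (g j)"
    proof (cases "j = m - 1")
      case False
      then have "\<beta> (g 0) (g j) = 0" using frame_bil[OF g(1) m_pos(1) j] by simp
      then show ?thesis using sub[of "g j"] g j m_pos u(1) by simp
    qed (use frame_bil[OF g(1) m_pos(1) j] g m_pos u(1) in simp)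
  qed (use g m_pos u(1) in simp)
  then show ?thesis using that g(2) by blast
qed

end

section \<open>The operator N = x - 1 of an isometry\<close>

locale isometry = char2_quadratic_space n m q
  for n m :: nat and q :: "'k::alg_closed_field vec \<Rightarrow> 'k" +
  fixes x :: "'k mat"
  assumes x: "x \<in> Or"
begin

definition N :: "'k vec \<Rightarrow> 'k vec" where "N v = x *\<^sub>v v + v"

lemma N_V [simp]: "v \<in> V \<Longrightarrow> N v \<in> V" unfolding N_def using x by simp

lemma N_add [simp]: "u \<in> V \<Longrightarrow> v \<in> V \<Longrightarrow> N (u + v) = N u + N v"
  unfolding N_def using Or_carrier[OF x] by (intro eq_vecI) (auto simp: algebra_simps)

lemma N_smult [simp]: "v \<in> V \<Longrightarrow> N (c \<cdot>\<^sub>v v) = c \<cdot>\<^sub>v N v"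
  unfolding N_def using Or_carrier[OF x] by (intro eq_vecI) (auto simp: algebra_simps)

lemma N_zero [simp]: "N (0\<^sub>v m) = 0\<^sub>v m"
  unfolding N_def using mat_zero[OF Or_carrier[OF x]] by simp

lemma Npow_V [simp]: "v \<in> V \<Longrightarrow> (N ^^ k) v \<in> V"
  by (induction k) auto

lemma Npow_zero [simp]: "(N ^^ k) (0\<^sub>v m) = 0\<^sub>v m"
  by (induction k) auto

lemma Npow_add: "u \<in> V \<Longrightarrow> v \<in> V \<Longrightarrow> (N ^^ k) (u + v) = (N ^^ k) u + (N ^^ k) v"
  by (induction k) auto

lemma Npow_smult: "v \<in> V \<Longrightarrow> (N ^^ k) (c \<cdot>\<^sub>v v) = c \<cdot>\<^sub>v (N ^^ k) v"
  by (induction k) auto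

lemma xx_eq:
  assumes v: "v \<in> V" shows "x *\<^sub>v (x *\<^sub>v v) = v + N (N v)"
proof -
  have c: "x *\<^sub>v v \<in> V" "x *\<^sub>v (x *\<^sub>v v) \<in> V" using x v by simp_all
  have "N (N v) = (x *\<^sub>v (x *\<^sub>v v) + x *\<^sub>v v) + (x *\<^sub>v v + v)"
    unfolding N_def using mat_add[OF Or_carrier[OF x] c(1) v] by simp
  moreover have "b = v + ((b + a) + (a + v))" if "a \<in> V" "b \<in> V" for a b
    using that v by (intro eq_vecI) (auto simp: algebra_simps)
  ultimately show ?thesis using c by simp
qed

lemma x_eq: "v \<in> V \<Longrightarrow> x *\<^sub>v v = v + N v"
  unfolding N_def using x by simp

lemma xx_eq_iff: "v \<in> V \<Longrightarrow> x *\<^sub>v (x *\<^sub>v v) = v \<longleftrightarrow> N (N v) = 0\<^sub>v m"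
proof
  assume v: "v \<in> V" "x *\<^sub>v (x *\<^sub>v v) = v"
  have "N (N v) = v + x *\<^sub>v (x *\<^sub>v v)" unfolding xx_eq[OF v(1)] using v(1) by simp
  then show "N (N v) = 0\<^sub>v m" using v by simp
qed (simp add: xx_eq)

text \<open>Ties the first pair of semi-invariants to \<open>N\<close>:
  \<open>\<beta> v (x *\<^sub>v v)\<close>, and its analogue for the square of \<open>x\<close>, are
  the values of \<open>q\<close> at \<open>N v\<close> and \<open>N (N v)\<close>, since squaring
  \<open>x\<close> squares \<open>N\<close> in characteristic two.\<close>

lemma q_N: "v \<in> V \<Longrightarrow> q (N v) = \<beta> v (x *\<^sub>v v)"
  unfolding N_def using x bil_sym[of v "x *\<^sub>v v"] by (simp add: q_add)

lemma q_NN: "v \<in> V \<Longrightarrow> q (N (N v)) = \<beta> v (x *\<^sub>v (x *\<^sub>v v))"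
proof -
  assume v: "v \<in> V"
  have "N (N v) = v + x *\<^sub>v (x *\<^sub>v v)" using v unfolding xx_eq[OF v] by simp
  then show ?thesis using v x by (simp add: q_add)
qed

lemma bil_x: "u \<in> V \<Longrightarrow> w \<in> V \<Longrightarrow> \<beta> u (x *\<^sub>v w) = \<beta> (minv x *\<^sub>v u) w"
  using bil_minv[OF x] by simp

text \<open>The right-hand side is the quantity \<open>a\<^sub>1\<^sub>2 + a\<^sub>2\<^sub>1\<close>
  of the second pair.\<close>

lemma bil_NN: "u \<in> V \<Longrightarrow> w \<in> V \<Longrightarrow> \<beta> (N u) (N w) = \<beta> u (x *\<^sub>v w) + \<beta> w (x *\<^sub>v u)"
  unfolding N_def using x bil_sym[of w "x *\<^sub>v u"] by (simp add: algebra_simps)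

lemma bil_NN': "u \<in> V \<Longrightarrow> w \<in> V \<Longrightarrow> \<beta> (N u) (N w) = \<beta> (x *\<^sub>v u + minv x *\<^sub>v u) w"
  using bil_NN[of u w] bil_x[of u w] bil_sym[of w "x *\<^sub>v u"] x minv(1)[OF x] by (simp add: add.commute)

text \<open>What the bilinear form sees is \<open>x\<close> plus its adjoint, the inverse.
  Multiplying by \<open>x\<close> gives the square of \<open>x\<close> plus 1, which is the square
  of \<open>N\<close>.\<close>

lemma NN_eq_x: "u \<in> V \<Longrightarrow> N (N u) = x *\<^sub>v (x *\<^sub>v u + minv x *\<^sub>v u)"
proof -
  assume u: "u \<in> V"
  have "x *\<^sub>v (x *\<^sub>v u + minv x *\<^sub>v u) = x *\<^sub>v (x *\<^sub>v u) + u"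
    using u x minv(1)[OF x] mat_add[OF Or_carrier[OF x], of "x *\<^sub>v u" "minv x *\<^sub>v u"] by simp
  also have "\<dots> = N (N u)" unfolding xx_eq[OF u] using u by simp
  finally show ?thesis by simp
qed

lemma NN_zeroI:
  assumes u: "u \<in> V" and 0: "\<And>w. w \<in> V \<Longrightarrow> \<beta> (N u) (N w) = 0" shows "N (N u) = 0\<^sub>v m"
proof -
  have "x *\<^sub>v u + minv x *\<^sub>v u = 0\<^sub>v m"
    by (rule bil_nondegenerate) (use u x minv(1)[OF x] bil_NN' 0 in auto)
  then show ?thesis using NN_eq_x[OF u] mat_zero[OF Or_carrier[OF x]] by simp
qed

lemma quadratic_form_NN: "quadratic_form m (\<lambda>v. s * q (N v) + t * q (N (N v)))"
  and polar_NN: "u \<in> V \<Longrightarrow> w \<in> V \<Longrightarrow>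
    polar (\<lambda>v. s * q (N v) + t * q (N (N v))) u w = s * \<beta> (N u) (N w) + t * \<beta> (N (N u)) (N (N w))"
proof -
  show p: "polar (\<lambda>v. s * q (N v) + t * q (N (N v))) u w = s * \<beta> (N u) (N w) + t * \<beta> (N (N u)) (N (N w))"
    if "u \<in> V" "w \<in> V" for u w
    unfolding polar_def[of "\<lambda>v. s * q (N v) + t * q (N (N v))"] using that
    by (simp add: q_add algebra_simps)
  show "quadratic_form m (\<lambda>v. s * q (N v) + t * q (N (N v)))"
    unfolding quadratic_form_def by (simp add: p algebra_simps)
qed

lemma all_NN_zeroI:
  assumes "\<And>v. v \<in> V \<Longrightarrow> q (N v) = 0" and v: "v \<in> V" shows "N (N v) = 0\<^sub>v m"
proof (rule NN_zeroI[OF v])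
  fix w assume w: "w \<in> V"
  have "q (N (v + w)) = 0" by (rule assms(1)[OF add_carrier_vec[OF v w]])
  then show "\<beta> (N v) (N w) = 0" using assms(1) v w by (simp add: q_add)
qed

end

locale unipotent_isometry = isometry n m q x
  for n m :: nat and q :: "'k::alg_closed_field vec \<Rightarrow> 'k" and x :: "'k mat" +
  fixes r :: nat
  assumes nilpotent: "(x - 1\<^sub>m m) ^\<^sub>m r = 0\<^sub>m m m"
begin

lemma N_eq: "v \<in> V \<Longrightarrow> (x - 1\<^sub>m m) *\<^sub>v v = N v"
  unfolding N_def using Or_carrier[OF x]
  by (subst minus_mult_distrib_mat_vec[of _ m m]) (auto intro!: eq_vecI)

lemma Npow_r: "v \<in> V \<Longrightarrow> (N ^^ r) v = 0\<^sub>v m"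
proof -
  have "(N ^^ k) v = ((x - 1\<^sub>m m) ^\<^sub>m k) *\<^sub>v v" if "v \<in> V" for k v
    using that
  proof (induction k arbitrary: v)
    case (Suc k)
    have M: "x - 1\<^sub>m m \<in> carrier_mat m m" by (rule minus_carrier_mat[OF one_carrier_mat])
    have "(N ^^ Suc k) v = (N ^^ k) (N v)" by (simp add: funpow_swap1)
    also have "\<dots> = ((x - 1\<^sub>m m) ^\<^sub>m k) *\<^sub>v ((x - 1\<^sub>m m) *\<^sub>v v)" using Suc by (simp add: N_eq)
    also have "\<dots> = ((x - 1\<^sub>m m) ^\<^sub>m Suc k) *\<^sub>v v"
      using assoc_mult_mat_vec[OF pow_carrier_mat[OF M] M Suc.prems, of k] by simp
    finally show ?case .
  qed (use Or_carrier[OF x] in simp)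
  moreover have "0\<^sub>m m m *\<^sub>v v = 0\<^sub>v m" if "v \<in> V" for v :: "'k vec" using that by (intro eq_vecI) auto
  ultimately show "v \<in> V \<Longrightarrow> (N ^^ r) v = 0\<^sub>v m" using nilpotent by simp
qed

lemma N_eigen:
  assumes u: "u \<in> V" "N u = c \<cdot>\<^sub>v u" shows "N u = 0\<^sub>v m"
proof (rule ccontr)
  assume ne: "N u \<noteq> 0\<^sub>v m"
  then have c: "c \<noteq> 0" "u \<noteq> 0\<^sub>v m" using u by auto
  have "(N ^^ k) u = c ^ k \<cdot>\<^sub>v u" for k
    by (induction k) (use u in \<open>auto simp: smult_smult_assoc mult.commute\<close>)
  then have "c ^ r \<cdot>\<^sub>v u = 0\<^sub>v m" using Npow_r[OF u(1)] by simp
  then show False using smult_eq_0_iff[OF u(1)] c by simp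
qed

text \<open>If \<open>c\<close> and \<open>u\<close> were nonzero, applying the last power of
  \<open>N\<close> not killing \<open>u\<close> would make \<open>c\<close> times a nonzero vector
  vanish. The relation expresses that \<open>x *\<^sub>v u + minv x *\<^sub>v u\<close> is
  proportional to \<open>u\<close>.\<close>

lemma N_quadratic_eigen:
  assumes u: "u \<in> V" "N (N u) = c \<cdot>\<^sub>v (u + N u)" shows "N (N u) = 0\<^sub>v m"
proof (cases "c = 0")
  case False
  have "u = 0\<^sub>v m" if "(N ^^ k) u = 0\<^sub>v m" for k
    using that
  proof (induction k)
    case (Suc k)
    have a: "N ((N ^^ k) u) = 0\<^sub>v m" using Suc.prems by simp
    have "(N ^^ k) (N (N u)) = N (N ((N ^^ k) u))" by (simp add: funpow_swap1)
    then have "(N ^^ k) (N (N u)) = 0\<^sub>v m" using a by simp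
    moreover have "(N ^^ k) (N u) = 0\<^sub>v m" using a by (simp add: funpow_swap1)
    moreover have "(N ^^ k) (c \<cdot>\<^sub>v (u + N u)) = c \<cdot>\<^sub>v ((N ^^ k) u + (N ^^ k) (N u))"
      using u(1) by (simp add: Npow_smult Npow_add)
    ultimately have "c \<cdot>\<^sub>v (N ^^ k) u = 0\<^sub>v m" using u by simp
    then show ?case using Suc.IH smult_eq_0_iff[of "(N ^^ k) u" c] False u(1) by simp
  qed simp
  then have "u = 0\<^sub>v m" using Npow_r[OF u(1)] by blast
  then show ?thesis by simp
qed (use u in simp)

text \<open>A quadratic form vanishing on the singular vectors is a multiple of \<open>q\<close>; as \<open>N\<close> has a kernel,
  the multiple is zero.\<close>

lemma form_vanishes:
  assumes sing: "\<And>w. w \<in> V \<Longrightarrow> q w = 0 \<Longrightarrow> s * q (N w) + t * q (N (N w)) = 0" and v: "v \<in> V"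
  shows "s * q (N v) + t * q (N (N v)) = 0"
proof -
  let ?Q = "\<lambda>v. s * q (N v) + t * q (N (N v))"
  obtain g where g: "frame g" using exists_frame0 by blast
  note gV = frame_carrier[OF g] and gb = frame_bil[OF g]
  have Qadd: "?Q (u + w) = ?Q u + ?Q w + polar ?Q u w" for u w unfolding polar_def by (simp add: add_ac)
  have pol_add: "polar ?Q (u + v) w = polar ?Q u w + polar ?Q v w"
    if "u \<in> V" "v \<in> V" "w \<in> V" for u v w
    using quadratic_form_NN that unfolding quadratic_form_def by blast
  have pol_add': "polar ?Q w (u + v) = polar ?Q w u + polar ?Q w v"
    if "u \<in> V" "v \<in> V" "w \<in> V" for u v w
    using that by (simp add: polar_NN algebra_simps)
  have Q0: "?Q (g i) = 0" if "i < m" for i using sing[OF gV[OF that] frame_q[OF g that]] .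
  \<comment> \<open>Orthogonal frame vectors have singular sums, so the mixed values of the form
    vanish.\<close>
  have off: "polar ?Q (g i) (g j) = 0" if "i < m" "j < m" "i + j \<noteq> m - 1" for i j
  proof -
    have "q (g i + g j) = 0" using that gV gb g by (simp add: q_add)
    then have "?Q (g i + g j) = 0" by (rule sing[OF add_carrier_vec[OF gV[OF that(1)] gV[OF that(2)]]])
    then show ?thesis unfolding Qadd using Q0 that by simp
  qed
  define d where "d = polar ?Q (g 0) (g (m - 1))"
  \<comment> \<open>The sum of two hyperbolic pairs is singular, because each pair contributes 1 and
    the characteristic is two; hence all pairs share the scalar \<open>d\<close>.\<close>
  have diag: "polar ?Q (g i) (g (m - 1 - i)) = d" if i: "i < n" for i
  proof (cases "i = 0")
    case False
    let ?i = "m - 1 - i" and ?j = "m - 1"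
    have lt: "i < m" "?i < m" "?j < m" "0 < m" "i + ?i = m - 1" "0 + ?j = m - 1" using i m_def by auto
    have ne: "i + 0 \<noteq> m - 1" "i + ?j \<noteq> m - 1" "?i + 0 \<noteq> m - 1" "?i + ?j \<noteq> m - 1"
      using i False m_def by auto
    let ?w = "(g i + g ?i) + (g 0 + g ?j)"
    have V: "g i \<in> V" "g ?i \<in> V" "g 0 \<in> V" "g ?j \<in> V" using gV lt by auto
    have b: "\<beta> (g i) (g ?i) = 1" "\<beta> (g 0) (g ?j) = 1" "\<beta> (g i) (g 0) = 0" "\<beta> (g i) (g ?j) = 0"
       "\<beta> (g ?i) (g 0) = 0" "\<beta> (g ?i) (g ?j) = 0"
      using gb lt ne by auto
    have "q ?w = 0" using V b frame_q[OF g] lt by (simp add: q_add)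
    moreover have "?w \<in> V" using V by simp
    ultimately have "?Q ?w = 0" using sing by blast
    moreover have "?Q ?w = polar ?Q (g i) (g ?i) + polar ?Q (g 0) (g ?j)"
    proof -
      have p: "polar ?Q (g i + g ?i) (g 0 + g ?j) = 0"
        using V off[OF lt(1,4) ne(1)] off[OF lt(1,3) ne(2)] off[OF lt(2,4) ne(3)] off[OF lt(2,3) ne(4)]
        by (simp only: pol_add pol_add' add_carrier_vec add_0)
      show ?thesis unfolding Qadd[of "g i + g ?i" "g 0 + g ?j"] Qadd[of "g i"] Qadd[of "g 0"] p
        using Q0 lt by simp
    qed
    ultimately show ?thesis unfolding d_def by (simp add: add_eq_0_iff2)
  qed (use m_pos in \<open>simp add: d_def\<close>)
  have Qq: "?Q v = d * q v" if "v \<in> V" for v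
  proof (rule quadratic_form_eq_on_frame[OF quadratic_form_NN g Q0 _ that])
    fix i j assume ij: "i < j" "j < m"
    then have lt: "i < m" by simp
    show "polar ?Q (g i) (g j) = d * \<beta> (g i) (g j)"
    proof (cases "i + j = m - 1")
      case True
      then have "j = m - 1 - i" "i < n" using ij m_def by auto
      then show ?thesis using diag gb[OF lt ij(2)] True by simp
    qed (use off[OF lt ij(2)] gb[OF lt ij(2)] in simp)
  qed
  \<comment> \<open>\<open>N\<close> kills some nonzero \<open>w\<close>, so the form is additive
    against \<open>w\<close>. For \<open>d\<close> times \<open>q\<close> this means that all
    products with \<open>w\<close> vanish, unless \<open>d = 0\<close>.\<close>
  have "d = 0"
  proof -
    have "\<exists>w\<in>V. w \<noteq> 0\<^sub>v m \<and> N w = 0\<^sub>v m"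
    proof (rule ccontr)
      assume no: "\<not> ?thesis"
      have "(N ^^ k) (g 0) \<noteq> 0\<^sub>v m" for k
        by (induction k) (use no frame_nonzero[OF g] gV m_pos in auto)
      then show False using Npow_r[OF gV[OF m_pos(1)]] by blast
    qed
    then obtain w where w: "w \<in> V" "w \<noteq> 0\<^sub>v m" "N w = 0\<^sub>v m" by blast
    obtain z where z: "z \<in> V" "\<beta> w z \<noteq> 0" using bil_nondegenerate w by blast
    have "?Q (w + z) = ?Q w + ?Q z" using w z by (simp add: q_add)
    then have "d * q (w + z) = d * q w + d * q z"
      unfolding Qq[OF w(1)] Qq[OF z(1)] Qq[OF add_carrier_vec[OF w(1) z(1)]] .
    then have "d * (q w + q z + \<beta> w z) = d * q w + d * q z"
      unfolding q_add[OF w(1) z(1)] .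
    then have "d * \<beta> w z = 0" by (simp add: algebra_simps add_eq_0_iff2)
    then show ?thesis using z by simp
  qed
  then show ?thesis using Qq[OF v] by simp
qed

text \<open>If \<open>s\<close> is not 0, descending induction from the vanishing power of
  \<open>N\<close> shows that all \<open>q (N v)\<close> vanish. Otherwise \<open>q\<close> vanishes
  on the image of \<open>N\<^sup>2\<close> and the second relation decides: with
  \<open>s' = 0\<close> it makes \<open>N u\<close> and \<open>N w\<close> orthogonal for singular
  orthogonal pairs, and with \<open>s'\<close> nonzero it yields the fact \<open>star\<close>, by
  which the nilpotency order drops from 4 to 3 to 2.\<close>

lemma involution_criterion:
  assumes st: "(s, t) \<noteq> (0, 0)" and P1: "\<And>w. w \<in> V \<Longrightarrow> q w = 0 \<Longrightarrow>
      s * \<beta> w (x *\<^sub>v w) + t * \<beta> w (x *\<^sub>v (x *\<^sub>v w)) = 0"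
    and st': "(s', t') \<noteq> (0, 0)" and P2: "\<And>u w. u \<in> V \<Longrightarrow> w \<in> V \<Longrightarrow> q u = 0 \<Longrightarrow> q w = 0 \<Longrightarrow> \<beta> u w = 0 \<Longrightarrow>
      s' * (\<beta> u (x *\<^sub>v u) * \<beta> w (x *\<^sub>v w) + \<beta> u (x *\<^sub>v w) * \<beta> w (x *\<^sub>v u)) +
      t' * (\<beta> u (x *\<^sub>v w) + \<beta> w (x *\<^sub>v u))\<^sup>2 = 0"
    and v: "v \<in> V"
  shows "x *\<^sub>v (x *\<^sub>v v) = v"
proof -
  have form: "s * q (N v) + t * q (N (N v)) = 0" if "v \<in> V" for v
    by (rule form_vanishes[OF _ that]) (use P1 in \<open>simp add: q_N[symmetric] q_NN[symmetric]\<close>)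
  have "N (N v) = 0\<^sub>v m"
  proof (cases "s = 0")
    case False
    have "q ((N ^^ Suc k) w) = 0" if "w \<in> V" for k w
    proof (cases "Suc k \<ge> r")
      case True
      have "(N ^^ Suc k) w = (N ^^ (Suc k - r)) ((N ^^ r) w)"
        using True by (metis funpow_add comp_apply le_add_diff_inverse2)
      then show ?thesis using Npow_r[OF that] by simp
    next
      case lt: False
      then have "k \<le> r" by simp
      then show ?thesis
      proof (induction k rule: inc_induct)
        case base
        then show ?case using Npow_r[OF that] by simp
      next
        case (step k)
        have "s * q (N ((N ^^ k) w)) + t * q (N (N ((N ^^ k) w))) = 0" using form that by simp
        then show ?case using step.IH False by simp
      qed
    qed
    from this[of _ 0] show ?thesis by (intro all_NN_zeroI v) simp
  next
    case True
    then have t: "t \<noteq> 0" using st by simp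
    have NN0: "q (N (N v)) = 0" if "v \<in> V" for v using form[OF that] True t by simp
    show ?thesis
    proof (cases "s' = 0")
      case s': True
      have NNs: "N (N u) = 0\<^sub>v m" if u: "u \<in> V" "u \<noteq> 0\<^sub>v m" "q u = 0" for u
      proof -
        have y: "x *\<^sub>v u + minv x *\<^sub>v u \<in> V" using u x minv(1)[OF x] by simp
        obtain c where "x *\<^sub>v u + minv x *\<^sub>v u = c \<cdot>\<^sub>v u"
        proof (rule mem_span_of_singular_perp[OF u y])
          fix w assume w: "w \<in> V" "q w = 0" "\<beta> u w = 0"
          have "(\<beta> u (x *\<^sub>v w) + \<beta> w (x *\<^sub>v u))\<^sup>2 = 0" using P2[OF u(1) w(1) u(3) w(2,3)] s' st' by simp
          then have "\<beta> (N u) (N w) = 0" using bil_NN[OF u(1) w(1)] by simp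
          then show "\<beta> (x *\<^sub>v u + minv x *\<^sub>v u) w = 0" using bil_NN'[OF u(1) w(1)] by simp
        qed
        then have "N (N u) = c \<cdot>\<^sub>v (u + N u)"
          using NN_eq_x[OF u(1)] mat_smult[OF Or_carrier[OF x] u(1)] x_eq[OF u(1)] by simp
        then show ?thesis by (rule N_quadratic_eigen[OF u(1)])
      qed
      obtain g where g: "frame g" using exists_frame0 by blast
      have "x * x = 1\<^sub>m m"
      proof (rule Or_eqI[OF g Or_mult[OF x x] Or_one])
        fix i assume i: "i < m"
        have "N (N (g i)) = 0\<^sub>v m" using NNs frame_nonzero[OF g i] g i by simp
        then show "(x * x) *\<^sub>v g i = 1\<^sub>m m *\<^sub>v g i" using xx_eq[of "g i"] g i x by simp
      qed
      then have "x *\<^sub>v (x *\<^sub>v v) = v" using Or_mult_vec[OF x x v] v by simp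
      then show ?thesis using xx_eq_iff[OF v] by simp
    next
      case s': False
      \<comment> \<open>Where the square of \<open>x\<close> fixes \<open>u\<close> and
        \<open>a\<^sub>1\<^sub>1 = 0\<close>, the entries \<open>a\<^sub>1\<^sub>2\<close> and
        \<open>a\<^sub>2\<^sub>1\<close> coincide, so the second relation reduces to
        \<open>a\<^sub>1\<^sub>2 = 0\<close>. Then \<open>x *\<^sub>v u\<close> is proportional to
        \<open>u\<close>, and unipotency leaves the factor 1.\<close>
      have star: "N u = 0\<^sub>v m" if u: "u \<in> V" "q u = 0" "N (N u) = 0\<^sub>v m" "q (N u) = 0" for u
      proof (cases "u = 0\<^sub>v m")
        case u0: False
        have xu: "x *\<^sub>v u \<in> V" using u x by simp
        have "x *\<^sub>v (x *\<^sub>v u) = u" using xx_eq_iff u by simp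
        then have inv: "minv x *\<^sub>v u = x *\<^sub>v u" using minv_vec(2)[OF x xu] by simp
        obtain c where c: "x *\<^sub>v u = c \<cdot>\<^sub>v u"
        proof (rule mem_span_of_singular_perp[OF u(1) u0 u(2) xu])
          fix w assume w: "w \<in> V" "q w = 0" "\<beta> u w = 0"
          have 1: "\<beta> u (x *\<^sub>v w) = \<beta> (x *\<^sub>v u) w" using bil_x[OF u(1) w(1)] inv by simp
          have 2: "\<beta> w (x *\<^sub>v u) = \<beta> (x *\<^sub>v u) w" using bil_sym xu w by simp
          have 3: "\<beta> u (x *\<^sub>v u) = 0" using q_N u by simp
          show "\<beta> (x *\<^sub>v u) w = 0" using P2[OF u(1) w(1) u(2) w(2,3)] s' unfolding 1 2 3 by simp
        qed
        have "N u = (c + 1) \<cdot>\<^sub>v u" unfolding N_def c using u(1) by (intro eq_vecI) (auto simp: algebra_simps)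
        then show ?thesis by (rule N_eigen[OF u(1)])
      qed simp
      \<comment> \<open>The square of \<open>x\<close>, which is 1 plus the square of
        \<open>N\<close>, is an isometry, and the image of \<open>N\<^sup>2\<close> is totally
        isotropic. Comparing products before and after this isometry kills the fourth power.\<close>
      have N4: "N (N (N (N z))) = 0\<^sub>v m" if z: "z \<in> V" for z
      proof -
        let ?y = "x * x"
        have y: "?y \<in> Or" using Or_mult x by blast
        have yv: "?y *\<^sub>v w = w + N (N w)" if "w \<in> V" for w using that x xx_eq by simp
        have b0: "\<beta> (N (N u)) (N (N w)) = 0" if "u \<in> V" "w \<in> V" for u w
        proof -
          have "q (N (N (u + w))) = 0" by (rule NN0[OF add_carrier_vec[OF that]])
          then show ?thesis using NN0 that by (simp add: q_add)
        qed
        have "\<beta> (N (N (N (N z)))) w = 0" if w: "w \<in> V" for w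
        proof -
          define w' where "w' = minv ?y *\<^sub>v w"
          have w': "w' \<in> V" "?y *\<^sub>v w' = w" unfolding w'_def using minv(1)[OF y] minv_vec(1)[OF y w] w by auto
          let ?M = "\<lambda>v. N (N v)"
          have e: "?M (?M z) \<in> V" "?M z \<in> V" "?M w' \<in> V" using z w' by auto
          have "\<beta> (?y *\<^sub>v ?M z) (?y *\<^sub>v w') = \<beta> (?M z) w'" by (rule Or_bil[OF y e(2) w'(1)])
          then have "\<beta> (?M z) w' + \<beta> (?M z) (?M w') + (\<beta> (?M (?M z)) w) = \<beta> (?M z) w'"
            unfolding w'(2)[symmetric] yv[OF e(2)] using yv[OF w'(1)] e w' by (simp add: algebra_simps)
          then show ?thesis using b0[OF z w'(1)] by (metis add.right_neutral add_self_left add_self)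
        qed
        then show ?thesis using bil_nondegenerate z by simp
      qed
      have N3: "N (N (N z)) = 0\<^sub>v m" if z: "z \<in> V" for z
        by (rule star) (use z NN0 N4 in auto)
      have N2: "N (N z) = 0\<^sub>v m" if z: "z \<in> V" "q (N z) = 0" for z
        by (rule star) (use z NN0 N3 in auto)
      show ?thesis
      proof (rule ccontr)
        assume ne: "N (N v) \<noteq> 0\<^sub>v m"
        then obtain w where w: "w \<in> V" "\<beta> (N v) (N w) \<noteq> 0" using NN_zeroI[OF v] by blast
        have Qv: "q (N v) \<noteq> 0" using N2[OF v] ne by blast
        obtain c where c: "q (N w) + \<beta> (N v) (N w) * c + q (N v) * c\<^sup>2 = 0"
          using exists_quadratic_root[OF Qv] by blast
        \<comment> \<open>The second root of the quadratic: it differs from \<open>c\<close> because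
          the sum of the roots is the nonzero linear coefficient over the leading one. Both roots
          give \<open>N (N w)\<close> as a multiple of \<open>N (N v)\<close>, with different
          factors.\<close>
        define c' where "c' = c + \<beta> (N v) (N w) / q (N v)"
        have c': "q (N w) + \<beta> (N v) (N w) * c' + q (N v) * c'\<^sup>2 = 0"
        proof -
          let ?b = "\<beta> (N v) (N w)" and ?d = "q (N v)"
          have "q (N w) + ?b * c' + ?d * c'\<^sup>2 =
            (q (N w) + ?b * c + ?d * c\<^sup>2) + (?b * (?b / ?d) + ?d * (?b / ?d)\<^sup>2)"
            unfolding c'_def by (simp add: power2_eq_square algebra_simps)
          also have "?b * (?b / ?d) + ?d * (?b / ?d)\<^sup>2 = 0"
            using Qv by (simp add: power2_eq_square)
          finally show ?thesis using c by simp
        qed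
        have root: "N (N (w + e \<cdot>\<^sub>v v)) = 0\<^sub>v m" if "q (N w) + \<beta> (N v) (N w) * e + q (N v) * e\<^sup>2 = 0" for e
        proof (rule N2)
          show "q (N (w + e \<cdot>\<^sub>v v)) = 0"
            using that v w bil_sym[of "N v" "N w"] by (simp add: q_add algebra_simps)
        qed (use v w in simp)
        have "N (N w) + c \<cdot>\<^sub>v N (N v) = 0\<^sub>v m" "N (N w) + c' \<cdot>\<^sub>v N (N v) = 0\<^sub>v m"
          using root[OF c] root[OF c'] v w by auto
        then have "N (N w) = c \<cdot>\<^sub>v N (N v)" "N (N w) = c' \<cdot>\<^sub>v N (N v)"
          using vec_add_eq_0_iff v w by auto
        then have "c \<cdot>\<^sub>v N (N v) + c' \<cdot>\<^sub>v N (N v) = 0\<^sub>v m" using v by simp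
        moreover have "c \<cdot>\<^sub>v N (N v) + c' \<cdot>\<^sub>v N (N v) = (c + c') \<cdot>\<^sub>v N (N v)"
          using v by (intro eq_vecI) (auto simp: algebra_simps)
        moreover have "c + c' = \<beta> (N v) (N w) / q (N v)" unfolding c'_def by simp
        ultimately have "(\<beta> (N v) (N w) / q (N v)) \<cdot>\<^sub>v N (N v) = 0\<^sub>v m" by simp
        then show False using smult_eq_0_iff[of "N (N v)"] v ne w(2) Qv by simp
      qed
    qed
  qed
  then show ?thesis using xx_eq_iff[OF v] by simp
qed

end

section \<open>Spherical classes\<close>

text \<open>Closed sets are zero sets of polynomials, so density means that no polynomial tells
  \<open>S\<close> from \<open>C\<close>.\<close>

lemma closure_of_eq_iff_vanishing:
  assumes C: "C \<subseteq> carrier_mat m m" "C \<subseteq> carrier G" and S: "S \<subseteq> C"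
  shows "(subtopology (zariski_on m G) C) closure_of S = C \<longleftrightarrow>
    (\<forall>f. polynomial_fun m f \<longrightarrow> (\<forall>y\<in>S. f y = 0) \<longrightarrow> (\<forall>y\<in>C. f y = (0::'a::field)))"
proof -
  have "subtopology (zariski_on m G) C = subtopology (zariski m) C"
    using C(2) by (simp add: subtopology_subtopology Int_absorb1)
  then have cl: "(subtopology (zariski_on m G) C) closure_of S = C \<inter> (zariski m closure_of S)"
    using S by (simp add: closure_of_subtopology Int_absorb1)
  show ?thesis
  proof
    assume "(subtopology (zariski_on m G) C) closure_of S = C"
    then have sub: "C \<subseteq> zariski m closure_of S" unfolding cl by blast
    show "\<forall>f. polynomial_fun m f \<longrightarrow> (\<forall>y\<in>S. f y = 0) \<longrightarrow> (\<forall>y\<in>C. f y = 0)"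
    proof (intro allI impI)
      fix f :: "'a mat \<Rightarrow> 'a" assume f: "polynomial_fun m f" "\<forall>y\<in>S. f y = 0"
      have "closedin (zariski m) (zero_locus m {f})"
        unfolding closedin_zariski algebraic_set_def using f(1) by (intro exI[of _ "{f}"]) simp
      moreover have "S \<subseteq> zero_locus m {f}" unfolding zero_locus_def using f(2) S C by auto
      ultimately have "zariski m closure_of S \<subseteq> zero_locus m {f}" by (rule closure_of_minimal[rotated])
      then show "\<forall>y\<in>C. f y = 0" using sub unfolding zero_locus_def by blast
    qed
  next
    assume *: "\<forall>f. polynomial_fun m f \<longrightarrow> (\<forall>y\<in>S. f y = 0) \<longrightarrow> (\<forall>y\<in>C. f y = 0)"
    have "algebraic_set m (zariski m closure_of S)"
      using closedin_closure_of[of "zariski m" S] unfolding closedin_zariski .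
    then obtain F where F: "\<forall>f\<in>F. polynomial_fun m f" "zariski m closure_of S = zero_locus m F"
      unfolding algebraic_set_def by blast
    have "S \<subseteq> zariski m closure_of S"
      by (rule closure_of_subset) (use S C in \<open>auto simp: topspace_zariski\<close>)
    then have "\<forall>f\<in>F. \<forall>y\<in>S. f y = 0" unfolding F(2) zero_locus_def by blast
    then have "C \<subseteq> zero_locus m F" using * F(1) C(1) unfolding zero_locus_def by blast
    then show "(subtopology (zariski_on m G) C) closure_of S = C" unfolding cl F(2) by blast
  qed
qed

context char2_quadratic_space
begin

abbreviation G :: "'k mat monoid" where "G \<equiv> special_orthogonal_group m q"

lemma G_eq: "G = (GL m)\<lparr>carrier := SO\<rparr>"
  unfolding SO_def special_orthogonal_group_def identity_component_def orthogonal_group_def by simp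

lemma G_simps [simp]: "mult G = (*)" "\<one>\<^bsub>G\<^esub> = 1\<^sub>m m" "carrier G = SO"
  unfolding G_eq by simp_all

lemma subgroup_Or: "subgroup Or (GL m)"
  using subgroup_orthogonal_group[of m q] unfolding carrier_orthogonal_group .

lemma subgroup_SO: "subgroup SO (GL m)"
proof -
  interpret GL: group "GL m :: 'k mat monoid" by (rule group_GL)
  have "subgroup SO ((GL m)\<lparr>carrier := Or\<rparr>)"
    using subgroup_identity_component[OF subgroup_Or]
    unfolding identity_component_def SO_eq by simp
  then show ?thesis using GL.incl_subgroup[OF subgroup_Or] by blast
qed

lemma SO_mult: "A \<in> SO \<Longrightarrow> B \<in> SO \<Longrightarrow> A * B \<in> SO"
  using subgroup.m_closed[OF subgroup_SO] by simp

lemma SO_minv: "A \<in> SO \<Longrightarrow> minv A \<in> SO"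
  using subgroup.m_inv_closed[OF subgroup_SO] unfolding minv_def .

lemma G_inv: "A \<in> SO \<Longrightarrow> inv\<^bsub>G\<^esub> A = minv A"
proof -
  interpret GL: group "GL m :: 'k mat monoid" by (rule group_GL)
  show "A \<in> SO \<Longrightarrow> inv\<^bsub>G\<^esub> A = minv A"
    unfolding G_eq minv_def using GL.m_inv_consistent[OF subgroup_SO] by simp
qed

lemma orbit_eq:
  assumes "B \<subseteq> SO" "x \<in> SO"
  shows "orbit (G\<lparr>carrier := B\<rparr>) (conjugation G) x = {b * x * minv b | b. b \<in> B}"
proof -
  have eq: "conjugation G b x = b * x * minv b" if "b \<in> B" for b
    unfolding conjugation_def using that assms by (simp add: G_inv subsetD)
  have "(\<exists>b. y = conjugation G b x \<and> b \<in> B) \<longleftrightarrow> (\<exists>b. y = b * x * minv b \<and> b \<in> B)" for y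
    using eq by metis
  then show ?thesis unfolding orbit_def by simp
qed

lemma class_eq:
  assumes "C \<in> conjugacy_classes G" "x \<in> C"
  shows "x \<in> SO" "C = {A * x * minv A | A. A \<in> SO}"
proof -
  obtain x0 where x0: "x0 \<in> SO" "C = orbit G (conjugation G) x0"
    using assms(1) unfolding conjugacy_classes_def orbits_def by auto
  have C: "C = {A * x0 * minv A | A. A \<in> SO}"
    using orbit_eq[OF subset_refl x0(1)] x0(2) G_eq by simp
  obtain A where A: "A \<in> SO" "x = A * x0 * minv A" using assms(2) C by blast
  then show x: "x \<in> SO" using SO_mult SO_minv x0 by blast
  note O = subsetD[OF SO_subset]
  have comp: "(B * A) * x0 * minv (B * A) = B * x * minv B" if B: "B \<in> SO" for B
  proof -
    have BA: "minv (B * A) = minv A * minv B"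
    proof (rule minv_unique)
      show "B * A \<in> Or" "minv A * minv B \<in> Or" using O A B Or_mult minv(1) by blast+
      show "(B * A) * (minv A * minv B) = 1\<^sub>m m"
      proof (rule mat_eq_iff_mult_vec)
        show "(B * A) * (minv A * minv B) \<in> carrier_mat m m"
          by (intro Or_carrier Or_mult minv(1) O A(1) B)
        show "1\<^sub>m m \<in> carrier_mat m m" by simp
        fix v assume "v \<in> V"
        then show "((B * A) * (minv A * minv B)) *\<^sub>v v = 1\<^sub>m m *\<^sub>v v"
          using O[OF A(1)] O[OF B] minv(1) by (simp add: Or_mult)
      qed
    qed
    show ?thesis unfolding BA A(2)
    proof (rule mat_eq_iff_mult_vec)
      have m: "minv A \<in> Or" "minv B \<in> Or" "A \<in> Or" "B \<in> Or" "x0 \<in> Or" using minv(1) O A(1) B x0(1) by auto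
      show "B * A * x0 * (minv A * minv B) \<in> carrier_mat m m" "B * (A * x0 * minv A) * minv B \<in> carrier_mat m m"
        by (intro Or_carrier Or_mult m)+
      fix v assume "v \<in> V"
      then show "(B * A * x0 * (minv A * minv B)) *\<^sub>v v = (B * (A * x0 * minv A) * minv B) *\<^sub>v v"
        using m by (simp add: Or_mult)
    qed
  qed
  show "C = {A * x * minv A | A. A \<in> SO}"
  proof (intro subset_antisym subsetI)
    fix y assume "y \<in> C"
    then obtain E where E: "E \<in> SO" "y = E * x0 * minv E" using C by blast
    have "(E * minv A) * A = E * (minv A * A)"
      by (rule assoc_mult_mat[OF Or_carrier[OF O[OF E(1)]] Or_carrier[OF minv(1)[OF O[OF A(1)]]] Or_carrier[OF O[OF A(1)]]])
    then have "(E * minv A) * A = E" using minv(3)[OF O[OF A(1)]] Or_carrier[OF O[OF E(1)]] by simp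
    then have "y = (E * minv A) * x * minv (E * minv A)"
      using comp[OF SO_mult[OF E(1) SO_minv[OF A(1)]]] E(2) by simp
    then show "y \<in> {A * x * minv A | A. A \<in> SO}" using SO_mult[OF E(1) SO_minv[OF A(1)]] by blast
  next
    fix y assume "y \<in> {A * x * minv A | A. A \<in> SO}"
    then obtain B where B: "B \<in> SO" "y = B * x * minv B" by blast
    then have "y = (B * A) * x0 * minv (B * A)" using comp[OF B(1)] by simp
    then show "y \<in> C" unfolding C using SO_mult[OF B(1) A(1)] by blast
  qed
qed

lemma spherical_iff:
  assumes C: "C \<in> conjugacy_classes G"
  shows "spherical m G C \<longleftrightarrow> (\<exists>B. borel_subgroup m G B \<and> (\<exists>x\<in>C. \<forall>f. polynomial_fun m f \<longrightarrow>
    (\<forall>b\<in>B. f (b * x * minv b) = 0) \<longrightarrow> (\<forall>y\<in>C. f y = 0)))"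
proof -
  have CSO: "C \<subseteq> SO" using class_eq(1)[OF C] by blast
  have Cm: "C \<subseteq> carrier_mat m m" using CSO SO_subset Or_carrier by blast
  have "((subtopology (zariski_on m G) C) closure_of (orbit (G\<lparr>carrier := B\<rparr>) (conjugation G) x) = C) \<longleftrightarrow>
    (\<forall>f. polynomial_fun m f \<longrightarrow> (\<forall>b\<in>B. f (b * x * minv b) = 0) \<longrightarrow> (\<forall>y\<in>C. f y = 0))"
    if B: "borel_subgroup m G B" and x: "x \<in> C" for B x
  proof -
    have "subgroup B G" using B unfolding borel_subgroup_def closed_connected_solvable_def by blast
    then have BSO: "B \<subseteq> SO" using subgroup.subset by fastforce
    have orb: "orbit (G\<lparr>carrier := B\<rparr>) (conjugation G) x = {b * x * minv b | b. b \<in> B}"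
      using orbit_eq[OF BSO] class_eq(1)[OF C x] by blast
    have "{b * x * minv b | b. b \<in> B} \<subseteq> C" using class_eq(2)[OF C x] BSO by blast
    moreover have "C \<subseteq> carrier G" using CSO by simp
    ultimately have "((subtopology (zariski_on m G) C) closure_of {b * x * minv b | b. b \<in> B} = C) \<longleftrightarrow>
      (\<forall>f. polynomial_fun m f \<longrightarrow> (\<forall>y\<in>{b * x * minv b | b. b \<in> B}. f y = 0) \<longrightarrow> (\<forall>y\<in>C. f y = 0))"
      by (rule closure_of_eq_iff_vanishing[OF Cm, rotated])
    moreover have "(\<forall>y\<in>{b * x * minv b | b. b \<in> B}. f y = 0) \<longleftrightarrow> (\<forall>b\<in>B. f (b * x * minv b) = 0)"
      for f :: "'k mat \<Rightarrow> 'k" by blast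
    ultimately show ?thesis unfolding orb by simp
  qed
  then show ?thesis unfolding spherical_def by blast
qed

text \<open>\<open>solvable\<close> speaks of the subgroup as a group of its own,
  \<open>lie_kolchin\<close> of the derived series taken in the general linear group; the two series
  agree term by term.\<close>

lemma closed_connected_solvableD:
  assumes "closed_connected_solvable m G H"
  shows "subgroup H (GL m)" "H \<subseteq> SO" "triangulable H"
proof -
  interpret GL: group "GL m :: 'k mat monoid" by (rule group_GL)
  have H: "subgroup H G" "connectedin (zariski_on m G) H" "solvable (G\<lparr>carrier := H\<rparr>)"
    using assms unfolding closed_connected_solvable_def by auto
  show HG: "subgroup H (GL m)" using GL.incl_subgroup[OF subgroup_SO] H(1) unfolding G_eq by blast
  show HSO: "H \<subseteq> SO" using subgroup.subset[OF H(1)] by simp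
  have conn: "connectedin (zariski m) H" using H(2) by (simp add: connectedin_subtopology)
  let ?K = "(GL m :: 'k mat monoid)\<lparr>carrier := H\<rparr>"
  have K: "G\<lparr>carrier := H\<rparr> = ?K" unfolding G_eq by simp
  interpret K: group ?K by (rule subgroup.subgroup_is_group[OF HG group_GL])
  obtain N where N: "(derived ?K ^^ N) H = {1\<^sub>m m}"
    using H(3) K.solvable_iff_trivial_derived_seq unfolding K by auto
  have "(derived ?K ^^ i) H = (derived (GL m) ^^ i) H \<and> (derived (GL m) ^^ i) H \<subseteq> H" for i
  proof (induction i)
    case (Suc i)
    then show ?case
      using GL.derived_consistent[OF _ HG, of "(derived (GL m) ^^ i) H"]
        GL.derived_incl[OF _ HG, of "(derived (GL m) ^^ i) H"] by simp
  qed simp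
  then have "(derived (GL m) ^^ N) H = {1\<^sub>m m}" using N by simp
  then show "triangulable H" using lie_kolchin[OF HG _ conn] HSO SO_subset by blast
qed

subsection \<open>Borel subgroups fix a singular flag\<close>

lemma perp_perp:
  assumes v: "v \<in> V" "v \<noteq> 0\<^sub>v m"
  shows "perp (perp {v}) = {c \<cdot>\<^sub>v v | c. True}"
proof (intro subset_antisym subsetI)
  fix w assume "w \<in> perp (perp {v})"
  then have w: "w \<in> V" "\<And>y. y \<in> V \<Longrightarrow> \<beta> y v = 0 \<Longrightarrow> \<beta> w y = 0" unfolding perp_def by auto
  obtain c where "w = c \<cdot>\<^sub>v v"
    by (rule mem_span_of_perp[OF v w(1)]) (use w(2) bil_sym v(1) in metis)
  then show "w \<in> {c \<cdot>\<^sub>v v | c. True}" by blast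
next
  fix w assume "w \<in> {c \<cdot>\<^sub>v v | c. True}"
  then obtain c where w: "w = c \<cdot>\<^sub>v v" by blast
  have "\<beta> v y = 0" if "y \<in> V" "\<beta> y v = 0" for y using that bil_sym v(1) by metis
  then show "w \<in> perp (perp {v})" unfolding perp_def w using v by auto
qed

lemma perp_perp2:
  assumes v: "v \<in> V" "v \<noteq> 0\<^sub>v m" and w: "w \<in> V" "\<And>c. w \<noteq> c \<cdot>\<^sub>v v"
  shows "perp (perp {v, w}) = {c \<cdot>\<^sub>v v + d \<cdot>\<^sub>v w | c d. True}"
proof (intro subset_antisym subsetI)
  fix z assume "z \<in> perp (perp {v, w})"
  then have z: "z \<in> V" "\<And>y. y \<in> V \<Longrightarrow> \<beta> y v = 0 \<Longrightarrow> \<beta> y w = 0 \<Longrightarrow> \<beta> z y = 0" unfolding perp_def by auto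
  obtain c d where "z = c \<cdot>\<^sub>v v + d \<cdot>\<^sub>v w"
  proof (rule mem_span_of_perp2[OF v w z(1)])
    fix y assume "y \<in> V" "\<beta> v y = 0" "\<beta> w y = 0"
    then show "\<beta> z y = 0" using z(2)[of y] bil_sym[of y v] bil_sym[of y w] v(1) w(1) by simp
  qed
  then show "z \<in> {c \<cdot>\<^sub>v v + d \<cdot>\<^sub>v w | c d. True}" by blast
next
  fix z assume "z \<in> {c \<cdot>\<^sub>v v + d \<cdot>\<^sub>v w | c d. True}"
  then obtain c d where z: "z = c \<cdot>\<^sub>v v + d \<cdot>\<^sub>v w" by blast
  have "\<beta> v y = 0" "\<beta> w y = 0" if "y \<in> V" "\<beta> y v = 0" "\<beta> y w = 0" for y
    using that bil_sym[of y v] bil_sym[of y w] v(1) w(1) by auto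
  then show "z \<in> perp (perp {v, w})" unfolding perp_def z using v w by auto
qed

text \<open>Supplies the strict inclusions in \<open>triangulable\<close>: a nonzero vector of
  \<open>perp X\<close> that is also orthogonal to suitable test vectors is outside the span of
  \<open>X\<close>. Four conditions leave a solution because the dimension is at least 6.\<close>

lemma exists_orthogonal_to_four:
  assumes "a \<in> V" "b \<in> V" "c \<in> V" "d \<in> V"
  obtains y where "y \<in> V" "y \<noteq> 0\<^sub>v m" "\<beta> y a = 0" "\<beta> y b = 0" "\<beta> y c = 0" "\<beta> y d = 0"
proof -
  define \<phi> where "\<phi> = (\<lambda>i::nat. \<lambda>y. \<beta> y (if i = 0 then a else if i = 1 then b else if i = 2 then c else d))"
  have "additive_on m (\<phi> i)" for i unfolding \<phi>_def using assms by (intro additive_bil) auto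
  moreover have "4 < m" using m_def n3 by simp
  ultimately obtain y where y: "y \<in> V" "y \<noteq> 0\<^sub>v m" "\<And>i. i < 4 \<Longrightarrow> \<phi> i y = 0"
    using exists_common_kernel[of 4 m \<phi>] by blast
  show ?thesis
    by (rule that[OF y(1,2)]) (use y(3)[of 0] y(3)[of 1] y(3)[of 2] y(3)[of 3] in \<open>auto simp: \<phi>_def\<close>)
qed

lemma stable_perp:
  assumes H: "H \<subseteq> Or" "\<And>A. A \<in> H \<Longrightarrow> minv A \<in> H" and X: "X \<subseteq> V"
    and st: "\<And>A y v. A \<in> H \<Longrightarrow> y \<in> X \<Longrightarrow> v \<in> perp X \<Longrightarrow> \<beta> v (A *\<^sub>v y) = 0"
  shows "stable H (perp X)"
  unfolding stable_def
proof (intro ballI)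
  fix A v assume A: "A \<in> H" and v: "v \<in> perp X"
  have AO: "A \<in> Or" using A H by blast
  have vV: "v \<in> V" using v unfolding perp_def by simp
  have "\<beta> (A *\<^sub>v v) y = 0" if y: "y \<in> X" for y
  proof -
    have "y \<in> V" using y X by blast
    then have "\<beta> (A *\<^sub>v v) y = \<beta> v (minv A *\<^sub>v y)"
      using Or_bil[OF AO vV, of "minv A *\<^sub>v y"] AO minv(1)[OF AO] by simp
    then show ?thesis using st[OF H(2)[OF A] y v] by simp
  qed
  then show "A *\<^sub>v v \<in> perp X" unfolding perp_def using AO vV by simp
qed

lemma exists_scaled_sum_singular:
  assumes "v \<in> V" "w \<in> V" "q v \<noteq> 0" "\<beta> w v = 0"
  obtains s where "q (w + s \<cdot>\<^sub>v v) = 0"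
proof -
  obtain s where "q w + 0 * s + q v * s\<^sup>2 = 0" using exists_quadratic_root[OF assms(3)] by blast
  then have "q (w + s \<cdot>\<^sub>v v) = 0" using assms by (simp add: q_add mult.commute)
  then show ?thesis using that by blast
qed

text \<open>A common eigenvector need not be singular, but it lies in its own complement, where a
  second eigenvector modulo the first can be found. Adding a square-root multiple of the nonsingular
  vector makes the second one singular, and preservation of \<open>q\<close> turns it into a genuine
  eigenvector. The same correction produces the plane.\<close>

lemma triangulable_singular_flag:
  assumes H: "H \<subseteq> Or" "\<And>A. A \<in> H \<Longrightarrow> minv A \<in> H" "triangulable H"
  obtains v w where "v \<in> V" "v \<noteq> 0\<^sub>v m" "q v = 0" "\<And>A. A \<in> H \<Longrightarrow> \<exists>c. A *\<^sub>v v = c \<cdot>\<^sub>v v"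
    "w \<in> V" "\<And>c. w \<noteq> c \<cdot>\<^sub>v v" "q w = 0" "\<beta> v w = 0" "\<And>A. A \<in> H \<Longrightarrow> \<exists>c d. A *\<^sub>v w = c \<cdot>\<^sub>v w + d \<cdot>\<^sub>v v"
proof -
  note tri = H(3)[unfolded triangulable_def, rule_format]
  have HO: "A \<in> Or" "A \<in> carrier_mat m m" if "A \<in> H" for A using that H(1) Or_carrier by auto
  have move: "y = c \<cdot>\<^sub>v u + z" if "y + c \<cdot>\<^sub>v u = z" "y \<in> V" "u \<in> V" for y u z c
  proof -
    have "c \<cdot>\<^sub>v u + (y + c \<cdot>\<^sub>v u) = y" using that(2,3) by simp
    then show ?thesis using that(1) by simp
  qed
  have line: "\<exists>w. w \<in> V \<and> \<beta> w v = 0 \<and> (\<forall>c. w \<noteq> c \<cdot>\<^sub>v v) \<and> (\<forall>A\<in>H. \<exists>c d. A *\<^sub>v w = c \<cdot>\<^sub>v w + d \<cdot>\<^sub>v v)"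
    if v: "v \<in> V" "v \<noteq> 0\<^sub>v m" "\<And>A. A \<in> H \<Longrightarrow> \<exists>c. A *\<^sub>v v = c \<cdot>\<^sub>v v" for v
  proof -
    let ?U = "perp {v}"
    have UV: "?U \<subseteq> V" unfolding perp_def by blast
    have stU: "stable H ?U"
    proof (rule stable_perp[OF H(1,2)])
      fix A y u assume *: "A \<in> H" "y \<in> {v}" "u \<in> perp {v}"
      then obtain c where "A *\<^sub>v y = c \<cdot>\<^sub>v v" using v(3) by blast
      then show "\<beta> u (A *\<^sub>v y) = 0" using * v(1) unfolding perp_def by simp
    qed (use v in auto)
    have stP: "stable H (perp ?U)" unfolding perp_perp[OF v(1,2)] stable_def
    proof (intro ballI)
      fix A u assume A: "A \<in> H" and "u \<in> {c \<cdot>\<^sub>v v | c. True}"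
      then obtain c d where "u = c \<cdot>\<^sub>v v" "A *\<^sub>v v = d \<cdot>\<^sub>v v" using v(3) by blast
      then have "A *\<^sub>v u = (c * d) \<cdot>\<^sub>v v" using HO[OF A] v(1) by (simp add: smult_smult_assoc)
      then show "A *\<^sub>v u \<in> {c \<cdot>\<^sub>v v | c. True}" by blast
    qed
    obtain a where a: "a \<in> V" "\<beta> v a \<noteq> 0" using bil_nondegenerate v by blast
    obtain y where y: "y \<in> V" "y \<noteq> 0\<^sub>v m" "\<beta> y v = 0" "\<beta> y a = 0"
      using exists_orthogonal_to_four[OF v(1) a(1) a(1) a(1)] by blast
    have "y \<notin> perp ?U"
    proof
      assume "y \<in> perp ?U"
      then obtain c where "y = c \<cdot>\<^sub>v v" using perp_perp[OF v(1,2)] by blast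
      then have "c = 0" using y(4) a v by simp
      then show False using \<open>y = c \<cdot>\<^sub>v v\<close> y(2) v by simp
    qed
    moreover have "y \<in> ?U" unfolding perp_def using y by simp
    moreover have "perp ?U \<subseteq> ?U" unfolding perp_perp[OF v(1,2)] unfolding perp_def using v by auto
    ultimately have "perp ?U \<subset> ?U" by blast
    then obtain w where w: "w \<in> ?U" "w \<notin> perp ?U" "\<forall>A\<in>H. \<exists>c. A *\<^sub>v w + c \<cdot>\<^sub>v w \<in> perp ?U"
      using tri[OF UV vsubspace_perp stU stP] v by auto
    have wV: "w \<in> V" "\<beta> w v = 0" using w(1) unfolding perp_def by auto
    have "\<exists>c d. A *\<^sub>v w = c \<cdot>\<^sub>v w + d \<cdot>\<^sub>v v" if A: "A \<in> H" for A
    proof -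
      obtain c d where "A *\<^sub>v w + c \<cdot>\<^sub>v w = d \<cdot>\<^sub>v v"
        using w(3) A unfolding perp_perp[OF v(1,2)] by blast
      then show ?thesis using move[OF _ _ wV(1)] HO[OF A] wV by (metis mat_V)
    qed
    then show ?thesis using w(2) wV unfolding perp_perp[OF v(1,2)] by blast
  qed
  have "\<exists>v. v \<in> V \<and> v \<noteq> 0\<^sub>v m \<and> (\<forall>A\<in>H. \<exists>c. A *\<^sub>v v = c \<cdot>\<^sub>v v)"
  proof -
    have P: "perp V = {0\<^sub>v m}" unfolding perp_def using bil_nondegenerate by auto
    have VV: "vsubspace m V" unfolding vsubspace_def by auto
    have "stable H V" "stable H (perp V)" unfolding P stable_def using HO mat_zero by auto
    moreover obtain g where "frame g" using exists_frame0 by blast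
    then have "g 0 \<in> V" "g 0 \<noteq> 0\<^sub>v m" using m_pos frame_nonzero by auto
    then have "perp V \<subset> V" unfolding P by (intro psubsetI) auto
    ultimately obtain v where v: "v \<in> V" "v \<noteq> 0\<^sub>v m" "\<forall>A\<in>H. \<exists>c. A *\<^sub>v v + c \<cdot>\<^sub>v v = 0\<^sub>v m"
      using tri[OF subset_refl VV] unfolding P by auto
    have "\<exists>c. A *\<^sub>v v = c \<cdot>\<^sub>v v" if "A \<in> H" for A
      using v(1,3) that vec_add_eq_0_iff HO by (metis mat_V smult_carrier_vec)
    then show ?thesis using v by blast
  qed
  then obtain v0 where v0: "v0 \<in> V" "v0 \<noteq> 0\<^sub>v m" "\<And>A. A \<in> H \<Longrightarrow> \<exists>c. A *\<^sub>v v0 = c \<cdot>\<^sub>v v0" by blast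
  have "\<exists>v. v \<in> V \<and> v \<noteq> 0\<^sub>v m \<and> q v = 0 \<and> (\<forall>A\<in>H. \<exists>c. A *\<^sub>v v = c \<cdot>\<^sub>v v)"
  proof (cases "q v0 = 0")
    case False
    obtain w where w: "w \<in> V" "\<beta> w v0 = 0" "\<And>c. w \<noteq> c \<cdot>\<^sub>v v0" "\<And>A. A \<in> H \<Longrightarrow> \<exists>c d. A *\<^sub>v w = c \<cdot>\<^sub>v w + d \<cdot>\<^sub>v v0"
      using line[OF v0] by blast
    obtain s where s: "q (w + s \<cdot>\<^sub>v v0) = 0" using exists_scaled_sum_singular[OF v0(1) w(1) False w(2)] by blast
    let ?u = "w + s \<cdot>\<^sub>v v0"
    have u: "?u \<in> V" "?u \<noteq> 0\<^sub>v m" "\<beta> ?u v0 = 0"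
      using w v0 vec_add_eq_0_iff[of w "s \<cdot>\<^sub>v v0"] by auto
    have "\<exists>c. A *\<^sub>v ?u = c \<cdot>\<^sub>v ?u" if A: "A \<in> H" for A
    proof -
      obtain c d e where *: "A *\<^sub>v w = c \<cdot>\<^sub>v w + d \<cdot>\<^sub>v v0" "A *\<^sub>v v0 = e \<cdot>\<^sub>v v0" using w(4) v0(3) A by blast
      define \<delta> where "\<delta> = d + s * e + c * s"
      have eq: "A *\<^sub>v ?u = c \<cdot>\<^sub>v ?u + \<delta> \<cdot>\<^sub>v v0"
      proof -
        have "A *\<^sub>v ?u = (c \<cdot>\<^sub>v w + d \<cdot>\<^sub>v v0) + s \<cdot>\<^sub>v (e \<cdot>\<^sub>v v0)" using HO[OF A] w v0 * by simp
        also have "\<dots> = c \<cdot>\<^sub>v ?u + \<delta> \<cdot>\<^sub>v v0"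
          unfolding \<delta>_def using w(1) v0(1) by (intro eq_vecI) (auto simp: algebra_simps)
        finally show ?thesis .
      qed
      \<comment> \<open>A stray component \<open>\<delta>\<close> along \<open>v0\<close> would
        contribute \<open>\<delta>\<^sup>2 * q v0\<close>, the only term left, since
        \<open>?u\<close> is singular and orthogonal to \<open>v0\<close>.\<close>
      have "0 = q (A *\<^sub>v ?u)" using Or_q[OF HO(1)[OF A] u(1)] s by simp
      also have "\<dots> = \<delta>\<^sup>2 * q v0"
        unfolding eq using q_add[of "c \<cdot>\<^sub>v ?u" "\<delta> \<cdot>\<^sub>v v0"] u v0 s q_smult[OF u(1), of c]
          bil_smult_left[OF u(1), of "\<delta> \<cdot>\<^sub>v v0" c] bil_smult_right[OF v0(1) u(1), of \<delta>]
        by (simp only: smult_carrier_vec q_smult) simp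
      finally have "\<delta> = 0" using False by simp
      then show ?thesis using eq u(1) v0(1) by auto
    qed
    then show ?thesis using u s by blast
  qed (use v0 in blast)
  then obtain v where v: "v \<in> V" "v \<noteq> 0\<^sub>v m" "q v = 0" "\<And>A. A \<in> H \<Longrightarrow> \<exists>c. A *\<^sub>v v = c \<cdot>\<^sub>v v" by blast
  obtain w where w: "w \<in> V" "\<beta> w v = 0" "\<And>c. w \<noteq> c \<cdot>\<^sub>v v" "\<And>A. A \<in> H \<Longrightarrow> \<exists>c d. A *\<^sub>v w = c \<cdot>\<^sub>v w + d \<cdot>\<^sub>v v"
    using line[OF v(1,2,4)] by blast
  have vw: "\<beta> v w = 0" using w(2) bil_sym[OF v(1) w(1)] by simp
  show ?thesis
  proof (cases "q w = 0")
    case True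
    then show ?thesis using that[OF v w(1,3) _ vw w(4)] by blast
  next
    case False
    \<comment> \<open>A nonsingular \<open>w\<close> is replaced by a vector one step higher: a
      further eigenvector \<open>z\<close> in the complement of \<open>v\<close> and
      \<open>w\<close>, modulo their span, is corrected by \<open>w\<close>, and its component along
      \<open>w\<close> drops out as before.\<close>
    let ?X = "perp {v, w}"
    have X: "?X \<subseteq> V" unfolding perp_def by blast
    note PP = perp_perp2[OF v(1,2) w(1,3)]
    have stX: "stable H ?X"
    proof (rule stable_perp[OF H(1,2)])
      fix A y u assume *: "A \<in> H" "y \<in> {v, w}" "u \<in> perp {v, w}"
      obtain c d e where e: "A *\<^sub>v v = c \<cdot>\<^sub>v v" "A *\<^sub>v w = d \<cdot>\<^sub>v w + e \<cdot>\<^sub>v v" using v(4) w(4) *(1) by blast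
      show "\<beta> u (A *\<^sub>v y) = 0" using * e v(1) w(1) unfolding perp_def by auto
    qed (use v w in auto)
    have stP: "stable H (perp ?X)" unfolding PP stable_def
    proof (intro ballI)
      fix A u assume A: "A \<in> H" and "u \<in> {c \<cdot>\<^sub>v v + d \<cdot>\<^sub>v w | c d. True}"
      then obtain a b where u: "u = a \<cdot>\<^sub>v v + b \<cdot>\<^sub>v w" by blast
      obtain c d e where e: "A *\<^sub>v v = c \<cdot>\<^sub>v v" "A *\<^sub>v w = d \<cdot>\<^sub>v w + e \<cdot>\<^sub>v v" using v(4) w(4) A by blast
      have "A *\<^sub>v u = a \<cdot>\<^sub>v (c \<cdot>\<^sub>v v) + b \<cdot>\<^sub>v (d \<cdot>\<^sub>v w + e \<cdot>\<^sub>v v)"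
        unfolding u using HO[OF A] v(1) w(1) e by simp
      also have "\<dots> = (a * c + b * e) \<cdot>\<^sub>v v + (b * d) \<cdot>\<^sub>v w"
        using v(1) w(1) by (intro eq_vecI) (auto simp: algebra_simps)
      finally show "A *\<^sub>v u \<in> {c \<cdot>\<^sub>v v + d \<cdot>\<^sub>v w | c d. True}" by blast
    qed
    obtain b where b: "b \<in> V" "\<beta> v b = 0" "\<beta> w b = 1" using exists_dual_vector[OF v(1,2) w(1,3)] by blast
    obtain a where a: "a \<in> V" "\<beta> v a \<noteq> 0" using bil_nondegenerate v by blast
    obtain y where y: "y \<in> V" "y \<noteq> 0\<^sub>v m" "\<beta> y v = 0" "\<beta> y w = 0" "\<beta> y a = 0" "\<beta> y b = 0"
      using exists_orthogonal_to_four[OF v(1) w(1) a(1) b(1)] by blast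
    have "y \<notin> perp ?X"
    proof
      assume "y \<in> perp ?X"
      then obtain c d where cd: "y = c \<cdot>\<^sub>v v + d \<cdot>\<^sub>v w" using PP by blast
      then have "d = 0" using y(6) a b v w by simp
      moreover have "c = 0" using y(5) cd calculation a v w by simp
      ultimately show False using cd y(2) v w by simp
    qed
    moreover have "y \<in> ?X" unfolding perp_def using y by simp
    moreover have "perp ?X \<subseteq> ?X" unfolding PP unfolding perp_def using v w vw by auto
    ultimately have "perp ?X \<subset> ?X" by blast
    then obtain z where z: "z \<in> ?X" "z \<notin> perp ?X" "\<forall>A\<in>H. \<exists>c. A *\<^sub>v z + c \<cdot>\<^sub>v z \<in> perp ?X"
      using tri[OF X vsubspace_perp stX stP] v w by auto
    have zV: "z \<in> V" "\<beta> z v = 0" "\<beta> z w = 0" using z(1) unfolding perp_def by auto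
    obtain s where s: "q (z + s \<cdot>\<^sub>v w) = 0" using exists_scaled_sum_singular[OF w(1) zV(1) False zV(3)] by blast
    let ?u = "z + s \<cdot>\<^sub>v w"
    have u: "?u \<in> V" "\<beta> ?u v = 0" "\<beta> ?u w = 0" using zV w v by auto
    have une: "?u \<noteq> c \<cdot>\<^sub>v v" for c
    proof
      assume "?u = c \<cdot>\<^sub>v v"
      then have "z = c \<cdot>\<^sub>v v + s \<cdot>\<^sub>v w"
        using zV(1) w(1) v(1) vec_add_self_left(4)[of "s \<cdot>\<^sub>v w" z] by (metis add_carrier_vec assoc_add_vec right_zero_vec smult_carrier_vec vec_add_self)
      then show False using z(2) PP by blast
    qed
    have "\<exists>c d. A *\<^sub>v ?u = c \<cdot>\<^sub>v ?u + d \<cdot>\<^sub>v v" if A: "A \<in> H" for A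
    proof -
      obtain c1 c d where "A *\<^sub>v z + c1 \<cdot>\<^sub>v z = c \<cdot>\<^sub>v v + d \<cdot>\<^sub>v w"
        using z(3) A unfolding PP by blast
      then have 1: "A *\<^sub>v z = c1 \<cdot>\<^sub>v z + (c \<cdot>\<^sub>v v + d \<cdot>\<^sub>v w)" using move[OF _ _ zV(1)] HO[OF A] zV(1) by (metis mat_V)
      obtain e f where 2: "A *\<^sub>v w = e \<cdot>\<^sub>v w + f \<cdot>\<^sub>v v" using w(4) A by blast
      define \<delta> where "\<delta> = d + s * e + c1 * s"
      define \<epsilon> where "\<epsilon> = c + s * f"
      have eq: "A *\<^sub>v ?u = c1 \<cdot>\<^sub>v ?u + (\<delta> \<cdot>\<^sub>v w + \<epsilon> \<cdot>\<^sub>v v)"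
      proof -
        have "A *\<^sub>v ?u = (c1 \<cdot>\<^sub>v z + (c \<cdot>\<^sub>v v + d \<cdot>\<^sub>v w)) + s \<cdot>\<^sub>v (e \<cdot>\<^sub>v w + f \<cdot>\<^sub>v v)"
          using HO[OF A] w(1) zV(1) 1 2 by simp
        also have "\<dots> = c1 \<cdot>\<^sub>v ?u + (\<delta> \<cdot>\<^sub>v w + \<epsilon> \<cdot>\<^sub>v v)"
          unfolding \<delta>_def \<epsilon>_def using w(1) v(1) zV(1) by (intro eq_vecI) (auto simp: algebra_simps)
        finally show ?thesis .
      qed
      have y: "\<delta> \<cdot>\<^sub>v w + \<epsilon> \<cdot>\<^sub>v v \<in> V" using v w by simp
      have "0 = q (A *\<^sub>v ?u)" using Or_q[OF HO(1)[OF A] u(1)] s by simp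
      also have "\<dots> = q (c1 \<cdot>\<^sub>v ?u) + q (\<delta> \<cdot>\<^sub>v w + \<epsilon> \<cdot>\<^sub>v v) + \<beta> (c1 \<cdot>\<^sub>v ?u) (\<delta> \<cdot>\<^sub>v w + \<epsilon> \<cdot>\<^sub>v v)"
        unfolding eq by (rule q_add) (use u(1) y in auto)
      also have "q (c1 \<cdot>\<^sub>v ?u) = 0" unfolding q_smult[OF u(1)] s by simp
      also have "\<beta> (c1 \<cdot>\<^sub>v ?u) (\<delta> \<cdot>\<^sub>v w + \<epsilon> \<cdot>\<^sub>v v) = 0"
        unfolding bil_smult_left[OF u(1) y] using bil_add_right[OF _ _ u(1), of "\<delta> \<cdot>\<^sub>v w" "\<epsilon> \<cdot>\<^sub>v v"]
          bil_smult_right[OF w(1) u(1)] bil_smult_right[OF v(1) u(1)] u v w by simp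
      also have "q (\<delta> \<cdot>\<^sub>v w + \<epsilon> \<cdot>\<^sub>v v) = \<delta>\<^sup>2 * q w" using v w by (simp add: q_add)
      finally have "\<delta> = 0" using False by simp
      then have "A *\<^sub>v ?u = c1 \<cdot>\<^sub>v ?u + \<epsilon> \<cdot>\<^sub>v v" using eq v w by simp
      then show ?thesis by blast
    qed
    moreover have "\<beta> v ?u = 0" using u bil_sym[OF v(1) u(1)] by simp
    ultimately show ?thesis using that[OF v u(1) une s] by blast
  qed
qed

subsection \<open>Spherical unipotent classes consist of involutions\<close>

lemma bil_conj:
  assumes "b \<in> Or" "y \<in> Or" "u \<in> V" "w \<in> V"
  shows "\<beta> u ((b * y * minv b) *\<^sub>v w) = \<beta> (minv b *\<^sub>v u) (y *\<^sub>v (minv b *\<^sub>v w))"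
  using assms minv(1)[OF assms(1)] bil_minv[OF assms(1,3)] by (simp add: Or_mult)

text \<open>The coefficients are \<open>F' x0\<close> and \<open>F x0\<close>, read off at the base
  point: a common factor keeps the combination zero on the orbit, and density extends it. If both
  values vanish, \<open>F\<close> alone already vanishes on the class.\<close>

lemma semi_invariants_proportional:
  assumes dense: "\<forall>f. polynomial_fun m f \<longrightarrow> (\<forall>b\<in>B. f (b * x0 * minv b) = 0) \<longrightarrow> (\<forall>y\<in>C. f y = 0)"
    and B: "B \<subseteq> Or" and x0: "x0 \<in> Or" and C: "C \<subseteq> Or" and F: "pf F" "pf F'"
    and semi: "\<And>b. b \<in> B \<Longrightarrow> \<exists>c. F (b * x0 * minv b) = c * F x0 \<and> F' (b * x0 * minv b) = c * F' x0"
  obtains s t where "(s, t) \<noteq> (0, 0)" "\<And>y. y \<in> C \<Longrightarrow> s * F y + t * F' y = 0"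
proof -
  have vanish: "\<And>y. y \<in> C \<Longrightarrow> s * F y + t * F' y = 0" if st: "s * F x0 + t * F' x0 = 0" for s t
  proof -
    have "pf (\<lambda>y. s * F y + t * F' y)" by (intro pf_add pf_mult pf_const F)
    then obtain f where f: "polynomial_fun m f" "\<forall>y\<in>Or. s * F y + t * F' y = f y" unfolding pf_def by blast
    have "f (b * x0 * minv b) = 0" if b: "b \<in> B" for b
    proof -
      have "b * x0 * minv b \<in> Or" using b B x0 Or_mult minv(1) by blast
      moreover obtain c where "F (b * x0 * minv b) = c * F x0" "F' (b * x0 * minv b) = c * F' x0" using semi[OF b] by blast
      moreover have "s * (c * F x0) + t * (c * F' x0) = c * (s * F x0 + t * F' x0)" for c by (simp add: algebra_simps)
      ultimately show ?thesis using f(2) st by (metis mult_zero_right)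
    qed
    then have "\<forall>y\<in>C. f y = 0" using dense f(1) by blast
    then show "\<And>y. y \<in> C \<Longrightarrow> s * F y + t * F' y = 0" using f(2) C by (metis subsetD)
  qed
  show ?thesis
  proof (cases "F x0 = 0 \<and> F' x0 = 0")
    case True
    then show ?thesis using that[of 1 0] vanish[of 1 0] by simp
  next
    case False
    have "F' x0 * F x0 + F x0 * F' x0 = 0" by (simp add: mult.commute)
    then show ?thesis using that[of "F' x0" "F x0"] vanish[of "F' x0" "F x0"] False by auto
  qed
qed

lemma SO_move_singular_vector:
  assumes "u \<in> V" "u \<noteq> 0\<^sub>v m" "q u = 0" "v \<in> V" "v \<noteq> 0\<^sub>v m" "q v = 0"
  obtains A where "A \<in> SO" "A *\<^sub>v u = v"
proof -
  obtain g where g: "frame g" "g 0 = u" using exists_frame_vector[OF assms(1-3)] by blast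
  obtain h where h: "frame h" "h 0 = v" using exists_frame_vector[OF assms(4-6)] by blast
  obtain A where A: "A \<in> SO" "\<And>i. i < n - 1 \<Longrightarrow> A *\<^sub>v g i = h i" using SO_transitive[OF g(1) h(1)] by blast
  show ?thesis using that[OF A(1)] A(2)[of 0] g(2) h(2) n3 by simp
qed

lemma SO_move_singular_pair:
  assumes "u \<in> V" "u \<noteq> 0\<^sub>v m" "q u = 0" "u' \<in> V" "q u' = 0" "\<beta> u u' = 0" "\<And>c. u' \<noteq> c \<cdot>\<^sub>v u"
    "v \<in> V" "v \<noteq> 0\<^sub>v m" "q v = 0" "v' \<in> V" "q v' = 0" "\<beta> v v' = 0" "\<And>c. v' \<noteq> c \<cdot>\<^sub>v v"
  obtains A where "A \<in> SO" "A *\<^sub>v u = v" "A *\<^sub>v u' = v'"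
proof -
  obtain g where g: "frame g" "g 0 = u" "g 1 = u'" using exists_frame_pair[OF assms(1-7)] by blast
  obtain h where h: "frame h" "h 0 = v" "h 1 = v'" using exists_frame_pair[OF assms(8-14)] by blast
  obtain A where A: "A \<in> SO" "\<And>i. i < n - 1 \<Longrightarrow> A *\<^sub>v g i = h i" using SO_transitive[OF g(1) h(1)] by blast
  show ?thesis using that[OF A(1)] A(2)[of 0] A(2)[of 1] g h n3 by simp
qed

theorem spherical_imp_involution:
  assumes C: "C \<in> conjugacy_classes G" and sph: "spherical m G C" and x: "x \<in> C" and uni: "unipotent m x"
    and v: "v \<in> V"
  shows "x *\<^sub>v (x *\<^sub>v v) = v"
proof -
  have CSO: "C \<subseteq> SO" using class_eq(1)[OF C] by blast
  then have CO: "C \<subseteq> Or" using SO_subset by blast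
  obtain r where r: "(x - 1\<^sub>m m) ^\<^sub>m r = 0\<^sub>m m m" using uni unfolding unipotent_def by blast
  have xO: "x \<in> Or" using x CO by blast
  interpret U: unipotent_isometry n m q x r by unfold_locales (rule xO, rule r)
  obtain B x0 where B: "borel_subgroup m G B" and x0: "x0 \<in> C" and
    dense: "\<forall>f. polynomial_fun m f \<longrightarrow> (\<forall>b\<in>B. f (b * x0 * minv b) = 0) \<longrightarrow> (\<forall>y\<in>C. f y = 0)"
    using sph unfolding spherical_iff[OF C] by blast
  have ccs: "closed_connected_solvable m G B" using B unfolding borel_subgroup_def by blast
  note BD = closed_connected_solvableD[OF ccs]
  have BO: "B \<subseteq> Or" using BD(2) SO_subset by blast
  have Bi: "minv b \<in> B" if "b \<in> B" for b using subgroup.m_inv_closed[OF BD(1) that] unfolding minv_def .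
  have x0O: "x0 \<in> Or" using x0 CO by blast
  obtain v1 v2 where v1: "v1 \<in> V" "v1 \<noteq> 0\<^sub>v m" "q v1 = 0" "\<And>A. A \<in> B \<Longrightarrow> \<exists>c. A *\<^sub>v v1 = c \<cdot>\<^sub>v v1"
    and v2: "v2 \<in> V" "\<And>c. v2 \<noteq> c \<cdot>\<^sub>v v1" "q v2 = 0" "\<beta> v1 v2 = 0"
      "\<And>A. A \<in> B \<Longrightarrow> \<exists>c d. A *\<^sub>v v2 = c \<cdot>\<^sub>v v2 + d \<cdot>\<^sub>v v1"
    using triangulable_singular_flag[OF BO Bi BD(3)] by blast
  have pfa: "pf (\<lambda>y. \<beta> u (y *\<^sub>v w))" if "u \<in> V" "w \<in> V" for u w
    by (intro pf_bil pfv_mult pfm_id pfv_const that)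
  have conj_mem: "A * x * minv A \<in> C" if "A \<in> SO" for A using class_eq(2)[OF C x] that by blast
  let ?a = "\<lambda>y i j. \<beta> i (y *\<^sub>v j)"
  obtain s t where st: "(s, t) \<noteq> (0, 0)" "\<And>y. y \<in> C \<Longrightarrow> s * ?a y v1 v1 + t * \<beta> v1 (y *\<^sub>v (y *\<^sub>v v1)) = 0"
  proof (rule semi_invariants_proportional[OF dense BO x0O CO])
    show "pf (\<lambda>y. \<beta> v1 (y *\<^sub>v v1))" by (rule pfa[OF v1(1) v1(1)])
    show "pf (\<lambda>y. \<beta> v1 (y *\<^sub>v (y *\<^sub>v v1)))" by (intro pf_bil pfv_mult pfm_id pfv_const v1(1))
    fix b assume b: "b \<in> B"
    then have bO: "b \<in> Or" using BO by blast
    \<comment> \<open>Both functions have the weight \<open>c\<^sup>2\<close>, since squaring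
      commutes with conjugation.\<close>
    obtain c where c: "minv b *\<^sub>v v1 = c \<cdot>\<^sub>v v1" using v1(4)[OF Bi[OF b]] by blast
    have 1: "\<beta> v1 ((b * x0 * minv b) *\<^sub>v v1) = c\<^sup>2 * \<beta> v1 (x0 *\<^sub>v v1)"
      unfolding bil_conj[OF bO x0O v1(1) v1(1)] c using v1(1) x0O Or_carrier[OF x0O] by (simp add: power2_eq_square)
    have "(b * x0 * minv b) *\<^sub>v ((b * x0 * minv b) *\<^sub>v v1) = (b * (x0 * x0) * minv b) *\<^sub>v v1"
      using bO x0O minv(1)[OF bO] v1(1) by (simp add: Or_mult)
    then have "\<beta> v1 ((b * x0 * minv b) *\<^sub>v ((b * x0 * minv b) *\<^sub>v v1)) = c\<^sup>2 * \<beta> v1 (x0 *\<^sub>v (x0 *\<^sub>v v1))"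
      using bil_conj[OF bO Or_mult[OF x0O x0O] v1(1) v1(1)] v1(1) x0O Or_carrier[OF x0O] unfolding c
      by (simp add: power2_eq_square Or_mult)
    then show "\<exists>c. \<beta> v1 ((b * x0 * minv b) *\<^sub>v v1) = c * \<beta> v1 (x0 *\<^sub>v v1) \<and>
       \<beta> v1 ((b * x0 * minv b) *\<^sub>v ((b * x0 * minv b) *\<^sub>v v1)) = c * \<beta> v1 (x0 *\<^sub>v (x0 *\<^sub>v v1))"
      using 1 by blast
  qed blast
  \<comment> \<open>\<open>?D\<close> is the determinant of the bilinear form with entries
    \<open>a\<^sub>i\<^sub>j\<close> on the plane, \<open>?E\<close> the square of its symmetrised
    entry \<open>a\<^sub>1\<^sub>2 + a\<^sub>2\<^sub>1\<close>. A triangular change of basis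
    multiplies both by the square of its determinant \<open>c * d\<close>.\<close>
  let ?D = "\<lambda>y. ?a y v1 v1 * ?a y v2 v2 + ?a y v1 v2 * ?a y v2 v1"
  let ?E = "\<lambda>y. (?a y v1 v2 + ?a y v2 v1)\<^sup>2"
  obtain s' t' where st': "(s', t') \<noteq> (0, 0)" "\<And>y. y \<in> C \<Longrightarrow> s' * ?D y + t' * ?E y = 0"
  proof (rule semi_invariants_proportional[OF dense BO x0O CO])
    show "pf ?D" by (intro pf_add pf_mult pfa v1(1) v2(1))
    show "pf ?E" by (intro pf_add pf_power pfa v1(1) v2(1))
    fix b assume b: "b \<in> B"
    then have bO: "b \<in> Or" using BO by blast
    obtain c d e where c: "minv b *\<^sub>v v1 = c \<cdot>\<^sub>v v1" "minv b *\<^sub>v v2 = d \<cdot>\<^sub>v v2 + e \<cdot>\<^sub>v v1"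
      using v1(4)[OF Bi[OF b]] v2(5)[OF Bi[OF b]] by blast
    let ?y = "b * x0 * minv b"
    note bc = bil_conj[OF bO x0O]
    have a11: "?a ?y v1 v1 = c * c * ?a x0 v1 v1"
      unfolding bc[OF v1(1) v1(1)] c using v1(1) x0O Or_carrier[OF x0O] by simp
    have a12: "?a ?y v1 v2 = c * (d * ?a x0 v1 v2 + e * ?a x0 v1 v1)"
      unfolding bc[OF v1(1) v2(1)] c using v1(1) v2(1) x0O Or_carrier[OF x0O] by (simp add: algebra_simps)
    have a21: "?a ?y v2 v1 = c * (d * ?a x0 v2 v1 + e * ?a x0 v1 v1)"
      unfolding bc[OF v2(1) v1(1)] c using v1(1) v2(1) x0O Or_carrier[OF x0O] by (simp add: algebra_simps)
    have a22: "?a ?y v2 v2 = d * (d * ?a x0 v2 v2 + e * ?a x0 v2 v1) + e * (d * ?a x0 v1 v2 + e * ?a x0 v1 v1)"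
      unfolding bc[OF v2(1) v2(1)] c using v1(1) v2(1) x0O Or_carrier[OF x0O] by (simp add: algebra_simps)
    have "?D ?y = (c * d)\<^sup>2 * ?D x0" unfolding a11 a12 a21 a22
      by (simp add: algebra_simps power2_eq_square)
    moreover have "?E ?y = (c * d)\<^sup>2 * ?E x0" unfolding a12 a21
      by (simp add: algebra_simps power2_eq_square)
    ultimately show "\<exists>c. ?D ?y = c * ?D x0 \<and> ?E ?y = c * ?E x0" by blast
  qed blast
  show ?thesis
  proof (rule U.involution_criterion[OF st(1) _ st'(1) _ v])
    fix w assume w: "w \<in> V" "q w = 0"
    show "s * \<beta> w (x *\<^sub>v w) + t * \<beta> w (x *\<^sub>v (x *\<^sub>v w)) = 0"
    proof (cases "w = 0\<^sub>v m")
      case False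
      obtain A where A: "A \<in> SO" "A *\<^sub>v w = v1" using SO_move_singular_vector[OF w(1) False w(2) v1(1-3)] by blast
      have AO: "A \<in> Or" using A SO_subset by blast
      have Aw: "minv A *\<^sub>v v1 = w" using minv_vec(2)[OF AO w(1)] A(2) by simp
      have 1: "\<beta> v1 ((A * x * minv A) *\<^sub>v v1) = \<beta> w (x *\<^sub>v w)"
        unfolding bil_conj[OF AO xO v1(1) v1(1)] Aw ..
      have "(A * x * minv A) *\<^sub>v ((A * x * minv A) *\<^sub>v v1) = (A * (x * x) * minv A) *\<^sub>v v1"
        using AO xO minv(1)[OF AO] v1(1) by (simp add: Or_mult)
      then have 2: "\<beta> v1 ((A * x * minv A) *\<^sub>v ((A * x * minv A) *\<^sub>v v1)) = \<beta> w (x *\<^sub>v (x *\<^sub>v w))"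
        using bil_conj[OF AO Or_mult[OF xO xO] v1(1) v1(1)] xO w(1) unfolding Aw by simp
      show ?thesis using st(2)[OF conj_mem[OF A(1)]] unfolding 1 2 .
    qed (use xO mat_zero[OF Or_carrier[OF xO]] in simp)
  next
    fix u w assume uw: "u \<in> V" "w \<in> V" "q u = 0" "q w = 0" "\<beta> u w = 0"
    show "s' * (\<beta> u (x *\<^sub>v u) * \<beta> w (x *\<^sub>v w) + \<beta> u (x *\<^sub>v w) * \<beta> w (x *\<^sub>v u)) +
      t' * (\<beta> u (x *\<^sub>v w) + \<beta> w (x *\<^sub>v u))\<^sup>2 = 0"
    proof (cases "u = 0\<^sub>v m \<or> (\<exists>c. w = c \<cdot>\<^sub>v u)")
      case True
      then show ?thesis
      proof
        assume "\<exists>c. w = c \<cdot>\<^sub>v u"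
        then obtain c where "w = c \<cdot>\<^sub>v u" by blast
        then show ?thesis using uw(1) xO Or_carrier[OF xO] by (simp add: mult_ac)
      qed (use uw xO mat_zero[OF Or_carrier[OF xO]] in simp)
    next
      case False
      obtain A where A: "A \<in> SO" "A *\<^sub>v u = v1" "A *\<^sub>v w = v2"
        using SO_move_singular_pair[OF uw(1) _ uw(3,2,4,5) _ v1(1-3) v2(1,3,4,2)] False by blast
      have AO: "A \<in> Or" using A SO_subset by blast
      have Au: "minv A *\<^sub>v v1 = u" "minv A *\<^sub>v v2 = w"
        using minv_vec(2)[OF AO uw(1)] minv_vec(2)[OF AO uw(2)] A by auto
      show ?thesis using st'(2)[OF conj_mem[OF A(1)]]
        unfolding bil_conj[OF AO xO v1(1) v1(1)] bil_conj[OF AO xO v1(1) v2(1)]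
          bil_conj[OF AO xO v2(1) v1(1)] bil_conj[OF AO xO v2(1) v2(1)] Au .
    qed
  qed
qed

section \<open>The stabiliser of a full singular flag is a Borel subgroup\<close>

text \<open>\<open>flag g i\<close> is the span of \<open>g 0, \<dots>, g (i - 1)\<close>, and \<open>V\<close> if \<open>i \<ge> m\<close>.\<close>

definition flag :: "(nat \<Rightarrow> 'k vec) \<Rightarrow> nat \<Rightarrow> 'k vec set" where
  "flag g i = perp {g j | j. j < m \<and> i + j < m}"

lemma flag_set: "frame g \<Longrightarrow> {g j | j. j < m \<and> i + j < m} \<subseteq> V"
  by auto

lemma flagI: "v \<in> V \<Longrightarrow> (\<And>j. j < m \<Longrightarrow> i + j < m \<Longrightarrow> \<beta> v (g j) = 0) \<Longrightarrow> v \<in> flag g i"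
  unfolding flag_def perp_def by auto

lemma flag_V: "v \<in> flag g i \<Longrightarrow> v \<in> V"
  unfolding flag_def perp_def by auto

lemma flag_bil:
  assumes "v \<in> flag g i" "i + j < m" shows "\<beta> v (g j) = 0"
proof -
  have "g j \<in> {g j | j. j < m \<and> i + j < m}" using assms(2) by auto
  then show ?thesis using assms(1) unfolding flag_def perp_def by blast
qed

lemma vsubspace_flag: "frame g \<Longrightarrow> vsubspace m (flag g i)"
  unfolding flag_def by (rule vsubspace_perp[OF flag_set])

lemma flag_add: "frame g \<Longrightarrow> u \<in> flag g i \<Longrightarrow> v \<in> flag g i \<Longrightarrow> u + v \<in> flag g i"
  and flag_smult: "frame g \<Longrightarrow> u \<in> flag g i \<Longrightarrow> c \<cdot>\<^sub>v u \<in> flag g i"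
  and flag_zero: "frame g \<Longrightarrow> 0\<^sub>v m \<in> flag g i"
  using vsubspace_flag unfolding vsubspace_def by blast+

lemma flag_mono: "v \<in> flag g i \<Longrightarrow> i \<le> j \<Longrightarrow> v \<in> flag g j"
  by (rule flagI) (auto intro: flag_V flag_bil)

lemma flag_0: "frame g \<Longrightarrow> v \<in> flag g 0 \<Longrightarrow> v = 0\<^sub>v m"
  by (rule frame_eqI_0) (auto intro: flag_V flag_bil)

lemma flag_top: "v \<in> V \<Longrightarrow> v \<in> flag g m"
  by (rule flagI) auto

lemma frame_in_flag:
  assumes "frame g" "i < m" "i < k" shows "g i \<in> flag g k"
proof (rule flagI)
  fix j assume "j < m" "k + j < m"
  then show "\<beta> (g i) (g j) = 0" using assms by (simp add: frame_bil)
qed (use assms in simp)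

lemma flag_decompose:
  assumes g: "frame g" and i: "i < m" and v: "v \<in> flag g (Suc i)"
  obtains w where "w \<in> flag g i" "v = \<beta> v (g (m - 1 - i)) \<cdot>\<^sub>v g i + w"
proof -
  let ?c = "\<beta> v (g (m - 1 - i))"
  define w where "w = ?c \<cdot>\<^sub>v g i + v"
  have vV: "v \<in> V" and gi: "g i \<in> V" using flag_V[OF v] g i by auto
  have "w \<in> flag g i"
  proof (rule flagI)
    show "w \<in> V" unfolding w_def using vV gi by simp
    fix j assume j: "j < m" "i + j < m"
    show "\<beta> w (g j) = 0"
    proof (cases "i + j = m - 1")
      case True
      then have "j = m - 1 - i" by simp
      then show ?thesis unfolding w_def using vV gi j frame_bil[OF g i j(1)] True g by simp
    next
      case False
      then have "Suc i + j < m" using j by simp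
      then show ?thesis unfolding w_def using vV gi j frame_bil[OF g i j(1)] False g flag_bil[OF v] by simp
    qed
  qed
  moreover have "v = ?c \<cdot>\<^sub>v g i + w" unfolding w_def using vV gi by simp
  ultimately show ?thesis using that by blast
qed

lemma flag_bil_zero:
  assumes g: "frame g" and v: "v \<in> flag g i" and t: "t \<in> V" "\<And>j. j < i \<Longrightarrow> j < m \<Longrightarrow> \<beta> (g j) t = 0"
  shows "\<beta> v t = 0"
proof -
  have "\<beta> v t = (\<Sum>k<m. \<beta> v (g (m - 1 - k)) * \<beta> t (g k))"
    by (rule bil_expand[OF g flag_V[OF v] t(1)])
  also have "\<dots> = 0"
  proof (intro sum.neutral ballI)
    fix k assume "k \<in> {..<m}"
    then have k: "k < m" by simp
    show "\<beta> v (g (m - 1 - k)) * \<beta> t (g k) = 0"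
    proof (cases "k < i")
      case True
      then show ?thesis using t(2)[OF True k] bil_sym[OF t(1) frame_carrier[OF g k]] by simp
    next
      case False
      then have "i + (m - 1 - k) < m" using k by simp
      then show ?thesis using flag_bil[OF v] by simp
    qed
  qed
  finally show ?thesis .
qed

lemma flag_isotropic:
  assumes g: "frame g" and uv: "u \<in> flag g i" "v \<in> flag g i" and i: "i \<le> n"
  shows "\<beta> u v = 0"
proof (rule flag_bil_zero[OF g uv(1) flag_V[OF uv(2)]])
  fix j assume j: "j < i" "j < m"
  then have "i + j < m" using i m_def by simp
  then show "\<beta> (g j) v = 0"
    using flag_bil[OF uv(2)] bil_sym[OF flag_V[OF uv(2)] frame_carrier[OF g j(2)]] by simp
qed

text \<open>Isotropy alone does not give singularity in characteristic two, so the flag is built up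
  one singular frame vector at a time.\<close>

lemma flag_singular:
  assumes g: "frame g" and i: "i \<le> n" and v: "v \<in> flag g i"
  shows "q v = 0"
  using i v
proof (induction i arbitrary: v)
  case 0
  have "v = 0\<^sub>v m" by (rule flag_0[OF g 0(2)])
  then show ?case by (simp only: q_zero)
next
  case (Suc i)
  have im: "i < m" using Suc.prems(1) m_def by simp
  obtain w where w: "w \<in> flag g i" "v = \<beta> v (g (m - 1 - i)) \<cdot>\<^sub>v g i + w"
    using flag_decompose[OF g im Suc.prems(2)] by blast
  define c where "c = \<beta> v (g (m - 1 - i))"
  have V: "w \<in> V" "g i \<in> V" using flag_V[OF w(1)] g im by auto
  have "q w = 0" using Suc.IH[OF _ w(1)] Suc.prems(1) by simp
  moreover have "\<beta> (g i) w = 0"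
    using flag_isotropic[OF g frame_in_flag[OF g im lessI] flag_mono[OF w(1)] Suc.prems(1)] by simp
  ultimately have "q (c \<cdot>\<^sub>v g i + w) = 0" using V frame_q[OF g im] by (simp add: q_add)
  then show ?case using w(2) unfolding c_def by simp
qed

lemma Bor_flag:
  assumes g: "frame g" and A: "A \<in> Bor g" and v: "v \<in> flag g i"
  shows "A *\<^sub>v v \<in> flag g i"
proof (rule flagI)
  note AO = Bor_Or[OF A]
  show "A *\<^sub>v v \<in> V" using AO flag_V[OF v] by simp
  fix j assume j: "j < m" "i + j < m"
  have V: "minv A *\<^sub>v g j \<in> V" using minv(1)[OF AO] g j by simp
  have "\<beta> (A *\<^sub>v v) (g j) = \<beta> v (minv A *\<^sub>v g j)"
    using Or_bil[OF AO flag_V[OF v] V] AO g j by simp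
  also have "\<dots> = 0"
  proof (rule flag_bil_zero[OF g v V])
    fix k assume k: "k < i" "k < m"
    then have "j + k < m - 1" using j by simp
    then show "\<beta> (g k) (minv A *\<^sub>v g j) = 0"
      using Bor_bil[OF Bor_minv[OF g A] j(1) k(2)] bil_sym[OF V frame_carrier[OF g k(2)]] by simp
  qed
  finally show "\<beta> (A *\<^sub>v v) (g j) = 0" .
qed

lemma one_Bor: "frame g \<Longrightarrow> 1\<^sub>m m \<in> Bor g"
  unfolding Bor_def using Or_one by (auto simp: frame_bil)

lemma subgroup_GLI:
  assumes "S \<subseteq> Or" "1\<^sub>m m \<in> S" "\<And>A B. A \<in> S \<Longrightarrow> B \<in> S \<Longrightarrow> A * B \<in> S" "\<And>A. A \<in> S \<Longrightarrow> minv A \<in> S"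
  shows "subgroup S (GL m)"
proof (rule subgroup.intro)
  show "S \<subseteq> carrier (GL m)" using assms(1) Or_GL by blast
qed (use assms(2-4) in \<open>auto simp: minv_def\<close>)

text \<open>The filtration of the flag stabiliser by depth; commutators increase the depth, so the
  stabiliser is solvable.\<close>

definition unip :: "(nat \<Rightarrow> 'k vec) \<Rightarrow> nat \<Rightarrow> 'k mat set" where
  "unip g k = {A \<in> Bor g. \<forall>i. \<forall>v\<in>flag g i. A *\<^sub>v v + v \<in> flag g (i - k)}"

lemma subgroup_unip:
  assumes g: "frame g" shows "subgroup (unip g k) (GL m)"
proof (rule subgroup_GLI)
  show "unip g k \<subseteq> Or" unfolding unip_def using Bor_Or by blast
  show "1\<^sub>m m \<in> unip g k" unfolding unip_def
  proof (intro CollectI conjI allI ballI one_Bor[OF g])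
    fix i v assume "v \<in> flag g i"
    then have "1\<^sub>m m *\<^sub>v v + v = 0\<^sub>v m" using flag_V by auto
    then show "1\<^sub>m m *\<^sub>v v + v \<in> flag g (i - k)" using flag_zero[OF g] by simp
  qed
next
  fix A B assume A: "A \<in> unip g k" and B: "B \<in> unip g k"
  then have AB: "A \<in> Bor g" "B \<in> Bor g" unfolding unip_def by auto
  note O = Bor_Or[OF AB(1)] Bor_Or[OF AB(2)]
  show "A * B \<in> unip g k" unfolding unip_def
  proof (intro CollectI conjI allI ballI Bor_mult[OF g AB])
    fix i v assume v: "v \<in> flag g i"
    then have V: "v \<in> V" by (rule flag_V)
    have "(A * B) *\<^sub>v v + v = A *\<^sub>v (B *\<^sub>v v + v) + (A *\<^sub>v v + v)"
    proof -
      have *: "a + v = (a + b) + (b + v)" if "a \<in> V" "b \<in> V" for a b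
        using that V by (intro eq_vecI) (auto simp: algebra_simps)
      show ?thesis using *[of "A *\<^sub>v (B *\<^sub>v v)" "A *\<^sub>v v"] V O Or_carrier[OF O(1)] by simp
    qed
    moreover have "B *\<^sub>v v + v \<in> flag g (i - k)" "A *\<^sub>v v + v \<in> flag g (i - k)"
      using A B v unfolding unip_def by auto
    ultimately show "(A * B) *\<^sub>v v + v \<in> flag g (i - k)"
      using flag_add[OF g] Bor_flag[OF g AB(1)] by simp
  qed
next
  fix A assume A: "A \<in> unip g k"
  then have AB: "A \<in> Bor g" unfolding unip_def by auto
  note O = Bor_Or[OF AB]
  show "minv A \<in> unip g k" unfolding unip_def
  proof (intro CollectI conjI allI ballI Bor_minv[OF g AB])
    fix i v assume v: "v \<in> flag g i"
    then have V: "v \<in> V" by (rule flag_V)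
    have "minv A *\<^sub>v (A *\<^sub>v v + v) = v + minv A *\<^sub>v v"
      using V O minv(1)[OF O] mat_add[OF Or_carrier[OF minv(1)[OF O]], of "A *\<^sub>v v" v] by simp
    also have "\<dots> = minv A *\<^sub>v v + v" by (rule comm_add_vec) (use V minv(1)[OF O] in auto)
    finally have eq: "minv A *\<^sub>v (A *\<^sub>v v + v) = minv A *\<^sub>v v + v" .
    have "A *\<^sub>v v + v \<in> flag g (i - k)" using A v unfolding unip_def by auto
    then show "minv A *\<^sub>v v + v \<in> flag g (i - k)"
      using Bor_flag[OF g Bor_minv[OF g AB]] eq by metis
  qed
qed

text \<open>For \<open>w\<close> the image of \<open>v\<close> under both inverses, the commutator
  displaces \<open>v\<close> by \<open>(A B + B A) w\<close>. At depth 0 the diagonal entries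
  commute, so one step is gained; at depth \<open>k > 0\<close> the expression is the sum of the two
  products of \<open>A + 1\<close> and \<open>B + 1\<close>, which gain \<open>2 * k\<close>
  steps.\<close>

lemma commutator_unip:
  assumes g: "frame g" and A: "A \<in> unip g k" and B: "B \<in> unip g k"
  shows "A * B * minv A * minv B \<in> unip g (Suc k)"
proof -
  have AB: "A \<in> Bor g" "B \<in> Bor g" using A B unfolding unip_def by auto
  note O = Bor_Or[OF AB(1)] Bor_Or[OF AB(2)]
  note Oi = minv(1)[OF O(1)] minv(1)[OF O(2)]
  have key: "A *\<^sub>v (B *\<^sub>v w) + B *\<^sub>v (A *\<^sub>v w) \<in> flag g (i - Suc k)" if w: "w \<in> flag g i" for w i
  proof (cases "k = 0")
    case False
    have wV: "w \<in> V" by (rule flag_V[OF w])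
    have step: "D *\<^sub>v u + u \<in> flag g (l - k)" if "D \<in> unip g k" "u \<in> flag g l" for D u l
      using that unfolding unip_def by blast
    note 1 = step[OF A step[OF B w]] step[OF B step[OF A w]]
    have *: "a + b = (a + c + (d + w)) + (b + d + (c + w))" if "a \<in> V" "b \<in> V" "c \<in> V" "d \<in> V" for a b c d
      using that wV by (intro eq_vecI) (auto simp: algebra_simps)
    have "A *\<^sub>v (B *\<^sub>v w) + B *\<^sub>v (A *\<^sub>v w) =
      (A *\<^sub>v (B *\<^sub>v w + w) + (B *\<^sub>v w + w)) + (B *\<^sub>v (A *\<^sub>v w + w) + (A *\<^sub>v w + w))"
      using *[of "A *\<^sub>v (B *\<^sub>v w)" "B *\<^sub>v (A *\<^sub>v w)" "A *\<^sub>v w" "B *\<^sub>v w"] wV O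
        mat_add[OF Or_carrier[OF O(1)], of "B *\<^sub>v w" w] mat_add[OF Or_carrier[OF O(2)], of "A *\<^sub>v w" w] by simp
    then have "A *\<^sub>v (B *\<^sub>v w) + B *\<^sub>v (A *\<^sub>v w) \<in> flag g (i - k - k)" using flag_add[OF g 1] by simp
    then show ?thesis by (rule flag_mono) (use False in simp)
  next
    case True
    show ?thesis
    proof (cases "0 < i \<and> i \<le> m")
      case False
      then consider "i = 0" | "i > m" by linarith
      then show ?thesis
      proof cases
        case 1
        then have "w = 0\<^sub>v m" using w flag_0[OF g] by simp
        then show ?thesis using mat_zero[OF Or_carrier[OF O(1)]] mat_zero[OF Or_carrier[OF O(2)]] flag_zero[OF g] by simp
      next
        case 2
        have "A *\<^sub>v (B *\<^sub>v w) + B *\<^sub>v (A *\<^sub>v w) \<in> flag g m" by (rule flag_top) (use flag_V[OF w] O in simp)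
        then show ?thesis by (rule flag_mono) (use 2 True in simp)
      qed
    next
      case True': True
      then obtain l where l: "i = Suc l" "l < m" by (cases i) auto
      have gl: "g l \<in> V" "g l \<in> flag g (Suc l)" using g l frame_in_flag[OF g l(2)] by auto
      have diag: "\<exists>c u. u \<in> flag g l \<and> D *\<^sub>v g l = c \<cdot>\<^sub>v g l + u" if "D \<in> Bor g" for D
        using flag_decompose[OF g l(2) Bor_flag[OF g that gl(2)]] by metis
      obtain a b u v where u: "u \<in> flag g l" "A *\<^sub>v g l = a \<cdot>\<^sub>v g l + u" and v: "v \<in> flag g l" "B *\<^sub>v g l = b \<cdot>\<^sub>v g l + v"
        using diag[OF AB(1)] diag[OF AB(2)] by blast
      obtain d w' where w': "w' \<in> flag g l" "w = d \<cdot>\<^sub>v g l + w'"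
        using flag_decompose[OF g l(2)] w unfolding l(1) by metis
      note FV = flag_V[OF u(1)] flag_V[OF v(1)] flag_V[OF w'(1)]
      have Bw: "B *\<^sub>v w = d \<cdot>\<^sub>v (b \<cdot>\<^sub>v g l + v) + B *\<^sub>v w'"
        unfolding w'(2) using gl FV Or_carrier[OF O(2)] v(2) by simp
      have Aw: "A *\<^sub>v w = d \<cdot>\<^sub>v (a \<cdot>\<^sub>v g l + u) + A *\<^sub>v w'"
        unfolding w'(2) using gl FV Or_carrier[OF O(1)] u(2) by simp
      have AB': "A *\<^sub>v (B *\<^sub>v w) = d \<cdot>\<^sub>v (b \<cdot>\<^sub>v (a \<cdot>\<^sub>v g l + u) + A *\<^sub>v v) + A *\<^sub>v (B *\<^sub>v w')"
        unfolding Bw using gl FV Or_carrier[OF O(1)] O u(2) by simp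
      have BA': "B *\<^sub>v (A *\<^sub>v w) = d \<cdot>\<^sub>v (a \<cdot>\<^sub>v (b \<cdot>\<^sub>v g l + v) + B *\<^sub>v u) + B *\<^sub>v (A *\<^sub>v w')"
        unfolding Aw using gl FV Or_carrier[OF O(2)] O v(2) by simp
      have *: "(d \<cdot>\<^sub>v (b \<cdot>\<^sub>v (a \<cdot>\<^sub>v x + u) + s) + y) + (d \<cdot>\<^sub>v (a \<cdot>\<^sub>v (b \<cdot>\<^sub>v x + v) + t) + z) =
        (d * b) \<cdot>\<^sub>v u + (d \<cdot>\<^sub>v s + (y + ((d * a) \<cdot>\<^sub>v v + (d \<cdot>\<^sub>v t + z))))"
        if "x \<in> V" "s \<in> V" "t \<in> V" "y \<in> V" "z \<in> V" for x s t y z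
        using that FV by (intro eq_vecI) (auto simp: algebra_simps)
      have "A *\<^sub>v (B *\<^sub>v w) + B *\<^sub>v (A *\<^sub>v w) = (d * b) \<cdot>\<^sub>v u + (d \<cdot>\<^sub>v (A *\<^sub>v v) +
        (A *\<^sub>v (B *\<^sub>v w') + ((d * a) \<cdot>\<^sub>v v + (d \<cdot>\<^sub>v (B *\<^sub>v u) + B *\<^sub>v (A *\<^sub>v w')))))"
        unfolding AB' BA' by (rule *) (use gl FV O in auto)
      also have "\<dots> \<in> flag g l"
        by (intro flag_add[OF g] flag_smult[OF g] Bor_flag[OF g AB(1)] Bor_flag[OF g AB(2)] u(1) v(1) w'(1))
      finally show ?thesis using l True by simp
    qed
  qed
  show ?thesis unfolding unip_def
  proof (intro CollectI conjI allI ballI)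
    show "A * B * minv A * minv B \<in> Bor g" by (intro Bor_mult[OF g] AB Bor_minv[OF g])
    fix i v assume v: "v \<in> flag g i"
    have vV: "v \<in> V" by (rule flag_V[OF v])
    define w where "w = minv A *\<^sub>v (minv B *\<^sub>v v)"
    have w: "w \<in> flag g i" unfolding w_def by (intro Bor_flag[OF g] Bor_minv[OF g] AB v)
    have "(A * B * minv A * minv B) *\<^sub>v v = A *\<^sub>v (B *\<^sub>v w)"
      unfolding w_def using vV O Oi by (simp add: Or_mult)
    moreover have "B *\<^sub>v (A *\<^sub>v w) = v" unfolding w_def using vV O Oi by simp
    ultimately show "(A * B * minv A * minv B) *\<^sub>v v + v \<in> flag g (i - Suc k)" using key[OF w] by simp
  qed
qed

lemma derived_series_Bor:
  assumes g: "frame g" shows "(derived (GL m) ^^ m) (Bor g) = {1\<^sub>m m}"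
proof -
  interpret GL: group "GL m :: 'k mat monoid" by (rule group_GL)
  have U0: "unip g 0 = Bor g"
    unfolding unip_def using Bor_flag[OF g] flag_add[OF g] by auto
  have sub: "(derived (GL m) ^^ k) (Bor g) \<subseteq> unip g k" for k
  proof (induction k)
    case (Suc k)
    have "derived (GL m) (unip g k) \<subseteq> unip g (Suc k)"
      unfolding derived_def
    proof (rule GL.generate_subgroup_incl[OF _ subgroup_unip[OF g]])
      show "derived_set (GL m) (unip g k) \<subseteq> unip g (Suc k)"
        using commutator_unip[OF g] unfolding minv_def by auto
    qed
    then show ?case using GL.mono_derived[OF Suc.IH] by auto
  qed (simp add: U0)
  have SB: "subgroup (Bor g) (GL m)" using subgroup_unip[OF g, of 0] U0 by simp
  have "A = 1\<^sub>m m" if A: "A \<in> unip g m" for A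
  proof (rule Or_eqI[OF g _ Or_one])
    show AO: "A \<in> Or" using A Bor_Or unfolding unip_def by blast
    fix i assume i: "i < m"
    have gV: "g i \<in> V" using g i by simp
    have "\<forall>v\<in>flag g m. A *\<^sub>v v + v \<in> flag g (m - m)" using A unfolding unip_def by blast
    then have "A *\<^sub>v g i + g i \<in> flag g 0" using flag_top[OF gV] by simp
    then have "A *\<^sub>v g i + g i = 0\<^sub>v m" by (rule flag_0[OF g])
    then show "A *\<^sub>v g i = 1\<^sub>m m *\<^sub>v g i" using vec_add_eq_0_iff[of "A *\<^sub>v g i" "g i"] AO gV by simp
  qed
  moreover have "1\<^sub>m m \<in> (derived (GL m) ^^ m) (Bor g)"
    using subgroup.one_closed[OF GL.exp_of_derived_is_subgroup[OF SB]] by simp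
  ultimately show ?thesis using sub[of m] by blast
qed

lemma subgroup_Bor: "frame g \<Longrightarrow> subgroup (Bor g) (GL m)"
  by (rule subgroup_GLI) (use Bor_Or one_Bor Bor_mult Bor_minv in blast)+

lemma Bor_subset_SO: "frame g \<Longrightarrow> Bor g \<subseteq> SO"
  by (rule connected_subset_SO[OF connected_Bor]) (use Bor_Or one_Bor in blast)+

lemma ccs_Bor:
  assumes g: "frame g" shows "closed_connected_solvable m G (Bor g)"
  unfolding closed_connected_solvable_def
proof (intro conjI)
  interpret GL: group "GL m :: 'k mat monoid" by (rule group_GL)
  interpret GG: group G by (rule group_special_orthogonal_group)
  note SB = subgroup_Bor[OF g]
  show "subgroup (Bor g) G"
  proof (rule subgroup.intro)
    show "inv\<^bsub>G\<^esub> A \<in> Bor g" if "A \<in> Bor g" for A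
      using that Bor_minv[OF g] G_inv Bor_subset_SO[OF g] by (metis subsetD)
  qed (use Bor_subset_SO[OF g] Bor_mult[OF g] one_Bor[OF g] in auto)
  show "connectedin (zariski_on m G) (Bor g)"
    using connected_Bor[OF g] Bor_subset_SO[OF g] by (simp add: connectedin_subtopology)
  define \<Phi> where "\<Phi> = {(\<lambda>A. \<beta> (A *\<^sub>v g i) (g j)) | i j. i < m \<and> j < m \<and> i + j < m - 1}"
  have "pf F" if "F \<in> \<Phi>" for F
  proof -
    obtain i j where F: "F = (\<lambda>A. \<beta> (A *\<^sub>v g i) (g j))" "i < m" "j < m" using \<open>F \<in> \<Phi>\<close> unfolding \<Phi>_def by blast
    show ?thesis unfolding F(1) by (intro pf_bil pfv_mult pfm_id pfv_const) (use F g in auto)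
  qed
  then obtain E where E: "closedin (zariski m) E" "{A \<in> SO. \<forall>F\<in>\<Phi>. F A = 0} = E \<inter> SO"
    using pf_zero_set_closed[OF _ SO_subset] by blast
  have "A \<in> Bor g \<longleftrightarrow> A \<in> {A \<in> SO. \<forall>F\<in>\<Phi>. F A = 0}" for A
  proof
    assume A: "A \<in> Bor g"
    then show "A \<in> {A \<in> SO. \<forall>F\<in>\<Phi>. F A = 0}"
      using Bor_subset_SO[OF g] Bor_bil[OF A] unfolding \<Phi>_def by auto
  next
    assume A: "A \<in> {A \<in> SO. \<forall>F\<in>\<Phi>. F A = 0}"
    have "\<beta> (A *\<^sub>v g i) (g j) = 0" if "i < m" "j < m" "i + j < m - 1" for i j
    proof -
      have "(\<lambda>A. \<beta> (A *\<^sub>v g i) (g j)) \<in> \<Phi>" unfolding \<Phi>_def using that by blast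
      then show ?thesis using A by auto
    qed
    then show "A \<in> Bor g" using A SO_subset unfolding Bor_def by auto
  qed
  then have "Bor g = E \<inter> SO" using E(2) by blast
  then show "closedin (zariski_on m G) (Bor g)" unfolding closedin_subtopology using E(1) by auto
  let ?K = "(GL m :: 'k mat monoid)\<lparr>carrier := Bor g\<rparr>"
  interpret K: group ?K by (rule subgroup.subgroup_is_group[OF SB group_GL])
  have "(derived ?K ^^ i) (Bor g) = (derived (GL m) ^^ i) (Bor g) \<and> (derived (GL m) ^^ i) (Bor g) \<subseteq> Bor g" for i
  proof (induction i)
    case (Suc i)
    then show ?case
      using GL.derived_consistent[OF _ SB, of "(derived (GL m) ^^ i) (Bor g)"]
        GL.derived_incl[OF _ SB, of "(derived (GL m) ^^ i) (Bor g)"] by simp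
  qed simp
  then have "(derived ?K ^^ m) (carrier ?K) = {\<one>\<^bsub>?K\<^esub>}" using derived_series_Bor[OF g] by simp
  then have "solvable ?K" unfolding K.solvable_iff_trivial_derived_seq by blast
  moreover have "G\<lparr>carrier := Bor g\<rparr> = ?K" unfolding G_eq by simp
  ultimately show "solvable (G\<lparr>carrier := Bor g\<rparr>)" by (simp only:)
qed

text \<open>The Siegel transformation at \<open>g a\<close> along \<open>g (m - 1 - b)\<close>: its
  quadratic term drops out because that vector is singular, and \<open>a < b\<close> makes it upper
  triangular. These are the root elements of the flag stabiliser.\<close>

lemma root_element:
  assumes g: "frame g" and ab: "a < b" "b < m" "a + b \<noteq> m - 1"
  obtains A where "A \<in> Bor g"
    "\<And>v. v \<in> V \<Longrightarrow> A *\<^sub>v v = v + (\<beta> v (g a) \<cdot>\<^sub>v g (m - 1 - b) + \<beta> v (g (m - 1 - b)) \<cdot>\<^sub>v g a)"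
proof -
  let ?b = "m - 1 - b"
  have lt: "a < m" "?b < m" "?b + a \<noteq> m - 1" using ab by auto
  have V: "g a \<in> V" "g ?b \<in> V" using g lt by auto
  have 0: "\<beta> (g ?b) (g a) = 0" using frame_bil[OF g lt(2,1)] lt(3) by simp
  obtain A where A: "A \<in> R" "\<And>v. v \<in> V \<Longrightarrow> A *\<^sub>v v = v + (\<beta> v (g a) \<cdot>\<^sub>v g ?b + (\<beta> v (g ?b) + q (g ?b) * \<beta> v (g a)) \<cdot>\<^sub>v g a)"
    using R_siegel[OF V(1) frame_q[OF g lt(1)] V(2) 0] by blast
  have A': "A *\<^sub>v v = v + (\<beta> v (g a) \<cdot>\<^sub>v g ?b + \<beta> v (g ?b) \<cdot>\<^sub>v g a)" if "v \<in> V" for v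
    using A(2)[OF that] frame_q[OF g lt(2)] by simp
  have "A \<in> Bor g" unfolding Bor_def
  proof (intro CollectI conjI allI impI)
    show "A \<in> Or" using A(1) R_Or by blast
    fix i j assume ij: "i < m" "j < m" "i + j < m - 1"
    have gi: "g i \<in> V" "g j \<in> V" using g ij by auto
    have "\<beta> (g i) (g a) * \<beta> (g ?b) (g j) = 0"
      using frame_bil[OF g ij(1) lt(1)] frame_bil[OF g lt(2) ij(2)] ij ab by auto
    moreover have "\<beta> (g i) (g ?b) * \<beta> (g a) (g j) = 0"
      using frame_bil[OF g ij(1) lt(2)] frame_bil[OF g lt(1) ij(2)] ij ab by auto
    moreover have "\<beta> (g i) (g j) = 0" using frame_bil[OF g ij(1,2)] ij(3) by simp
    ultimately show "\<beta> (A *\<^sub>v g i) (g j) = 0" unfolding A'[OF gi(1)] using gi V by auto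
  qed
  then show ?thesis using that A' by blast
qed

text \<open>Root elements force all coordinates of \<open>v\<close> modulo the flag to vanish except
  the next one. At \<open>j = n - 1\<close> the complement of the flag modulo the flag is a
  hyperbolic plane with two stable singular lines, so \<open>v\<close> may also point along
  \<open>g n\<close>; this is the second alternative, where \<open>n - 1 + 1\<close> is
  \<open>n\<close>.\<close>

lemma flag_eigenvector:
  assumes g: "frame g" and j: "j < n" and v: "v \<in> V" "v \<notin> flag g j"
    and eig: "\<And>A. A \<in> Bor g \<Longrightarrow> \<exists>c. A *\<^sub>v v + c \<cdot>\<^sub>v v \<in> flag g j"
  shows "v \<in> flag g (Suc j) \<or> (j = n - 1 \<and> (\<forall>l<m. l < n - 1 \<or> l = n - 1 + 1 \<longrightarrow> \<beta> v (g l) = 0))"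
proof -
  have jm: "j < m" using j m_def by simp
  have F: "vsubspace m (flag g j)" by (rule vsubspace_flag[OF g])
  \<comment> \<open>The displacement \<open>w\<close> of \<open>v\<close> is fixed by
    \<open>A\<close>. From \<open>w + (c + 1) v\<close> in the flag, applying \<open>A + 1\<close>
    gives \<open>(c + 1) w\<close> in it; so \<open>w\<close> lies there whether or not
    \<open>c\<close> is 1.\<close>
  have root: "\<beta> v (g a) \<cdot>\<^sub>v g (m - 1 - b) + \<beta> v (g (m - 1 - b)) \<cdot>\<^sub>v g a \<in> flag g j"
    if ab: "a < b" "b < m" "a + b \<noteq> m - 1" for a b
  proof -
    let ?b = "m - 1 - b"
    obtain A where A: "A \<in> Bor g"
      "\<And>v. v \<in> V \<Longrightarrow> A *\<^sub>v v = v + (\<beta> v (g a) \<cdot>\<^sub>v g ?b + \<beta> v (g ?b) \<cdot>\<^sub>v g a)"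
      using root_element[OF g ab] by blast
    have lt: "a < m" "?b < m" "a + ?b \<noteq> m - 1" "?b + a \<noteq> m - 1" using ab by auto
    have V: "g a \<in> V" "g ?b \<in> V" using g lt by auto
    define w where "w = \<beta> v (g a) \<cdot>\<^sub>v g ?b + \<beta> v (g ?b) \<cdot>\<^sub>v g a"
    have wV: "w \<in> V" unfolding w_def using V by simp
    have w0: "\<beta> w (g a) = 0" "\<beta> w (g ?b) = 0"
      unfolding w_def using V frame_bil[OF g lt(1,2)] frame_bil[OF g lt(2,1)] lt by auto
    have Aw: "A *\<^sub>v w = w" using A(2)[OF wV] w0 V wV by simp
    obtain c where "A *\<^sub>v v + c \<cdot>\<^sub>v v \<in> flag g j" using eig[OF A(1)] by blast
    moreover have "A *\<^sub>v v + c \<cdot>\<^sub>v v = w + (c + 1) \<cdot>\<^sub>v v"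
      unfolding A(2)[OF v(1), folded w_def] using v(1) wV by (intro eq_vecI) (auto simp: algebra_simps)
    ultimately have in1: "w + (c + 1) \<cdot>\<^sub>v v \<in> flag g j" by simp
    have "A *\<^sub>v (w + (c + 1) \<cdot>\<^sub>v v) + (w + (c + 1) \<cdot>\<^sub>v v) = (c + 1) \<cdot>\<^sub>v w"
    proof -
      have "A *\<^sub>v (w + (c + 1) \<cdot>\<^sub>v v) = w + (c + 1) \<cdot>\<^sub>v (v + w)"
        using Or_carrier[OF Bor_Or[OF A(1)]] wV v(1) Aw A(2)[OF v(1), folded w_def] by simp
      moreover have "w + (c + 1) \<cdot>\<^sub>v (v + w) + (w + (c + 1) \<cdot>\<^sub>v v) = (c + 1) \<cdot>\<^sub>v w"
        using wV v(1) by (intro eq_vecI) (auto simp: algebra_simps)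
      ultimately show ?thesis by simp
    qed
    then have in2: "(c + 1) \<cdot>\<^sub>v w \<in> flag g j"
      using flag_add[OF g Bor_flag[OF g A(1) in1] in1] by simp
    show ?thesis
    proof (cases "c + 1 = 0")
      case True
      then show ?thesis using in1 v(1) wV unfolding w_def[symmetric] True by simp
    next
      case False
      then show ?thesis using in2 vsubspace_smult_iff[OF F False wV] unfolding w_def by simp
    qed
  qed
  have coeff0: "\<beta> v (g (m - 1 - b)) = 0 \<or> a < j"
    if ab: "a < b" "b < m" "a + b \<noteq> m - 1" "m - 1 - b \<noteq> a" for a b
  proof (cases "a < j")
    case False
    let ?a = "m - 1 - a" and ?b = "m - 1 - b"
    have lt: "a < m" "?a < m" "?b < m" "j + ?a < m" "?b + ?a \<noteq> m - 1" "a + ?a = m - 1" using ab False by auto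
    have V: "g a \<in> V" "g ?a \<in> V" "g ?b \<in> V" using g lt by auto
    have "\<beta> (\<beta> v (g a) \<cdot>\<^sub>v g ?b + \<beta> v (g ?b) \<cdot>\<^sub>v g a) (g ?a) = 0"
      by (rule flag_bil[OF root[OF ab(1-3)] lt(4)])
    then show ?thesis using V frame_bil[OF g lt(3,2)] frame_bil[OF g lt(1,2)] lt by simp
  qed simp
  have most: "\<beta> v (g l) = 0" if "l < m - 1 - j" "l \<noteq> j" for l
  proof -
    have "j < m - 1 - l" "m - 1 - l < m" "j + (m - 1 - l) \<noteq> m - 1" "m - 1 - (m - 1 - l) \<noteq> j" "m - 1 - (m - 1 - l) = l"
      using that jm by auto
    then show ?thesis using coeff0[of j "m - 1 - l"] by simp
  qed
  show ?thesis
  proof (cases "j < n - 1")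
    case True
    then have "Suc j < m - 1 - j" "m - 1 - j < m" "Suc j + (m - 1 - j) \<noteq> m - 1"
      "m - 1 - (m - 1 - j) \<noteq> Suc j" "m - 1 - (m - 1 - j) = j"
      using m_def by auto
    then have vj: "\<beta> v (g j) = 0" using coeff0[of "Suc j" "m - 1 - j"] by simp
    have "v \<in> flag g (Suc j)"
    proof (rule flagI[OF v(1)])
      fix l assume "l < m" "Suc j + l < m"
      then have "l < m - 1 - j" by simp
      then show "\<beta> v (g l) = 0" using most[of l] vj by (cases "l = j") auto
    qed
    then show ?thesis ..
  next
    case False
    then have jn: "j = n - 1" "m - 1 - j = n" "n = Suc j" using j m_def by auto
    have lt: "n - 1 < n" "n - 1 < m" "n < m" "m - 1 - (n - 1) = n" using m_def n3 by auto
    \<comment> \<open>Excluding 0 and 1 ensures that \<open>c\<close> differs from its inverse, as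
      equality would mean \<open>(c + 1)\<^sup>2 = 0\<close>. The diagonal element with these two
      entries then separates \<open>g (n - 1)\<close> from \<open>g n\<close>.\<close>
    obtain c :: 'k where c: "c \<noteq> 0" "c \<noteq> 1"
    proof -
      obtain c :: 'k where "poly [:0, 1, 1:] c \<noteq> 0" using exists_poly_nonzero[of "[:0, 1, 1::'k:]"] by auto
      then have "c * (1 + c) \<noteq> 0" by simp
      moreover have "(1::'k) + 1 = 0" by (rule add_self)
      ultimately show ?thesis using that[of c] by (cases "c = 1") auto
    qed
    have cc: "c \<noteq> inverse c"
    proof
      assume "c = inverse c"
      then have "c * c + 1 = 0" using c(1) by (metis add_self right_inverse)
      moreover have "c * c + 1 = (c + 1) * (c + 1)" by (simp add: algebra_simps)
      ultimately show False using c(2) by (simp add: add_eq_0_iff2)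
    qed
    define s where "s = (\<lambda>i. if i = n - 1 then c else if i = n then inverse c else 1)"
    have s: "s i * s (m - 1 - i) = 1" if "i < m" for i
    proof -
      have "m - 1 - i = n \<longleftrightarrow> i = n - 1" "m - 1 - i = n - 1 \<longleftrightarrow> i = n" using that m_def n3 by auto
      then show ?thesis unfolding s_def using c(1) n3 by auto
    qed
    obtain D where D: "D \<in> Or" "\<And>i. i < m \<Longrightarrow> D *\<^sub>v g i = s i \<cdot>\<^sub>v g i"
      using frame_map[OF g frame_smult[of g s, OF g s]] by blast
    obtain e where e: "D *\<^sub>v v + e \<cdot>\<^sub>v v \<in> flag g j" using eig[OF diagonal_Bor[OF g D]] by blast
    have Dv: "\<beta> (D *\<^sub>v v) (g i) = inverse (s i) * \<beta> v (g i)" if i: "i < m" for i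
    proof -
      have si: "s i \<noteq> 0" using s[OF i] by auto
      have "\<beta> (D *\<^sub>v v) (D *\<^sub>v g i) = \<beta> v (g i)" using D(1) v(1) g i by simp
      then have "s i * \<beta> (D *\<^sub>v v) (g i) = \<beta> v (g i)" unfolding D(2)[OF i] using D(1) v(1) g i by simp
      then show ?thesis using si by (metis left_inverse mult.assoc mult_1)
    qed
    have "\<beta> (D *\<^sub>v v + e \<cdot>\<^sub>v v) (g n) = 0" "\<beta> (D *\<^sub>v v + e \<cdot>\<^sub>v v) (g (n - 1)) = 0"
      by (rule flag_bil[OF e]; use jn lt m_def in simp)+
    moreover have "s n = inverse c" "s (n - 1) = c" using n3 by (auto simp: s_def)
    then have "\<beta> (D *\<^sub>v v) (g n) = c * \<beta> v (g n)" "\<beta> (D *\<^sub>v v) (g (n - 1)) = inverse c * \<beta> v (g (n - 1))"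
      using Dv[OF lt(3)] Dv[OF lt(2)] by simp_all
    ultimately have *: "(c + e) * \<beta> v (g n) = 0" "(inverse c + e) * \<beta> v (g (n - 1)) = 0"
      using v(1) D(1) g lt by (simp_all add: distrib_right)
    have "\<beta> v (g n) = 0 \<or> \<beta> v (g (n - 1)) = 0"
    proof (rule ccontr)
      assume "\<not> ?thesis"
      then have "c = e" "inverse c = e" using * by (auto simp: add_eq_0_iff2)
      then show False using cc by simp
    qed
    then show ?thesis
    proof
      assume 0: "\<beta> v (g (n - 1)) = 0"
      have "v \<in> flag g (Suc j)"
      proof (rule flagI[OF v(1)])
        fix l assume l: "l < m" "Suc j + l < m"
        then have "l < m - 1 - j" by simp
        moreover have "\<beta> v (g j) = 0" unfolding jn(1) by (rule 0)
        ultimately show "\<beta> v (g l) = 0" using most[of l] by (cases "l = j") auto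
      qed
      then show ?thesis ..
    next
      assume 0: "\<beta> v (g n) = 0"
      have "\<beta> v (g l) = 0" if "l < m" "l < n - 1 \<or> l = n - 1 + 1" for l
        using that(2)
      proof
        assume l: "l < n - 1"
        then have "l < m - 1 - j" "l \<noteq> j" unfolding jn(2) using jn(1) by simp_all
        then show ?thesis by (rule most)
      next
        assume "l = n - 1 + 1"
        then have "l = n" using lt(1) by simp
        then show ?thesis using 0 by simp
      qed
      then show ?thesis using jn(1) by blast
    qed
  qed
qed

text \<open>A common eigenvector of \<open>H\<close> modulo the flag is in particular one of the
  flag stabiliser, so it is known up to the ambiguity at the last step. There \<open>H\<close> may
  at first be seen to stabilise only the other maximal totally singular subspace; being made of
  isometries, it then stabilises the intended one too.\<close>

lemma triangulable_stable_flag: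
  assumes g: "frame g" and H: "H \<subseteq> Or" "\<And>A. A \<in> H \<Longrightarrow> minv A \<in> H" "triangulable H" "Bor g \<subseteq> H"
    and j: "j \<le> n"
  shows "stable H (flag g j)"
  using j
proof (induction j)
  case 0
  have "A *\<^sub>v v \<in> flag g 0" if "A \<in> H" "v \<in> flag g 0" for A v
    using flag_0[OF g that(2)] mat_zero[OF Or_carrier] H(1) that flag_zero[OF g] by auto
  then show ?case unfolding stable_def by blast
next
  case (Suc j)
  have j: "j < n" "j < m" using Suc.prems m_def by auto
  have HO: "A \<in> Or" if "A \<in> H" for A using that H(1) by blast
  have st: "A *\<^sub>v v \<in> flag g j" if "A \<in> H" "v \<in> flag g j" for A v
    using Suc.IH Suc.prems that unfolding stable_def by auto
  let ?X = "{g i | i. i < m \<and> j + i < m}"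
  have X: "?X \<subseteq> V" by (rule flag_set[OF g])
  have VV: "vsubspace m V" unfolding vsubspace_def by auto
  have "g j \<in> V" "g j \<notin> flag g j"
  proof -
    show "g j \<in> V" using g j by simp
    have "\<beta> (g j) (g (m - 1 - j)) = 1" using frame_bil[OF g j(2), of "m - 1 - j"] j by simp
    then show "g j \<notin> flag g j" using flag_bil[of "g j" g j "m - 1 - j"] j by auto
  qed
  then have "flag g j \<subset> V" using flag_V by blast
  moreover have "stable H V" unfolding stable_def using HO by simp
  moreover have "stable H (flag g j)" unfolding stable_def using st by blast
  ultimately obtain v where v: "v \<in> V" "v \<notin> flag g j" "\<And>A. A \<in> H \<Longrightarrow> \<exists>c. A *\<^sub>v v + c \<cdot>\<^sub>v v \<in> flag g j"
    using H(3)[unfolded triangulable_def, rule_format, OF X VV] unfolding flag_def by blast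
  have eig: "\<exists>c. A *\<^sub>v v + c \<cdot>\<^sub>v v \<in> flag g j" if "A \<in> Bor g" for A using v(3) H(4) that by blast
  have split: "A *\<^sub>v v = c \<cdot>\<^sub>v v + (A *\<^sub>v v + c \<cdot>\<^sub>v v)" if "A \<in> H" for A c
    using v(1) HO[OF that] by simp
  consider "v \<in> flag g (Suc j)" | "j = n - 1" "\<forall>l<m. l < n - 1 \<or> l = n - 1 + 1 \<longrightarrow> \<beta> v (g l) = 0"
    using flag_eigenvector[OF g j(1) v(1,2) eig] by blast
  then show ?case
  proof cases
    case 1
    define d where "d = \<beta> v (g (m - 1 - j))"
    have d0: "d \<noteq> 0"
    proof
      assume "d = 0"
      moreover obtain w where "w \<in> flag g j" "v = d \<cdot>\<^sub>v g j + w"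
        using flag_decompose[OF g j(2) 1] unfolding d_def by blast
      ultimately show False using v(2) g j flag_V by simp
    qed
    show ?thesis unfolding stable_def
    proof (intro ballI)
      fix A u assume A: "A \<in> H" and u: "u \<in> flag g (Suc j)"
      have uV: "u \<in> V" by (rule flag_V[OF u])
      define e where "e = \<beta> u (g (m - 1 - j)) / d"
      define u' where "u' = e \<cdot>\<^sub>v v + u"
      have u'V: "u' \<in> V" unfolding u'_def using uV v by simp
      have "u' \<in> flag g j"
      proof (rule flagI[OF u'V])
        fix l assume l: "l < m" "j + l < m"
        show "\<beta> u' (g l) = 0"
        proof (cases "l = m - 1 - j")
          case True
          then show ?thesis unfolding u'_def using uV v(1) g l d0 by (simp add: e_def d_def)
        next
          case False
          then have "Suc j + l < m" using l by simp
          then show ?thesis unfolding u'_def using uV v(1) g l flag_bil[OF u] flag_bil[OF 1] by simp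
        qed
      qed
      then have Au': "A *\<^sub>v u' \<in> flag g (Suc j)" using flag_mono[OF st[OF A]] by simp
      obtain c where c: "A *\<^sub>v v + c \<cdot>\<^sub>v v \<in> flag g j" using v(3)[OF A] by blast
      have "A *\<^sub>v v \<in> flag g (Suc j)"
        by (subst split[OF A, of c], intro flag_add[OF g] flag_smult[OF g] 1 flag_mono[OF c]) simp
      moreover have "u = e \<cdot>\<^sub>v v + u'" unfolding u'_def using uV v(1) by simp
      then have "A *\<^sub>v u = e \<cdot>\<^sub>v (A *\<^sub>v v) + A *\<^sub>v u'" using Or_carrier[OF HO[OF A]] v(1) u'V by simp
      ultimately show "A *\<^sub>v u \<in> flag g (Suc j)" using flag_add[OF g] flag_smult[OF g] Au' by simp
    qed
  next
    case 2
    have n: "n - 1 < m" "n < m" "n - 1 + 1 = n" "Suc j = n" "n - 1 + n = m - 1" "n + (n - 1) = m - 1" "j + n = m - 1"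
      using 2 m_def n3 by auto
    have gV: "g (n - 1) \<in> V" "g n \<in> V" using g n by auto
    define b where "b = \<beta> v (g (n - 1))"
    have vn: "\<beta> v (g n) = 0" using 2(2) n by simp
    have veq: "b \<cdot>\<^sub>v g n + v \<in> flag g j"
    proof (rule flagI)
      fix l assume l: "l < m" "j + l < m"
      consider "l = n - 1" | "l = n" | "l < n - 1" using l 2(1) n by linarith
      then show "\<beta> (b \<cdot>\<^sub>v g n + v) (g l) = 0"
      proof cases
        case 1
        then show ?thesis using v(1) gV frame_bil[OF g n(2,1)] n(6) by (simp add: b_def)
      next
        case 22: 2
        then show ?thesis using v(1) gV vn by simp
      next
        case 3
        then have "n + l \<noteq> m - 1" using n by simp
        then show ?thesis using 3 v(1) gV g l frame_bil[OF g n(2) l(1)] 2(2) by simp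
      qed
    qed (use v(1) gV in simp)
    have b0: "b \<noteq> 0"
    proof
      assume "b = 0"
      then show False using veq v(1,2) gV by simp
    qed
    \<comment> \<open>Modulo the flag the image \<open>u\<close> of \<open>g (n - 1)\<close> is
      \<open>x\<close> times \<open>g (n - 1)\<close> plus \<open>y\<close> times
      \<open>g n\<close>. Singularity gives \<open>x * y = 0\<close>. The image of
      \<open>g n\<close> is a multiple of \<open>g n\<close> modulo the flag, and its product 1 with
      \<open>u\<close> shows \<open>x\<close> nonzero; hence \<open>y = 0\<close>.\<close>
    have key: "A *\<^sub>v g (n - 1) \<in> flag g n" if A: "A \<in> H" for A
    proof -
      note AO = HO[OF A]
      define u where "u = A *\<^sub>v g (n - 1)"
      have uV: "u \<in> V" unfolding u_def using AO gV by simp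
      have low: "\<beta> u (g l) = 0" if l: "l < n - 1" for l
      proof -
        have lm: "l < m" using l n by simp
        have gl: "g l \<in> V" "g l \<in> flag g j" using g lm frame_in_flag[OF g lm] l 2(1) by auto
        have "\<beta> u (g l) = \<beta> (g (n - 1)) (minv A *\<^sub>v g l)"
          unfolding u_def using Or_bil[OF AO gV(1), of "minv A *\<^sub>v g l"] AO gl minv(1)[OF AO] by simp
        also have "\<dots> = \<beta> (minv A *\<^sub>v g l) (g (n - 1))"
          using bil_sym gV(1) minv(1)[OF AO] gl by simp
        also have "\<dots> = 0" by (rule flag_bil[OF st[OF H(2)[OF A] gl(2)]]) (use n in simp)
        finally show ?thesis .
      qed
      obtain c where c: "A *\<^sub>v v + c \<cdot>\<^sub>v v \<in> flag g j" using v(3)[OF A] by blast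
      define w where "w = A *\<^sub>v g n"
      have wV: "w \<in> V" unfolding w_def using AO gV by simp
      have "w + c \<cdot>\<^sub>v g n \<in> flag g j"
      proof -
        have 1: "A *\<^sub>v (b \<cdot>\<^sub>v g n + v) + c \<cdot>\<^sub>v (b \<cdot>\<^sub>v g n + v) \<in> flag g j"
          using st[OF A veq] veq flag_add[OF g] flag_smult[OF g] by simp
        have *: "(b \<cdot>\<^sub>v x + y) + c \<cdot>\<^sub>v (b \<cdot>\<^sub>v z + v) + (y + c \<cdot>\<^sub>v v) = b \<cdot>\<^sub>v (x + c \<cdot>\<^sub>v z)"
          if "x \<in> V" "y \<in> V" "z \<in> V" for x y z
          using that v(1) by (intro eq_vecI) (auto simp: algebra_simps)
        have "A *\<^sub>v (b \<cdot>\<^sub>v g n + v) = b \<cdot>\<^sub>v w + A *\<^sub>v v"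
          unfolding w_def using Or_carrier[OF AO] gV v(1) by simp
        then have "(b \<cdot>\<^sub>v w + A *\<^sub>v v) + c \<cdot>\<^sub>v (b \<cdot>\<^sub>v g n + v) + (A *\<^sub>v v + c \<cdot>\<^sub>v v) \<in> flag g j"
          using flag_add[OF g 1 c] by simp
        then have "b \<cdot>\<^sub>v (w + c \<cdot>\<^sub>v g n) \<in> flag g j" using *[of w "A *\<^sub>v v" "g n"] wV AO v(1) gV by simp
        then show ?thesis using vsubspace_smult_iff[OF vsubspace_flag[OF g] b0] wV gV by simp
      qed
      then have wn: "\<beta> w (g n) = 0"
        using flag_bil[of "w + c \<cdot>\<^sub>v g n" g j n] n wV gV m_pos by simp
      have wl: "\<beta> w (g l) = 0" if "l < n - 1" for l
      proof -
        have lm: "l < m" "n + l \<noteq> m - 1" "j + l < m" using that n by auto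
        have "\<beta> (w + c \<cdot>\<^sub>v g n) (g l) = 0" by (rule flag_bil[OF \<open>w + c \<cdot>\<^sub>v g n \<in> flag g j\<close> lm(3)])
        then show ?thesis using wV gV g lm frame_bil[OF g n(2) lm(1)] by simp
      qed
      define x y d where "x = \<beta> u (g n)" and "y = \<beta> u (g (n - 1))" and "d = \<beta> w (g (n - 1))"
      define u' where "u' = x \<cdot>\<^sub>v g (n - 1) + (y \<cdot>\<^sub>v g n + u)"
      have u'V: "u' \<in> V" unfolding u'_def using gV uV by simp
      have u'F: "u' \<in> flag g j"
      proof (rule flagI[OF u'V])
        fix l assume l: "l < m" "j + l < m"
        consider "l = n - 1" | "l = n" | "l < n - 1" using l 2(1) n by linarith
        then show "\<beta> u' (g l) = 0"
        proof cases
          case 1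
          then show ?thesis unfolding u'_def using gV uV frame_bil[OF g n(2,1)] n by (simp add: y_def)
        next
          case 22: 2
          then show ?thesis unfolding u'_def using gV uV frame_bil[OF g n(1,2)] n by (simp add: x_def)
        next
          case 3
          then have "n + l \<noteq> m - 1" "n - 1 + l \<noteq> m - 1" using n by auto
          then show ?thesis unfolding u'_def
            using gV uV g l frame_bil[OF g n(2) l(1)] frame_bil[OF g n(1) l(1)] low[OF 3] by simp
        qed
      qed
      have ueq: "u = x \<cdot>\<^sub>v g (n - 1) + (y \<cdot>\<^sub>v g n + u')"
        unfolding u'_def using gV uV by (intro eq_vecI) (auto simp: algebra_simps)
      have u'0: "q u' = 0" "\<beta> (g (n - 1)) u' = 0" "\<beta> (g n) u' = 0"
        using flag_singular[OF g _ u'F] j flag_bil[OF u'F, of "n - 1"] flag_bil[OF u'F, of n] n m_pos bil_sym[OF u'V] gV by auto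
      have "q u = 0" unfolding u_def using AO gV frame_q[OF g n(1)] by simp
      moreover have "q u = x * y"
        by (subst ueq) (use gV u'V u'0 frame_q[OF g n(1)] frame_q[OF g n(2)] frame_bil[OF g n(1,2)] n in \<open>simp add: q_add\<close>)
      ultimately have xy: "x * y = 0" by simp
      have w0: "\<beta> w u' = 0"
      proof -
        have "\<beta> u' w = 0"
        proof (rule flag_bil_zero[OF g u'F wV])
          fix l assume "l < j" "l < m"
          then show "\<beta> (g l) w = 0" using wl[of l] 2(1) bil_sym[OF wV frame_carrier[OF g]] by simp
        qed
        then show ?thesis using bil_sym[OF wV u'V] by simp
      qed
      have "\<beta> w u = 1"
        unfolding u_def w_def using AO gV frame_bil[OF g n(2,1)] n by simp
      moreover have "\<beta> w u = x * d"
        by (subst ueq) (use gV u'V wV w0 wn in \<open>simp add: d_def\<close>)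
      ultimately have "x \<noteq> 0" by auto
      then have y0: "y = 0" using xy by simp
      show ?thesis
      proof (fold u_def, rule flagI[OF uV])
        fix l assume l: "l < m" "n + l < m"
        then have "l < n - 1 \<or> l = n - 1" using n by linarith
        then show "\<beta> u (g l) = 0" using low y0 unfolding y_def by auto
      qed
    qed
    show ?thesis unfolding stable_def
    proof (intro ballI)
      fix A u assume A: "A \<in> H" and u: "u \<in> flag g (Suc j)"
      obtain w where w: "w \<in> flag g j" "u = \<beta> u (g (m - 1 - j)) \<cdot>\<^sub>v g j + w"
        using flag_decompose[OF g j(2) u] by blast
      define c where "c = \<beta> u (g (m - 1 - j))"
      have wV: "w \<in> V" by (rule flag_V[OF w(1)])
      have "A *\<^sub>v (c \<cdot>\<^sub>v g j + w) = c \<cdot>\<^sub>v (A *\<^sub>v g j) + A *\<^sub>v w"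
        using Or_carrier[OF HO[OF A]] gV wV 2(1) by simp
      moreover have "A *\<^sub>v g j \<in> flag g (Suc j)" using key[OF A] 2(1) n by simp
      moreover have "A *\<^sub>v w \<in> flag g (Suc j)" using flag_mono[OF st[OF A w(1)]] by simp
      ultimately have "A *\<^sub>v (c \<cdot>\<^sub>v g j + w) \<in> flag g (Suc j)" using flag_add[OF g] flag_smult[OF g] by simp
      then show "A *\<^sub>v u \<in> flag g (Suc j)" using w(2) unfolding c_def by simp
    qed
  qed
qed

text \<open>The flag up to its maximal totally singular member determines the rest: by adjointness,
  the conditions on the images of the later frame vectors are those for the inverse on the earlier
  ones.\<close>

theorem borel_Bor:
  assumes g: "frame g" shows "borel_subgroup m G (Bor g)"
  unfolding borel_subgroup_def
proof (intro conjI allI impI)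
  show "closed_connected_solvable m G (Bor g)" by (rule ccs_Bor[OF g])
  fix H assume H: "closed_connected_solvable m G H \<and> Bor g \<subseteq> H"
  note HD = closed_connected_solvableD[OF conjunct1[OF H]]
  have HO: "H \<subseteq> Or" using HD(2) SO_subset by blast
  have Hi: "minv A \<in> H" if "A \<in> H" for A using subgroup.m_inv_closed[OF HD(1) that] unfolding minv_def .
  have st: "A *\<^sub>v v \<in> flag g j" if "A \<in> H" "v \<in> flag g j" "j \<le> n" for A v j
    using triangulable_stable_flag[OF g HO Hi HD(3) conjunct2[OF H] that(3)] that unfolding stable_def by blast
  have "H \<subseteq> Bor g"
  proof
    fix A assume A: "A \<in> H"
    then have AO: "A \<in> Or" using HO by blast
    have low: "\<beta> (A *\<^sub>v g i) (g j) = 0" if "A \<in> H" "i < n" "i + j < m - 1" for A i j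
    proof (rule flag_bil)
      have "i < m" using that m_def by simp
      then show "A *\<^sub>v g i \<in> flag g (Suc i)" using st[OF that(1) frame_in_flag[OF g _ lessI]] that by simp
    qed (use that in simp)
    have "\<beta> (A *\<^sub>v g i) (g j) = 0" if ij: "i < m" "j < m" "i + j < m - 1" for i j
    proof (cases "i < n")
      case False
      then have jn: "j < n" "j + i < m - 1" using ij m_def by auto
      have "\<beta> (A *\<^sub>v g i) (g j) = \<beta> (g i) (minv A *\<^sub>v g j)"
        using Or_bil[OF AO, of "g i" "minv A *\<^sub>v g j"] AO g ij minv(1)[OF AO] by simp
      also have "\<dots> = \<beta> (minv A *\<^sub>v g j) (g i)" using bil_sym g ij minv(1)[OF AO] by simp
      also have "\<dots> = 0" by (rule low[OF Hi[OF A] jn])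
      finally show ?thesis .
    qed (use low A ij in blast)
    then show "A \<in> Bor g" unfolding Bor_def using AO by blast
  qed
  then show "H = Bor g" using H by blast
qed

end

section \<open>Normal form of an involution\<close>

context char2_quadratic_space
begin

lemma hyp_le:
  assumes h: "hyp k e f" shows "k \<le> n"
proof (rule ccontr)
  assume "\<not> k \<le> n"
  then have k: "n < k" by simp
  have hn: "hyp n e f" using h k unfolding hyp_def by auto
  note e = hypD[OF h k]
  have "e n = 0\<^sub>v m"
  proof (rule frame_eqI_0[OF hyp_frame[OF hn] e(1)])
    fix j assume "j < m"
    then show "\<beta> (e n) (if j < n then e j else f (m - 1 - j)) = 0"
      using e(5,7) k m_def by auto
  qed
  then show False using e(7)[OF k] e(2) by simp
qed

end

definition swap :: "nat \<Rightarrow> nat" where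
  "swap i = (if even i then Suc i else i - 1)"

lemma swap_swap: "swap (swap i) = i"
  by (auto simp: swap_def elim!: oddE)

lemma swap_neq: "swap i \<noteq> i"
  by (auto simp: swap_def elim!: oddE)

lemma swap_less: "even k \<Longrightarrow> i < k \<Longrightarrow> swap i < k"
  by (auto simp: swap_def elim!: evenE)

locale involution = isometry n m q x
  for n m :: nat and q :: "'k::alg_closed_field vec \<Rightarrow> 'k" and x :: "'k mat" +
  assumes involutive: "v \<in> V \<Longrightarrow> x *\<^sub>v (x *\<^sub>v v) = v"
begin

lemma NN [simp]: "v \<in> V \<Longrightarrow> N (N v) = 0\<^sub>v m"
  using xx_eq_iff involutive by blast

lemma N_adjoint: "u \<in> V \<Longrightarrow> w \<in> V \<Longrightarrow> \<beta> (N u) w = \<beta> u (N w)"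
proof -
  assume V: "u \<in> V" "w \<in> V"
  have "\<beta> (x *\<^sub>v u) w = \<beta> (x *\<^sub>v (x *\<^sub>v u)) (x *\<^sub>v w)" using x V by simp
  then have "\<beta> (x *\<^sub>v u) w = \<beta> u (x *\<^sub>v w)" unfolding involutive[OF V(1)] .
  then show ?thesis unfolding N_def using x V by simp
qed

lemma bil_N_N [simp]: "u \<in> V \<Longrightarrow> w \<in> V \<Longrightarrow> \<beta> (N u) (N w) = 0"
  by (simp add: N_adjoint)

lemma N_sym: "u \<in> V \<Longrightarrow> w \<in> V \<Longrightarrow> \<beta> u (N w) = \<beta> w (N u)"
  using N_adjoint[of u w] bil_sym[of w "N u"] by simp

text \<open>The symmetric form \<open>\<beta> u (N w)\<close> thus has the diagonal values
  \<open>q (N v)\<close>, and it is alternating exactly when these vanish.\<close>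

lemma bil_N_self: "v \<in> V \<Longrightarrow> \<beta> v (N v) = q (N v)"
  using q_N[of v] x_eq[of v] by simp

lemma q_N_add: "u \<in> V \<Longrightarrow> v \<in> V \<Longrightarrow> q (N (u + v)) = q (N u) + q (N v)"
  by (simp add: q_add)

lemma N_comb:
  assumes "finite K" "\<And>i. i \<in> K \<Longrightarrow> g i \<in> V"
  shows "N (comb m K c g) = comb m K c (\<lambda>i. N (g i))"
  using assms
proof (induction K rule: finite_induct)
  case (insert i K)
  then have V: "g i \<in> V" "\<And>j. j \<in> insert i K \<Longrightarrow> g j \<in> V" "\<And>j. j \<in> insert i K \<Longrightarrow> N (g j) \<in> V" by auto
  have IH: "N (comb m K c g) = comb m K c (\<lambda>i. N (g i))" by (rule insert.IH) (use V in auto)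
  have "comb m (insert i K) c g = c i \<cdot>\<^sub>v g i + comb m K c g" by (rule comb_insert[OF insert.hyps V(2)])
  moreover have "comb m (insert i K) c (\<lambda>i. N (g i)) = c i \<cdot>\<^sub>v N (g i) + comb m K c (\<lambda>i. N (g i))"
    by (rule comb_insert[OF insert.hyps V(3)])
  ultimately show ?case using V(1) IH by simp
qed simp

text \<open>\<open>N\<close> maps the span of these pairs into itself, so the orthogonal complement
  is stable and further pairs can be split off there. The \<open>f i\<close> are determined by the
  \<open>e i\<close>, so matching the \<open>e i\<close> of two such systems matches the
  action.\<close>

definition matched :: "nat \<Rightarrow> (nat \<Rightarrow> nat) \<Rightarrow> 'k \<Rightarrow> (nat \<Rightarrow> 'k vec) \<Rightarrow> (nat \<Rightarrow> 'k vec) \<Rightarrow> bool" where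
  "matched k \<sigma> c e f \<longleftrightarrow> hyp k e f \<and> (\<forall>i<k. \<sigma> i < k \<and> \<sigma> (\<sigma> i) = i \<and> f i = N (e (\<sigma> i)) + c \<cdot>\<^sub>v e i)"

lemma matchedD:
  assumes "matched k \<sigma> c e f"
  shows "hyp k e f" "i < k \<Longrightarrow> \<sigma> i < k" "i < k \<Longrightarrow> \<sigma> (\<sigma> i) = i" "i < k \<Longrightarrow> f i = N (e (\<sigma> i)) + c \<cdot>\<^sub>v e i"
    "i < k \<Longrightarrow> N (e i) = f (\<sigma> i) + c \<cdot>\<^sub>v e (\<sigma> i)"
proof -
  show 1: "hyp k e f" "i < k \<Longrightarrow> \<sigma> i < k" "i < k \<Longrightarrow> \<sigma> (\<sigma> i) = i" "\<And>i. i < k \<Longrightarrow> f i = N (e (\<sigma> i)) + c \<cdot>\<^sub>v e i"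
    for i using assms unfolding matched_def by auto
  assume i: "i < k"
  have V: "e i \<in> V" "e (\<sigma> i) \<in> V" using hypD[OF 1(1)] 1(2) i by auto
  have *: "u = u + v + v" if "u \<in> V" "v \<in> V" for u v :: "'k vec"
    using that by (intro eq_vecI) (auto simp: algebra_simps)
  show "N (e i) = f (\<sigma> i) + c \<cdot>\<^sub>v e (\<sigma> i)"
    unfolding 1(4)[OF 1(2)[OF i]] 1(3)[OF i] by (rule *) (use V in auto)
qed

lemma orth_N:
  assumes M: "matched k \<sigma> c e f" and z: "orth k e f z" shows "orth k e f (N z)"
proof -
  note M' = matchedD[OF M]
  have zV: "z \<in> V" and z0: "\<And>i. i < k \<Longrightarrow> \<beta> z (e i) = 0" "\<And>i. i < k \<Longrightarrow> \<beta> z (f i) = 0"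
    using z unfolding orth_def by auto
  have 1: "\<beta> (N z) (e i) = 0" if i: "i < k" for i
    unfolding N_adjoint[OF zV hypD(1)[OF M'(1) i]] M'(5)[OF i]
    using zV hypD[OF M'(1) M'(2)[OF i]] z0[OF M'(2)[OF i]] by simp
  have "\<beta> (N z) (f i) = 0" if i: "i < k" for i
    unfolding M'(4)[OF i] using zV hypD(1)[OF M'(1)] M'(2)[OF i] i 1[OF i] by simp
  then show ?thesis unfolding orth_def using 1 zV by simp
qed

lemma matched_gram:
  assumes M: "matched k \<sigma> c e f" and ij: "i < k" "j < k"
  shows "\<beta> (e i) (N (e j)) = (if i = \<sigma> j then 1 else 0)"
  using matchedD(5)[OF M ij(2)] hypD[OF matchedD(1)[OF M] ij(1)] matchedD(2)[OF M ij(2)]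
    hypD(1,2)[OF matchedD(1)[OF M] matchedD(2)[OF M ij(2)]] by simp

text \<open>Adding to \<open>z\<close> the combination \<open>s\<close> of vectors
  \<open>N (e (\<sigma> i))\<close> that has the same products with the \<open>e j\<close> moves it
  into the complement, where \<open>N\<close> vanishes; and \<open>N s = 0\<close>, as
  \<open>N\<close> squares to zero.\<close>

lemma matched_rank:
  assumes M: "matched k \<sigma> c e f" and N0: "\<And>z. orth k e f z \<Longrightarrow> N z = 0\<^sub>v m"
    and z: "z \<in> V" "\<And>i. i < k \<Longrightarrow> \<beta> z (N (e i)) = 0"
  shows "N z = 0\<^sub>v m"
proof -
  note M' = matchedD[OF M]
  note H = hypD[OF M'(1)]
  define s where "s = comb m {..<k} (\<lambda>i. \<beta> z (e i)) (\<lambda>i. N (e (\<sigma> i)))"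
  have sV: "s \<in> V" unfolding s_def by simp
  have eV: "\<And>i. i \<in> {..<k} \<Longrightarrow> N (e (\<sigma> i)) \<in> V" "\<And>i. i \<in> {..<k} \<Longrightarrow> e (\<sigma> i) \<in> V" using H(1) M'(2) by auto
  have 1: "\<beta> s (e j) = \<beta> z (e j)" if j: "j < k" for j
  proof -
    have "\<beta> s (e j) = (\<Sum>i<k. \<beta> z (e i) * \<beta> (N (e (\<sigma> i))) (e j))"
      unfolding s_def using bil_comb_left[OF finite_lessThan eV(1) H(1)[OF j]] .
    also have "\<dots> = (\<Sum>i<k. if i = j then \<beta> z (e i) else 0)"
    proof (intro sum.cong refl)
      fix i assume "i \<in> {..<k}"
      then have i: "i < k" by simp
      have "\<beta> (N (e (\<sigma> i))) (e j) = \<beta> (e j) (N (e (\<sigma> i)))"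
        using bil_sym H(1)[OF j] eV(1) i by simp
      then show "\<beta> z (e i) * \<beta> (N (e (\<sigma> i))) (e j) = (if i = j then \<beta> z (e i) else 0)"
        using matched_gram[OF M j M'(2)[OF i]] M'(3)[OF i] by simp
    qed
    finally show ?thesis using j by simp
  qed
  have 2: "\<beta> s (N w) = 0" if "w \<in> V" for w
  proof -
    have "\<beta> s (N w) = (\<Sum>i<k. \<beta> z (e i) * \<beta> (N (e (\<sigma> i))) (N w))"
      unfolding s_def using bil_comb_left[OF finite_lessThan eV(1) N_V[OF that]] .
    then show ?thesis using eV(2) that by simp
  qed
  have "orth k e f (z + s)"
    unfolding orth_def
  proof (intro conjI allI impI)
    fix i assume i: "i < k"
    show 3: "\<beta> (z + s) (e i) = 0" using 1[OF i] z(1) sV H(1)[OF i] by simp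
    have "\<beta> (z + s) (N (e (\<sigma> i))) = 0" using z(2)[OF M'(2)[OF i]] 2 z(1) sV H(1)[OF M'(2)[OF i]] by simp
    then show "\<beta> (z + s) (f i) = 0"
      unfolding M'(4)[OF i] using 3 z(1) sV H(1)[OF i] H(1)[OF M'(2)[OF i]] by simp
  qed (use z(1) sV in simp)
  then have "N (z + s) = 0\<^sub>v m" by (rule N0)
  moreover have "N s = 0\<^sub>v m"
  proof (rule bil_nondegenerate)
    show "\<beta> (N s) w = 0" if "w \<in> V" for w using 2[OF that] N_adjoint[OF sV that] by simp
  qed (use sV in simp)
  ultimately show ?thesis using z(1) sV by simp
qed

text \<open>Splitting off an arbitrary vector with \<open>q (N z) \<noteq> 0\<close> may leave a nonzero alternating form on the
  complement, from which no further orthonormal vector can be chosen; \<open>z\<close> is then replaced by \<open>z + w\<close>.\<close>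

lemma orthonormal_step_aux:
  assumes M: "matched k id 1 e f" and z: "orth k e f z" "q (N z) \<noteq> 0"
  obtains u where "orth k e f u" "q (N u) \<noteq> 0"
    "(\<forall>w. orth k e f w \<and> \<beta> w (N u) = 0 \<longrightarrow> N w = 0\<^sub>v m) \<or> (\<exists>w. orth k e f w \<and> \<beta> w (N u) = 0 \<and> q (N w) \<noteq> 0)"
proof (cases "(\<forall>w. orth k e f w \<and> \<beta> w (N z) = 0 \<longrightarrow> N w = 0\<^sub>v m) \<or> (\<exists>w. orth k e f w \<and> \<beta> w (N z) = 0 \<and> q (N w) \<noteq> 0)")
  case True
  then show ?thesis using that[OF z] by blast
next
  case False
  have H: "hyp k e f" by (rule matchedD(1)[OF M])
  have V: "w \<in> V" if "orth k e f w" for w using that unfolding orth_def by simp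
  obtain w where w: "orth k e f w" "\<beta> w (N z) = 0" "N w \<noteq> 0\<^sub>v m" using False by blast
  have iso: "q (N v) = 0" if "orth k e f v" "\<beta> v (N z) = 0" for v using False that by blast
  obtain y where y: "orth k e f y" "\<beta> (N w) y = 1" using exists_orth_dual[OF H orth_N[OF M w(1)] w(3)] by blast
  note VV = V[OF w(1)] V[OF y(1)] V[OF z(1)]
  have zz: "\<beta> z (N z) = q (N z)" using bil_N_self VV by simp
  have zw: "\<beta> z (N w) = 0" using N_sym[OF VV(3,1)] w(2) by simp
  have yw: "\<beta> y (N w) = 1" using y(2) bil_sym VV by simp
  define d where "d = \<beta> y (N z) / q (N z)"
  define y' where "y' = y + d \<cdot>\<^sub>v z"
  have y': "orth k e f y'" unfolding y'_def by (intro orth_add orth_smult y(1) z(1) H)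
  have y'V: "y' \<in> V" by (rule V[OF y'])
  have y'z: "\<beta> y' (N z) = 0" unfolding y'_def using VV zz z(2) by (simp add: d_def)
  have y'w: "\<beta> y' (N w) = 1" unfolding y'_def using VV yw zw by simp
  \<comment> \<open>Chosen so that its products with \<open>N z\<close> and \<open>N w\<close>
    cancel, while \<open>q (N t) = q (N z)\<close> stays nonzero: the complement of
    \<open>z + w\<close> is not alternating.\<close>
  define t where "t = q (N z) \<cdot>\<^sub>v y' + z"
  have t: "orth k e f t" unfolding t_def by (intro orth_add orth_smult y' z(1) H)
  show ?thesis
  proof (rule that)
    show "orth k e f (z + w)" by (intro orth_add z(1) w(1) H)
    show "q (N (z + w)) \<noteq> 0" using q_N_add VV iso[OF w(1,2)] z(2) by simp
    have "\<beta> t (N (z + w)) = 0" unfolding t_def using VV y'V y'z y'w zz zw by simp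
    moreover have "q (N t) = q (N z)"
      unfolding t_def using q_N_add[of "q (N z) \<cdot>\<^sub>v y'" z] VV y'V iso[OF y' y'z] by simp
    ultimately show "(\<forall>v. orth k e f v \<and> \<beta> v (N (z + w)) = 0 \<longrightarrow> N v = 0\<^sub>v m) \<or>
        (\<exists>v. orth k e f v \<and> \<beta> v (N (z + w)) = 0 \<and> q (N v) \<noteq> 0)" using t z(2) by auto
  qed
qed

text \<open>The second hypothesis keeps the form on the complement zero or non-alternating, so the
  process never gets stuck. Scaling gives \<open>q (N u) = 1\<close>, adding a multiple of
  \<open>N u\<close> makes \<open>u\<close> singular, and then \<open>N u + u\<close> is a singular
  partner.\<close>

lemma exists_orthonormal:
  assumes "matched k id 1 e f" "(\<forall>w. orth k e f w \<longrightarrow> N w = 0\<^sub>v m) \<or> (\<exists>w. orth k e f w \<and> q (N w) \<noteq> 0)"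
  shows "\<exists>r e f. matched r id 1 e f \<and> (\<forall>w. orth r e f w \<longrightarrow> N w = 0\<^sub>v m)"
  using assms
proof (induction "n - k" arbitrary: k e f rule: less_induct)
  case less
  note M = less.prems(1)
  have H: "hyp k e f" by (rule matchedD(1)[OF M])
  have oV: "w \<in> V" if "orth k e f w" for w using that unfolding orth_def by simp
  show ?case
  proof (cases "\<forall>w. orth k e f w \<longrightarrow> N w = 0\<^sub>v m")
    case True
    then show ?thesis using M by blast
  next
    case False
    then obtain z where z: "orth k e f z" "q (N z) \<noteq> 0" using less.prems(2) by blast
    obtain u0 where u0: "orth k e f u0" "q (N u0) \<noteq> 0"
      "(\<forall>w. orth k e f w \<and> \<beta> w (N u0) = 0 \<longrightarrow> N w = 0\<^sub>v m) \<or> (\<exists>w. orth k e f w \<and> \<beta> w (N u0) = 0 \<and> q (N w) \<noteq> 0)"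
      using orthonormal_step_aux[OF M z] by blast
    obtain a where a: "a\<^sup>2 = q (N u0)" using exists_sqrt by blast
    have a0: "a \<noteq> 0" using a u0(2) by auto
    define u1 where "u1 = inverse a \<cdot>\<^sub>v u0"
    have u1: "orth k e f u1" unfolding u1_def by (intro orth_smult u0(1) H)
    note V1 = oV[OF u0(1)] oV[OF u1]
    have qN1: "q (N u1) = 1" unfolding u1_def using V1 a0 by (simp add: a[symmetric] power_inverse)
    \<comment> \<open>As \<open>q\<close> takes the value \<open>q u1 + b + b\<^sup>2\<close> at
      \<open>u1\<close> plus \<open>b\<close> times \<open>N u1\<close>, this root makes
      \<open>u\<close> singular without changing \<open>N u\<close>.\<close>
    obtain b where b: "q u1 + 1 * b + 1 * b\<^sup>2 = 0" using exists_quadratic_root[of 1] by (metis one_neq_zero)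
    define u where "u = u1 + b \<cdot>\<^sub>v N u1"
    have u: "orth k e f u" unfolding u_def by (intro orth_add orth_smult u1 orth_N[OF M u1] H)
    have uV: "u \<in> V" by (rule oV[OF u])
    have Nu: "N u = N u1" unfolding u_def using V1 by simp
    have qu: "q u = 0"
      unfolding u_def using V1 qN1 b bil_N_self[OF V1(2)] by (simp add: q_add algebra_simps)
    have uNu: "\<beta> u (N u) = 1" using bil_N_self[OF uV] Nu qN1 by simp
    define w where "w = N u + u"
    have w: "orth k e f w" unfolding w_def by (intro orth_add orth_N[OF M u] u H)
    have wV: "w \<in> V" by (rule oV[OF w])
    have qw: "q w = 0"
    proof -
      have "q w = q (N u) + q u + \<beta> (N u) u" unfolding w_def using uV by (simp only: q_add N_V)
      moreover have "\<beta> (N u) u = 1" using uNu bil_sym[of "N u" u] uV by simp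
      ultimately show ?thesis using qu qN1 unfolding Nu by simp
    qed
    have uw: "\<beta> u w = 1" unfolding w_def using uV uNu by simp
    let ?e = "e(k := u)" and ?f = "f(k := w)"
    have H': "hyp (Suc k) ?e ?f" by (rule hyp_extend[OF H u w qu qw uw])
    have M': "matched (Suc k) id 1 ?e ?f"
      using H' matchedD(4)[OF M] unfolding matched_def w_def by (auto simp: less_Suc_eq)
    have perp: "\<beta> v (N u0) = 0 \<longleftrightarrow> \<beta> v (N u) = 0" if "v \<in> V" for v
      unfolding Nu u1_def using that V1 a0 by simp
    have inv: "(\<forall>v. orth (Suc k) ?e ?f v \<longrightarrow> N v = 0\<^sub>v m) \<or> (\<exists>v. orth (Suc k) ?e ?f v \<and> q (N v) \<noteq> 0)"
      using u0(3)
    proof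
      assume 0: "\<forall>w. orth k e f w \<and> \<beta> w (N u0) = 0 \<longrightarrow> N w = 0\<^sub>v m"
      have "N v = 0\<^sub>v m" if v: "orth (Suc k) ?e ?f v" for v
      proof -
        have v1: "orth k e f v" and v2: "\<beta> v u = 0" "\<beta> v w = 0" and vV: "v \<in> V"
          using v unfolding orth_def by (auto simp: less_Suc_eq)
        have "\<beta> v (N u) = 0" using v2 vV uV unfolding w_def by simp
        then show ?thesis using 0 v1 perp[OF vV] by blast
      qed
      then show ?thesis by blast
    next
      assume "\<exists>w. orth k e f w \<and> \<beta> w (N u0) = 0 \<and> q (N w) \<noteq> 0"
      then obtain v where v: "orth k e f v" "\<beta> v (N u0) = 0" "q (N v) \<noteq> 0" by blast
      have vV: "v \<in> V" by (rule oV[OF v(1)])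
      have vN: "\<beta> v (N u) = 0" using v(2) perp[OF vV] by simp
      \<comment> \<open>Restores orthogonality to \<open>u\<close>, as
        \<open>\<beta> (N u) u = 1\<close>, without disturbing \<open>N v\<close>.\<close>
      define v' where "v' = v + \<beta> v u \<cdot>\<^sub>v N u"
      have v': "orth k e f v'" unfolding v'_def by (intro orth_add orth_smult orth_N[OF M u] v(1) H)
      have "\<beta> (N u) u = 1" using uNu bil_sym[of "N u" u] uV by simp
      then have vu: "\<beta> v' u = 0" unfolding v'_def using vV uV by simp
      have "\<beta> v' (N u) = 0" unfolding v'_def using vV uV vN by simp
      then have "\<beta> v' w = 0" unfolding w_def using vu uV oV[OF v'] by simp
      then have "orth (Suc k) ?e ?f v'" using v' vu unfolding orth_def by (auto simp: less_Suc_eq)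
      moreover have "N v' = N v" unfolding v'_def using vV uV by simp
      ultimately show ?thesis using v(3) by metis
    qed
    have "n - Suc k < n - k" using hyp_le[OF H'] by simp
    then show ?thesis by (rule less.hyps[OF _ M' inv])
  qed
qed

text \<open>A hyperbolic pair for the alternating form is corrected by vectors from the image of
  \<open>N\<close>, which is totally singular and killed by \<open>N\<close>, until both members are
  singular and orthogonal to each other. Then \<open>N v\<close> is the partner of \<open>u\<close>
  and \<open>N u\<close> that of \<open>v\<close>, whence \<open>swap\<close>.\<close>

lemma exists_alternating:
  assumes alt: "\<And>v. v \<in> V \<Longrightarrow> q (N v) = 0" and "matched k swap 0 e f" "even k"
  shows "\<exists>r e f. matched r swap 0 e f \<and> even r \<and> (\<forall>w. orth r e f w \<longrightarrow> N w = 0\<^sub>v m)"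
  using assms(2,3)
proof (induction "n - k" arbitrary: k e f rule: less_induct)
  case less
  note M = less.prems(1)
  have H: "hyp k e f" by (rule matchedD(1)[OF M])
  have oV: "w \<in> V" if "orth k e f w" for w using that unfolding orth_def by simp
  show ?case
  proof (cases "\<forall>w. orth k e f w \<longrightarrow> N w = 0\<^sub>v m")
    case True
    then show ?thesis using less.prems by blast
  next
    case False
    then obtain b where b: "orth k e f b" "N b \<noteq> 0\<^sub>v m" by blast
    obtain a where a: "orth k e f a" "\<beta> (N b) a = 1" using exists_orth_dual[OF H orth_N[OF M b(1)] b(2)] by blast
    note V = oV[OF a(1)] oV[OF b(1)]
    have ab: "\<beta> a (N b) = 1" "\<beta> b (N a) = 1" using a(2) bil_sym[of "N b" a] N_sym[of b a] V by simp_all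
    have self: "\<beta> v (N v) = 0" if "v \<in> V" for v using bil_N_self[OF that] alt[OF that] by simp
    \<comment> \<open>The leftover product of the corrected vectors; adding \<open>d\<close> times
      \<open>N a\<close> to the first one cancels it, because
      \<open>\<beta> (N a) v = 1\<close>.\<close>
    define d where "d = \<beta> (a + q a \<cdot>\<^sub>v N b) (b + q b \<cdot>\<^sub>v N a)"
    define u where "u = (a + q a \<cdot>\<^sub>v N b) + d \<cdot>\<^sub>v N a"
    define v where "v = b + q b \<cdot>\<^sub>v N a"
    have uv: "orth k e f u" "orth k e f v"
      unfolding u_def v_def by (intro orth_add orth_smult orth_N[OF M] a(1) b(1) H)+
    note W = oV[OF uv(1)] oV[OF uv(2)]
    have Nuv: "N u = N a" "N v = N b" unfolding u_def v_def using V by simp_all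
    have "\<beta> (N b) (N a) = 0" using V by simp
    then have q0: "q u = 0" "q v = 0" unfolding u_def v_def using V alt ab self[OF V(1)] self[OF V(2)] by (simp_all add: q_add)
    have "\<beta> (N a) b = 1" using ab(2) bil_sym[of "N a" b] V by simp
    then have "\<beta> (N a) v = 1" unfolding v_def using V by simp
    moreover have "\<beta> u v = \<beta> (a + q a \<cdot>\<^sub>v N b) v + d * \<beta> (N a) v" unfolding u_def using V W(2) by simp
    ultimately have uv0: "\<beta> u v = 0" unfolding d_def v_def[symmetric] by simp
    have uNv: "\<beta> u (N v) = 1" "\<beta> v (N u) = 1"
      using N_sym[OF W(2,1)] unfolding Nuv(2) unfolding u_def using V ab by simp_all
    note f = orth_N[OF M uv(2)] orth_N[OF M uv(1)]
    let ?e = "e(k := u)" and ?f = "f(k := N v)"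
    have H': "hyp (Suc k) ?e ?f" by (rule hyp_extend[OF H uv(1) f(1) q0(1) alt[OF W(2)] uNv(1)])
    have o2: "orth (Suc k) ?e ?f v" "orth (Suc k) ?e ?f (N u)"
      using uv(2) f(2) uv0 self[OF W(1)] self[OF W(2)] bil_sym W unfolding orth_def by (auto simp: less_Suc_eq)
    let ?e' = "?e(Suc k := v)" and ?f' = "?f(Suc k := N u)"
    have H'': "hyp (Suc (Suc k)) ?e' ?f'"
      by (rule hyp_extend[OF H' o2 q0(2) alt[OF W(1)] uNv(2)])
    have sw: "swap k = Suc k" "swap (Suc k) = k" using less.prems(2) by (auto simp: swap_def)
    have old: "swap i < k" "swap i \<noteq> k" "swap i \<noteq> Suc k" if "i < k" for i using swap_less[OF less.prems(2) that] by auto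
    have M': "matched (Suc (Suc k)) swap 0 ?e' ?f'"
      unfolding matched_def
    proof (intro conjI allI impI H'')
      fix i assume i: "i < Suc (Suc k)"
      show "swap i < Suc (Suc k)" by (rule swap_less[OF _ i]) (use less.prems(2) in simp)
      show "swap (swap i) = i" by (rule swap_swap)
      consider "i < k" | "i = k" | "i = Suc k" using i by linarith
      then show "?f' i = N (?e' (swap i)) + 0 \<cdot>\<^sub>v ?e' i"
      proof cases
        case 1
        then show ?thesis using matchedD(4)[OF M 1] old[OF 1] by simp
      qed (use sw W in simp_all)
    qed
    have "n - Suc (Suc k) < n - k" using hyp_le[OF H''] by simp
    then show ?thesis by (rule less.hyps[OF _ M']) (use less.prems(2) in simp)
  qed
qed

text \<open>The form \<open>\<beta> u (N w)\<close> has an orthonormal basis on a complement of its radical if it is not alternating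
  (\<open>c = 1\<close>), and a symplectic one, paired by \<open>swap\<close>, if it is (\<open>c = 0\<close>). The partner
  \<open>N (e (\<sigma> i)) + c e\<^sub>i\<close> of \<open>e\<^sub>i\<close> in \<open>matched\<close> is singular in both cases.\<close>

definition pairing :: "nat \<Rightarrow> (nat \<Rightarrow> nat) \<Rightarrow> 'k \<Rightarrow> bool" where
  "pairing r \<sigma> c \<longleftrightarrow> \<sigma> = id \<and> c = 1 \<or> \<sigma> = swap \<and> c = 0 \<and> even r \<and> (\<forall>v\<in>V. q (N v) = 0)"

lemma pairingD:
  assumes "pairing r \<sigma> c"
  shows "i < r \<Longrightarrow> \<sigma> i < r" "\<sigma> (\<sigma> i) = i" "c = (if \<sigma> i = i then 1 else 0)"
  using assms swap_less swap_swap swap_neq unfolding pairing_def by auto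

lemma exists_matched:
  obtains r \<sigma> c e f where "pairing r \<sigma> c" "matched r \<sigma> c e f" "\<And>w. orth r e f w \<Longrightarrow> N w = 0\<^sub>v m"
proof (cases "\<forall>v\<in>V. q (N v) = 0")
  case True
  have "matched 0 swap 0 e e" for e unfolding matched_def hyp_def by simp
  then show ?thesis using exists_alternating[of 0] True that unfolding pairing_def by (metis even_zero)
next
  case False
  then obtain v where v: "v \<in> V" "q (N v) \<noteq> 0" by blast
  have "matched 0 id 1 e e" "orth 0 e e v" for e unfolding matched_def hyp_def orth_def using v by simp_all
  then show ?thesis using exists_orthonormal[of 0] v that unfolding pairing_def by metis
qed

end

section \<open>Density of a Borel orbit on a class of involutions\<close>

lemma solve_system:
  fixes F :: "nat \<Rightarrow> nat \<Rightarrow> 'a::field"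
  assumes "det (mat k k (\<lambda>(i, j). F i j)) \<noteq> 0"
  obtains c where "\<And>i. i < k \<Longrightarrow> (\<Sum>j<k. F i j * c j) = a i"
proof -
  let ?M = "mat k k (\<lambda>(i, j). F i j)"
  have M: "?M \<in> carrier_mat k k" by simp
  obtain B where B: "B \<in> carrier_mat k k" "?M * B = 1\<^sub>m k"
    using det_non_zero_imp_unit[OF M assms] unfolding Units_def by (auto simp: ring_mat_simps)
  define v where "v = B *\<^sub>v vec k a"
  have vk: "dim_vec v = k" unfolding v_def using B(1) by simp
  have eq: "?M *\<^sub>v v = vec k a"
    unfolding v_def using assoc_mult_mat_vec[OF M B(1), of "vec k a"] B(2) by simp
  have "(\<Sum>j<k. F i j * v $ j) = a i" if "i < k" for i
  proof -
    have "(?M *\<^sub>v v) $ i = (\<Sum>j<k. F i j * v $ j)"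
      using that vk by (simp add: scalar_prod_def atLeast0LessThan)
    then show ?thesis unfolding eq using that by simp
  qed
  then show ?thesis using that by blast
qed

context char2_quadratic_space
begin

lemma flag_comb:
  assumes g: "frame g" and k: "k \<le> m" shows "comb m {..<k} c g \<in> flag g k"
  by (rule vsubspace_comb[OF vsubspace_flag[OF g]]) (use frame_in_flag[OF g] k in auto)

lemma flag_eqI_0:
  assumes g: "frame g" and k: "k \<le> m" and v: "v \<in> flag g k"
    and 0: "\<And>i. i < k \<Longrightarrow> \<beta> v (g (m - 1 - i)) = 0"
  shows "v = 0\<^sub>v m"
proof (rule frame_eqI_0[OF g flag_V[OF v]])
  fix j assume j: "j < m"
  show "\<beta> v (g j) = 0"
  proof (cases "k + j < m")
    case True
    then show ?thesis by (rule flag_bil[OF v])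
  next
    case False
    then have "m - 1 - j < k" "m - 1 - (m - 1 - j) = j" using j by auto
    then show ?thesis using 0[of "m - 1 - j"] by simp
  qed
qed

text \<open>Being triangular with nonzero diagonal, the \<open>e i\<close> span the flag.\<close>

lemma triangular_perp:
  assumes g: "frame g" and k: "k \<le> m" and e: "\<And>i. i < k \<Longrightarrow> e i \<in> flag g (Suc i)"
    "\<And>i. i < k \<Longrightarrow> \<beta> (e i) (g (m - 1 - i)) \<noteq> 0"
    and t: "t \<in> V" "\<And>i. i < k \<Longrightarrow> \<beta> (e i) t = 0" and v: "v \<in> flag g k"
  shows "\<beta> v t = 0"
  using k e t(2) v
proof (induction k arbitrary: v)
  case 0
  have "v = 0\<^sub>v m" by (rule flag_0[OF g 0(5)])
  then show ?case using t(1) by (simp only: bil_zero)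
next
  case (Suc k)
  have k: "k < m" using Suc.prems(1) by simp
  have IH: "\<beta> w t = 0" if "w \<in> flag g k" for w using Suc.IH[OF _ _ _ _ that] Suc.prems by simp
  obtain w where w: "w \<in> flag g k" "v = \<beta> v (g (m - 1 - k)) \<cdot>\<^sub>v g k + w"
    using flag_decompose[OF g k Suc.prems(5)] by blast
  obtain w' where w': "w' \<in> flag g k" "e k = \<beta> (e k) (g (m - 1 - k)) \<cdot>\<^sub>v g k + w'"
    using flag_decompose[OF g k Suc.prems(2)] by blast
  define c d where "c = \<beta> v (g (m - 1 - k))" and "d = \<beta> (e k) (g (m - 1 - k))"
  have gk: "g k \<in> V" using g k by simp
  have "\<beta> (d \<cdot>\<^sub>v g k + w') t = 0" using Suc.prems(4)[of k] w'(2) unfolding d_def by simp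
  then have "d * \<beta> (g k) t = 0" using gk flag_V[OF w'(1)] t(1) IH[OF w'(1)] by simp
  then have "\<beta> (g k) t = 0" using Suc.prems(3)[of k] unfolding d_def by simp
  then have "\<beta> (c \<cdot>\<^sub>v g k + w) t = 0" using gk flag_V[OF w(1)] t(1) IH[OF w(1)] by simp
  then show ?case using w(2) unfolding c_def by simp
qed

end

section \<open>Gram-Schmidt along a flag\<close>

context involution
begin

lemma solve_in_flag:
  assumes g: "frame g" and k: "k \<le> m" and d: "det (mat k k (\<lambda>(i, j). \<beta> (g i) (N (g j)))) \<noteq> 0"
  obtains s where "s \<in> flag g k" "\<And>j. j < k \<Longrightarrow> \<beta> (g j) (N s) = a j"
proof -
  obtain c where c: "\<And>i. i < k \<Longrightarrow> (\<Sum>j<k. \<beta> (g i) (N (g j)) * c j) = a i" using solve_system[OF d, of a] by blast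
  have gV: "\<And>i. i \<in> {..<k} \<Longrightarrow> g i \<in> V" "\<And>i. i \<in> {..<k} \<Longrightarrow> N (g i) \<in> V" using g k by auto
  show ?thesis
  proof (rule that[OF flag_comb[OF g k, of c]])
    fix j assume j: "j < k"
    then have jV: "g j \<in> V" using gV by simp
    have "\<beta> (g j) (N (comb m {..<k} c g)) = \<beta> (g j) (comb m {..<k} c (\<lambda>i. N (g i)))"
      using N_comb[OF finite_lessThan gV(1)] by simp
    also have "\<dots> = (\<Sum>i<k. c i * \<beta> (g j) (N (g i)))"
      using bil_comb_right[OF finite_lessThan gV(2) jV] .
    finally show "\<beta> (g j) (N (comb m {..<k} c g)) = a j" using c[OF j] by (simp add: mult.commute)
  qed
qed

text \<open>By the nonvanishing minor each coordinate functional on the flag is a product with some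
  \<open>N s\<close>, and \<open>u\<close> annihilates all of these.\<close>

lemma N_nondegenerate_on_flag:
  assumes g: "frame g" and k: "k \<le> m" and d: "det (mat k k (\<lambda>(i, j). \<beta> (g i) (N (g j)))) \<noteq> 0"
    and u: "u \<in> flag g k" "\<And>j. j < k \<Longrightarrow> \<beta> (g j) (N u) = 0"
  shows "u = 0\<^sub>v m"
proof (rule flag_eqI_0[OF g k u(1)])
  fix i assume i: "i < k"
  obtain s where s: "s \<in> flag g k" "\<And>j. j < k \<Longrightarrow> \<beta> (g j) (N s) = (if j = i then 1 else 0)"
    using solve_in_flag[OF g k d, of "\<lambda>j. if j = i then 1 else 0"] by blast
  have V: "u \<in> V" "s \<in> V" "g (m - 1 - i) \<in> V" using flag_V u(1) s(1) g m_pos by auto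
  have "\<beta> u (N s + g (m - 1 - i)) = 0"
  proof (rule flag_bil_zero[OF g u(1)])
    fix j assume j: "j < k" "j < m"
    have im: "m - 1 - i < m" "j + (m - 1 - i) = m - 1 \<longleftrightarrow> j = i" using i k j by auto
    show "\<beta> (g j) (N s + g (m - 1 - i)) = 0"
      using s(2)[OF j(1)] frame_bil[OF g j(2) im(1)] im(2) V g j by simp
  qed (use V in auto)
  moreover have "\<beta> u (N s) = 0"
  proof -
    have "\<beta> s (N u) = 0" by (rule flag_bil_zero[OF g s(1)]) (use V u(2) in auto)
    then show ?thesis using N_sym V by simp
  qed
  ultimately show "\<beta> u (g (m - 1 - i)) = 0" using V by simp
qed

text \<open>One step of the process: remove from \<open>g l\<close> its part in
  \<open>flag g p\<close>. The orthonormal case uses \<open>p = l\<close>, the symplectic one the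
  last even number, as an alternating form has no nonzero minors of odd size.\<close>

lemma exists_N_perp:
  assumes g: "frame g" and p: "p \<le> l" "l < m" and d: "det (mat p p (\<lambda>(i, j). \<beta> (g i) (N (g j)))) \<noteq> 0"
  shows "\<exists>t. t \<in> flag g (Suc l) \<and> t + g l \<in> flag g p \<and> (\<forall>v\<in>flag g p. \<beta> v (N t) = 0) \<and> \<beta> t (g (m - 1 - l)) = 1"
proof -
  have pm: "p \<le> m" using p by simp
  obtain s where s: "s \<in> flag g p" "\<And>j. j < p \<Longrightarrow> \<beta> (g j) (N s) = \<beta> (g j) (N (g l))"
    using solve_in_flag[OF g pm d, of "\<lambda>j. \<beta> (g j) (N (g l))"] by blast
  have gl: "g l \<in> V" "g l \<in> flag g (Suc l)" "g (m - 1 - l) \<in> V" using g p frame_in_flag[OF g p(2)] by auto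
  have sV: "s \<in> V" by (rule flag_V[OF s(1)])
  define t where "t = g l + s"
  have tV: "t \<in> V" unfolding t_def using gl sV by simp
  show ?thesis
  proof (intro exI[of _ t] conjI ballI)
    show "t \<in> flag g (Suc l)" unfolding t_def by (intro flag_add[OF g] gl flag_mono[OF s(1)]) (use p in simp)
    have "t + g l = s" unfolding t_def using gl sV by simp
    then show "t + g l \<in> flag g p" using s(1) by simp
    fix v assume v: "v \<in> flag g p"
    show "\<beta> v (N t) = 0"
    proof (rule flag_bil_zero[OF g v])
      fix j assume j: "j < p" "j < m"
      then show "\<beta> (g j) (N t) = 0" unfolding t_def using s(2)[OF j(1)] gl sV g by simp
    qed (use tV in simp)
  next
    have "\<beta> s (g (m - 1 - l)) = 0" by (rule flag_bil[OF s(1)]) (use p in simp)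
    moreover have "\<beta> (g l) (g (m - 1 - l)) = 1" using frame_bil[OF g p(2), of "m - 1 - l"] p by simp
    ultimately show "\<beta> t (g (m - 1 - l)) = 1" unfolding t_def using gl sV by simp
  qed
qed

definition gram :: "nat \<Rightarrow> (nat \<Rightarrow> nat) \<Rightarrow> (nat \<Rightarrow> 'k vec) \<Rightarrow> bool" where
  "gram r \<sigma> e \<longleftrightarrow> (\<forall>i<r. \<forall>j<r. \<beta> (e i) (N (e j)) = (if i = \<sigma> j then 1 else 0))"

lemma gram_schmidt_id:
  assumes g: "frame g" and r: "r \<le> n"
    and d: "\<And>k. k \<le> r \<Longrightarrow> det (mat k k (\<lambda>(i, j). \<beta> (g i) (N (g j)))) \<noteq> 0"
  obtains e where "\<And>i. i < r \<Longrightarrow> e i \<in> flag g (Suc i)" "\<And>i. i < r \<Longrightarrow> \<beta> (e i) (g (m - 1 - i)) \<noteq> 0" "gram r id e"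
proof -
  have rm: "r \<le> m" using r m_def by simp
  have "\<exists>t. t \<in> flag g (Suc k) \<and> t + g k \<in> flag g k \<and> (\<forall>v\<in>flag g k. \<beta> v (N t) = 0) \<and> \<beta> t (g (m - 1 - k)) = 1"
    if "k < r" for k using exists_N_perp[OF g le_refl _ d] that rm by simp
  then obtain t where t: "\<And>k. k < r \<Longrightarrow> t k \<in> flag g (Suc k)" "\<And>k. k < r \<Longrightarrow> t k + g k \<in> flag g k"
    "\<And>k v. k < r \<Longrightarrow> v \<in> flag g k \<Longrightarrow> \<beta> v (N (t k)) = 0" "\<And>k. k < r \<Longrightarrow> \<beta> (t k) (g (m - 1 - k)) = 1" by metis
  have tV: "t k \<in> V" if "k < r" for k by (rule flag_V[OF t(1)[OF that]])
  \<comment> \<open>Otherwise \<open>t k\<close> would be orthogonal, for the symmetric form, to all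
    of \<open>flag g (Suc k)\<close>, against the minor of size \<open>k + 1\<close>.\<close>
  have d0: "\<beta> (t k) (N (t k)) \<noteq> 0" if k: "k < r" for k
  proof
    assume 0: "\<beta> (t k) (N (t k)) = 0"
    have km: "k < m" using k rm by simp
    have gk: "g k \<in> V" using g km by simp
    have "t k = 0\<^sub>v m"
    proof (rule N_nondegenerate_on_flag[OF g _ d t(1)[OF k]])
      fix j assume "j < Suc k"
      then consider "j < k" | "j = k" by linarith
      then show "\<beta> (g j) (N (t k)) = 0"
      proof cases
        case 1
        then show ?thesis using t(3)[OF k frame_in_flag[OF g _ 1]] km by simp
      next
        case 2
        have "\<beta> (t k + g k) (N (t k)) = 0" by (rule t(3)[OF k t(2)[OF k]])
        then show ?thesis using 0 2 tV[OF k] gk by simp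
      qed
    qed (use k rm in auto)
    then show False using t(4)[OF k] g m_pos by simp
  qed
  have "\<exists>a. a\<^sup>2 = \<beta> (t k) (N (t k))" for k using exists_sqrt by metis
  then obtain a where a: "\<And>k. (a k)\<^sup>2 = \<beta> (t k) (N (t k))" by metis
  have a0: "a k \<noteq> 0" if "k < r" for k using a[of k] d0[OF that] by auto
  define e where "e = (\<lambda>k. inverse (a k) \<cdot>\<^sub>v t k)"
  have e1: "e k \<in> flag g (Suc k)" if "k < r" for k unfolding e_def by (intro flag_smult[OF g] t(1) that)
  have eV: "e k \<in> V" if "k < r" for k by (rule flag_V[OF e1[OF that]])
  have lt: "\<beta> (e i) (N (e j)) = 0" if ij: "i < j" "j < r" for i j
  proof -
    have i: "i < r" using ij by simp
    have "\<beta> (e i) (N (t j)) = 0" by (rule t(3)[OF ij(2) flag_mono[OF e1[OF i]]]) (use ij in simp)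
    then show ?thesis using eV[OF i] tV[OF ij(2)] unfolding e_def[THEN fun_cong, of j] by simp
  qed
  show ?thesis
  proof (rule that[OF e1])
    fix i assume i: "i < r"
    have "g (m - 1 - i) \<in> V" using g m_pos by simp
    then show "\<beta> (e i) (g (m - 1 - i)) \<noteq> 0" unfolding e_def using t(4)[OF i] tV[OF i] a0[OF i] by simp
  next
    show "gram r id e" unfolding gram_def
    proof (intro allI impI)
      fix i j assume ij: "i < r" "j < r"
      consider "i < j" | "j < i" | "i = j" by linarith
      then show "\<beta> (e i) (N (e j)) = (if i = id j then 1 else 0)"
      proof cases
        case 1
        then show ?thesis using lt[OF 1 ij(2)] by simp
      next
        case 2
        then show ?thesis using lt[OF 2 ij(1)] N_sym[OF eV[OF ij(1)] eV[OF ij(2)]] by simp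
      next
        case 3
        have "\<beta> (e i) (N (e i)) = inverse (a i) * (inverse (a i) * (a i)\<^sup>2)"
          unfolding e_def using tV[OF ij(1)] a[of i] by simp
        then show ?thesis using 3 a0[OF ij(1)] by (simp add: power2_eq_square field_simps)
      qed
    qed
  qed auto
qed

lemma gram_schmidt_swap:
  assumes alt: "\<And>v. v \<in> V \<Longrightarrow> q (N v) = 0" and g: "frame g" and r: "r \<le> n" "even r"
    and d: "\<And>k. k \<le> r \<Longrightarrow> even k \<Longrightarrow> det (mat k k (\<lambda>(i, j). \<beta> (g i) (N (g j)))) \<noteq> 0"
  obtains e where "\<And>i. i < r \<Longrightarrow> e i \<in> flag g (Suc i)" "\<And>i. i < r \<Longrightarrow> \<beta> (e i) (g (m - 1 - i)) \<noteq> 0" "gram r swap e"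
proof -
  have rm: "r \<le> m" using r m_def by simp
  \<comment> \<open>The largest even number up to \<open>l\<close>: both members of a pair are made
    orthogonal to the flag below the pair, not to each other.\<close>
  define p where "p = (\<lambda>l::nat. if even l then l else l - 1)"
  have p: "p l \<le> l" "even (p l)" for l unfolding p_def by (auto elim!: oddE)
  have self: "\<beta> v (N v) = 0" if "v \<in> V" for v using bil_N_self[OF that] alt[OF that] by simp
  have "\<exists>t. t \<in> flag g (Suc l) \<and> t + g l \<in> flag g (p l) \<and> (\<forall>v\<in>flag g (p l). \<beta> v (N t) = 0) \<and> \<beta> t (g (m - 1 - l)) = 1"
    if l: "l < r" for l
  proof (rule exists_N_perp[OF g p(1)])
    show "det (mat (p l) (p l) (\<lambda>(i, j). \<beta> (g i) (N (g j)))) \<noteq> 0" by (rule d[OF _ p(2)]) (use p(1)[of l] l in simp)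
  qed (use l rm in simp)
  then obtain t where t: "\<And>k. k < r \<Longrightarrow> t k \<in> flag g (Suc k)" "\<And>k. k < r \<Longrightarrow> t k + g k \<in> flag g (p k)"
    "\<And>k v. k < r \<Longrightarrow> v \<in> flag g (p k) \<Longrightarrow> \<beta> v (N (t k)) = 0" "\<And>k. k < r \<Longrightarrow> \<beta> (t k) (g (m - 1 - k)) = 1" by metis
  have tV: "t k \<in> V" if "k < r" for k by (rule flag_V[OF t(1)[OF that]])
  have d0: "\<beta> (t k) (N (t (Suc k))) \<noteq> 0" if k: "k < r" "even k" for k
  proof
    assume 0: "\<beta> (t k) (N (t (Suc k))) = 0"
    have Sk: "Suc k < r" using k r(2) by (metis Suc_lessI even_Suc)
    have km: "k < m" "Suc k < m" using Sk rm by auto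
    have gk: "g k \<in> V" "g (Suc k) \<in> V" using g km by auto
    have pk: "p k = k" "p (Suc k) = k" using k(2) by (simp_all add: p_def)
    have "t k = 0\<^sub>v m"
    proof (rule N_nondegenerate_on_flag[OF g _ d])
      show "t k \<in> flag g (Suc (Suc k))" by (rule flag_mono[OF t(1)[OF k(1)]]) simp
      fix j assume "j < Suc (Suc k)"
      then consider "j < k" | "j = k" | "j = Suc k" by linarith
      then show "\<beta> (g j) (N (t k)) = 0"
      proof cases
        case 1
        then show ?thesis using t(3)[OF k(1)] frame_in_flag[OF g _ 1] pk km by simp
      next
        case 2
        have "\<beta> (t k + g k) (N (t k)) = 0" by (rule t(3)[OF k(1) t(2)[OF k(1)]])
        then show ?thesis using self 2 tV[OF k(1)] gk by simp
      next
        case 3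
        have "t (Suc k) + g (Suc k) \<in> flag g (p k)" using t(2)[OF Sk] pk by simp
        then have "\<beta> (t (Suc k) + g (Suc k)) (N (t k)) = 0" by (rule t(3)[OF k(1)])
        moreover have "\<beta> (t (Suc k)) (N (t k)) = 0" using 0 N_sym[OF tV[OF Sk] tV[OF k(1)]] by simp
        ultimately show ?thesis using 3 tV k(1) Sk gk by simp
      qed
    qed (use k Sk rm in auto)
    then show False using t(4)[OF k(1)] g m_pos by simp
  qed
  \<comment> \<open>Only the second member of each pair is rescaled, to make the product of the two
    equal to 1.\<close>
  define a where "a = (\<lambda>l. if even l then 1 else inverse (\<beta> (t (l - 1)) (N (t l))))"
  have a0: "a l \<noteq> 0" if "l < r" for l
    unfolding a_def using d0[of "l - 1"] that by (auto elim!: oddE)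
  define e where "e = (\<lambda>l. a l \<cdot>\<^sub>v t l)"
  have e1: "e k \<in> flag g (Suc k)" if "k < r" for k unfolding e_def by (intro flag_smult[OF g] t(1) that)
  have eV: "e k \<in> V" if "k < r" for k by (rule flag_V[OF e1[OF that]])
  have lt: "\<beta> (e i) (N (e j)) = (if i = swap j then 1 else 0)" if ij: "i < j" "j < r" for i j
  proof -
    have i: "i < r" using ij by simp
    show ?thesis
    proof (cases "Suc i \<le> p j")
      case True
      have "\<beta> (e i) (N (t j)) = 0" by (rule t(3)[OF ij(2) flag_mono[OF e1[OF i] True]])
      moreover have "i \<noteq> swap j" using True unfolding p_def swap_def by (auto split: if_splits elim!: oddE)
      ultimately show ?thesis using eV[OF i] tV[OF ij(2)] unfolding e_def[THEN fun_cong, of j] by simp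
    next
      case False
      then have "odd j" using ij(1) by (auto simp: p_def split: if_splits)
      then obtain b where b: "j = Suc (2 * b)" by (elim oddE) simp
      then have "i = 2 * b" using False ij(1) by (simp add: p_def)
      then have ev: "even i" "j = Suc i" "i = swap j" using b by (simp_all add: swap_def)
      have "\<beta> (e i) (N (e j)) = a j * \<beta> (t i) (N (t j))"
        unfolding e_def using tV[OF i] tV[OF ij(2)] ev(1) by (simp add: a_def)
      also have "\<dots> = 1" using d0[OF i ev(1)] ev(1,2) by (simp add: a_def)
      finally show ?thesis using ev(3) by simp
    qed
  qed
  show ?thesis
  proof (rule that[OF e1])
    fix i assume i: "i < r"
    have "g (m - 1 - i) \<in> V" using g m_pos by simp
    then show "\<beta> (e i) (g (m - 1 - i)) \<noteq> 0" unfolding e_def using t(4)[OF i] tV[OF i] a0[OF i] by simp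
  next
    show "gram r swap e" unfolding gram_def
    proof (intro allI impI)
      fix i j assume ij: "i < r" "j < r"
      consider "i < j" | "j < i" | "i = j" by linarith
      then show "\<beta> (e i) (N (e j)) = (if i = swap j then 1 else 0)"
      proof cases
        case 1
        then show ?thesis by (rule lt[OF _ ij(2)])
      next
        case 2
        have "i = swap j \<longleftrightarrow> j = swap i" using swap_swap by metis
        then show ?thesis using lt[OF 2 ij(1)] N_sym[OF eV[OF ij(1)] eV[OF ij(2)]] by simp
      next
        case 3
        then show ?thesis using self[OF eV[OF ij(1)]] swap_neq[of j] by simp
      qed
    qed
  qed auto
qed

lemma gram_schmidt:
  assumes P: "pairing r \<sigma> c" and g: "frame g" and r: "r \<le> n"
    and d: "\<And>k. k \<le> r \<Longrightarrow> (\<And>i. i < k \<Longrightarrow> \<sigma> i < k) \<Longrightarrow> det (mat k k (\<lambda>(i, j). \<beta> (g i) (N (g j)))) \<noteq> 0"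
  obtains e where "\<And>i. i < r \<Longrightarrow> e i \<in> flag g (Suc i)" "\<And>i. i < r \<Longrightarrow> \<beta> (e i) (g (m - 1 - i)) \<noteq> 0" "gram r \<sigma> e"
proof (cases "\<sigma> = id")
  case True
  have "det (mat k k (\<lambda>(i, j). \<beta> (g i) (N (g j)))) \<noteq> 0" if "k \<le> r" for k using d[OF that] True by simp
  then show ?thesis using gram_schmidt_id[OF g r] that True by metis
next
  case False
  then have sw: "\<sigma> = swap" "even r" "\<And>v. v \<in> V \<Longrightarrow> q (N v) = 0" using P unfolding pairing_def by auto
  have "det (mat k k (\<lambda>(i, j). \<beta> (g i) (N (g j)))) \<noteq> 0" if "k \<le> r" "even k" for k
    using d[OF that(1)] swap_less[OF that(2)] sw(1) by simp
  then show ?thesis using gram_schmidt_swap[OF sw(3) g r sw(2)] that sw(1) by metis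
qed

text \<open>The partner is singular because \<open>q (N (e (\<sigma> i)))\<close>, a diagonal value
  of the form, equals \<open>c\<close> and the mixed term contributes \<open>c\<close>
  again.\<close>

lemma gram_matched:
  assumes P: "pairing r \<sigma> c" and G: "gram r \<sigma> e"
    and e: "\<And>i. i < r \<Longrightarrow> e i \<in> V" "\<And>i. i < r \<Longrightarrow> q (e i) = 0" "\<And>i j. i < r \<Longrightarrow> j < r \<Longrightarrow> \<beta> (e i) (e j) = 0"
  shows "matched r \<sigma> c e (\<lambda>i. N (e (\<sigma> i)) + c \<cdot>\<^sub>v e i)"
proof -
  note PD = pairingD[OF P]
  have B: "\<beta> (e i) (N (e (\<sigma> j))) = (if i = j then 1 else 0)" "\<beta> (N (e (\<sigma> j))) (e i) = (if i = j then 1 else 0)"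
    if "i < r" "j < r" for i j
  proof -
    show 1: "\<beta> (e i) (N (e (\<sigma> j))) = (if i = j then 1 else 0)"
      using G that PD(1)[OF that(2)] PD(2)[of j] unfolding gram_def by simp
    show "\<beta> (N (e (\<sigma> j))) (e i) = (if i = j then 1 else 0)"
      using 1 bil_sym[of "N (e (\<sigma> j))" "e i"] e(1) that PD(1)[OF that(2)] by simp
  qed
  have qN: "q (N (e (\<sigma> i))) = c" if "i < r" for i
  proof -
    have "q (N (e (\<sigma> i))) = \<beta> (e (\<sigma> i)) (N (e (\<sigma> i)))" using bil_N_self e(1) PD(1)[OF that] by simp
    then show ?thesis using B(1)[OF PD(1)[OF that] that] PD(3)[of i] by simp
  qed
  have "hyp r e (\<lambda>i. N (e (\<sigma> i)) + c \<cdot>\<^sub>v e i)"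
    unfolding hyp_def
  proof (intro conjI allI impI)
    fix i assume i: "i < r"
    note V = e(1)[OF i] e(1)[OF PD(1)[OF i]]
    show "e i \<in> V" "N (e (\<sigma> i)) + c \<cdot>\<^sub>v e i \<in> V" "q (e i) = 0" using V e(2)[OF i] by auto
    show "q (N (e (\<sigma> i)) + c \<cdot>\<^sub>v e i) = 0"
      using V e(2)[OF i] qN[OF i] B(2)[OF i i] by (simp add: q_add)
    fix j assume j: "j < r"
    note V' = e(1)[OF j] e(1)[OF PD(1)[OF j]]
    show "\<beta> (e i) (e j) = 0" by (rule e(3)[OF i j])
    show "\<beta> (N (e (\<sigma> i)) + c \<cdot>\<^sub>v e i) (N (e (\<sigma> j)) + c \<cdot>\<^sub>v e j) = 0"
      using V V' e(3)[OF i j] B(1)[OF i j] B(2)[OF j i] by simp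
    show "\<beta> (e i) (N (e (\<sigma> j)) + c \<cdot>\<^sub>v e j) = (if i = j then 1 else 0)"
      using V V' e(3)[OF i j] B(1)[OF i j] by simp
  qed
  then show ?thesis unfolding matched_def using PD by auto
qed

text \<open>Products with the \<open>N (e k)\<close> embed vectors modulo the kernel of
  \<open>N\<close> in an \<open>r\<close>-dimensional space, so \<open>e'\<close> and
  \<open>z\<close> are dependent there. Pairing with \<open>N (e' (\<sigma> i))\<close> kills every
  coefficient but that of \<open>z\<close>.\<close>

lemma rank_transfer:
  assumes e: "\<And>i. i < r \<Longrightarrow> e i \<in> V" and rank: "\<And>z. z \<in> V \<Longrightarrow> (\<And>i. i < r \<Longrightarrow> \<beta> z (N (e i)) = 0) \<Longrightarrow> N z = 0\<^sub>v m"
    and P: "pairing r \<sigma> c" and e': "\<And>i. i < r \<Longrightarrow> e' i \<in> V" "gram r \<sigma> e'"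
    and z: "z \<in> V" "\<And>i. i < r \<Longrightarrow> \<beta> z (N (e' i)) = 0"
  shows "N z = 0\<^sub>v m"
proof -
  note PD = pairingD[OF P]
  define w where "w = e'(r := z)"
  have wV: "w i \<in> V" if "i \<le> r" for i unfolding w_def using that e'(1) z(1) by auto
  obtain a where a: "comb r {..r} a (\<lambda>i. vec r (\<lambda>k. \<beta> (w i) (N (e k)))) = 0\<^sub>v r" "\<exists>i\<le>r. a i \<noteq> 0"
    using exists_dependency[of r "\<lambda>i. vec r (\<lambda>k. \<beta> (w i) (N (e k)))"] by auto
  define s where "s = comb m {..r} a w"
  have sV: "s \<in> V" unfolding s_def by simp
  have wV': "\<And>i. i \<in> {..r} \<Longrightarrow> w i \<in> V" using wV by simp
  have "N s = 0\<^sub>v m"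
  proof (rule rank[OF sV])
    fix k assume k: "k < r"
    have "\<beta> s (N (e k)) = (\<Sum>i\<le>r. a i * \<beta> (w i) (N (e k)))"
      unfolding s_def using bil_comb_left[OF finite_atMost wV' N_V[OF e[OF k]]] .
    also have "\<dots> = comb r {..r} a (\<lambda>i. vec r (\<lambda>k. \<beta> (w i) (N (e k)))) $ k"
      unfolding comb_def using k by simp
    finally show "\<beta> s (N (e k)) = 0" using a(1) k by simp
  qed
  have ai: "a i = 0" if i: "i < r" for i
  proof -
    have si: "\<sigma> i < r" by (rule PD(1)[OF i])
    have NV: "N (e' (\<sigma> i)) \<in> V" using e'(1)[OF si] by simp
    have "\<beta> s (N (e' (\<sigma> i))) = (\<Sum>k\<le>r. a k * \<beta> (w k) (N (e' (\<sigma> i))))"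
      unfolding s_def using bil_comb_left[OF finite_atMost wV' NV] .
    also have "\<dots> = (\<Sum>k\<le>r. if k = i then a i else 0)"
    proof (intro sum.cong refl)
      fix k assume "k \<in> {..r}"
      then consider "k < r" | "k = r" by fastforce
      then show "a k * \<beta> (w k) (N (e' (\<sigma> i))) = (if k = i then a i else 0)"
      proof cases
        case 1
        then have "\<beta> (w k) (N (e' (\<sigma> i))) = (if k = i then 1 else 0)"
          using e'(2) si PD(2)[of i] unfolding gram_def w_def by simp
        then show ?thesis by simp
      next
        case 2
        then show ?thesis using z(2)[OF si] i unfolding w_def by simp
      qed
    qed
    also have "\<dots> = a i" using i by simp
    finally have "a i = \<beta> s (N (e' (\<sigma> i)))" by simp
    also have "\<dots> = \<beta> (N s) (e' (\<sigma> i))" using N_adjoint[OF sV e'(1)[OF si]] by simp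
    finally show ?thesis using \<open>N s = 0\<^sub>v m\<close> e'(1)[OF si] by simp
  qed
  then have ar: "a r \<noteq> 0" using a(2) by (metis le_neq_implies_less)
  have "N s = comb m {..r} a (\<lambda>i. N (w i))" unfolding s_def by (rule N_comb[OF _ wV']) simp_all
  also have "\<dots> = a r \<cdot>\<^sub>v N z"
  proof -
    have eq: "{..r} = insert r {..<r}" by auto
    have NV: "\<And>j. j \<in> insert r {..<r} \<Longrightarrow> N (w j) \<in> V" using wV by auto
    have "comb m {..r} a (\<lambda>i. N (w i)) = a r \<cdot>\<^sub>v N (w r) + comb m {..<r} a (\<lambda>i. N (w i))"
      unfolding eq by (rule comb_insert[OF _ _ NV]) simp_all
    moreover have "comb m {..<r} a (\<lambda>i. N (w i)) = 0\<^sub>v m" unfolding comb_def using ai by (intro eq_vecI) auto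
    ultimately show ?thesis using z(1) unfolding w_def by simp
  qed
  finally show ?thesis using \<open>N s = 0\<^sub>v m\<close> ar smult_eq_0_iff[of "N z" "a r"] z(1) by simp
qed

lemma N_expand:
  assumes P: "pairing r \<sigma> c" and e: "\<And>i. i < r \<Longrightarrow> e i \<in> V" "gram r \<sigma> e"
    and rank: "\<And>z. z \<in> V \<Longrightarrow> (\<And>i. i < r \<Longrightarrow> \<beta> z (N (e i)) = 0) \<Longrightarrow> N z = 0\<^sub>v m" and z: "z \<in> V"
  shows "N z = comb m {..<r} (\<lambda>i. \<beta> z (N (e (\<sigma> i)))) (\<lambda>i. N (e i))"
proof -
  note PD = pairingD[OF P]
  define s where "s = comb m {..<r} (\<lambda>i. \<beta> z (N (e (\<sigma> i)))) e"
  have sV: "s \<in> V" unfolding s_def by simp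
  have eV: "\<And>i. i \<in> {..<r} \<Longrightarrow> e i \<in> V" using e(1) by simp
  have "N (z + s) = 0\<^sub>v m"
  proof (rule rank)
    fix j assume j: "j < r"
    have "\<beta> s (N (e j)) = (\<Sum>i<r. \<beta> z (N (e (\<sigma> i))) * \<beta> (e i) (N (e j)))"
      unfolding s_def by (rule bil_comb_left[OF finite_lessThan eV]) (use e(1)[OF j] in simp_all)
    also have "\<dots> = (\<Sum>i<r. if i = \<sigma> j then \<beta> z (N (e (\<sigma> i))) else 0)"
      using e(2) j unfolding gram_def by (intro sum.cong) auto
    also have "\<dots> = \<beta> z (N (e j))" using PD(1)[OF j] PD(2)[of j] by simp
    finally show "\<beta> (z + s) (N (e j)) = 0" using z sV e(1)[OF j] by simp
  qed (use z sV in simp)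
  then have "N z = N s" using z sV vec_add_eq_0_iff[of "N z" "N s"] by simp
  also have "\<dots> = comb m {..<r} (\<lambda>i. \<beta> z (N (e (\<sigma> i)))) (\<lambda>i. N (e i))"
    unfolding s_def by (rule N_comb[OF finite_lessThan eV])
  finally show ?thesis .
qed

end

section \<open>Frames adapted to a flag\<close>

context char2_quadratic_space
begin

text \<open>The middle vectors \<open>g l\<close> are corrected by \<open>s l\<close> in
  \<open>flag g r\<close> to become orthogonal to the \<open>f i\<close>; this disturbs no other
  product, as \<open>flag g r\<close> is totally singular and orthogonal to the middle. The
  \<open>f i\<close> fit the flag because they are orthogonal to the \<open>e k\<close> with
  \<open>k < i\<close>, which span \<open>flag g i\<close>.\<close>

lemma exists_adapted_frame:
  assumes g: "frame g" and r: "r \<le> n" and H: "hyp r e f"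
    and e: "\<And>i. i < r \<Longrightarrow> e i \<in> flag g (Suc i)" "\<And>i. i < r \<Longrightarrow> \<beta> (e i) (g (m - 1 - i)) \<noteq> 0"
  obtains h where "frame h" "\<And>i. i < r \<Longrightarrow> h i = e i" "\<And>i. i < r \<Longrightarrow> h (m - 1 - i) = f i"
    "\<And>i. i < m \<Longrightarrow> h i \<in> flag g (Suc i)"
proof -
  note HD = hypD[OF H]
  define s where "s = (\<lambda>l. comb m {..<r} (\<lambda>i. \<beta> (g l) (f i)) e)"
  define h where "h = (\<lambda>l. if l < r then e l else if m - 1 - l < r then f (m - 1 - l) else g l + s l)"
  have er: "e i \<in> flag g r" if "i < r" for i by (rule flag_mono[OF e(1)[OF that]]) (use that in simp)
  have sr: "s l \<in> flag g r" for l
    unfolding s_def by (rule vsubspace_comb[OF vsubspace_flag[OF g]]) (use er in auto)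
  have sV: "s l \<in> V" for l by (rule flag_V[OF sr])
  have sf: "\<beta> (s l) (f j) = \<beta> (g l) (f j)" if j: "j < r" for l j
  proof -
    have "\<beta> (s l) (f j) = (\<Sum>i<r. \<beta> (g l) (f i) * \<beta> (e i) (f j))"
      unfolding s_def by (rule bil_comb_left) (use HD j in auto)
    also have "\<dots> = (\<Sum>i<r. if i = j then \<beta> (g l) (f i) else 0)"
      by (intro sum.cong) (use HD j in auto)
    finally show ?thesis using j by simp
  qed
  have mid: "l < m" "g l \<in> V" "\<And>v. v \<in> flag g r \<Longrightarrow> \<beta> v (g l) = 0" "\<And>v. v \<in> flag g r \<Longrightarrow> \<beta> (g l) v = 0"
    if "r \<le> l" "l < m - r" for l
  proof -
    show "l < m" using that by simp
    then show gl: "g l \<in> V" using g by simp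
    show 1: "\<beta> v (g l) = 0" if "v \<in> flag g r" for v by (rule flag_bil[OF that]) (use \<open>l < m - r\<close> in simp)
    show "\<beta> (g l) v = 0" if "v \<in> flag g r" for v using 1[OF that] bil_sym[OF gl flag_V[OF that]] by simp
  qed
  have hlo: "h l = e l" if "l < r" for l using that unfolding h_def by simp
  have hhi: "h (m - 1 - i) = f i" if i: "i < r" for i
  proof -
    have "\<not> m - 1 - i < r" "m - 1 - (m - 1 - i) = i" using i r m_def by auto
    then show ?thesis unfolding h_def using i by simp
  qed
  have hmid: "h l = g l + s l" if "r \<le> l" "l < m - r" for l using that unfolding h_def by auto
  have hhi': "m - 1 - l < r" "h l = f (m - 1 - l)" "l = m - 1 - (m - 1 - l)" if "m - r \<le> l" "l < m" for l
  proof -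
    show 1: "m - 1 - l < r" "l = m - 1 - (m - 1 - l)" using that by auto
    show "h l = f (m - 1 - l)" using hhi[OF 1(1)] 1(2) by simp
  qed
  have V_q: "h l \<in> V \<and> q (h l) = 0" if l: "l < m" for l
  proof -
    consider "l < r" | "r \<le> l" "l < m - r" | "m - r \<le> l" by linarith
    then show ?thesis
    proof cases
      case 1
      then show ?thesis using HD(1,3)[OF 1] hlo[OF 1] by simp
    next
      case 2
      note M = mid[OF 2]
      have "q (g l + s l) = 0"
        using M(2) sV[of l] M(4)[OF sr] frame_q[OF g M(1)] flag_singular[OF g r sr] by (simp add: q_add)
      then show ?thesis unfolding hmid[OF 2] using M(2) sV by simp
    next
      case 3
      show ?thesis unfolding hhi'(2)[OF 3 l] using HD(2,4)[OF hhi'(1)[OF 3 l]] by simp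
    qed
  qed
  have le: "\<beta> (h i) (h j) = (if i + j = m - 1 then 1 else 0)" if ij: "i \<le> j" "j < m" for i j
  proof -
    have i: "i < m" using ij by simp
    consider (ll) "j < r" | (lm) "i < r" "r \<le> j" "j < m - r" | (lh) "i < r" "m - r \<le> j"
      | (mm) "r \<le> i" "i < m - r" "r \<le> j" "j < m - r" | (mh) "r \<le> i" "i < m - r" "m - r \<le> j"
      | (hh) "m - r \<le> i" "m - r \<le> j"
      using ij(1) by linarith
    then show ?thesis
    proof cases
      case ll
      then have ne: "i < r" "i + j \<noteq> m - 1" using ij r m_def by auto
      show ?thesis unfolding hlo[OF ll] hlo[OF ne(1)] using HD(5)[OF ne(1) ll] ne(2) by simp
    next
      case lm
      then have ne: "i + j \<noteq> m - 1" by auto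
      show ?thesis unfolding hlo[OF lm(1)] hmid[OF lm(2,3)]
        using ne HD(1)[OF lm(1)] mid(2)[OF lm(2,3)] mid(3)[OF lm(2,3) er[OF lm(1)]] sV
          flag_isotropic[OF g er[OF lm(1)] sr r] by simp
    next
      case lh
      note j = hhi'[OF lh(2) ij(2)]
      have "i + j = m - 1 \<longleftrightarrow> i = m - 1 - j" using lh ij by auto
      then show ?thesis unfolding j(2) hlo[OF lh(1)] HD(7)[OF lh(1) j(1)] by simp
    next
      case mm
      show ?thesis unfolding hmid[OF mm(1,2)] hmid[OF mm(3,4)]
        using mid(2)[OF mm(1,2)] mid(2)[OF mm(3,4)] mid(4)[OF mm(1,2) sr] mid(3)[OF mm(3,4) sr] sV
          flag_isotropic[OF g sr sr r] frame_bil[OF g i ij(2)] by simp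
    next
      case mh
      note j = hhi'[OF mh(3) ij(2)]
      have ne: "i + j \<noteq> m - 1" using mh by auto
      have "\<beta> (g i + s i) (f (m - 1 - j)) = 0"
        using mid(2)[OF mh(1,2)] sV HD(2)[OF j(1)] sf[OF j(1)] by simp
      then show ?thesis unfolding j(2) hmid[OF mh(1,2)] using ne by simp
    next
      case hh
      have ne: "i + j \<noteq> m - 1" using hh r m_def m_pos ij by auto
      show ?thesis unfolding hhi'(2)[OF hh(1) i] hhi'(2)[OF hh(2) ij(2)]
        using HD(6)[OF hhi'(1)[OF hh(1) i] hhi'(1)[OF hh(2) ij(2)]] ne by simp
    qed
  qed
  have fr: "frame h" unfolding frame_def
  proof (intro conjI allI impI)
    fix i j assume ij: "i < m" "j < m"
    show "\<beta> (h i) (h j) = (if i + j = m - 1 then 1 else 0)"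
    proof (cases "i \<le> j")
      case False
      then show ?thesis using le[of j i] bil_sym[of "h i" "h j"] V_q ij by (simp add: add.commute)
    qed (use le ij in simp)
  qed (use V_q in auto)
  show ?thesis
  proof (rule that[OF fr hlo hhi])
    fix l assume l: "l < m"
    show "h l \<in> flag g (Suc l)"
    proof -
      consider "l < r" | "r \<le> l" "l < m - r" | "m - r \<le> l" by linarith
      then show ?thesis
      proof cases
        case 1
        then show ?thesis using hlo[OF 1] e(1)[OF 1] by simp
      next
        case 2
        show ?thesis unfolding hmid[OF 2]
          by (intro flag_add[OF g] frame_in_flag[OF g l] flag_mono[OF sr]) (use 2 in auto)
      next
        case 3
        define i where "i = m - 1 - l"
        have i: "i < r" "l = m - 1 - i" using hhi'[OF 3 l] unfolding i_def by auto
        have hl: "h l = f i" using hhi'(2)[OF 3 l] unfolding i_def .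
        show ?thesis unfolding hl
        proof (rule flagI)
          show fV: "f i \<in> V" by (rule HD(2)[OF i(1)])
          fix j assume j: "j < m" "Suc l + j < m"
          have im: "i \<le> m" "j < i" using i l j r m_def by auto
          have "\<beta> (g j) (f i) = 0"
          proof (rule triangular_perp[OF g im(1) _ _ fV _ frame_in_flag[OF g j(1) im(2)]])
            fix k assume "k < i"
            then have k: "k < r" "k \<noteq> i" using i(1) by auto
            show "e k \<in> flag g (Suc k)" "\<beta> (e k) (g (m - 1 - k)) \<noteq> 0" using e k(1) by auto
            show "\<beta> (e k) (f i) = 0" using HD(7)[OF k(1) i(1)] k(2) by simp
          qed
          then show "\<beta> (f i) (g j) = 0" using bil_sym[OF fV frame_carrier[OF g j(1)]] by simp
        qed
      qed
    qed
  qed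
qed

end

section \<open>The dense orbit\<close>

context involution
begin

text \<open>\<open>N\<close> is determined by the \<open>N (e i)\<close>, which are expressed
  through the pairs; so \<open>A\<close> carries \<open>N\<close> to itself.\<close>

lemma commutes_of_matched:
  assumes P: "pairing r \<sigma> c" and M: "matched r \<sigma> c e f" "matched r \<sigma> c e' f'"
    and rank: "\<And>z. z \<in> V \<Longrightarrow> (\<And>i. i < r \<Longrightarrow> \<beta> z (N (e i)) = 0) \<Longrightarrow> N z = 0\<^sub>v m"
      "\<And>z. z \<in> V \<Longrightarrow> (\<And>i. i < r \<Longrightarrow> \<beta> z (N (e' i)) = 0) \<Longrightarrow> N z = 0\<^sub>v m"
    and A: "A \<in> Or" "\<And>i. i < r \<Longrightarrow> A *\<^sub>v e i = e' i" "\<And>i. i < r \<Longrightarrow> A *\<^sub>v f i = f' i" and v: "v \<in> V"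
  shows "A *\<^sub>v (x *\<^sub>v v) = x *\<^sub>v (A *\<^sub>v v)"
proof -
  note PD = pairingD[OF P]
  note H = hypD[OF matchedD(1)[OF M(1)]] and H' = hypD[OF matchedD(1)[OF M(2)]]
  have gram: "gram r \<sigma> e" "gram r \<sigma> e'" unfolding gram_def using matched_gram[OF M(1)] matched_gram[OF M(2)] by auto
  have AN: "A *\<^sub>v N (e i) = N (e' i)" if i: "i < r" for i
  proof -
    note \<sigma>i = PD(1)[OF i]
    have "A *\<^sub>v (f (\<sigma> i) + c \<cdot>\<^sub>v e (\<sigma> i)) = A *\<^sub>v f (\<sigma> i) + c \<cdot>\<^sub>v (A *\<^sub>v e (\<sigma> i))"
      using H(1,2)[OF \<sigma>i] Or_carrier[OF A(1)] by simp
    then show ?thesis unfolding matchedD(5)[OF M(1) i] matchedD(5)[OF M(2) i] A(2)[OF \<sigma>i] A(3)[OF \<sigma>i] .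
  qed
  have AvV: "A *\<^sub>v v \<in> V" using A v by simp
  have NV: "\<And>i. i \<in> {..<r} \<Longrightarrow> N (e i) \<in> V" using H(1) by simp
  have "A *\<^sub>v N v = A *\<^sub>v comb m {..<r} (\<lambda>i. \<beta> v (N (e (\<sigma> i)))) (\<lambda>i. N (e i))"
    by (rule arg_cong[OF N_expand[OF P H(1) gram(1) rank(1) v]])
  also have "\<dots> = comb m {..<r} (\<lambda>i. \<beta> v (N (e (\<sigma> i)))) (\<lambda>i. A *\<^sub>v N (e i))"
    by (rule mult_mat_comb[OF Or_carrier[OF A(1)] _ NV]) simp_all
  also have "\<dots> = comb m {..<r} (\<lambda>i. \<beta> (A *\<^sub>v v) (N (e' (\<sigma> i)))) (\<lambda>i. N (e' i))"
  proof (rule comb_cong)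
    fix i assume "i \<in> {..<r}"
    then have i: "i < r" "\<sigma> i < r" using PD(1) by auto
    show "A *\<^sub>v N (e i) = N (e' i)" by (rule AN[OF i(1)])
    show "\<beta> v (N (e (\<sigma> i))) = \<beta> (A *\<^sub>v v) (N (e' (\<sigma> i)))"
      unfolding AN[OF i(2), symmetric] using A(1) v H(1)[OF i(2)] by simp
  qed
  also have "\<dots> = N (A *\<^sub>v v)"
    by (rule N_expand[OF P H'(1) gram(2) rank(2) AvV, symmetric])
  finally have "A *\<^sub>v N v = N (A *\<^sub>v v)" .
  then show ?thesis unfolding x_eq[OF v] x_eq[OF AvV] using Or_carrier[OF A(1)] v by simp
qed

lemma N_mat: "v \<in> V \<Longrightarrow> N v = (x + 1\<^sub>m m) *\<^sub>v v"
  unfolding N_def using Or_carrier[OF x] by (simp add: add_mult_distrib_mat_vec)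

text \<open>The Gram matrix is the permutation matrix of the involution \<open>\<sigma>\<close> and
  therefore its own inverse.\<close>

lemma gram_det:
  assumes G: "gram r \<sigma> e" and P: "pairing r \<sigma> c" and k: "k \<le> r" "\<And>i. i < k \<Longrightarrow> \<sigma> i < k"
  shows "det (mat k k (\<lambda>(i, j). \<beta> (e i) (N (e j)))) \<noteq> 0"
proof -
  let ?M = "mat k k (\<lambda>(i, j). \<beta> (e i) (N (e j)))"
  have M: "?M \<in> carrier_mat k k" by simp
  have ent: "\<beta> (e i) (N (e j)) = (if i = \<sigma> j then 1 else 0)" if "i < k" "j < k" for i j
    using G that k(1) unfolding gram_def by simp
  have "?M * ?M = 1\<^sub>m k"
  proof (rule eq_matI)
    fix i j assume ij: "i < dim_row (1\<^sub>m k :: 'k mat)" "j < dim_col (1\<^sub>m k :: 'k mat)"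
    then have ij: "i < k" "j < k" by auto
    have "(?M * ?M) $$ (i, j) = (\<Sum>l<k. \<beta> (e i) (N (e l)) * \<beta> (e l) (N (e j)))"
      using ij by (simp add: scalar_prod_def atLeast0LessThan)
    also have "\<dots> = (\<Sum>l<k. if l = \<sigma> j then \<beta> (e i) (N (e l)) else 0)"
      by (intro sum.cong) (use ent ij in auto)
    also have "\<dots> = 1\<^sub>m k $$ (i, j)" using ij k(2)[OF ij(2)] ent[OF ij(1) k(2)[OF ij(2)]] pairingD(2)[OF P, of j] by simp
    finally show "(?M * ?M) $$ (i, j) = 1\<^sub>m k $$ (i, j)" .
  qed auto
  then have "det ?M * det ?M = 1" using det_mult[OF M M] by simp
  then show ?thesis by auto
qed

text \<open>\<open>\<Delta>\<close> is the product of the minors that must not vanish for Gram-Schmidt with respect to the flag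
  of \<open>A\<^bsup>-1\<^esup> g\<close> to succeed; moving the flag instead of \<open>x\<close> keeps \<open>N\<close> fixed.\<close>

theorem dense_Bor_orbit:
  obtains g where "frame g"
    "\<And>f A. polynomial_fun m f \<Longrightarrow> (\<And>b. b \<in> Bor g \<Longrightarrow> f (b * x * minv b) = 0) \<Longrightarrow> A \<in> SO \<Longrightarrow> f (A * x * minv A) = 0"
proof -
  obtain r \<sigma> c e f where P: "pairing r \<sigma> c" and M: "matched r \<sigma> c e f" and N0: "\<And>w. orth r e f w \<Longrightarrow> N w = 0\<^sub>v m"
    using exists_matched by blast
  note H = matchedD(1)[OF M]
  have r: "r \<le> n" by (rule hyp_le[OF H])
  \<comment> \<open>The flag is chosen so that the normal form of \<open>x\<close> is already
    adapted to it; at the identity all minors are then nonzero, so \<open>\<Delta>\<close> does not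
    vanish identically.\<close>
  obtain g where g: "frame g" "\<And>i. i < r \<Longrightarrow> g i = e i" "\<And>i. i < r \<Longrightarrow> g (m - 1 - i) = f i"
    using exists_frame[OF H r] by blast
  have rank: "N z = 0\<^sub>v m" if "z \<in> V" "\<And>i. i < r \<Longrightarrow> \<beta> z (N (e i)) = 0" for z
    by (rule matched_rank[OF M N0 that])
  have gram: "gram r \<sigma> g" unfolding gram_def using matched_gram[OF M] g(2) by simp
  define S where "S = {k. k \<le> r \<and> (\<forall>i<k. \<sigma> i < k)}"
  have finS: "finite S" unfolding S_def by simp
  define \<Delta> where "\<Delta> = (\<lambda>A. \<Prod>k\<in>S. det (mat k k (\<lambda>(i, j). \<beta> (minv A *\<^sub>v g i) ((x + 1\<^sub>m m) *\<^sub>v (minv A *\<^sub>v g j)))))"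
  have rm: "r \<le> m" using r m_def by simp
  have xm: "x + 1\<^sub>m m \<in> carrier_mat m m" using Or_carrier[OF x] by simp
  have "pf \<Delta>" unfolding \<Delta>_def
  proof (rule pf_prod[OF finS])
    fix k assume "k \<in> S"
    then have k: "k \<le> r" unfolding S_def by simp
    show "pf (\<lambda>A. det (mat k k (\<lambda>(i, j). \<beta> (minv A *\<^sub>v g i) ((x + 1\<^sub>m m) *\<^sub>v (minv A *\<^sub>v g j)))))"
    proof (rule pf_det)
      fix i j assume "i < k" "j < k"
      then have "g i \<in> V" "g j \<in> V" using g(1) k rm by auto
      then show "pf (\<lambda>A. \<beta> (minv A *\<^sub>v g i) ((x + 1\<^sub>m m) *\<^sub>v (minv A *\<^sub>v g j)))"
        by (intro pf_bil pfv_mult pfm_minv pfv_const pfm_const xm)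
    qed
  qed
  then obtain d where d: "polynomial_fun m d" "\<And>A. A \<in> Or \<Longrightarrow> \<Delta> A = d A" unfolding pf_def by blast
  have \<Delta>_det: "\<Delta> A \<noteq> 0 \<longleftrightarrow> (\<forall>k\<in>S. det (mat k k (\<lambda>(i, j). \<beta> (minv A *\<^sub>v g i) (N (minv A *\<^sub>v g j)))) \<noteq> 0)"
    if A: "A \<in> Or" for A
  proof -
    have "mat k k (\<lambda>(i, j). \<beta> (minv A *\<^sub>v g i) ((x + 1\<^sub>m m) *\<^sub>v (minv A *\<^sub>v g j))) =
      mat k k (\<lambda>(i, j). \<beta> (minv A *\<^sub>v g i) (N (minv A *\<^sub>v g j)))" if "k \<in> S" for k
      using that minv(1)[OF A] g(1) rm unfolding S_def by (intro eq_matI) (auto simp: N_mat)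
    then show ?thesis unfolding \<Delta>_def using finS by simp
  qed
  have minv1: "minv (1\<^sub>m m) = 1\<^sub>m m" by (rule minv_unique[OF Or_one Or_one]) simp
  have "\<Delta> (1\<^sub>m m) \<noteq> 0" unfolding \<Delta>_det[OF Or_one] minv1
  proof
    fix k assume k: "k \<in> S"
    have "mat k k (\<lambda>(i, j). \<beta> (1\<^sub>m m *\<^sub>v g i) (N (1\<^sub>m m *\<^sub>v g j))) = mat k k (\<lambda>(i, j). \<beta> (g i) (N (g j)))"
      using k g(1) rm unfolding S_def by (intro eq_matI) auto
    then show "det (mat k k (\<lambda>(i, j). \<beta> (1\<^sub>m m *\<^sub>v g i) (N (1\<^sub>m m *\<^sub>v g j)))) \<noteq> 0"
      using gram_det[OF gram P, of k] k unfolding S_def by simp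
  qed
  then have d1: "d (1\<^sub>m m) \<noteq> 0" using d(2)[OF Or_one] by simp
  \<comment> \<open>If the minors at \<open>A\<close> do not vanish, a second normal form arises in
    a frame \<open>h\<close> adapted to the flag moved by the inverse of \<open>A\<close>. The map
    \<open>D\<close> from \<open>g\<close> to \<open>h\<close> commutes with \<open>x\<close>, and
    \<open>A * D\<close> fixes the original flag.\<close>
  have conj: "\<exists>b\<in>Bor g. b * x * minv b = A * x * minv A" if A: "A \<in> Or" "\<Delta> A \<noteq> 0" for A
  proof -
    note Ai = minv(1)[OF A(1)]
    define g' where "g' = (\<lambda>i. minv A *\<^sub>v g i)"
    have g': "frame g'" unfolding g'_def by (rule frame_image[OF g(1) Ai])
    have "det (mat k k (\<lambda>(i, j). \<beta> (g' i) (N (g' j)))) \<noteq> 0" if "k \<le> r" "\<And>i. i < k \<Longrightarrow> \<sigma> i < k" for k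
      using A(2) that unfolding \<Delta>_det[OF A(1)] S_def g'_def by blast
    then obtain e' where e': "\<And>i. i < r \<Longrightarrow> e' i \<in> flag g' (Suc i)" "\<And>i. i < r \<Longrightarrow> \<beta> (e' i) (g' (m - 1 - i)) \<noteq> 0" "gram r \<sigma> e'"
      using gram_schmidt[OF P g' r] by blast
    have e'r: "e' i \<in> flag g' r" if "i < r" for i by (rule flag_mono[OF e'(1)[OF that]]) (use that in simp)
    have e'V: "e' i \<in> V" if "i < r" for i by (rule flag_V[OF e'(1)[OF that]])
    define f' where "f' = (\<lambda>i. N (e' (\<sigma> i)) + c \<cdot>\<^sub>v e' i)"
    have M': "matched r \<sigma> c e' f'" unfolding f'_def
      by (rule gram_matched[OF P e'(3) e'V flag_singular[OF g' r e'r] flag_isotropic[OF g' e'r e'r r]])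
    have rank': "N z = 0\<^sub>v m" if "z \<in> V" "\<And>i. i < r \<Longrightarrow> \<beta> z (N (e' i)) = 0" for z
      by (rule rank_transfer[OF hypD(1)[OF H] rank P e'V e'(3) that])
    obtain h where h: "frame h" "\<And>i. i < r \<Longrightarrow> h i = e' i" "\<And>i. i < r \<Longrightarrow> h (m - 1 - i) = f' i"
      "\<And>i. i < m \<Longrightarrow> h i \<in> flag g' (Suc i)"
      using exists_adapted_frame[OF g' r matchedD(1)[OF M'] e'(1,2)] by blast
    obtain D where D: "D \<in> Or" "\<And>i. i < m \<Longrightarrow> D *\<^sub>v g i = h i" using frame_map[OF g(1) h(1)] by blast
    have com: "D *\<^sub>v (x *\<^sub>v v) = x *\<^sub>v (D *\<^sub>v v)" if "v \<in> V" for v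
    proof (rule commutes_of_matched[OF P M M' rank rank' D(1) _ _ that])
      fix i assume i: "i < r"
      then have im: "i < m" "m - 1 - i < m" using rm by auto
      show "D *\<^sub>v e i = e' i" using D(2)[OF im(1)] g(2)[OF i] h(2)[OF i] by simp
      show "D *\<^sub>v f i = f' i" using D(2)[OF im(2)] g(3)[OF i] h(3)[OF i] by simp
    qed
    define b where "b = A * D"
    have bO: "b \<in> Or" unfolding b_def by (rule Or_mult[OF A(1) D(1)])
    have "b \<in> Bor g" unfolding Bor_def
    proof (intro CollectI conjI allI impI bO)
      fix i j assume ij: "i < m" "j < m" "i + j < m - 1"
      have V: "h i \<in> V" "g i \<in> V" "g j \<in> V" using h(1) g(1) ij by auto
      have "\<beta> (b *\<^sub>v g i) (g j) = \<beta> (A *\<^sub>v h i) (A *\<^sub>v (minv A *\<^sub>v g j))"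
        unfolding b_def using Or_mult_vec[OF A(1) D(1) V(2)] D(2)[OF ij(1)] minv_vec[OF A(1) V(3)] by simp
      also have "\<dots> = \<beta> (h i) (g' j)" unfolding g'_def using Or_bil[OF A(1) V(1)] Ai V(3) by simp
      also have "\<dots> = 0" by (rule flag_bil[OF h(4)[OF ij(1)]]) (use ij in simp)
      finally show "\<beta> (b *\<^sub>v g i) (g j) = 0" .
    qed
    moreover have "b * x * minv b = A * x * minv A"
    proof (rule mat_eq_iff_mult_vec)
      note bi = minv(1)[OF bO]
      show "b * x * minv b \<in> carrier_mat m m" "A * x * minv A \<in> carrier_mat m m"
        by (intro Or_carrier Or_mult bO bi A(1) Ai x)+
      fix v assume v: "v \<in> V"
      define u where "u = minv b *\<^sub>v v"
      have uV: "u \<in> V" unfolding u_def using bi v by simp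
      have "A *\<^sub>v (D *\<^sub>v u) = v" using minv_vec[OF bO v] A(1) D(1) uV unfolding u_def b_def by simp
      then have "minv A *\<^sub>v v = D *\<^sub>v u"
        using Or_mult_vec[OF Ai A(1), of "D *\<^sub>v u"] minv(3)[OF A(1)] D(1) uV by simp
      then have "(A * x * minv A) *\<^sub>v v = A *\<^sub>v (x *\<^sub>v (D *\<^sub>v u))" using A(1) Ai x v D(1) uV by (simp add: Or_mult)
      moreover have "(b * x * minv b) *\<^sub>v v = A *\<^sub>v (D *\<^sub>v (x *\<^sub>v u))"
        using bO bi x v A(1) D(1) uV unfolding u_def b_def by (simp add: Or_mult)
      ultimately show "(b * x * minv b) *\<^sub>v v = (A * x * minv A) *\<^sub>v v" using com[OF uV] by simp
    qed
    ultimately show ?thesis by blast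
  qed
  show ?thesis
  proof (rule that[OF g(1)])
    fix F A assume F: "polynomial_fun m F" "\<And>b. b \<in> Bor g \<Longrightarrow> F (b * x * minv b) = 0" and A: "A \<in> SO"
    have "pf (\<lambda>A. F (A * x * minv A))"
      by (intro pf_compose F(1) pfm_mult pfm_id pfm_minv pfm_const Or_carrier[OF x])
    then obtain p where p: "polynomial_fun m p" "\<And>A. A \<in> Or \<Longrightarrow> F (A * x * minv A) = p A" unfolding pf_def by blast
    have O: "B \<in> Or" if "B \<in> SO" for B using that SO_subset by blast
    show "F (A * x * minv A) = 0"
    proof (rule ccontr)
      assume "F (A * x * minv A) \<noteq> 0"
      then have "\<exists>A\<in>SO. p A \<noteq> 0" using p(2)[OF O[OF A]] A by auto
      moreover have "\<exists>A\<in>SO. d A \<noteq> 0" using d1 one_SO by blast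
      \<comment> \<open>Irreducibility yields one \<open>B\<close> where the minors and the value of
        \<open>F\<close> at the conjugate are both nonzero; but that conjugate lies in the orbit of
        the flag stabiliser.\<close>
      ultimately obtain B where B: "B \<in> SO" "p B \<noteq> 0" "d B \<noteq> 0"
        using irreducible_SO p(1) d(1) unfolding irreducible_set_def by blast
      note BO = O[OF B(1)]
      obtain b where b: "b \<in> Bor g" "b * x * minv b = B * x * minv B" using conj[OF BO] B(3) d(2)[OF BO] by auto
      then show False using F(2)[OF b(1)] p(2)[OF BO] B(2) by simp
    qed
  qed
qed

end

section \<open>The equivalence for unipotent classes\<close>

context char2_quadratic_space
begin

theorem spherical_iff_involution:
  assumes C: "C \<in> conjugacy_classes G" and uni: "\<And>x. x \<in> C \<Longrightarrow> unipotent m x"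
  shows "spherical m G C \<longleftrightarrow> (\<forall>x\<in>C. x * x = 1\<^sub>m m)"
proof
  assume sph: "spherical m G C"
  show "\<forall>x\<in>C. x * x = 1\<^sub>m m"
  proof
    fix x assume x: "x \<in> C"
    have xO: "x \<in> Or" using class_eq(1)[OF C x] SO_subset by blast
    show "x * x = 1\<^sub>m m"
    proof (rule mat_eq_iff_mult_vec)
      show "x * x \<in> carrier_mat m m" using Or_carrier[OF xO] by simp
      show "(x * x) *\<^sub>v v = 1\<^sub>m m *\<^sub>v v" if "v \<in> V" for v
        using spherical_imp_involution[OF C sph x uni[OF x] that] xO that by simp
    qed simp
  qed
next
  assume inv: "\<forall>x\<in>C. x * x = 1\<^sub>m m"
  obtain x where x: "x \<in> C"
  proof -
    obtain x0 where "C = orbit G (conjugation G) x0" "x0 \<in> SO"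
      using C unfolding conjugacy_classes_def orbits_def by auto
    then have "1\<^sub>m m * x0 * minv (1\<^sub>m m) \<in> C" using orbit_eq[OF subset_refl, of x0] one_SO G_eq by auto
    then show ?thesis using that by blast
  qed
  have xO: "x \<in> Or" using class_eq(1)[OF C x] SO_subset by blast
  interpret X: involution n m q x
  proof unfold_locales
    show "x *\<^sub>v (x *\<^sub>v v) = v" if "v \<in> V" for v
      using Or_mult_vec[OF xO xO that] inv x that by simp
  qed (rule xO)
  obtain g where g: "frame g"
    "\<And>f A. polynomial_fun m f \<Longrightarrow> (\<And>b. b \<in> Bor g \<Longrightarrow> f (b * x * minv b) = 0) \<Longrightarrow> A \<in> SO \<Longrightarrow> f (A * x * minv A) = 0"
    using X.dense_Bor_orbit by blast
  have "\<forall>y\<in>C. f y = 0" if "polynomial_fun m f" "\<forall>b\<in>Bor g. f (b * x * minv b) = 0" for f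
    using g(2)[OF that(1)] that(2) class_eq(2)[OF C x] by blast
  then show "spherical m G C" unfolding spherical_iff[OF C] using borel_Bor[OF g(1)] x by blast
qed

lemma ord_eq_2_iff:
  assumes x: "x \<in> SO" shows "group.ord G x = 2 \<longleftrightarrow> x \<noteq> 1\<^sub>m m \<and> x * x = 1\<^sub>m m"
proof -
  interpret GG: group G by (rule group_special_orthogonal_group)
  have xG: "x \<in> carrier G" using x by simp
  have "GG.ord x = 2 \<longleftrightarrow> GG.ord x \<noteq> 1 \<and> GG.ord x dvd 2"
    using prime_nat_iff[of 2] two_is_prime_nat by auto
  moreover have "x [^]\<^bsub>G\<^esub> (2::nat) = x * x"
    using Or_carrier[of x] x SO_subset by (auto simp: numeral_2_eq_2)
  ultimately show ?thesis using GG.pow_eq_id[OF xG, of 2] GG.ord_eq_1[OF xG] by simp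
qed

end

theorem proposition3p10:
  fixes n :: nat
    and q :: "'k::alg_closed_field vec \<Rightarrow> 'k"
    and \<O> :: "'k mat set"
  assumes "CHAR('k) = 2"
    and "n \<ge> 4"
    and "nondegenerate_quadratic_form (2 * n) q"
    and "\<O> \<in> conjugacy_classes (special_orthogonal_group (2 * n) q)"
    and "\<forall>x\<in>\<O>. unipotent (2 * n) x"
    and "\<O> \<noteq> {\<one>\<^bsub>special_orthogonal_group (2 * n) q\<^esub>}"
  shows "spherical (2 * n) (special_orthogonal_group (2 * n) q) \<O> \<longleftrightarrow>
         (\<forall>x\<in>\<O>. group.ord (special_orthogonal_group (2 * n) q) x = 2)"
proof -
  interpret char2_quadratic_space n "2 * n" q
    by unfold_locales (use assms in auto)
  \<comment> \<open>The class of 1 is a singleton, so a non-trivial class avoids 1, and having order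
    2 reduces to squaring to 1.\<close>
  have "1\<^sub>m (2 * n) \<notin> \<O>"
  proof
    assume 1: "1\<^sub>m (2 * n) \<in> \<O>"
    have "A * 1\<^sub>m (2 * n) * minv A = 1\<^sub>m (2 * n)" if "A \<in> SO" for A
      using minv(2)[of A] that SO_subset Or_carrier[of A] by auto
    then have "y = 1\<^sub>m (2 * n)" if "y \<in> \<O>" for y using class_eq(2)[OF assms(4) 1] that by auto
    then have "\<O> = {1\<^sub>m (2 * n)}" using 1 by blast
    then show False using assms(6) by simp
  qed
  then have "group.ord G x = 2 \<longleftrightarrow> x * x = 1\<^sub>m (2 * n)" if "x \<in> \<O>" for x
    using ord_eq_2_iff[OF class_eq(1)[OF assms(4) that]] that by auto
  then show ?thesis using spherical_iff_involution[OF assms(4)] assms(5) by auto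
qed

end
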